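(* Let $D$ be a $d$-embeddable curve with $d\ge\deg(D)+4$, and let $P_D$ be the Hilbert polynomial of $D$. Let $L$ be an irreducible component of $H_{P_D}$ such that a general point of $L$ corresponds to a curve $D_g$ which is $d$-embeddable but not first order $d$-embedded (i.e. there is a smooth degree $d$ surface $X_g\supset D_g$ such that $(D_g,X_g)$ is not first order $d$-embedded). Then $L$ is generically non-reduced.
   Context: The base field is $\mathbb{C}$. A curve is a closed subscheme of $\mathbb{P}^3$ of pure dimension $1$ (not necessarily reduced). A curve is $d$-embeddable if it is contained in a smooth degree $d$ surface in $\mathbb{P}^3$; a $d$-embedded curve is a pair $(C,X)$ with $X$ a smooth degree $d$ surface in $\mathbb{P}^3$ and $C\subset X$ a curve. $H_P$ is the Hilbert scheme of closed subschemes of $\mathbb{P}^3$ with Hilbert polynomial $P$. A general point of an irreducible component is one outside a finite union of proper closed subsets. An irreducible component of a scheme $H$ is regarded as a (possibly non-reduced) scheme: the scheme-theoretic closure in $H$ of the open subscheme of points lying on no other irreducible component; it is generically non-reduced if it has no non-empty reduced open subscheme. Let $\mathcal{N}_{Y|\mathbb{P}^3}=\mathcal{H}om_{\mathbb{P}^3}(\mathcal{I}_Y,\mathcal{O}_Y)$. For a $d$-embedded curve $(C,X)$, $\rho_C:H^0(\mathcal{N}_{X|\mathbb{P}^3})\to H^0(\mathcal{N}_{X|\mathbb{P}^3}\otimes\mathcal{O}_C)$ is restriction and $\beta_C:H^0(\mathcal{N}_{C|\mathbb{P}^3})\to H^0(\mathcal{N}_{X|\mathbb{P}^3}\otimes\mathcal{O}_C)$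 is induced by the exact sequence $0\to\mathcal{N}_{C|X}\to\mathcal{N}_{C|\mathbb{P}^3}\to\mathcal{N}_{X|\mathbb{P}^3}\otimes\mathcal{O}_C\to0$. $(C,X)$ is first order $d$-embedded if $\mathrm{Im}\,\beta_C\subset\mathrm{Im}\,\rho_C$. *)

theory Defs
  imports
    "HOL-Analysis.Analysis"
    "HOL-Algebra.QuotRing"
    "HOL-Algebra.Generated_Rings"
    "HOL-Library.Function_Algebras"
    "HOL-Computational_Algebra.Polynomial"
begin

section \<open>Schemes over the complex numbers\<close>

text \<open>
  A space carries a topology, a sheaf of rings \<open>sec\<close> with restriction maps \<open>rest U V\<close>
  (for \<open>V \<subseteq> U\<close>), and a structure of sheaf of complex algebras: \<open>scal U c\<close> is the constant
  section \<open>c\<close> over \<open>U\<close>.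
\<close>

definition CC :: "complex ring" where
  "CC = \<lparr>carrier = UNIV, mult = (*), one = 1, zero = 0, add = (+)\<rparr>"

record ('p, 's) cspace =
  zar :: "'p topology"
  sec :: "'p set \<Rightarrow> 's ring"
  rest :: "'p set \<Rightarrow> 'p set \<Rightarrow> 's \<Rightarrow> 's"
  scal :: "'p set \<Rightarrow> complex \<Rightarrow> 's"

definition ringed_cspace :: "('p, 's) cspace \<Rightarrow> bool" where
  "ringed_cspace X \<longleftrightarrow>
     (\<forall>U. openin (zar X) U \<longrightarrow>
        cring (sec X U) \<and> scal X U \<in> ring_hom CC (sec X U) \<and>
        (\<forall>s\<in>carrier (sec X U). rest X U U s = s)) \<and>
     (\<forall>U V. openin (zar X) U \<and> openin (zar X) V \<and> V \<subseteq> U \<longrightarrow>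
        rest X U V \<in> ring_hom (sec X U) (sec X V) \<and>
        (\<forall>c. rest X U V (scal X U c) = scal X V c)) \<and>
     (\<forall>U V W. openin (zar X) U \<and> openin (zar X) V \<and> openin (zar X) W \<and> W \<subseteq> V \<and> V \<subseteq> U \<longrightarrow>
        (\<forall>s\<in>carrier (sec X U). rest X V W (rest X U V s) = rest X U W s)) \<and>
     (\<forall>\<U> s. (\<forall>U\<in>\<U>. openin (zar X) U \<and> s U \<in> carrier (sec X U)) \<and>
        (\<forall>U\<in>\<U>. \<forall>V\<in>\<U>. rest X U (U \<inter> V) (s U) = rest X V (U \<inter> V) (s V)) \<longrightarrow>
        (\<exists>!t. t \<in> carrier (sec X (\<Union>\<U>)) \<and> (\<forall>U\<in>\<U>. rest X (\<Union>\<U>) U t = s U)))"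

text \<open>The germ at \<open>x\<close> of the section \<open>s\<close> over \<open>U\<close> is a unit of the stalk.\<close>

definition invertible_at :: "('p, 's) cspace \<Rightarrow> 'p set \<Rightarrow> 'p \<Rightarrow> 's \<Rightarrow> bool" where
  "invertible_at X U x s \<longleftrightarrow>
     (\<exists>V. openin (zar X) V \<and> x \<in> V \<and> V \<subseteq> U \<and> rest X U V s \<in> Units (sec X V))"

definition open_subspace :: "('p, 's) cspace \<Rightarrow> 'p set \<Rightarrow> ('p, 's) cspace" where
  "open_subspace X U = \<lparr>zar = subtopology (zar X) U, sec = sec X, rest = rest X, scal = scal X\<rparr>"

text \<open>
  A morphism is a map of points together with the maps
  \<open>sec Y U \<rightarrow> sec X (f\<inverse> U)\<close>; both are extensional, so that equality of pairs is equality of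
  morphisms. The last clause is locality of the maps on stalks.
\<close>

definition preim :: "('p, 's) cspace \<Rightarrow> ('p \<Rightarrow> 'q) \<Rightarrow> 'q set \<Rightarrow> 'p set" where
  "preim X m U = {x \<in> topspace (zar X). m x \<in> U}"

definition morphism ::
  "('p, 's) cspace \<Rightarrow> ('q, 't) cspace \<Rightarrow> ('p \<Rightarrow> 'q) \<times> ('q set \<Rightarrow> 't \<Rightarrow> 's) \<Rightarrow> bool" where
  "morphism X Y f \<longleftrightarrow> (case f of (m, h) \<Rightarrow>
     m \<in> extensional (topspace (zar X)) \<and> continuous_map (zar X) (zar Y) m \<and>
     h \<in> extensional {U. openin (zar Y) U} \<and>
     (\<forall>U. openin (zar Y) U \<longrightarrow>
        h U \<in> extensional (carrier (sec Y U)) \<and>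
        h U \<in> ring_hom (sec Y U) (sec X (preim X m U)) \<and>
        (\<forall>c. h U (scal Y U c) = scal X (preim X m U) c)) \<and>
     (\<forall>U V. openin (zar Y) U \<and> openin (zar Y) V \<and> V \<subseteq> U \<longrightarrow>
        (\<forall>s\<in>carrier (sec Y U).
           h V (rest Y U V s) = rest X (preim X m U) (preim X m V) (h U s))) \<and>
     (\<forall>U. openin (zar Y) U \<longrightarrow>
        (\<forall>s\<in>carrier (sec Y U). \<forall>x\<in>preim X m U.
           invertible_at X (preim X m U) x (h U s) \<longrightarrow> invertible_at Y U (m x) s)))"

definition isomorphism ::
  "('p, 's) cspace \<Rightarrow> ('q, 't) cspace \<Rightarrow> ('p \<Rightarrow> 'q) \<times> ('q set \<Rightarrow> 't \<Rightarrow> 's) \<Rightarrow> bool" where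
  "isomorphism X Y f \<longleftrightarrow> morphism X Y f \<and> homeomorphic_map (zar X) (zar Y) (fst f) \<and>
     (\<forall>U. openin (zar Y) U \<longrightarrow>
        bij_betw (snd f U) (carrier (sec Y U)) (carrier (sec X (preim X (fst f) U))))"

subsection \<open>Affine schemes\<close>

text \<open>Localisation of a ring at (the complement of) a prime ideal; \<open>frac_at R p a b\<close> is \<open>a/b\<close>.\<close>

definition frac_rel :: "'a ring \<Rightarrow> 'a set \<Rightarrow> (('a \<times> 'a) \<times> ('a \<times> 'a)) set" where
  "frac_rel R p = {((a, b), (a', b')).
     a \<in> carrier R \<and> a' \<in> carrier R \<and> b \<in> carrier R - p \<and> b' \<in> carrier R - p \<and>
     (\<exists>t\<in>carrier R - p. t \<otimes>\<^bsub>R\<^esub> ((a \<otimes>\<^bsub>R\<^esub> b') \<ominus>\<^bsub>R\<^esub> (a' \<otimes>\<^bsub>R\<^esub> b)) = \<zero>\<^bsub>R\<^esub>)}"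

definition frac_at :: "'a ring \<Rightarrow> 'a set \<Rightarrow> 'a \<Rightarrow> 'a \<Rightarrow> ('a \<times> 'a) set" where
  "frac_at R p a b = frac_rel R p `` {(a, b)}"

definition local_ring :: "'a ring \<Rightarrow> 'a set \<Rightarrow> ('a \<times> 'a) set ring" where
  "local_ring R p =
     \<lparr>carrier = (carrier R \<times> (carrier R - p)) // frac_rel R p,
      mult = (\<lambda>x y. \<Union>(a, b)\<in>x. \<Union>(c, d)\<in>y. frac_at R p (a \<otimes>\<^bsub>R\<^esub> c) (b \<otimes>\<^bsub>R\<^esub> d)),
      one = frac_at R p \<one>\<^bsub>R\<^esub> \<one>\<^bsub>R\<^esub>,
      zero = frac_at R p \<zero>\<^bsub>R\<^esub> \<one>\<^bsub>R\<^esub>,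
      add = (\<lambda>x y. \<Union>(a, b)\<in>x. \<Union>(c, d)\<in>y.
               frac_at R p ((a \<otimes>\<^bsub>R\<^esub> d) \<oplus>\<^bsub>R\<^esub> (c \<otimes>\<^bsub>R\<^esub> b)) (b \<otimes>\<^bsub>R\<^esub> d))\<rparr>"

definition Spec_sections :: "'a ring \<Rightarrow> 'a set topology \<Rightarrow> 'a set set \<Rightarrow> ('a set \<Rightarrow> ('a \<times> 'a) set) set" where
  "Spec_sections R T U =
     {s \<in> (\<Pi>\<^sub>E p\<in>U. carrier (local_ring R p)).
        \<forall>p\<in>U. \<exists>V. openin T V \<and> p \<in> V \<and> V \<subseteq> U \<and>
          (\<exists>a\<in>carrier R. \<exists>b\<in>carrier R. \<forall>q\<in>V. b \<notin> q \<and> s q = frac_at R q a b)}"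

definition Zariski :: "'a ring \<Rightarrow> 'a set topology" where
  "Zariski R = topology_generated_by {{p. primeideal p R \<and> f \<notin> p} | f. f \<in> carrier R}"

definition Spec :: "'a ring \<Rightarrow> (complex \<Rightarrow> 'a) \<Rightarrow> ('a set, 'a set \<Rightarrow> ('a \<times> 'a) set) cspace" where
  "Spec R k =
     \<lparr>zar = Zariski R,
      sec = (\<lambda>U.
        \<lparr>carrier = Spec_sections R (Zariski R) U,
         mult = (\<lambda>s t. \<lambda>p\<in>U. s p \<otimes>\<^bsub>local_ring R p\<^esub> t p),
         one = (\<lambda>p\<in>U. \<one>\<^bsub>local_ring R p\<^esub>),
         zero = (\<lambda>p\<in>U. \<zero>\<^bsub>local_ring R p\<^esub>),
         add = (\<lambda>s t. \<lambda>p\<in>U. s p \<oplus>\<^bsub>local_ring R p\<^esub> t p)\<rparr>),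
      rest = (\<lambda>U V s. restrict s V),
      scal = (\<lambda>U c. \<lambda>p\<in>U. frac_at R p (k c) \<one>\<^bsub>R\<^esub>)\<rparr>"

definition affine_open :: "('p, 's) cspace \<Rightarrow> 'p set \<Rightarrow> bool" where
  "affine_open X U \<longleftrightarrow> openin (zar X) U \<and>
     (\<exists>f. isomorphism (open_subspace X U) (Spec (sec X U) (scal X U)) f)"

definition finite_type_algebra :: "'a ring \<Rightarrow> (complex \<Rightarrow> 'a) \<Rightarrow> bool" where
  "finite_type_algebra R k \<longleftrightarrow>
     (\<exists>S. finite S \<and> S \<subseteq> carrier R \<and> generate_ring R (range k \<union> S) = carrier R)"

definition finite_type_scheme :: "('p, 's) cspace \<Rightarrow> bool" where
  "finite_type_scheme X \<longleftrightarrow> ringed_cspace X \<and> compact_space (zar X) \<and>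
     (\<forall>x\<in>topspace (zar X). \<exists>U. affine_open X U \<and> x \<in> U \<and>
        finite_type_algebra (sec X U) (scal X U))"

definition closed_point :: "('p, 's) cspace \<Rightarrow> 'p \<Rightarrow> bool" where
  "closed_point X x \<longleftrightarrow> closedin (zar X) {x}"

text \<open>
  Value of a section at a closed point of a scheme of finite type, whose residue field is the
  field of complex numbers: the unique constant \<open>c\<close> for which \<open>s - c\<close> is not a unit at \<open>x\<close>.
\<close>

definition value_at :: "('p, 's) cspace \<Rightarrow> 'p set \<Rightarrow> 'p \<Rightarrow> 's \<Rightarrow> complex" where
  "value_at X U x s = (THE c. \<not> invertible_at X U x (s \<ominus>\<^bsub>sec X U\<^esub> scal X U c))"

subsection \<open>Irreducible components\<close>

definition irreducible_in :: "'p topology \<Rightarrow> 'p set \<Rightarrow> bool" where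
  "irreducible_in T A \<longleftrightarrow> A \<noteq> {} \<and> A \<subseteq> topspace T \<and>
     (\<forall>B C. closedin T B \<and> closedin T C \<and> A \<subseteq> B \<union> C \<longrightarrow> A \<subseteq> B \<or> A \<subseteq> C)"

definition irreducible_component :: "'p topology \<Rightarrow> 'p set \<Rightarrow> bool" where
  "irreducible_component T L \<longleftrightarrow> irreducible_in T L \<and>
     (\<forall>A. irreducible_in T A \<and> L \<subseteq> A \<longrightarrow> A = L)"

definition interior_component :: "'p topology \<Rightarrow> 'p set \<Rightarrow> 'p set" where
  "interior_component T L =
     topspace T - \<Union>{L'. irreducible_component T L' \<and> L' \<noteq> L}"

text \<open>
  The scheme-theoretic closure of an open subscheme \<open>W\<close> of \<open>X\<close> is defined by the kernel of
  \<open>O_X \<rightarrow> j_* O_W\<close>; \<open>closure_ideal X W x U s\<close> says that the germ at \<open>x\<close> of the section \<open>s\<close> over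
  \<open>U\<close> lies in the stalk of this kernel. So the stalk of the structure sheaf of the closure at \<open>x\<close> is
  the stalk of \<open>O_X\<close> modulo these germs.
\<close>

definition closure_ideal ::
  "('p, 's) cspace \<Rightarrow> 'p set \<Rightarrow> 'p \<Rightarrow> 'p set \<Rightarrow> 's \<Rightarrow> bool" where
  "closure_ideal X W x U s \<longleftrightarrow>
     (\<exists>V. openin (zar X) V \<and> x \<in> V \<and> V \<subseteq> U \<and> rest X U (V \<inter> W) s = \<zero>\<^bsub>sec X (V \<inter> W)\<^esub>)"

definition closure_reduced_at :: "('p, 's) cspace \<Rightarrow> 'p set \<Rightarrow> 'p \<Rightarrow> bool" where
  "closure_reduced_at X W x \<longleftrightarrow>
     (\<forall>U s n. openin (zar X) U \<and> x \<in> U \<and> s \<in> carrier (sec X U) \<and>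
        closure_ideal X W x U (s [^]\<^bsub>sec X U\<^esub> (n::nat)) \<longrightarrow> closure_ideal X W x U s)"

text \<open>A component \<open>L\<close> is the scheme-theoretic closure of the open set of points on no other
  component; a scheme is reduced if all its stalks are.\<close>

definition generically_nonreduced :: "('p, 's) cspace \<Rightarrow> 'p set \<Rightarrow> bool" where
  "generically_nonreduced X L \<longleftrightarrow>
     \<not> (\<exists>V. openin (subtopology (zar X) L) V \<and> V \<noteq> {} \<and>
           (\<forall>x\<in>V. closure_reduced_at X (interior_component (zar X) L) x))"

text \<open>The property \<open>P\<close> holds for the complex points (equivalently, the closed points) of \<open>L\<close>
  outside a finite union of proper closed subsets of \<open>L\<close>.\<close>

definition general_point :: "('p, 's) cspace \<Rightarrow> 'p set \<Rightarrow> ('p \<Rightarrow> bool) \<Rightarrow> bool" where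
  "general_point X L P \<longleftrightarrow>
     (\<exists>\<B>. finite \<B> \<and> (\<forall>B\<in>\<B>. closedin (subtopology (zar X) L) B \<and> B \<noteq> L) \<and>
        (\<forall>x\<in>L - \<Union>\<B>. closed_point X x \<longrightarrow> P x))"


section \<open>Closed subschemes of projective three-space\<close>

text \<open>
  Laurent polynomials in the homogeneous coordinates \<open>x0, x1, x2, x3\<close> are their coefficient
  functions on exponent vectors \<open>e :: nat \<Rightarrow> int\<close>. For \<open>F \<subseteq> {0,1,2,3}\<close>, \<open>forms R F n\<close> consists of
  those that are homogeneous of degree \<open>n\<close> and polynomial in the variables outside \<open>F\<close>; for
  nonempty \<open>F\<close>, \<open>P3_ring R F\<close> is the coordinate ring of the affine open subset of projective
  three-space over \<open>R\<close> on which the \<open>x i\<close> with \<open>i \<in> F\<close> do not vanish. These open sets form an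
  affine cover that is closed under intersections, and the ring for \<open>F\<close> is a subset of the ring for
  any larger \<open>F\<close>, the inclusion being restriction.
\<close>

definition charts :: "nat set set" where
  "charts = {F. F \<noteq> {} \<and> F \<subseteq> {..<4}}"

definition exponents :: "nat set \<Rightarrow> int \<Rightarrow> (nat \<Rightarrow> int) set" where
  "exponents F n =
     {e. (\<forall>k\<ge>4. e k = 0) \<and> (\<forall>k<4. k \<notin> F \<longrightarrow> e k \<ge> 0) \<and> (\<Sum>k<4. e k) = n}"

type_synonym 'a laurent = "(nat \<Rightarrow> int) \<Rightarrow> 'a"

definition forms :: "'a ring \<Rightarrow> nat set \<Rightarrow> int \<Rightarrow> 'a laurent set" where
  "forms R F n =
     {p. (\<forall>e. p e \<in> carrier R) \<and> finite {e. p e \<noteq> \<zero>\<^bsub>R\<^esub>} \<and> {e. p e \<noteq> \<zero>\<^bsub>R\<^esub>} \<subseteq> exponents F n}"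

definition laurent_mult :: "'a ring \<Rightarrow> 'a laurent \<Rightarrow> 'a laurent \<Rightarrow> 'a laurent" where
  "laurent_mult R p q = (\<lambda>e. \<Oplus>\<^bsub>R\<^esub>a\<in>{a. p a \<noteq> \<zero>\<^bsub>R\<^esub>}. p a \<otimes>\<^bsub>R\<^esub> q (e - a))"

definition laurent_const :: "'a ring \<Rightarrow> 'a \<Rightarrow> 'a laurent" where
  "laurent_const R r = (\<lambda>e. if e = 0 then r else \<zero>\<^bsub>R\<^esub>)"

definition P3_ring :: "'a ring \<Rightarrow> nat set \<Rightarrow> 'a laurent ring" where
  "P3_ring R F =
     \<lparr>carrier = forms R F 0,
      mult = laurent_mult R,
      one = laurent_const R \<one>\<^bsub>R\<^esub>,
      zero = laurent_const R \<zero>\<^bsub>R\<^esub>,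
      add = (\<lambda>p q e. p e \<oplus>\<^bsub>R\<^esub> q e)\<rparr>"

text \<open>
  A closed subscheme of projective three-space over \<open>R\<close> is given by its quasi-coherent ideal
  sheaf: an ideal on every chart, compatible with restriction to smaller charts. Values off
  \<open>charts\<close> are irrelevant.
\<close>

type_synonym 'a subscheme = "nat set \<Rightarrow> 'a laurent set"

definition closed_subscheme :: "'a ring \<Rightarrow> 'a subscheme \<Rightarrow> bool" where
  "closed_subscheme R Y \<longleftrightarrow>
     (\<forall>F\<in>charts. ideal (Y F) (P3_ring R F)) \<and>
     (\<forall>F\<in>charts. \<forall>G\<in>charts. F \<subseteq> G \<longrightarrow> Y G = genideal (P3_ring R G) (Y F))"

definition subscheme_le :: "'a subscheme \<Rightarrow> 'a subscheme \<Rightarrow> bool" where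
  "subscheme_le Y Z \<longleftrightarrow> (\<forall>F\<in>charts. Z F \<subseteq> Y F)"

subsection \<open>Hilbert polynomials\<close>

text \<open>\<open>form_ideal Y n\<close> is the degree \<open>n\<close> part of the saturated homogeneous ideal of \<open>Y\<close>:
  the shifted coefficient function below is the dehomogenisation \<open>f / x i ^ n\<close>.\<close>

definition form_ideal :: "complex subscheme \<Rightarrow> int \<Rightarrow> complex laurent set" where
  "form_ideal Y n =
     {f \<in> forms CC {} n. \<forall>i<4. (\<lambda>e. f (e(i := e i + n))) \<in> Y {i}}"

abbreviation cdim :: "complex laurent set \<Rightarrow> nat" where
  "cdim \<equiv> vector_space.dim (\<lambda>c f e. c * f e)"

definition has_hilbert_poly :: "complex subscheme \<Rightarrow> rat poly \<Rightarrow> bool" where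
  "has_hilbert_poly Y P \<longleftrightarrow>
     (\<exists>n0. \<forall>n\<ge>n0. poly P (of_nat n) =
        of_nat (cdim (forms CC {} (int n))) - of_nat (cdim (form_ideal Y (int n))))"

definition hilbert_poly :: "complex subscheme \<Rightarrow> rat poly" where
  "hilbert_poly Y = (THE P. has_hilbert_poly Y P)"

subsection \<open>Curves and smooth surfaces\<close>

definition associated_prime :: "'a ring \<Rightarrow> 'a set \<Rightarrow> 'a set \<Rightarrow> bool" where
  "associated_prime R I p \<longleftrightarrow> primeideal p R \<and>
     (\<exists>a\<in>carrier R. p = {r \<in> carrier R. r \<otimes>\<^bsub>R\<^esub> a \<in> I})"

definition prime_chain :: "'a ring \<Rightarrow> 'a set \<Rightarrow> nat \<Rightarrow> bool" where
  "prime_chain R p n \<longleftrightarrow>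
     (\<exists>q. q 0 = p \<and> (\<forall>i\<le>n. primeideal (q i) R) \<and> (\<forall>i<n. q i \<subset> q (Suc i)))"

text \<open>The Krull dimension of the quotient of \<open>R\<close> by the prime \<open>p\<close> is \<open>n\<close>.\<close>

definition prime_dim :: "'a ring \<Rightarrow> 'a set \<Rightarrow> nat \<Rightarrow> bool" where
  "prime_dim R p n \<longleftrightarrow> prime_chain R p n \<and> \<not> prime_chain R p (Suc n)"

text \<open>Pure dimension one: nonempty, and all associated points, embedded ones included,
  have one-dimensional closure.\<close>

definition curve :: "complex subscheme \<Rightarrow> bool" where
  "curve C \<longleftrightarrow> closed_subscheme CC C \<and>
     (\<exists>i<4. C {i} \<noteq> carrier (P3_ring CC {i})) \<and>
     (\<forall>i<4. \<forall>p. associated_prime (P3_ring CC {i}) (C {i}) p \<longrightarrow> prime_dim (P3_ring CC {i}) p 1)"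

text \<open>The leading coefficient of the (linear) Hilbert polynomial of a curve.\<close>

definition curve_degree :: "complex subscheme \<Rightarrow> rat" where
  "curve_degree C = Polynomial.coeff (hilbert_poly C) 1"

definition form_eval :: "complex laurent \<Rightarrow> (nat \<Rightarrow> complex) \<Rightarrow> complex" where
  "form_eval G z = (\<Sum>e | G e \<noteq> 0. G e * (\<Prod>k<4. z k ^ nat (e k)))"

definition form_partial :: "nat \<Rightarrow> complex laurent \<Rightarrow> complex laurent" where
  "form_partial k G = (\<lambda>e. of_int (e k + 1) * G (e(k := e k + 1)))"

definition hypersurface :: "nat \<Rightarrow> complex laurent \<Rightarrow> complex subscheme" where
  "hypersurface d G = (\<lambda>F. laurent_mult CC G ` forms CC F (- int d))"

text \<open>Smoothness by the Jacobian criterion, on the affine cone without its vertex.\<close>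

definition smooth_surface :: "nat \<Rightarrow> complex subscheme \<Rightarrow> bool" where
  "smooth_surface d X \<longleftrightarrow>
     (\<exists>G\<in>forms CC {} (int d). (\<forall>F\<in>charts. X F = hypersurface d G F) \<and>
        (\<forall>z. (\<exists>k<4. z k \<noteq> 0) \<and> form_eval G z = 0 \<longrightarrow>
           (\<exists>k<4. form_eval (form_partial k G) z \<noteq> 0)))"

definition d_embedded :: "nat \<Rightarrow> complex subscheme \<Rightarrow> complex subscheme \<Rightarrow> bool" where
  "d_embedded d C X \<longleftrightarrow> curve C \<and> smooth_surface d X \<and> subscheme_le C X"

definition d_embeddable :: "nat \<Rightarrow> complex subscheme \<Rightarrow> bool" where
  "d_embeddable d C \<longleftrightarrow> (\<exists>X. d_embedded d C X)"

subsection \<open>Normal sheaves\<close>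

text \<open>
  \<open>H0_Hom Y Z\<close> is the space of global sections of the sheaf \<open>Hom(I_Y, O_Z)\<close>: a linear map on each
  chart, compatible with restriction. Elements of \<open>O_Z\<close> are cosets of the ideal of \<open>Z\<close>, and a
  coset on a chart restricts to the unique coset on the smaller chart that contains it.
\<close>

definition H0_Hom :: "complex subscheme \<Rightarrow> complex subscheme \<Rightarrow>
    (nat set \<Rightarrow> complex laurent \<Rightarrow> complex laurent set) set" where
  "H0_Hom Y Z = {\<phi> \<in> extensional charts.
     (\<forall>F\<in>charts.
        \<phi> F \<in> Y F \<rightarrow>\<^sub>E carrier (P3_ring CC F Quot Z F) \<and>
        (\<forall>a\<in>Y F. \<forall>b\<in>Y F. \<phi> F (a \<oplus>\<^bsub>P3_ring CC F\<^esub> b) = \<phi> F a \<oplus>\<^bsub>P3_ring CC F Quot Z F\<^esub> \<phi> F b) \<and>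
        (\<forall>r\<in>carrier (P3_ring CC F). \<forall>a\<in>Y F.
           \<phi> F (r \<otimes>\<^bsub>P3_ring CC F\<^esub> a)
             = (Z F +>\<^bsub>P3_ring CC F\<^esub> r) \<otimes>\<^bsub>P3_ring CC F Quot Z F\<^esub> \<phi> F a)) \<and>
     (\<forall>F\<in>charts. \<forall>G\<in>charts. F \<subseteq> G \<longrightarrow> (\<forall>a\<in>Y F. \<phi> F a \<subseteq> \<phi> G a))}"

definition H0_normal :: "complex subscheme \<Rightarrow>
    (nat set \<Rightarrow> complex laurent \<Rightarrow> complex laurent set) set" where
  "H0_normal Y = H0_Hom Y Y"

text \<open>
  For a \<open>d\<close>-embedded curve \<open>(C, X)\<close> the ideal sheaf of \<open>X\<close> is invertible, so the tensor product of
  the normal sheaf of \<open>X\<close> with \<open>O_C\<close> is canonically \<open>Hom(I_X, O_C)\<close>. Under this identification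
  \<open>\<rho>\<close> is composition with \<open>O_X \<rightarrow> O_C\<close>, and the map of normal sheaves inducing \<open>\<beta>\<close> is
  restriction along the inclusion of \<open>I_X\<close> in \<open>I_C\<close>.
\<close>

definition normal_beta :: "complex subscheme \<Rightarrow>
    (nat set \<Rightarrow> complex laurent \<Rightarrow> complex laurent set) \<Rightarrow>
    (nat set \<Rightarrow> complex laurent \<Rightarrow> complex laurent set)" where
  "normal_beta X \<phi> = (\<lambda>F\<in>charts. \<lambda>a\<in>X F. \<phi> F a)"

definition normal_rho :: "complex subscheme \<Rightarrow> complex subscheme \<Rightarrow>
    (nat set \<Rightarrow> complex laurent \<Rightarrow> complex laurent set) \<Rightarrow>
    (nat set \<Rightarrow> complex laurent \<Rightarrow> complex laurent set)" where
  "normal_rho C X \<psi> = (\<lambda>F\<in>charts. \<lambda>a\<in>X F. C F <+>\<^bsub>P3_ring CC F\<^esub> \<psi> F a)"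

definition first_order_embedded :: "complex subscheme \<Rightarrow> complex subscheme \<Rightarrow> bool" where
  "first_order_embedded C X \<longleftrightarrow> normal_beta X ` H0_normal C \<subseteq> normal_rho C X ` H0_normal X"


section \<open>The Hilbert scheme\<close>

text \<open>Flatness of a ring homomorphism \<open>h : R \<rightarrow> B\<close>, by the equational criterion: every linear
  relation over \<open>R\<close> between elements of \<open>B\<close> comes from relations in \<open>R\<close>.\<close>

definition flat_hom :: "'a ring \<Rightarrow> 'b ring \<Rightarrow> ('a \<Rightarrow> 'b) \<Rightarrow> bool" where
  "flat_hom R B h \<longleftrightarrow>
     (\<forall>(n::nat) r m. r \<in> {..<n} \<rightarrow> carrier R \<and> m \<in> {..<n} \<rightarrow> carrier B \<and>
        (\<Oplus>\<^bsub>B\<^esub>i\<in>{..<n}. h (r i) \<otimes>\<^bsub>B\<^esub> m i) = \<zero>\<^bsub>B\<^esub> \<longrightarrow>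
        (\<exists>(k::nat) a y. (\<forall>i<n. \<forall>j<k. a i j \<in> carrier R) \<and> y \<in> {..<k} \<rightarrow> carrier B \<and>
           (\<forall>i<n. m i = (\<Oplus>\<^bsub>B\<^esub>j\<in>{..<k}. h (a i j) \<otimes>\<^bsub>B\<^esub> y j)) \<and>
           (\<forall>j<k. (\<Oplus>\<^bsub>R\<^esub>i\<in>{..<n}. r i \<otimes>\<^bsub>R\<^esub> a i j) = \<zero>\<^bsub>R\<^esub>)))"

text \<open>
  A closed subscheme of projective three-space over a scheme \<open>T\<close>, again by its ideal sheaf: for
  each affine open \<open>U\<close> a closed subscheme over the ring of \<open>U\<close>, compatible with restriction.
\<close>

definition relative_subscheme :: "('p, 's) cspace \<Rightarrow> ('p set \<Rightarrow> 's subscheme) \<Rightarrow> bool" where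
  "relative_subscheme T Z \<longleftrightarrow>
     (\<forall>U. affine_open T U \<longrightarrow> closed_subscheme (sec T U) (Z U)) \<and>
     (\<forall>U V. affine_open T U \<and> affine_open T V \<and> V \<subseteq> U \<longrightarrow>
        (\<forall>F\<in>charts. Z V F = genideal (P3_ring (sec T V) F) ((\<lambda>p e. rest T U V (p e)) ` Z U F)))"

definition fibre :: "('p, 's) cspace \<Rightarrow> ('p set \<Rightarrow> 's subscheme) \<Rightarrow> 'p \<Rightarrow> complex subscheme" where
  "fibre T Z t = (\<lambda>F. {(\<lambda>e. value_at T U t (p e)) | U p. affine_open T U \<and> t \<in> U \<and> p \<in> Z U F})"

text \<open>
  Flat families with Hilbert polynomial \<open>P\<close>. The Hilbert polynomials of the fibres of a flat family
  are locally constant, and the closed points of a scheme of finite type meet every nonempty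
  open subset, so it suffices to prescribe those of the fibres over the closed points.
\<close>

definition hilbert_family :: "rat poly \<Rightarrow> ('p, 's) cspace \<Rightarrow> ('p set \<Rightarrow> 's subscheme) \<Rightarrow> bool" where
  "hilbert_family P T Z \<longleftrightarrow> relative_subscheme T Z \<and>
     (\<forall>U F. affine_open T U \<and> F \<in> charts \<longrightarrow>
        flat_hom (sec T U) (P3_ring (sec T U) F Quot Z U F)
          (\<lambda>r. Z U F +>\<^bsub>P3_ring (sec T U) F\<^esub> laurent_const (sec T U) r)) \<and>
     (\<forall>t. closed_point T t \<longrightarrow> has_hilbert_poly (fibre T Z t) P)"

text \<open>\<open>Z'\<close> is the pullback of \<open>Z\<close> along the morphism \<open>f\<close> from \<open>T\<close> to \<open>H\<close>.\<close>

definition is_pullback :: "('q, 't) cspace \<Rightarrow> ('p, 's) cspace \<Rightarrow>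
    ('q \<Rightarrow> 'p) \<times> ('p set \<Rightarrow> 's \<Rightarrow> 't) \<Rightarrow>
    ('p set \<Rightarrow> 's subscheme) \<Rightarrow> ('q set \<Rightarrow> 't subscheme) \<Rightarrow> bool" where
  "is_pullback T H f Z Z' \<longleftrightarrow>
     (\<forall>U V. affine_open H U \<and> affine_open T V \<and> fst f ` V \<subseteq> U \<longrightarrow>
        (\<forall>F\<in>charts. Z' V F = genideal (P3_ring (sec T V) F)
           ((\<lambda>p e. rest T (preim T (fst f) U) V (snd f U (p e))) ` Z U F)))"

text \<open>
  \<open>H\<close> together with the family \<open>Z\<close> represents the Hilbert functor on schemes of finite type. Such
  a scheme has at most continuum many points and sections, so every one is isomorphic to one whose
  points and sections are (coded by) complex numbers, and it suffices to test on those.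
\<close>

definition hilbert_scheme :: "rat poly \<Rightarrow> ('p, 's) cspace \<Rightarrow> ('p set \<Rightarrow> 's subscheme) \<Rightarrow> bool" where
  "hilbert_scheme P H Z \<longleftrightarrow> finite_type_scheme H \<and> hilbert_family P H Z \<and>
     (\<forall>(T :: (complex, complex) cspace) Z'. finite_type_scheme T \<and> hilbert_family P T Z' \<longrightarrow>
        (\<exists>!f. morphism T H f \<and> is_pullback T H f Z Z'))"

end

theory Submission
 imports Defs "HOL-Computational_Algebra.Fundamental_Theorem_Algebra"
begin

text \<open>
 Suppose the component is reduced at its generic point. On an affine chart with ring \<open>A\<close>, the forms of degree \<open>d\<close>
 in the ideal of the universal family then commute with passing to the fibre over a point \<open>x\<close> that avoids
 countably many proper hypersurfaces; such closed points exist because the complex field is uncountable, and this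
 replaces semicontinuity and base change. So the equation \<open>G\<close> of the surface containing the fibre \<open>C\<close> lifts to a
 form over \<open>A\<close> in the ideal of the family. A section \<open>\<phi>\<close> of the normal sheaf of \<open>C\<close> is a flat family over the dual
 numbers, hence a tangent vector of the Hilbert scheme at \<open>x\<close>. Applied to the lifted equation, this tangent vector
 gives a form \<open>G1\<close>, and \<open>G \<mapsto> G1\<close> is a section of the normal sheaf of the surface with the same image as \<open>\<phi>\<close> in
 \<open>Hom(I_X, O_C)\<close>. So the pair is first order embedded, against the assumption on \<open>L\<close>.
\<close>

text \<open>Reducedness enters through one fact: every element of the prime \<open>p0\<close> of the
  component is killed by an element outside \<open>p0\<close>, so the local ring there is a field. A
  module over it has a basis, and the denominators needed to reduce to that basis form a countable
  set, because forms have countably many exponents. The closed points avoiding them come from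
  Amitsur's argument: in an algebra of countable dimension over an uncountable field the inverses of
  \<open>a - c\<close>, for all constants \<open>c\<close>, cannot be independent. Two features of
  the setting shape the rest. An affine open set is only known to be isomorphic to a spectrum
  somehow, possibly through a nontrivial automorphism of its ring of sections; hence affineness is
  recast in terms of sections and restrictions alone. And the Hilbert scheme is tested only on
  schemes whose points and sections are complex numbers; hence the point and the spectrum of the
  dual numbers are built by hand as one-point schemes, and the image of the closed point is
  identified with \<open>x\<close> by the uniqueness half of representability.\<close>

abbreviation (input) ring_mult ("(_ \<otimes>[_]/ _)" [70, 0, 71] 70) where "a \<otimes>[R] b \<equiv> a \<otimes>\<^bsub>R\<^esub> b"
abbreviation (input) ring_add ("(_ \<oplus>[_]/ _)" [65, 0, 66] 65) where "a \<oplus>[R] b \<equiv> a \<oplus>\<^bsub>R\<^esub> b"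
abbreviation (input) ring_minus ("(_ \<ominus>[_]/ _)" [65, 0, 66] 65) where "a \<ominus>[R] b \<equiv> a \<ominus>\<^bsub>R\<^esub> b"
abbreviation (input) ring_uminus ("(\<ominus>[_] _)" [0, 81] 80) where "\<ominus>[R] a \<equiv> \<ominus>\<^bsub>R\<^esub> a"
abbreviation (input) ring_zero ("(\<zero>[_])" [0] 1000) where "\<zero>[R] \<equiv> \<zero>\<^bsub>R\<^esub>"
abbreviation (input) ring_one ("(\<one>[_])" [0] 1000) where "\<one>[R] \<equiv> \<one>\<^bsub>R\<^esub>"
abbreviation (input) ring_pow ("(_ [^][_]/ _)" [76, 0, 75] 75) where "a [^][R] n \<equiv> a [^]\<^bsub>R\<^esub> n"
abbreviation (input) ring_coset ("(_ +>[_]/ _)" [60, 0, 61] 60) where "I +>[R] a \<equiv> I +>\<^bsub>R\<^esub> a"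

abbreviation P3 :: "nat set \<Rightarrow> complex laurent ring" where "P3 \<equiv> P3_ring CC"

lemma CC_simps [simp]:
 "carrier CC = UNIV" "x \<otimes>[CC] y = x * y" "\<one>[CC] = 1" "\<zero>[CC] = 0" "x \<oplus>[CC] y = x + y"
 by (simp_all add: CC_def)

lemma cring_CC: "cring CC"
proof (rule cringI)
 show "abelian_group CC"
  by (rule abelian_groupI) (auto simp: algebra_simps intro: exI[of _ "- x" for x] left_minus)
 show "Group.comm_monoid CC"
  by (rule comm_monoidI) (auto simp: algebra_simps)
qed (auto simp: algebra_simps)

lemma CC_a_inv [simp]: "\<ominus>[CC] x = - x"
proof -
 interpret cring CC by (rule cring_CC)
 show ?thesis using minus_equality[of "- x" x] by simp
qed

lemma CC_minus [simp]: "x \<ominus>[CC] y = x - y"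
 by (simp add: a_minus_def)

context cring
begin

subsection \<open>Prime ideals avoiding a multiplicative set\<close>

lemma ideal_chain_Union:
 assumes "C \<noteq> {}" "\<And>J. J \<in> C \<Longrightarrow> ideal J R" "\<And>J K. J \<in> C \<Longrightarrow> K \<in> C \<Longrightarrow> J \<subseteq> K \<or> K \<subseteq> J"
 shows "ideal (\<Union>C) R"
proof (rule idealI)
 show "ring R" by (rule ring_axioms)
 show "subgroup (\<Union>C) (add_monoid R)"
 proof (rule subgroup.intro)
  show "\<Union>C \<subseteq> carrier (add_monoid R)" using assms(2) ideal.Icarr by fastforce
  show "x \<otimes>[add_monoid R] y \<in> \<Union>C" if "x \<in> \<Union>C" "y \<in> \<Union>C" for x y
  proof -
   from that obtain J K where JK: "J \<in> C" "K \<in> C" "x \<in> J" "y \<in> K" by auto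
   hence "x \<oplus> y \<in> J \<or> x \<oplus> y \<in> K"
    using assms(2,3) additive_subgroup.a_closed[OF ideal.axioms(1)] by (metis subsetD)
   with JK show ?thesis by auto
  qed
  show "\<one>[add_monoid R] \<in> \<Union>C"
   using assms(1,2) additive_subgroup.zero_closed[OF ideal.axioms(1)] by fastforce
  show "inv\<^bsub>add_monoid R\<^esub> x \<in> \<Union>C" if "x \<in> \<Union>C" for x
   using that assms(2) additive_subgroup.a_inv_closed[OF ideal.axioms(1)]
   by (fastforce simp: a_inv_def)
 qed
 show "x \<otimes> a \<in> \<Union>C" "a \<otimes> x \<in> \<Union>C" if "a \<in> \<Union>C" "x \<in> carrier R" for a x
  using that assms(2) ideal.I_l_closed ideal.I_r_closed by fast+
qed

text \<open>An ideal that is maximal among those containing \<open>I\<close> and missing a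
  multiplicative set is prime. The last conclusion keeps the maximality itself: enlarging
  \<open>p\<close> by any further element must hit \<open>S\<close>. The construction of closed
  points needs this and not only primality.\<close>

lemma ideal_maximal_avoiding:
 assumes I: "ideal I R" and S: "S \<subseteq> carrier R" "\<one> \<in> S" "\<And>a b. a \<in> S \<Longrightarrow> b \<in> S \<Longrightarrow> a \<otimes> b \<in> S"
  and IS: "I \<inter> S = {}"
 obtains p where "primeideal p R" "I \<subseteq> p" "p \<inter> S = {}"
  "\<And>a. a \<in> carrier R \<Longrightarrow> a \<notin> p \<Longrightarrow> \<exists>m\<in>p. \<exists>r\<in>carrier R. m \<oplus> r \<otimes> a \<in> S"
proof -
 define \<A> where "\<A> = {J. ideal J R \<and> I \<subseteq> J \<and> J \<inter> S = {}}"
 have "\<exists>M\<in>\<A>. \<forall>X\<in>\<A>. M \<subseteq> X \<longrightarrow> X = M"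
 proof (rule subset_Zorn_nonempty)
  show "\<A> \<noteq> {}" using I IS by (auto simp: \<A>_def)
  fix C assume C: "C \<noteq> {}" "subset.chain \<A> C"
  have "ideal (\<Union>C) R"
   using C by (intro ideal_chain_Union) (auto simp: subset_chain_def \<A>_def)
  moreover have "I \<subseteq> \<Union>C" "\<Union>C \<inter> S = {}"
   using C unfolding subset_chain_def \<A>_def by blast+
  ultimately show "\<Union>C \<in> \<A>" by (simp add: \<A>_def)
 qed
 then obtain p where p: "p \<in> \<A>" and pmax: "\<And>X. X \<in> \<A> \<Longrightarrow> p \<subseteq> X \<Longrightarrow> X = p" by blast
 have pid: "ideal p R" and Ip: "I \<subseteq> p" and pS: "p \<inter> S = {}" using p by (auto simp: \<A>_def)
 interpret p: ideal p R by (rule pid)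
 have ex: "\<exists>m\<in>p. \<exists>r\<in>carrier R. m \<oplus> r \<otimes> a \<in> S" if a: "a \<in> carrier R" "a \<notin> p" for a
 proof (rule ccontr)
  assume no: "\<not> ?thesis"
  have id: "ideal (p <+> PIdl a) R" by (intro add_ideals pid cgenideal_ideal a)
  have sub: "p \<subseteq> p <+> PIdl a"
  proof
   fix x assume x: "x \<in> p"
   moreover have "\<zero> \<in> PIdl a" using additive_subgroup.zero_closed[OF ideal.axioms(1)[OF cgenideal_ideal[OF a(1)]]] .
   moreover have "x = x \<oplus> \<zero>" using x p.Icarr by simp
   ultimately show "x \<in> p <+> PIdl a" unfolding set_add_def' by blast
  qed
  have "p <+> PIdl a \<in> \<A>"
   using id sub Ip no by (auto simp: \<A>_def set_add_def' cgenideal_def)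
  hence "p <+> PIdl a = p" using pmax sub by blast
  moreover have "a \<in> p <+> PIdl a"
  proof -
   have "a = \<zero> \<oplus> a" using a by simp
   thus ?thesis using cgenideal_self[OF a(1)] p.zero_closed unfolding set_add_def' by blast
  qed
  ultimately show False using a by simp
 qed
 have "primeideal p R"
 proof (rule primeidealI[OF pid cring_axioms])
  show "carrier R \<noteq> p" using pS S by auto
  fix a b assume ab: "a \<in> carrier R" "b \<in> carrier R" "a \<otimes> b \<in> p"
  show "a \<in> p \<or> b \<in> p"
  proof (rule ccontr)
   assume "\<not> ?thesis"
   then obtain m r n t where mr: "m \<in> p" "r \<in> carrier R" "m \<oplus> r \<otimes> a \<in> S"
    and nt: "n \<in> p" "t \<in> carrier R" "n \<oplus> t \<otimes> b \<in> S"
    using ex ab by meson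
   have c: "m \<in> carrier R" "n \<in> carrier R" using mr nt p.Icarr by auto
   \<comment> \<open>Every term of the expansion has a factor in \<open>p\<close>, the last one
     because it contains \<open>a \<otimes> b\<close>; so a product of two elements of
     \<open>S\<close> would lie in \<open>p\<close>.\<close>
   have "(m \<oplus> r \<otimes> a) \<otimes> (n \<oplus> t \<otimes> b) = (n \<oplus> t \<otimes> b) \<otimes> m \<oplus> (r \<otimes> a) \<otimes> n \<oplus> (r \<otimes> t) \<otimes> (a \<otimes> b)"
    using ab mr nt c by algebra
   also have "\<dots> \<in> p"
    using ab mr nt c by (meson p.a_closed p.I_l_closed m_closed a_closed)
   finally show False using S(3)[OF mr(3) nt(3)] pS by auto
  qed
 qed
 thus ?thesis using Ip pS ex that by blast
qed

subsection \<open>Chain conditions\<close>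

text \<open>Ideals of a subring \<open>S\<close>, kept as subsets of the ambient ring so that
  generators can be adjoined to \<open>S\<close> without changing the ring structure. Negatives are
  covered by multiplication with the element -1 of a subring.\<close>

definition sideal :: "'a set \<Rightarrow> 'a set \<Rightarrow> bool" where
 "sideal S I \<longleftrightarrow> I \<subseteq> S \<and> \<zero> \<in> I \<and> (\<forall>a\<in>I. \<forall>b\<in>I. a \<oplus> b \<in> I) \<and> (\<forall>s\<in>S. \<forall>a\<in>I. s \<otimes> a \<in> I)"

definition sacc :: "'a set \<Rightarrow> bool" where
 "sacc S \<longleftrightarrow> (\<forall>f::nat \<Rightarrow> 'a set. (\<forall>n. sideal S (f n)) \<and> (\<forall>n. f n \<subseteq> f (Suc n)) \<longrightarrow>
  (\<exists>N. \<forall>n\<ge>N. f n = f N))"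

text \<open>Values at \<open>t\<close> of polynomials of degree less than \<open>n\<close> with
  coefficients in \<open>S\<close>; the union over \<open>n\<close> is the subring S[t].\<close>

fun low_terms :: "'a set \<Rightarrow> 'a \<Rightarrow> nat \<Rightarrow> 'a set" where
 "low_terms S t 0 = {\<zero>}"
| "low_terms S t (Suc n) = {q \<oplus> s \<otimes> t [^] n | q s. q \<in> low_terms S t n \<and> s \<in> S}"

context
 fixes S t
 assumes S: "subring S R" and t: "t \<in> carrier R"
begin

lemma S_carr: "s \<in> S \<Longrightarrow> s \<in> carrier R"
 using subringE(1)[OF S] by auto

lemma low_terms_carr: "q \<in> low_terms S t n \<Longrightarrow> q \<in> carrier R"
 by (induction n arbitrary: q) (use S_carr t in auto)

lemma low_terms_zero: "\<zero> \<in> low_terms S t n"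
proof (induction n)
 case (Suc n)
 have "\<zero> = \<zero> \<oplus> \<zero> \<otimes> t [^] n" using t by simp
 with Suc subringE(2)[OF S] show ?case by auto
qed auto

lemma low_terms_base: "s \<in> S \<Longrightarrow> s \<in> low_terms S t 1"
proof -
 assume s: "s \<in> S"
 have "s = \<zero> \<oplus> s \<otimes> t [^] (0::nat)" using S_carr[OF s] by simp
 with s show ?thesis unfolding One_nat_def low_terms.simps by blast
qed

lemma low_terms_Suc: "q \<in> low_terms S t n \<Longrightarrow> q \<in> low_terms S t (Suc n)"
proof -
 assume q: "q \<in> low_terms S t n"
 have "q = q \<oplus> \<zero> \<otimes> t [^] n" using t low_terms_carr[OF q] by simp
 with q subringE(2)[OF S] show ?thesis by auto
qed

lemma low_terms_mono: "m \<le> n \<Longrightarrow> q \<in> low_terms S t m \<Longrightarrow> q \<in> low_terms S t n"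
 by (induction rule: dec_induct) (use low_terms_Suc in auto)

lemma low_terms_add: "q \<in> low_terms S t n \<Longrightarrow> q' \<in> low_terms S t n \<Longrightarrow> q \<oplus> q' \<in> low_terms S t n"
proof (induction n arbitrary: q q')
 case (Suc n)
 then obtain u v s s' where *: "q = u \<oplus> s \<otimes> t [^] n" "q' = v \<oplus> s' \<otimes> t [^] n"
  "u \<in> low_terms S t n" "v \<in> low_terms S t n" "s \<in> S" "s' \<in> S" by auto
 have tn: "t [^] n \<in> carrier R" using t by simp
 have "q \<oplus> q' = (u \<oplus> v) \<oplus> (s \<oplus> s') \<otimes> t [^] n"
  unfolding * using *(3-6) S_carr low_terms_carr tn
  by (simp add: l_distr a_ac)
 moreover have "s \<oplus> s' \<in> S" using * subringE(7)[OF S] by auto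
 ultimately show ?case using Suc.IH[OF *(3,4)] by auto
qed auto

lemma low_terms_smult: "q \<in> low_terms S t n \<Longrightarrow> r \<in> S \<Longrightarrow> r \<otimes> q \<in> low_terms S t n"
proof (induction n arbitrary: q)
 case (Suc n)
 then obtain u s where *: "q = u \<oplus> s \<otimes> t [^] n" "u \<in> low_terms S t n" "s \<in> S" by auto
 have "r \<otimes> q = r \<otimes> u \<oplus> (r \<otimes> s) \<otimes> t [^] n"
  unfolding * using * S_carr low_terms_carr t Suc.prems by (simp add: r_distr m_assoc)
 moreover have "r \<otimes> s \<in> S" using * Suc.prems subringE(6)[OF S] by auto
 ultimately show ?case using Suc.IH[OF *(2)] Suc.prems by auto
qed (use S_carr in auto)

lemma low_terms_shift: "q \<in> low_terms S t n \<Longrightarrow> t \<otimes> q \<in> low_terms S t (Suc n)"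
proof (induction n arbitrary: q)
 case 0
 thus ?case using t low_terms_zero[of 1] by auto
next
 case (Suc n)
 then obtain u s where *: "q = u \<oplus> s \<otimes> t [^] n" "u \<in> low_terms S t n" "s \<in> S" by auto
 have "t \<otimes> q = t \<otimes> u \<oplus> s \<otimes> t [^] (Suc n)"
  unfolding * using * S_carr low_terms_carr t by (simp add: r_distr m_ac)
 with Suc.IH[OF *(2)] * show ?case by auto
qed

lemma low_terms_prod:
 assumes "p \<in> low_terms S t m" "q \<in> low_terms S t n"
 shows "p \<otimes> q \<in> low_terms S t (m + n)"
 using assms(2)
proof (induction n arbitrary: q)
 case 0
 thus ?case using low_terms_zero low_terms_carr[OF assms(1)] by auto
next
 case (Suc n)
 then obtain u s where *: "q = u \<oplus> s \<otimes> t [^] n" "u \<in> low_terms S t n" "s \<in> S" by auto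
 have pw: "(t [^] k) \<otimes> (s \<otimes> p) \<in> low_terms S t (m + k)" for k
 proof (induction k)
  case 0
  thus ?case using low_terms_smult[OF assms(1) *(3)] low_terms_carr by auto
 next
  case (Suc k)
  have "(t [^] Suc k) \<otimes> (s \<otimes> p) = t \<otimes> ((t [^] k) \<otimes> (s \<otimes> p))"
   using t * S_carr low_terms_carr[OF assms(1)] by (simp add: m_ac)
  with low_terms_shift[OF Suc] show ?case by simp
 qed
 have "p \<otimes> q = p \<otimes> u \<oplus> (t [^] n) \<otimes> (s \<otimes> p)"
  unfolding * using * S_carr low_terms_carr[OF assms(1)] low_terms_carr t by (simp add: r_distr m_ac)
 moreover have "p \<otimes> u \<in> low_terms S t (m + Suc n)"
  by (rule low_terms_mono[OF _ Suc.IH[OF *(2)]]) simp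
 moreover have "(t [^] n) \<otimes> (s \<otimes> p) \<in> low_terms S t (m + Suc n)"
  by (rule low_terms_mono[OF _ pw[of n]]) simp
 ultimately show ?case by (simp only: low_terms_add)
qed

lemma subring_low_terms: "subring (\<Union>n. low_terms S t n) R"
proof (rule subringI)
 show "(\<Union>n. low_terms S t n) \<subseteq> carrier R" using low_terms_carr by auto
 have "\<one> \<in> low_terms S t 1" using low_terms_base subringE(3)[OF S] by blast
 thus "\<one> \<in> (\<Union>n. low_terms S t n)" by blast
 fix p assume "p \<in> (\<Union>n. low_terms S t n)"
 then obtain m where p: "p \<in> low_terms S t m" by auto
 have "\<ominus> \<one> \<in> S" using subringE(3,5)[OF S] by auto
 from low_terms_smult[OF p this] have "\<ominus> p \<in> low_terms S t m"
  using low_terms_carr[OF p] by (simp add: l_minus)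
 thus "\<ominus> p \<in> (\<Union>n. low_terms S t n)" by blast
 fix q assume "q \<in> (\<Union>n. low_terms S t n)"
 then obtain n where q: "q \<in> low_terms S t n" by auto
 show "p \<otimes> q \<in> (\<Union>n. low_terms S t n)" using low_terms_prod[OF p q] by blast
 have "p \<oplus> q \<in> low_terms S t (max m n)"
  by (intro low_terms_add low_terms_mono[OF _ p] low_terms_mono[OF _ q]) auto
 thus "p \<oplus> q \<in> (\<Union>n. low_terms S t n)" by blast
qed

text \<open>These are the ideals of leading coefficients from Hilbert's basis theorem, growing with
  the degree by multiplication with \<open>t\<close>. As \<open>t\<close> may be algebraic over
  \<open>S\<close>, an element has no leading coefficient of its own; the set collects the
  coefficients of all its expressions.\<close>

lemma sideal_leading:
 assumes "sideal S' I" "S \<subseteq> S'" "t \<in> S'" "S' \<subseteq> carrier R"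
 shows "sideal S {r \<in> S. \<exists>q\<in>low_terms S t n. q \<oplus> r \<otimes> t [^] n \<in> I}"
  and "{r \<in> S. \<exists>q\<in>low_terms S t n. q \<oplus> r \<otimes> t [^] n \<in> I}
   \<subseteq> {r \<in> S. \<exists>q\<in>low_terms S t (Suc n). q \<oplus> r \<otimes> t [^] Suc n \<in> I}"
proof -
 have tn: "t [^] n \<in> carrier R" using t by simp
 show "sideal S {r \<in> S. \<exists>q\<in>low_terms S t n. q \<oplus> r \<otimes> t [^] n \<in> I}"
  unfolding sideal_def
 proof (intro conjI ballI)
  show "\<zero> \<in> {r \<in> S. \<exists>q\<in>low_terms S t n. q \<oplus> r \<otimes> t [^] n \<in> I}"
   using subringE(2)[OF S] assms(1) low_terms_zero t by (auto simp: sideal_def intro!: bexI[of _ \<zero>])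
 next
  fix a b assume a: "a \<in> {r \<in> S. \<exists>q\<in>low_terms S t n. q \<oplus> r \<otimes> t [^] n \<in> I}"
   and b: "b \<in> {r \<in> S. \<exists>q\<in>low_terms S t n. q \<oplus> r \<otimes> t [^] n \<in> I}"
  obtain q q' where q: "q \<in> low_terms S t n" "q \<oplus> a \<otimes> t [^] n \<in> I" "q' \<in> low_terms S t n" "q' \<oplus> b \<otimes> t [^] n \<in> I"
   using a b by auto
  have "(q \<oplus> a \<otimes> t [^] n) \<oplus> (q' \<oplus> b \<otimes> t [^] n) = (q \<oplus> q') \<oplus> (a \<oplus> b) \<otimes> t [^] n"
   using q a b S_carr low_terms_carr tn by (simp add: l_distr a_ac)
  hence "(q \<oplus> q') \<oplus> (a \<oplus> b) \<otimes> t [^] n \<in> I"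
   using q(2,4) assms(1) unfolding sideal_def by metis
  moreover have "a \<oplus> b \<in> S" using a b subringE(7)[OF S] by auto
  ultimately show "a \<oplus> b \<in> {r \<in> S. \<exists>q\<in>low_terms S t n. q \<oplus> r \<otimes> t [^] n \<in> I}"
   using low_terms_add[OF q(1,3)] by blast
 next
  fix s a assume s: "s \<in> S" and a: "a \<in> {r \<in> S. \<exists>q\<in>low_terms S t n. q \<oplus> r \<otimes> t [^] n \<in> I}"
  obtain q where q: "q \<in> low_terms S t n" "q \<oplus> a \<otimes> t [^] n \<in> I" using a by auto
  have "s \<otimes> (q \<oplus> a \<otimes> t [^] n) = s \<otimes> q \<oplus> (s \<otimes> a) \<otimes> t [^] n"
   using q a s S_carr low_terms_carr tn by (simp add: r_distr m_ac)
  hence "s \<otimes> q \<oplus> (s \<otimes> a) \<otimes> t [^] n \<in> I"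
   using q(2) s assms(1,2) unfolding sideal_def by (metis subsetD)
  moreover have "s \<otimes> a \<in> S" using a s subringE(6)[OF S] by auto
  ultimately show "s \<otimes> a \<in> {r \<in> S. \<exists>q\<in>low_terms S t n. q \<oplus> r \<otimes> t [^] n \<in> I}"
   using low_terms_smult[OF q(1) s] by blast
 qed auto
 show "{r \<in> S. \<exists>q\<in>low_terms S t n. q \<oplus> r \<otimes> t [^] n \<in> I}
   \<subseteq> {r \<in> S. \<exists>q\<in>low_terms S t (Suc n). q \<oplus> r \<otimes> t [^] Suc n \<in> I}"
 proof clarify
  fix r q assume r: "r \<in> S" "q \<in> low_terms S t n" "q \<oplus> r \<otimes> t [^] n \<in> I"
  have "t \<otimes> (q \<oplus> r \<otimes> t [^] n) = t \<otimes> q \<oplus> r \<otimes> t [^] Suc n"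
   using r S_carr low_terms_carr t by (simp add: r_distr m_ac)
  moreover have "t \<otimes> (q \<oplus> r \<otimes> t [^] n) \<in> I" using assms r by (auto simp: sideal_def)
  ultimately show "\<exists>q\<in>low_terms S t (Suc n). q \<oplus> r \<otimes> t [^] Suc n \<in> I"
   using low_terms_shift[OF r(2)] by auto
 qed
qed

text \<open>Hilbert's basis theorem, for S[t] inside a larger ring. A chain of ideals is controlled
  by the doubly indexed family \<open>J n m\<close> of leading coefficients in degree
  \<open>n\<close> of the \<open>m\<close>-th ideal.\<close>

lemma sacc_adjoin:
 assumes acc: "sacc S"
 shows "sacc (\<Union>n. low_terms S t n)"
 unfolding sacc_def
proof (intro allI impI, elim conjE)
 fix f :: "nat \<Rightarrow> 'a set"
 let ?S' = "\<Union>n. low_terms S t n"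
 assume f: "\<forall>n. sideal ?S' (f n)" and inc: "\<forall>n. f n \<subseteq> f (Suc n)"
 have mono: "f m \<subseteq> f n" if "m \<le> n" for m n using inc that lift_Suc_mono_le by blast
 define J where "J n m = {r \<in> S. \<exists>q\<in>low_terms S t n. q \<oplus> r \<otimes> t [^] n \<in> f m}" for n m
 have SS': "S \<subseteq> ?S'" using low_terms_base by blast
 have "\<one> \<in> low_terms S t 1" using low_terms_base subringE(3)[OF S] by blast
 from low_terms_shift[OF this] have tS': "t \<in> ?S'" using t by (metis UN_iff UNIV_I r_one)
 have S'c: "?S' \<subseteq> carrier R" using low_terms_carr by auto
 have Jid: "sideal S (J n m)" for n m
  unfolding J_def using sideal_leading(1)[OF _ SS' tS' S'c] f by blast
 have Jn: "J n m \<subseteq> J (Suc n) m" for n m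
  unfolding J_def using sideal_leading(2)[OF _ SS' tS' S'c] f by blast
 have Jnm: "J n m \<subseteq> J n' m'" if "n \<le> n'" "m \<le> m'" for n m n' m'
 proof -
  have "J n m \<subseteq> J n' m" using Jn that lift_Suc_mono_le[of "\<lambda>n. J n m"] by blast
  also have "\<dots> \<subseteq> J n' m'" using mono[OF that(2)] by (auto simp: J_def)
  finally show ?thesis .
 qed
 have ex: "\<exists>N. \<forall>k\<ge>N. g k = g N" if "\<And>k. sideal S (g k)" "\<And>k. g k \<subseteq> g (Suc k)" for g :: "nat \<Rightarrow> 'a set"
  using acc that unfolding sacc_def by blast
 \<comment> \<open>The diagonal chain settles all degrees from \<open>N0\<close> on at once; the
   finitely many smaller degrees are stabilised one by one, and \<open>M\<close> bounds all these
   stages.\<close>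
 obtain N0 where N0: "\<forall>k\<ge>N0. J k k = J N0 N0"
  using ex[of "\<lambda>k. J k k"] Jid Jnm by (metis Suc_n_not_le_n nat_le_linear)
 have "\<exists>N. \<forall>k\<ge>N. J n k = J n N" for n
  using ex[of "J n"] Jid Jnm by (metis Suc_n_not_le_n nat_le_linear)
 then obtain N1 where N1: "\<And>n k. k \<ge> N1 n \<Longrightarrow> J n k = J n (N1 n)" by metis
 define M where "M = Max (insert N0 (N1 ` {..<N0}))"
 have M0: "N0 \<le> M" and M1: "n < N0 \<Longrightarrow> N1 n \<le> M" for n by (auto simp: M_def)
 have JM: "J n m = J n M" if "m \<ge> M" for n m
 proof (cases "n < N0")
  case True
  thus ?thesis using N1[of n m] N1[of n M] M1 that by fastforce
 next
  case False
  have "J n m \<subseteq> J (max n m) (max n m)" by (rule Jnm) auto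
  also have "\<dots> = J N0 N0" using N0 False by (meson linorder_not_less max.coboundedI1)
  also have "\<dots> \<subseteq> J n M" using False M0 by (intro Jnm) auto
  finally show ?thesis using Jnm[of n n M m] that by auto
 qed
 \<comment> \<open>Induction on the degree: an element of the \<open>m\<close>-th ideal shares its
   leading coefficient with one of the \<open>M\<close>-th ideal, and the difference has lower
   degree.\<close>
 have key: "f m \<inter> low_terms S t n \<subseteq> f M" if m: "m \<ge> M" for m n
 proof (induction n)
  case 0
  thus ?case using f by (auto simp: sideal_def)
 next
  case (Suc n)
  show ?case
  proof
   fix x assume x: "x \<in> f m \<inter> low_terms S t (Suc n)"
   then obtain q r where q: "x = q \<oplus> r \<otimes> t [^] n" "q \<in> low_terms S t n" "r \<in> S" by auto
   hence "r \<in> J n M" using x JM[OF m, of n] by (auto simp: J_def)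
   then obtain q' where q': "q' \<in> low_terms S t n" "q' \<oplus> r \<otimes> t [^] n \<in> f M" by (auto simp: J_def)
   have m1: "\<ominus> \<one> \<in> S" using subringE(3,5)[OF S] by auto
   have cs: "q \<in> carrier R" "q' \<in> carrier R" "r \<otimes> t [^] n \<in> carrier R"
    using q q' low_terms_carr S_carr t by auto
   have eq: "q \<oplus> (\<ominus> \<one>) \<otimes> q' = x \<oplus> (\<ominus> \<one>) \<otimes> (q' \<oplus> r \<otimes> t [^] n)"
    unfolding q(1) using cs by algebra
   have "q' \<oplus> r \<otimes> t [^] n \<in> f m" using q' mono[OF m] by auto
   hence "q \<oplus> (\<ominus> \<one>) \<otimes> q' \<in> f m"
    unfolding eq using x f m1 SS' unfolding sideal_def by (metis IntE subsetD)
   moreover have "q \<oplus> (\<ominus> \<one>) \<otimes> q' \<in> low_terms S t n"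
    using low_terms_add low_terms_smult q q' m1 by blast
   ultimately have "q \<oplus> (\<ominus> \<one>) \<otimes> q' \<in> f M" using Suc.IH by blast
   moreover have "x = (q \<oplus> (\<ominus> \<one>) \<otimes> q') \<oplus> (q' \<oplus> r \<otimes> t [^] n)"
    unfolding q(1) using cs by algebra
   ultimately show "x \<in> f M" using q' f by (auto simp: sideal_def)
  qed
 qed
 have "f m = f M" if "m \<ge> M" for m
 proof
  show "f m \<subseteq> f M" using key[OF that] f unfolding sideal_def by blast
 qed (use mono that in auto)
 thus "\<exists>N. \<forall>n\<ge>N. f n = f N" by blast
qed

end

end

text \<open>The constants are the image of a field, whose only ideals are zero and everything; the
  finitely many generators are then adjoined one at a time.\<close>

lemma sacc_finite_type:
 fixes R :: "'a ring" (structure)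
 assumes R: "cring R" and k: "k \<in> ring_hom CC R" and ft: "finite_type_algebra R k"
 shows "cring.sacc R (carrier R)"
proof -
 interpret cring R by (rule R)
 interpret k: ring_hom_ring CC R k
  using k cring_CC ring_axioms by (simp add: ring_hom_ringI2 cring.axioms(1))
 have kc: "range k \<subseteq> carrier R" using k.hom_closed by auto
 have sub0: "subring (range k) R"
  using k.img_is_subring[OF ring.carrier_is_subring[OF k.R.ring_axioms]] by simp
 have "sacc (range k)"
  unfolding sacc_def
 proof (intro allI impI, elim conjE)
  fix f :: "nat \<Rightarrow> 'a set"
  assume f: "\<forall>n. sideal (range k) (f n)" and inc: "\<forall>n. f n \<subseteq> f (Suc n)"
  have dich: "f n = {\<zero>} \<or> f n = range k" for n
  proof (cases "f n = {\<zero>}")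
   case False
   then obtain x where x: "x \<in> f n" "x \<noteq> \<zero>" using f by (auto simp: sideal_def)
   then obtain c where c: "x = k c" using f unfolding sideal_def by blast
   hence "c \<noteq> 0" using x k.hom_zero by auto
   have "k e \<in> f n" for e
   proof -
    have "k e = k (e / c) \<otimes> k c"
     using k.hom_mult[of "e / c" c] \<open>c \<noteq> 0\<close> by simp
    thus ?thesis using x c f by (auto simp: sideal_def)
   qed
   thus ?thesis using f by (auto simp: sideal_def)
  qed auto
  show "\<exists>N. \<forall>n\<ge>N. f n = f N"
  proof (cases "\<forall>n. f n = {\<zero>}")
   case False
   then obtain N where N: "f N = range k" using dich by blast
   have "f n = f N" if "n \<ge> N" for n
   proof -
    have "f N \<subseteq> f n" using inc that lift_Suc_mono_le by blast
    thus ?thesis using N f unfolding sideal_def by (metis subset_antisym)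
   qed
   thus ?thesis by blast
  qed auto
 qed
 obtain S where S: "finite S" "S \<subseteq> carrier R" "generate_ring R (range k \<union> S) = carrier R"
  using ft by (auto simp: finite_type_algebra_def)
 have "\<exists>E. subring E R \<and> range k \<union> S \<subseteq> E \<and> sacc E"
  using S(1,2)
 proof (induction S)
  case empty
  thus ?case using sub0 \<open>sacc (range k)\<close> by auto
 next
  case (insert a F)
  then obtain E where E: "subring E R" "range k \<union> F \<subseteq> E" "sacc E" by auto
  have a: "a \<in> carrier R" using insert by auto
  have "E \<subseteq> (\<Union>n. low_terms E a n)" using low_terms_base[OF E(1) a] by blast
  moreover have "a \<in> (\<Union>n. low_terms E a n)"
  proof -
   have "\<one> \<in> low_terms E a 1" using low_terms_base[OF E(1) a] subringE(3)[OF E(1)] by blast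
   from low_terms_shift[OF E(1) a this] show ?thesis using a by (metis UN_iff UNIV_I r_one)
  qed
  ultimately show ?case
   using subring_low_terms[OF E(1) a] sacc_adjoin[OF E(1) a E(3)] E(2) by blast
 qed
 then obtain E where E: "subring E R" "range k \<union> S \<subseteq> E" "sacc E" by blast
 have "carrier R \<subseteq> E" using generate_ring_min_subring1[OF _ E(1,2)] S kc by auto
 hence "E = carrier R" using subringE(1)[OF E(1)] by auto
 thus ?thesis using E by simp
qed

text \<open>Gaussian elimination, by induction on the number of coordinates. The vectors are indexed
  by an arbitrary finite set, so that complex numbers can serve as indices later.\<close>

lemma nontrivial_linear_relation:
 fixes v :: "'i \<Rightarrow> nat \<Rightarrow> complex"
 assumes "finite I" "card I > n"
 shows "\<exists>\<mu>. (\<exists>i\<in>I. \<mu> i \<noteq> 0) \<and> (\<forall>j<n. (\<Sum>i\<in>I. \<mu> i * v i j) = 0)"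
 using assms
proof (induction n arbitrary: I v)
 case 0
 thus ?case by (intro exI[of _ "\<lambda>_. 1"]) (auto simp: card_gt_0_iff)
next
 case (Suc n)
 show ?case
 proof (cases "\<forall>i\<in>I. v i n = 0")
  case True
  with Suc.IH[of I v] Suc.prems obtain \<mu> where
   "\<exists>i\<in>I. \<mu> i \<noteq> 0" "\<forall>j<n. (\<Sum>i\<in>I. \<mu> i * v i j) = 0" by auto
  with True show ?thesis by (intro exI[of _ \<mu>]) (auto simp: less_Suc_eq)
 next
  case False
  then obtain l where l: "l \<in> I" "v l n \<noteq> 0" by auto
  \<comment> \<open>Subtracting a multiple of the pivot vector \<open>v l\<close> clears coordinate
    \<open>n\<close>.\<close>
  define w where "w = (\<lambda>i j. v i j - v i n / v l n * v l j)"
  obtain \<mu> where \<mu>: "\<exists>i\<in>I - {l}. \<mu> i \<noteq> 0" "\<forall>j<n. (\<Sum>i\<in>I - {l}. \<mu> i * w i j) = 0"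
   using Suc.IH[of "I - {l}" w] Suc.prems l by (metis card_Suc_Diff1 finite_Diff not_less_eq)
  \<comment> \<open>The coefficient of the pivot collects what was subtracted from the other
    vectors.\<close>
  define \<nu> where "\<nu> = \<mu>(l := - (\<Sum>i\<in>I - {l}. \<mu> i * v i n) / v l n)"
  have eq: "(\<Sum>i\<in>I. \<nu> i * v i j) = (\<Sum>i\<in>I - {l}. \<mu> i * w i j)" for j
  proof -
   have "(\<Sum>i\<in>I. \<nu> i * v i j) = \<nu> l * v l j + (\<Sum>i\<in>I - {l}. \<mu> i * v i j)"
    using Suc.prems(1) l(1) by (subst sum.remove) (auto simp: \<nu>_def intro!: sum.cong)
   also have "\<nu> l * v l j = (\<Sum>i\<in>I - {l}. - (\<mu> i * (v i n / v l n * v l j)))"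
    by (simp add: \<nu>_def sum_negf sum_distrib_right sum_divide_distrib times_divide_eq_right times_divide_eq_left del: sum_distrib_left) (simp add: sum_distrib_left mult_ac)
   also have "\<dots> + (\<Sum>i\<in>I - {l}. \<mu> i * v i j) = (\<Sum>i\<in>I - {l}. \<mu> i * w i j)"
    by (simp add: w_def algebra_simps flip: sum.distrib)
   finally show ?thesis .
  qed
  have "\<forall>j<Suc n. (\<Sum>i\<in>I - {l}. \<mu> i * w i j) = 0"
   using \<mu>(2) l by (auto simp: less_Suc_eq w_def)
  moreover have "\<exists>i\<in>I. \<nu> i \<noteq> 0" using \<mu>(1) by (auto simp: \<nu>_def)
  ultimately show ?thesis using eq by (intro exI[of _ \<nu>]) auto
 qed
qed

locale C_algebra = cring R for R :: "'a ring" (structure) +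
 fixes k :: "complex \<Rightarrow> 'a"
 assumes k: "k \<in> ring_hom CC R"
begin

lemma k_hom: "ring_hom_cring CC R k"
 using k cring_CC cring_axioms by (simp add: ring_hom_cring_axioms.intro ring_hom_cring.intro)

sublocale k: ring_hom_cring CC R k by (rule k_hom)

lemma k_closed [simp]: "k c \<in> carrier R"
 using k.hom_closed by simp

lemma k_add: "k (a + b) = k a \<oplus> k b" using k.hom_add[of a b] by simp
lemma k_mult: "k (a * b) = k a \<otimes> k b" using k.hom_mult[of a b] by simp
lemma k_zero [simp]: "k 0 = \<zero>" using k.hom_zero by simp
lemma k_one [simp]: "k 1 = \<one>" using k.hom_one by simp
lemma k_minus: "k (- a) = \<ominus> k a" using k.hom_a_inv[of a] by simp
lemma k_diff: "k (a - b) = k a \<ominus> k b" using k_add[of a "- b"] by (simp add: k_minus a_minus_def)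

lemma k_sum: "finite I \<Longrightarrow> k (\<Sum>i\<in>I. f i) = (\<Oplus>i\<in>I. k (f i))"
 by (induction I rule: finite_induct) (auto simp: k_add Pi_iff)

subsection \<open>Countable dimension\<close>

definition spanned_by :: "(nat \<Rightarrow> 'a) \<Rightarrow> 'a \<Rightarrow> nat \<Rightarrow> (nat \<Rightarrow> complex) \<Rightarrow> bool" where
 "spanned_by e a n c \<longleftrightarrow> a = (\<Oplus>j\<in>{..<n}. k (c j) \<otimes> e j)"

lemma spanned_by_extend:
 assumes "range e \<subseteq> carrier R" "spanned_by e a n c" "n \<le> m"
 shows "\<exists>c'. spanned_by e a m c'"
proof -
 have ec: "e j \<in> carrier R" for j using assms by auto
 have "(\<Oplus>j\<in>{..<m}. k (if j < n then c j else 0) \<otimes> e j)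
   = (\<Oplus>j\<in>{..<n} \<union> {n..<m}. k (if j < n then c j else 0) \<otimes> e j)"
  using assms(3) by (simp add: ivl_disj_un)
 also have "\<dots> = (\<Oplus>j\<in>{..<n}. k (if j < n then c j else 0) \<otimes> e j)
   \<oplus> (\<Oplus>j\<in>{n..<m}. k (if j < n then c j else 0) \<otimes> e j)"
  by (rule add.finprod_Un_disjoint) (auto simp: ec)
 also have "(\<Oplus>j\<in>{n..<m}. k (if j < n then c j else 0) \<otimes> e j) = \<zero>"
  by (rule add.finprod_one_eqI) (auto simp: ec)
 also have "(\<Oplus>j\<in>{..<n}. k (if j < n then c j else 0) \<otimes> e j) = (\<Oplus>j\<in>{..<n}. k (c j) \<otimes> e j)"
  by (rule add.finprod_cong') (auto simp: ec)
 finally have "spanned_by e a m (\<lambda>j. if j < n then c j else 0)"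
  using assms(2) by (simp add: spanned_by_def ec Pi_iff)
 thus ?thesis by blast
qed

lemma spanned_by_add:
 assumes "range e \<subseteq> carrier R" "spanned_by e a n c" "spanned_by e b n d"
 shows "spanned_by e (a \<oplus> b) n (\<lambda>j. c j + d j)"
proof -
 have ec: "e j \<in> carrier R" for j using assms by auto
 show ?thesis using assms(2,3) unfolding spanned_by_def
  by (simp add: ec k_add l_distr finsum_addf)
qed

lemma spanned_by_smult:
 assumes "range e \<subseteq> carrier R" "spanned_by e a n c"
 shows "spanned_by e (k x \<otimes> a) n (\<lambda>j. x * c j)"
proof -
 have ec: "e j \<in> carrier R" for j using assms by auto
 show ?thesis using assms(2) unfolding spanned_by_def
  by (simp add: ec k_mult m_assoc finsum_rdistr Pi_iff)
qed

text \<open>A spanning sequence, possibly with repetitions: only the upper bound on the dimension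
  matters.\<close>

definition countable_dim :: bool where
 "countable_dim \<longleftrightarrow> (\<exists>e. range e \<subseteq> carrier R \<and> (\<forall>a\<in>carrier R. \<exists>n c. spanned_by e a n c))"

text \<open>Monomials are represented by words in the finite set of generators. There are countably
  many words, and their span is closed under multiplication because concatenation of words is
  multiplication of monomials.\<close>

lemma countable_dim_finite_type:
 assumes "finite_type_algebra R k"
 shows countable_dim
proof -
 obtain S where S: "finite S" "S \<subseteq> carrier R" "generate_ring R (range k \<union> S) = carrier R"
  using assms by (auto simp: finite_type_algebra_def)
 define mon where "mon = (\<lambda>xs. foldr (\<otimes>) xs \<one>)"
 have monc: "set xs \<subseteq> carrier R \<Longrightarrow> mon xs \<in> carrier R" for xs
  by (induction xs) (auto simp: mon_def)
 have monS: "xs \<in> lists S \<Longrightarrow> mon xs \<in> carrier R" for xs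
  using monc[of xs] S(2) by (auto simp: in_lists_conv_set)
 have mon_app: "set xs \<subseteq> carrier R \<Longrightarrow> set ys \<subseteq> carrier R \<Longrightarrow> mon (xs @ ys) = mon xs \<otimes> mon ys" for xs ys
  by (induction xs) (use monc in \<open>auto simp: mon_def m_assoc\<close>)
 have cl: "countable (lists S)" using S(1) countable_finite by blast
 have ne: "lists S \<noteq> {}" by auto
 define e where "e = (\<lambda>n. mon (from_nat_into (lists S) n))"
 have inS: "from_nat_into (lists S) n \<in> lists S" for n using from_nat_into[OF ne] .
 have ec: "e n \<in> carrier R" for n unfolding e_def using inS[of n] S(2) by (intro monc) auto
 hence er: "range e \<subseteq> carrier R" by auto
 define W where "W = {a \<in> carrier R. \<exists>n c. spanned_by e a n c}"
 have Wadd: "a \<oplus> b \<in> W" if "a \<in> W" "b \<in> W" for a b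
 proof -
  from that obtain n c m d where "spanned_by e a n c" "spanned_by e b m d" by (auto simp: W_def)
  then obtain c' d' where "spanned_by e a (max n m) c'" "spanned_by e b (max n m) d'"
   using spanned_by_extend[OF er] by (metis max.cobounded1 max.cobounded2)
  from spanned_by_add[OF er this] show ?thesis using that by (auto simp: W_def)
 qed
 have Wsm: "k x \<otimes> a \<in> W" if "a \<in> W" for a x
  using that spanned_by_smult[OF er] by (fastforce simp: W_def)
 have We: "e i \<in> W" for i
 proof -
  have "(\<Oplus>j\<in>{..<Suc i}. k (if j = i then 1 else 0) \<otimes> e j) = (\<Oplus>j\<in>{..<Suc i}. if i = j then e j else \<zero>)"
   by (rule add.finprod_cong') (auto simp: ec)
  also have "\<dots> = e i" by (rule add.finprod_singleton) (auto simp: ec)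
  finally have "spanned_by e (e i) (Suc i) (\<lambda>j. if j = i then 1 else 0)" by (simp add: spanned_by_def)
  thus ?thesis using ec by (auto simp: W_def)
 qed
 have Wmon: "mon xs \<in> W" if xs: "xs \<in> lists S" for xs
 proof -
  obtain i where "from_nat_into (lists S) i = xs" using from_nat_into_surj[OF cl xs] by blast
  thus ?thesis using We[of i] by (simp add: e_def)
 qed
 have W0: "\<zero> \<in> W" using Wsm[OF We, of 0 0] ec by simp
 \<comment> \<open>Induction principle for the span: an element is reached from zero by adding
   multiples of single monomials.\<close>
 have Wind: "P a" if aW: "a \<in> W" and "P \<zero>" "\<And>x xs b. b \<in> W \<Longrightarrow> P b \<Longrightarrow> xs \<in> lists S \<Longrightarrow> P (b \<oplus> k x \<otimes> mon xs)"
  for P :: "'a \<Rightarrow> bool" and a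
 proof -
  obtain n c where "spanned_by e a n c" using aW by (auto simp: W_def)
  thus ?thesis
  proof (induction n arbitrary: a)
   case 0
   thus ?case using that by (simp add: spanned_by_def)
  next
   case (Suc n)
   define b where "b = (\<Oplus>j\<in>{..<n}. k (c j) \<otimes> e j)"
   have b: "spanned_by e b n c" "b \<in> carrier R" by (auto simp: spanned_by_def b_def ec Pi_iff)
   have "a = k (c n) \<otimes> e n \<oplus> b"
    using Suc.prems by (simp add: spanned_by_def lessThan_Suc b_def ec Pi_iff)
   hence "a = b \<oplus> k (c n) \<otimes> mon (from_nat_into (lists S) n)"
    using b ec[of n] by (simp add: a_comm) (simp add: e_def)
   moreover have "b \<in> W" using b by (auto simp: W_def)
   ultimately show ?case using Suc.IH[OF b(1)] that(3) inS by simp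
  qed
 qed
 have Wmm: "mon xs \<otimes> a \<in> W" if "a \<in> W" "xs \<in> lists S" for a xs
  using that(1)
 proof (rule Wind)
  show "mon xs \<otimes> \<zero> \<in> W" using W0 monS that by simp
 next
  fix x ys b assume *: "b \<in> W" "mon xs \<otimes> b \<in> W" "ys \<in> lists S"
  have c: "mon xs \<in> carrier R" "mon ys \<in> carrier R" "b \<in> carrier R"
   using monS * that by (auto simp: W_def)
  have "mon xs \<otimes> (b \<oplus> k x \<otimes> mon ys) = mon xs \<otimes> b \<oplus> k x \<otimes> mon (xs @ ys)"
   using c mon_app[of xs ys] that * S(2) by (simp add: r_distr m_ac subset_iff in_lists_conv_set)
  thus "mon xs \<otimes> (b \<oplus> k x \<otimes> mon ys) \<in> W"
   using Wadd[OF *(2)] Wsm[OF Wmon[of "xs @ ys"]] that * by simp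
 qed
 have "subring W R"
 proof (rule subringI)
  show "W \<subseteq> carrier R" by (auto simp: W_def)
  show "\<one> \<in> W" using Wmon[of "[]"] by (simp add: mon_def)
  fix a assume a: "a \<in> W"
  hence ac: "a \<in> carrier R" by (auto simp: W_def)
  show "\<ominus> a \<in> W" using Wsm[OF a, of "-1"] ac k_minus[of 1] by (simp add: l_minus)
  fix b assume b: "b \<in> W"
  hence bc: "b \<in> carrier R" by (auto simp: W_def)
  show "a \<oplus> b \<in> W" using Wadd a b by auto
  show "a \<otimes> b \<in> W" using a
  proof (rule Wind)
   show "\<zero> \<otimes> b \<in> W" using W0 bc by simp
   fix x xs a' assume *: "a' \<in> W" "a' \<otimes> b \<in> W" "xs \<in> lists S"
   have c: "mon xs \<in> carrier R" "a' \<in> carrier R"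
    using monS * by (auto simp: W_def)
   have "(a' \<oplus> k x \<otimes> mon xs) \<otimes> b = a' \<otimes> b \<oplus> k x \<otimes> (mon xs \<otimes> b)"
    using c bc by (simp add: l_distr m_assoc)
   thus "(a' \<oplus> k x \<otimes> mon xs) \<otimes> b \<in> W" using Wadd[OF *(2)] Wsm[OF Wmm[OF b *(3)]] by simp
  qed
 qed
 moreover have "range k \<union> S \<subseteq> W"
 proof -
  have "k x \<in> W" for x using Wsm[OF Wmon[of "[]"], of x] by (simp add: mon_def)
  moreover have "s \<in> W" if "s \<in> S" for s using Wmon[of "[s]"] that S by (auto simp: mon_def)
  ultimately show ?thesis by auto
 qed
 ultimately have "carrier R \<subseteq> W" using generate_ring_min_subring1[of "range k \<union> S" W] S by (simp add: image_subset_iff)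
 thus ?thesis unfolding countable_dim_def using er by (auto simp: W_def)
qed

text \<open>Each vector lies in the span of finitely many initial terms of the sequence. Uncountably
  many vectors share the same bound \<open>m\<close>, and any \<open>m + 1\<close> of them are
  dependent.\<close>

lemma uncountable_dependent:
 assumes cd: countable_dim and C: "uncountable C" and r: "\<And>c. c \<in> C \<Longrightarrow> r c \<in> carrier R"
 shows "\<exists>I \<mu>. finite I \<and> I \<subseteq> C \<and> (\<exists>i\<in>I. \<mu> i \<noteq> 0) \<and> (\<Oplus>i\<in>I. k (\<mu> i) \<otimes> r i) = \<zero>"
proof -
 obtain e where e: "range e \<subseteq> carrier R" "\<And>a. a \<in> carrier R \<Longrightarrow> \<exists>n c. spanned_by e a n c"
  using cd by (auto simp: countable_dim_def)
 have ec: "e j \<in> carrier R" for j using e by auto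
 have "\<forall>c\<in>C. \<exists>n v. spanned_by e (r c) n v" using e(2) r by blast
 then obtain n v where nv: "\<And>c. c \<in> C \<Longrightarrow> spanned_by e (r c) (n c) (v c)" by metis
 have "\<exists>m. uncountable {c \<in> C. n c = m}"
 proof (rule ccontr)
  assume "\<nexists>m. uncountable {c \<in> C. n c = m}"
  hence "countable (\<Union>m. {c \<in> C. n c = m})" by (intro countable_UN) auto
  moreover have "(\<Union>m. {c \<in> C. n c = m}) = C" by auto
  ultimately show False using C by simp
 qed
 then obtain m where "infinite {c \<in> C. n c = m}" using countable_finite by blast
 then obtain I where I: "finite I" "card I = Suc m" "I \<subseteq> {c \<in> C. n c = m}"
  using infinite_arbitrarily_large by blast
 obtain \<mu> where \<mu>: "\<exists>i\<in>I. \<mu> i \<noteq> 0" "\<forall>j<m. (\<Sum>i\<in>I. \<mu> i * v i j) = 0"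
  using nontrivial_linear_relation[of I m v] I by auto
 have "(\<Oplus>i\<in>I. k (\<mu> i) \<otimes> r i) = (\<Oplus>i\<in>I. \<Oplus>j\<in>{..<m}. k (\<mu> i * v i j) \<otimes> e j)"
 proof (rule finsum_cong')
  show "(\<lambda>i. \<Oplus>j\<in>{..<m}. k (\<mu> i * v i j) \<otimes> e j) \<in> I \<rightarrow> carrier R"
   by (auto simp: ec Pi_iff)
  fix i assume i: "i \<in> I"
  hence "spanned_by e (r i) m (v i)" using nv I by auto
  from spanned_by_smult[OF e(1) this, of "\<mu> i"]
  show "k (\<mu> i) \<otimes> r i = (\<Oplus>j\<in>{..<m}. k (\<mu> i * v i j) \<otimes> e j)" by (simp add: spanned_by_def)
 qed auto
 also have "\<dots> = (\<Oplus>j\<in>{..<m}. \<Oplus>i\<in>I. k (\<mu> i * v i j) \<otimes> e j)"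
  using I(1)
 proof (induction I rule: finite_induct)
  case empty
  have "(\<Oplus>j\<in>{..<m}. \<zero>) = \<zero>" by (rule add.finprod_one_eqI) auto
  thus ?case by simp
 next
  case (insert x F)
  thus ?case by (simp add: ec Pi_iff finsum_addf)
 qed
 also have "\<dots> = (\<Oplus>j\<in>{..<m}. k (\<Sum>i\<in>I. \<mu> i * v i j) \<otimes> e j)"
  by (rule add.finprod_cong') (auto simp: ec k_sum[OF I(1)] finsum_ldistr[OF I(1)] Pi_iff)
 also have "\<dots> = \<zero>" by (rule add.finprod_one_eqI) (use \<mu> ec in auto)
 finally show ?thesis using I \<mu> by blast
qed

subsection \<open>Evaluation of polynomials\<close>

definition ev :: "'a \<Rightarrow> complex poly \<Rightarrow> 'a" where
 "ev a p = fold_coeffs (\<lambda>c y. k c \<oplus> a \<otimes> y) p \<zero>"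

context
 fixes a assumes a: "a \<in> carrier R"
begin

lemma ev_0 [simp]: "ev a 0 = \<zero>" by (simp add: ev_def)

lemma ev_pCons: "ev a (pCons c p) = k c \<oplus> a \<otimes> ev a p"
 using a by (cases "c = 0 \<and> p = 0") (auto simp: ev_def)

lemma ev_closed [simp]: "ev a p \<in> carrier R"
 by (induction p) (auto simp: ev_pCons a)

lemma ev_add: "ev a (p + q) = ev a p \<oplus> ev a q"
proof (induction p q rule: poly_induct2)
 case (pCons c p d q)
 thus ?case using a by (simp add: ev_pCons k_add r_distr a_ac)
qed simp

lemma ev_smult: "ev a (Polynomial.smult c p) = k c \<otimes> ev a p"
proof (induction p)
 case (pCons d p)
 thus ?case using a by (simp add: ev_pCons k_mult r_distr m_ac)
qed simp

lemma ev_mult: "ev a (p * q) = ev a p \<otimes> ev a q"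
proof (induction p)
 case (pCons d p)
 thus ?case using a by (simp add: ev_pCons ev_add ev_smult l_distr m_assoc)
qed simp

lemma ev_linear: "ev a [:- c, 1:] = a \<ominus> k c"
 using a by (simp add: ev_pCons k_minus a_minus_def a_comm)

lemma ev_1: "ev a 1 = \<one>" using a by (simp add: one_pCons ev_pCons)

lemma ev_sum: "finite I \<Longrightarrow> ev a (\<Sum>i\<in>I. f i) = (\<Oplus>i\<in>I. ev a (f i))"
 by (induction I rule: finite_induct) (auto simp: ev_add Pi_iff)

text \<open>Over the complex numbers the polynomial splits into linear factors, and a prime ideal
  containing the product of their values contains one of them.\<close>

lemma prime_contains_linear:
 assumes p: "primeideal m R" and q: "q \<noteq> 0" "ev a q \<in> m"
 shows "\<exists>c. a \<ominus> k c \<in> m"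
 using q
proof (induction "degree q" arbitrary: q rule: less_induct)
 case less
 interpret m: primeideal m R by (rule p)
 show ?case
 proof (cases "degree q = 0")
  case True
  then obtain c where c: "q = [:c:]" by (auto elim: degree_eq_zeroE)
  hence "k c \<in> m" "c \<noteq> 0" using less a by (auto simp: ev_pCons)
  hence "k (inverse c) \<otimes> k c \<in> m" by (intro m.I_l_closed) auto
  hence "\<one> \<in> m" using \<open>c \<noteq> 0\<close> by (simp flip: k_mult)
  thus ?thesis using m.one_imp_carrier m.I_notcarr by blast
 next
  case False
  then obtain z where "poly q z = 0"
   using fundamental_theorem_of_algebra[of q] by (auto simp: constant_degree)
  then obtain q' where q': "q = [:- z, 1:] * q'" by (metis dvd_def poly_eq_0_iff_dvd)
  hence nz: "q' \<noteq> 0" using less by auto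
  hence deg: "degree q' < degree q" unfolding q' by (subst degree_mult_eq) auto
  have "(a \<ominus> k z) \<otimes> ev a q' \<in> m" using less(3) by (simp only: q' ev_mult ev_linear)
  hence "a \<ominus> k z \<in> m \<or> ev a q' \<in> m" using a by (intro m.I_prime) auto
  thus ?thesis using less(1)[OF deg nz] by blast
 qed
qed

end

subsection \<open>Points avoiding countably many hypersurfaces\<close>

text \<open>A prime that is maximal among the ideals containing \<open>p0\<close> and missing all
  products of elements of \<open>T\<close> has complex residue field. If no
  \<open>a \<ominus> k c\<close> were in it, maximality would give, for each \<open>c\<close>, an
  equation \<open>x c + r c (a - c) = s c\<close> with \<open>x c\<close> in \<open>m\<close> and
  \<open>s c\<close> in a countable set. One value \<open>y\<close> occurs for uncountably many
  \<open>c\<close>, and there \<open>r c\<close> behaves like \<open>y / (a - c)\<close> modulo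
  \<open>m\<close>. Countable dimension makes finitely many of these dependent; clearing
  denominators leaves a nonzero polynomial whose value at \<open>a\<close> lies in
  \<open>m\<close>.\<close>

theorem point_avoiding_countable:
 assumes cd: countable_dim and p0: "primeideal p0 R"
  and T: "countable T" "T \<subseteq> carrier R - p0"
 obtains m where "primeideal m R" "p0 \<subseteq> m" "T \<inter> m = {}" "\<And>a. a \<in> carrier R \<Longrightarrow> \<exists>c. a \<ominus> k c \<in> m"
proof -
 \<comment> \<open>All finite products of elements of \<open>T\<close>; a countable multiplicative
   set, which still misses the prime \<open>p0\<close>.\<close>
 define S where "S = (\<lambda>xs. foldr (\<otimes>) xs \<one>) ` lists T"
 interpret p0: primeideal p0 R by (rule p0)
 have one_p0: "\<one> \<notin> p0" using p0.one_imp_carrier p0.I_notcarr by blast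
 have mon: "foldr (\<otimes>) xs \<one> \<in> carrier R - p0" if "xs \<in> lists T" for xs
  using that
 proof (induction xs)
  case (Cons x xs)
  thus ?case using p0.I_prime[of x "foldr (\<otimes>) xs \<one>"] T by auto
 qed (use one_p0 in auto)
 have app: "foldr (\<otimes>) (xs @ ys) \<one> = foldr (\<otimes>) xs \<one> \<otimes> foldr (\<otimes>) ys \<one>"
  if "xs \<in> lists T" "ys \<in> lists T" for xs ys
  using that
 proof (induction xs)
  case (Cons x xs)
  thus ?case using mon[of xs] mon[of ys] T by (auto simp: m_assoc)
 qed (use mon in auto)
 have Sm: "x \<otimes> y \<in> S" if "x \<in> S" "y \<in> S" for x y
 proof -
  from that obtain xs ys where "x = foldr (\<otimes>) xs \<one>" "y = foldr (\<otimes>) ys \<one>" "xs \<in> lists T" "ys \<in> lists T"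
   by (auto simp only: S_def)
  thus ?thesis using app[of xs ys] append_in_lists_conv[of xs ys T] unfolding S_def by (metis imageI)
 qed
 have S1: "\<one> \<in> S" unfolding S_def by (rule image_eqI[of _ _ "[]"]) auto
 have TS: "T \<subseteq> S"
 proof
  fix t assume t: "t \<in> T"
  show "t \<in> S" unfolding S_def by (rule image_eqI[of _ _ "[t]"]) (use t T in auto)
 qed
 have cS: "countable S" unfolding S_def using T(1) by blast
 obtain m where m: "primeideal m R" "p0 \<subseteq> m" "m \<inter> S = {}"
  and mx: "\<And>a. a \<in> carrier R \<Longrightarrow> a \<notin> m \<Longrightarrow> \<exists>x\<in>m. \<exists>r\<in>carrier R. x \<oplus> r \<otimes> a \<in> S"
  by (rule ideal_maximal_avoiding[of p0 S]) (use p0.is_ideal mon Sm S1 in \<open>auto simp: S_def\<close>)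
 interpret m: primeideal m R by (rule m)
 have "\<exists>c. a \<ominus> k c \<in> m" if a: "a \<in> carrier R" for a
 proof (rule ccontr)
  assume no: "\<nexists>c. a \<ominus> k c \<in> m"
  have "\<forall>c. \<exists>x r. x \<in> m \<and> r \<in> carrier R \<and> x \<oplus> r \<otimes> (a \<ominus> k c) \<in> S"
   using mx[of "a \<ominus> k _"] no a by (metis minus_closed k_closed)
  then obtain x r where xr: "\<And>c. x c \<in> m" "\<And>c. r c \<in> carrier R" "\<And>c. x c \<oplus> r c \<otimes> (a \<ominus> k c) \<in> S"
   by metis
  define s where "s c = x c \<oplus> r c \<otimes> (a \<ominus> k c)" for c
  have sS: "s c \<in> S" for c using xr by (simp add: s_def)
  \<comment> \<open>Uncountably many constants are distributed over the countable set
    \<open>S\<close>. This is where the uncountability of the complex field is used.\<close>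
  have "\<exists>y\<in>S. uncountable {c. s c = y}"
  proof (rule ccontr)
   assume "\<not> ?thesis"
   hence "countable (\<Union>y\<in>S. {c. s c = y})" by (intro countable_UN cS) auto
   moreover have "(\<Union>y\<in>S. {c. s c = y}) = UNIV" using sS by auto
   ultimately show False using uncountable_UNIV_complex by simp
  qed
  then obtain y where y: "y \<in> S" "uncountable {c. s c = y}" by blast
  obtain I \<mu> where I: "finite I" "I \<subseteq> {c. s c = y}" "\<exists>i\<in>I. \<mu> i \<noteq> 0" "(\<Oplus>i\<in>I. k (\<mu> i) \<otimes> r i) = \<zero>"
   using uncountable_dependent[OF cd y(2), of r] xr by blast
  have yc: "y \<in> carrier R" using y mon by (auto simp: S_def)
  define P where "P J = (\<Prod>j\<in>J. [:- j, 1:])" for J :: "complex set"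
  \<comment> \<open>Numerator of the sum of the fractions \<mu> i / (X - i) over \<open>i\<close> in
    \<open>I\<close>, with common denominator \<open>P I\<close>.\<close>
  define q where "q = (\<Sum>i\<in>I. Polynomial.smult (\<mu> i) (P (I - {i})))"
  obtain l where l: "l \<in> I" "\<mu> l \<noteq> 0" using I by auto
  \<comment> \<open>At a pole \<open>l\<close> with nonzero coefficient only one term of
    \<open>q\<close> survives, so \<open>q\<close> is not zero.\<close>
  have "poly (P (I - {i})) l = 0" if "i \<in> I" "i \<noteq> l" for i
   unfolding P_def poly_prod using I(1) l that by (subst prod_zero_iff) auto
  hence "poly q l = \<mu> l * poly (P (I - {l})) l"
   using I(1) l by (simp add: q_def poly_sum sum.remove[of I l])
  moreover have "poly (P (I - {l})) l \<noteq> 0"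
   unfolding P_def poly_prod using I(1) by (subst prod_zero_iff) auto
  ultimately have "poly q l \<noteq> 0" using l by simp
  hence qnz: "q \<noteq> 0" by auto
  \<comment> \<open>The equation for \<open>i\<close> is multiplied by all the other linear factors,
    so that up to an element of \<open>m\<close> each term becomes the common multiple
    \<open>ev a (P I)\<close> of a term of the linear relation.\<close>
  have diff: "\<exists>z\<in>m. ev a (Polynomial.smult (\<mu> i) (P (I - {i}))) \<otimes> y = z \<oplus> ev a (P I) \<otimes> (k (\<mu> i) \<otimes> r i)" if i: "i \<in> I" for i
  proof -
   have yi: "y = x i \<oplus> r i \<otimes> (a \<ominus> k i)" using I i by (auto simp: s_def)
   have xc: "x i \<in> carrier R" using xr m.Icarr by auto
   have PI: "P I = [:- i, 1:] * P (I - {i})" unfolding P_def using I i by (simp add: prod.remove)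
   have e: "ev a (P I) = (a \<ominus> k i) \<otimes> ev a (P (I - {i}))"
    unfolding PI using a by (simp only: ev_mult ev_linear)
   have "ev a (Polynomial.smult (\<mu> i) (P (I - {i}))) \<otimes> y
    = (k (\<mu> i) \<otimes> ev a (P (I - {i}))) \<otimes> x i \<oplus> ev a (P I) \<otimes> (k (\<mu> i) \<otimes> r i)"
    unfolding e using a xc xr(2)
    by (simp add: ev_smult yi r_distr m_ac)
   moreover have "(k (\<mu> i) \<otimes> ev a (P (I - {i}))) \<otimes> x i \<in> m"
    using xr a by (intro m.I_l_closed) auto
   ultimately show ?thesis by blast
  qed
  then obtain z where z: "\<And>i. i \<in> I \<Longrightarrow> z i \<in> m"
   "\<And>i. i \<in> I \<Longrightarrow> ev a (Polynomial.smult (\<mu> i) (P (I - {i}))) \<otimes> y = z i \<oplus> ev a (P I) \<otimes> (k (\<mu> i) \<otimes> r i)"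
   by metis
  have zc: "\<And>i. i \<in> I \<Longrightarrow> z i \<in> carrier R" using z(1) m.Icarr by auto
  have "ev a q \<otimes> y = (\<Oplus>i\<in>I. ev a (Polynomial.smult (\<mu> i) (P (I - {i}))) \<otimes> y)"
   unfolding q_def using a I yc by (simp add: ev_sum finsum_ldistr Pi_iff)
  also have "\<dots> = (\<Oplus>i\<in>I. z i \<oplus> ev a (P I) \<otimes> (k (\<mu> i) \<otimes> r i))"
   by (rule add.finprod_cong') (use z zc xr a in auto)
  also have "\<dots> = (\<Oplus>i\<in>I. z i) \<oplus> (\<Oplus>i\<in>I. ev a (P I) \<otimes> (k (\<mu> i) \<otimes> r i))"
   by (rule finsum_addf) (use zc xr a in auto)
  also have "(\<Oplus>i\<in>I. ev a (P I) \<otimes> (k (\<mu> i) \<otimes> r i)) = ev a (P I) \<otimes> (\<Oplus>i\<in>I. k (\<mu> i) \<otimes> r i)"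
   using I(1) xr a by (simp add: finsum_rdistr Pi_iff)
  also have "ev a (P I) \<otimes> (\<Oplus>i\<in>I. k (\<mu> i) \<otimes> r i) = \<zero>" using I(4) a by simp
  also have "(\<Oplus>i\<in>I. z i) \<oplus> \<zero> = (\<Oplus>i\<in>I. z i)" using zc by (auto simp: Pi_iff)
  also have "(\<Oplus>i\<in>I. z i) \<in> m"
   using I(1) z(1) zc by (induction I rule: finite_induct) (auto simp: Pi_iff)
  finally have "ev a q \<otimes> y \<in> m" .
  moreover have "y \<notin> m" using y m by auto
  ultimately have "ev a q \<in> m" using m.I_prime[of "ev a q" y] a yc by auto
  thus False using prime_contains_linear[OF a m(1) qnz] no by blast
 qed
 thus ?thesis using that m TS by blast
qed

end

context cring
begin

subsection \<open>Relations over a generically reduced ring\<close>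

text \<open>Elements of the free module on \<open>I\<close> with all coordinates in \<aa>. They are
  total functions vanishing off \<open>I\<close>, so that vectors for different index sets can be
  added.\<close>

definition fin_supp :: "'i set \<Rightarrow> 'a set \<Rightarrow> ('i \<Rightarrow> 'a) set" where
 "fin_supp I \<aa> = {c. (\<forall>i. c i \<in> carrier R) \<and> finite {i. c i \<noteq> \<zero>} \<and> {i. c i \<noteq> \<zero>} \<subseteq> I \<and> range c \<subseteq> \<aa>}"

lemma fin_suppI:
 assumes "\<And>i. c i \<in> carrier R" "finite J" "\<And>i. i \<notin> J \<Longrightarrow> c i = \<zero>" "\<And>i. i \<notin> I \<Longrightarrow> c i = \<zero>" "\<And>i. c i \<in> \<aa>"
 shows "c \<in> fin_supp I \<aa>"
proof -
 have "{i. c i \<noteq> \<zero>} \<subseteq> J" using assms(3) by auto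
 thus ?thesis using assms finite_subset unfolding fin_supp_def by auto
qed

lemma fin_suppD:
 assumes "c \<in> fin_supp I \<aa>"
 shows "c i \<in> carrier R" "finite {i. c i \<noteq> \<zero>}" "i \<notin> I \<Longrightarrow> c i = \<zero>" "c i \<in> \<aa>"
 using assms by (auto simp: fin_supp_def)

lemma fin_supp_comb:
 assumes "c \<in> fin_supp I \<aa>" "d \<in> fin_supp I \<aa>" "ideal \<aa> R" "a \<in> carrier R" "b \<in> carrier R"
 shows "(\<lambda>i. a \<otimes> c i \<oplus> b \<otimes> d i) \<in> fin_supp I \<aa>"
proof -
 interpret aa: ideal \<aa> R by (rule assms)
 show ?thesis
  by (rule fin_suppI[where J = "{i. c i \<noteq> \<zero>} \<union> {i. d i \<noteq> \<zero>}"])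
   (use assms(4,5) fin_suppD[OF assms(1)] fin_suppD[OF assms(2)]
    additive_subgroup.a_closed[OF ideal.axioms(1)[OF assms(3)]] aa.I_l_closed in auto)
qed

context
 fixes p0 :: "'a set" and Rel :: "('i \<Rightarrow> 'a) set"
 assumes p0: "primeideal p0 R"
  and red: "\<And>a. a \<in> p0 \<Longrightarrow> \<exists>t\<in>carrier R - p0. t \<otimes> a = \<zero>"
  and Rel: "Rel \<subseteq> fin_supp UNIV (carrier R)" "(\<lambda>i. \<zero>) \<in> Rel"
  and Rel_comb: "\<And>c d a b. c \<in> Rel \<Longrightarrow> d \<in> Rel \<Longrightarrow> a \<in> carrier R \<Longrightarrow> b \<in> carrier R \<Longrightarrow>
   (\<lambda>i. a \<otimes> c i \<oplus> b \<otimes> d i) \<in> Rel"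
begin

text \<open>Linear independence modulo \<open>Rel\<close> over the local ring at \<open>p0\<close>.
  By the assumption on \<open>p0\<close> that ring is a field in which the elements of
  \<open>p0\<close> become zero, so a trivial relation is one with all coefficients in
  \<open>p0\<close>.\<close>

definition indep :: "'i set \<Rightarrow> bool" where
 "indep J \<longleftrightarrow> (\<forall>c\<in>Rel. {i. c i \<noteq> \<zero>} \<subseteq> J \<longrightarrow> (\<forall>i. c i \<in> p0))"

lemma indepD: "indep J \<Longrightarrow> c \<in> Rel \<Longrightarrow> {i. c i \<noteq> \<zero>} \<subseteq> J \<Longrightarrow> c i \<in> p0"
 by (auto simp: indep_def)

text \<open>Zorn's lemma applies because a relation has finite support and therefore involves only
  one member of a chain.\<close>

lemma maximal_indep:
 assumes "indep J0" "J0 \<subseteq> I"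
 obtains J where "indep J" "J0 \<subseteq> J" "J \<subseteq> I" "\<And>k. k \<in> I \<Longrightarrow> indep (insert k J) \<Longrightarrow> k \<in> J"
proof -
 define \<A> where "\<A> = {J. indep J \<and> J0 \<subseteq> J \<and> J \<subseteq> I}"
 have "\<exists>M\<in>\<A>. \<forall>X\<in>\<A>. M \<subseteq> X \<longrightarrow> X = M"
 proof (rule subset_Zorn_nonempty)
  show "\<A> \<noteq> {}" using assms by (auto simp: \<A>_def)
  fix C assume C: "C \<noteq> {}" "subset.chain \<A> C"
  have "indep (\<Union>C)"
   unfolding indep_def
  proof (intro ballI impI)
   fix c assume c: "c \<in> Rel" "{i. c i \<noteq> \<zero>} \<subseteq> \<Union>C"
   have "finite {i. c i \<noteq> \<zero>}" using c Rel fin_suppD(2)[of c UNIV "carrier R"] by auto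
   then obtain J where "J \<in> C" "{i. c i \<noteq> \<zero>} \<subseteq> J"
    using finite_subset_Union_chain[OF _ c(2) C] by blast
   moreover have "indep J" using C(2) \<open>J \<in> C\<close> by (auto simp: subset_chain_def \<A>_def)
   ultimately show "\<forall>i. c i \<in> p0" using c by (auto simp: indep_def)
  qed
  moreover have "J0 \<subseteq> \<Union>C" "\<Union>C \<subseteq> I" using C unfolding subset_chain_def \<A>_def by blast+
  ultimately show "\<Union>C \<in> \<A>" by (simp add: \<A>_def)
 qed
 then obtain J where J: "J \<in> \<A>" "\<And>X. X \<in> \<A> \<Longrightarrow> J \<subseteq> X \<Longrightarrow> X = J" by blast
 have "k \<in> J" if k: "k \<in> I" "indep (insert k J)" for k
 proof -
  have "insert k J = J" by (rule J(2)) (use k J(1) in \<open>auto simp: \<A>_def\<close>)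
  thus ?thesis by blast
 qed
 thus ?thesis using that J(1) by (auto simp: \<A>_def)
qed

definition unit_vec :: "'i \<Rightarrow> 'i \<Rightarrow> 'a" where
 "unit_vec k = (\<lambda>i. if i = k then \<one> else \<zero>)"

text \<open>For \<open>k\<close> outside \<open>J\<close> maximality yields a relation on
  \<open>insert k J\<close> that is not trivial. Its coefficient at \<open>k\<close> is outside
  \<open>p0\<close>: otherwise it is killed by some \<open>t\<close> outside \<open>p0\<close>,
  which leaves a nontrivial relation on \<open>J\<close>. So that coefficient can serve as the
  denominator \<open>t\<close>.\<close>

lemma reduce_unit_vec:
 assumes J: "indep J" "\<And>k. k \<in> I \<Longrightarrow> indep (insert k J) \<Longrightarrow> k \<in> J" and k: "k \<in> I"
 shows "\<exists>t\<in>carrier R - p0. \<exists>w\<in>fin_supp J (carrier R). (\<lambda>i. t \<otimes> unit_vec k i \<ominus> w i) \<in> Rel"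
proof -
 interpret p0: primeideal p0 R by (rule p0)
 show ?thesis
 proof (cases "k \<in> J")
  case True
  have "\<one> \<in> carrier R - p0" using p0.one_imp_carrier p0.I_notcarr by blast
  moreover have "unit_vec k \<in> fin_supp J (carrier R)"
   by (rule fin_suppI[of _ "{k}"]) (use True in \<open>auto simp: unit_vec_def\<close>)
  moreover have "(\<lambda>i. \<one> \<otimes> unit_vec k i \<ominus> unit_vec k i) = (\<lambda>i. \<zero>)"
   by (auto simp: unit_vec_def a_minus_def r_neg)
  ultimately show ?thesis using Rel(2) by metis
 next
  case False
  then obtain c i0 where c: "c \<in> Rel" "{i. c i \<noteq> \<zero>} \<subseteq> insert k J" "c i0 \<notin> p0"
   using J(2)[OF k] by (auto simp: indep_def)
  have cf: "c \<in> fin_supp UNIV (carrier R)" using c Rel by auto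
  note cc = fin_suppD[OF cf]
  have "c k \<notin> p0"
  proof
   assume "c k \<in> p0"
   then obtain t where t: "t \<in> carrier R - p0" "t \<otimes> c k = \<zero>" using red by blast
   have "(\<lambda>i. t \<otimes> c i \<oplus> \<zero> \<otimes> c i) \<in> Rel" using Rel_comb[OF c(1) c(1)] t by auto
   moreover have "(\<lambda>i. t \<otimes> c i \<oplus> \<zero> \<otimes> c i) = (\<lambda>i. t \<otimes> c i)" using t cc(1) by auto
   moreover have "{i. t \<otimes> c i \<noteq> \<zero>} \<subseteq> J"
   proof clarify
    fix i assume ne: "t \<otimes> c i \<noteq> \<zero>"
    hence "c i \<noteq> \<zero>" "i \<noteq> k" using t by auto
    thus "i \<in> J" using c(2) by auto
   qed
   ultimately have "t \<otimes> c i0 \<in> p0" using J(1) unfolding indep_def by metis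
   thus False using p0.I_prime[of t "c i0"] t cc(1) c(3) by auto
  qed
  moreover define w where "w = (\<lambda>i. if i = k then \<zero> else \<ominus> c i)"
  moreover have "w \<in> fin_supp J (carrier R)"
   by (rule fin_suppI[of _ "{i. c i \<noteq> \<zero>}"]) (use cc c(2) in \<open>auto simp: w_def\<close>)
  moreover have "(\<lambda>i. c k \<otimes> unit_vec k i \<ominus> w i) = c"
   using cc(1) by (auto simp: unit_vec_def w_def a_minus_def)
  ultimately show ?thesis using c(1) cc(1) by (metis DiffI)
 qed
qed

text \<open>The denominators are cleared index by index over the support of \<open>y\<close>. The
  coordinates of \<open>v\<close> stay in \<aa> because they are combinations of coordinates of
  \<open>y\<close>. Only the denominators \<open>t k\<close> have to avoid the prime
  \<open>m\<close>, which may be larger than \<open>p0\<close>.\<close>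

lemma reduce_vector:
 assumes t: "\<And>k. k \<in> I \<Longrightarrow> t k \<in> carrier R - m"
  and w: "\<And>k. k \<in> I \<Longrightarrow> w k \<in> fin_supp J (carrier R)"
  and tw: "\<And>k. k \<in> I \<Longrightarrow> (\<lambda>i. t k \<otimes> unit_vec k i \<ominus> w k i) \<in> Rel"
  and m: "primeideal m R" and \<aa>: "ideal \<aa> R" and y: "y \<in> fin_supp I \<aa>"
 shows "\<exists>s\<in>carrier R - m. \<exists>v\<in>fin_supp J \<aa>. (\<lambda>i. s \<otimes> y i \<ominus> v i) \<in> Rel"
proof -
 interpret m: primeideal m R by (rule m)
 interpret a: ideal \<aa> R by (rule \<aa>)
 have "finite {i. y i \<noteq> \<zero>}" using y by (simp add: fin_supp_def)
 moreover have "\<exists>s\<in>carrier R - m. \<exists>v\<in>fin_supp J \<aa>. (\<lambda>i. s \<otimes> y i \<ominus> v i) \<in> Rel"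
  if "finite F" "y \<in> fin_supp I \<aa>" "{i. y i \<noteq> \<zero>} \<subseteq> F" for y F
  using that
 proof (induction F arbitrary: y rule: finite_induct)
  case empty
  hence "y = (\<lambda>i. \<zero>)" by auto
  moreover have "(\<lambda>i. \<zero>) \<in> fin_supp J \<aa>" by (rule fin_suppI[of _ "{}"]) auto
  moreover have "\<one> \<in> carrier R - m" using m.one_imp_carrier m.I_notcarr by blast
  ultimately show ?case using Rel(2) by (force intro!: bexI[of _ \<one>] bexI[of _ "\<lambda>i. \<zero>"] simp: a_minus_def)
 next
  case (insert k F)
  note yc = fin_suppD[OF insert.prems(1)]
  show ?case
  proof (cases "k \<in> I")
   case False
   hence "{i. y i \<noteq> \<zero>} \<subseteq> F" using insert.prems yc(3) by auto
   thus ?thesis using insert by blast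
  next
   case k: True
   define y' where "y' = y(k := \<zero>)"
   have "y' \<in> fin_supp I \<aa>"
    by (rule fin_suppI[of _ "{i. y i \<noteq> \<zero>}"]) (use yc in \<open>auto simp: y'_def\<close>)
   moreover have "{i. y' i \<noteq> \<zero>} \<subseteq> F" using insert.prems by (auto simp: y'_def)
   ultimately obtain s v where s: "s \<in> carrier R - m" "v \<in> fin_supp J \<aa>" "(\<lambda>i. s \<otimes> y' i \<ominus> v i) \<in> Rel"
    using insert.IH by blast
   note vc = fin_suppD[OF s(2)] and wc = fin_suppD[OF w[OF k]]
   have st: "s \<otimes> t k \<in> carrier R - m" using m.I_prime[of s "t k"] s t[OF k] by auto
   define u where "u = (\<lambda>i. t k \<otimes> v i \<oplus> s \<otimes> (y k \<otimes> w k i))"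
   have "(\<lambda>i. y k \<otimes> w k i) \<in> fin_supp J \<aa>"
    by (rule fin_suppI[of _ "{i. w k i \<noteq> \<zero>}"]) (use yc wc a.I_r_closed in auto)
   hence "u \<in> fin_supp J \<aa>" unfolding u_def using s t[OF k] by (intro fin_supp_comb \<aa>) auto
   moreover have "(\<lambda>i. t k \<otimes> (s \<otimes> y' i \<ominus> v i) \<oplus> (s \<otimes> y k) \<otimes> (t k \<otimes> unit_vec k i \<ominus> w k i)) \<in> Rel"
    by (rule Rel_comb[OF s(3) tw[OF k]]) (use t[OF k] s yc in auto)
   moreover have "t k \<otimes> (s \<otimes> y' i \<ominus> v i) \<oplus> (s \<otimes> y k) \<otimes> (t k \<otimes> unit_vec k i \<ominus> w k i) = (s \<otimes> t k) \<otimes> y i \<ominus> u i" for i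
   proof -
    have c: "t k \<in> carrier R" "s \<in> carrier R" "v i \<in> carrier R" "w k i \<in> carrier R" "y k \<in> carrier R" "y i \<in> carrier R"
     using t[OF k] s vc wc yc by auto
    show ?thesis
    proof (cases "i = k")
     case True
     thus ?thesis using c unfolding y'_def u_def unit_vec_def by simp algebra
    next
     case False
     thus ?thesis using c unfolding y'_def u_def unit_vec_def by simp algebra
    qed
   qed
   ultimately show ?thesis using st by auto
  qed
 qed
 ultimately show ?thesis using y by blast
qed

text \<open>
 Modulo \<open>p0\<close> the ring is a field of fractions away from countably many hypersurfaces, so the module
 presented by \<open>Rel\<close> becomes free there, with a basis that extends a basis of the submodule
 generated by \<open>I0\<close>.
\<close>

lemma very_general_pure:
 assumes I: "countable (I :: 'i set)" and I0: "I0 \<subseteq> I"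
 shows "\<exists>T. countable T \<and> T \<subseteq> carrier R - p0 \<and>
  (\<forall>m. primeideal m R \<and> p0 \<subseteq> m \<and> T \<inter> m = {} \<longrightarrow>
   (\<forall>y\<in>fin_supp I0 (carrier R). \<forall>\<mu>\<in>fin_supp I m. (\<lambda>i. y i \<ominus> \<mu> i) \<in> Rel \<longrightarrow>
    (\<exists>s\<in>carrier R - m. \<exists>v\<in>fin_supp I0 m. (\<lambda>i. s \<otimes> y i \<ominus> v i) \<in> Rel)))"
proof -
 have "indep {}"
  using additive_subgroup.zero_closed[OF ideal.axioms(1)[OF primeideal.axioms(1)[OF p0]]]
  by (auto simp: indep_def)
 obtain J0 where J0: "indep J0" "J0 \<subseteq> I0" "\<And>k. k \<in> I0 \<Longrightarrow> indep (insert k J0) \<Longrightarrow> k \<in> J0"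
  by (rule maximal_indep[OF \<open>indep {}\<close> empty_subsetI[of I0]]) (rule that)
 have "J0 \<subseteq> I" using J0(2) I0 by auto
 \<comment> \<open>A basis of the submodule generated by \<open>I0\<close> is extended to one of the
   whole module; the inclusion of the two bases is what makes the comparison below possible.\<close>
 obtain J where J: "indep J" "J0 \<subseteq> J" "J \<subseteq> I" "\<And>k. k \<in> I \<Longrightarrow> indep (insert k J) \<Longrightarrow> k \<in> J"
  by (rule maximal_indep[OF J0(1) \<open>J0 \<subseteq> I\<close>]) (rule that)
 have "\<forall>k\<in>I0. \<exists>t w. t\<in>carrier R - p0 \<and> w\<in>fin_supp J0 (carrier R) \<and> (\<lambda>i. t \<otimes> unit_vec k i \<ominus> w i) \<in> Rel"
  using reduce_unit_vec[OF J0(1,3)] by blast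
 then obtain t0 w0 where t0: "\<And>k. k \<in> I0 \<Longrightarrow> t0 k\<in>carrier R - p0"
  "\<And>k. k \<in> I0 \<Longrightarrow> w0 k\<in>fin_supp J0 (carrier R)"
  "\<And>k. k \<in> I0 \<Longrightarrow> (\<lambda>i. t0 k \<otimes> unit_vec k i \<ominus> w0 k i) \<in> Rel" by metis
 have "\<forall>k\<in>I. \<exists>t w. t\<in>carrier R - p0 \<and> w\<in>fin_supp J (carrier R) \<and> (\<lambda>i. t \<otimes> unit_vec k i \<ominus> w i) \<in> Rel"
  using reduce_unit_vec[OF J(1,4)] by blast
 then obtain t w where t: "\<And>k. k \<in> I \<Longrightarrow> t k\<in>carrier R - p0"
  "\<And>k. k \<in> I \<Longrightarrow> w k\<in>fin_supp J (carrier R)"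
  "\<And>k. k \<in> I \<Longrightarrow> (\<lambda>i. t k \<otimes> unit_vec k i \<ominus> w k i) \<in> Rel" by metis
 \<comment> \<open>The denominators of both reductions, countably many since the index sets are
   countable.\<close>
 define T where "T = t0 ` I0 \<union> t ` I"
 \<comment> \<open>In terms of modules: an element of the submodule generated by \<open>I0\<close>
   that lies in \<open>m\<close> times the whole module lies, up to a denominator outside
   \<open>m\<close>, in \<open>m\<close> times the submodule. Equivalently, the inclusion stays
   injective on the fibre at \<open>m\<close>.\<close>
 have "\<exists>s\<in>carrier R - m. \<exists>v\<in>fin_supp I0 m. (\<lambda>i. s \<otimes> y i \<ominus> v i) \<in> Rel"
  if m: "primeideal m R" "p0 \<subseteq> m" "T \<inter> m = {}"
   and y: "y \<in> fin_supp I0 (carrier R)" and \<mu>: "\<mu> \<in> fin_supp I m" and y\<mu>: "(\<lambda>i. y i \<ominus> \<mu> i) \<in> Rel"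
  for m y \<mu>
 proof -
  interpret m: primeideal m R by (rule m)
  have t0m: "\<And>k. k \<in> I0 \<Longrightarrow> t0 k \<in> carrier R - m" and tm: "\<And>k. k \<in> I \<Longrightarrow> t k \<in> carrier R - m"
   using t0(1) t(1) m(3) unfolding T_def by blast+
  obtain s v where s: "s \<in> carrier R - m" "v \<in> fin_supp J0 (carrier R)" "(\<lambda>i. s \<otimes> y i \<ominus> v i) \<in> Rel"
   using reduce_vector[OF t0m t0(2,3) m(1) oneideal y] by blast
  obtain s' v' where s': "s' \<in> carrier R - m" "v' \<in> fin_supp J m" "(\<lambda>i. s' \<otimes> \<mu> i \<ominus> v' i) \<in> Rel"
   using reduce_vector[OF tm t(2,3) m(1) m.is_ideal \<mu>] by blast
  note c = fin_suppD[OF s(2)] fin_suppD[OF s'(2)] fin_suppD[OF y] fin_suppD[OF \<mu>]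
  \<comment> \<open>Since \<open>y\<close> and \<mu> have the same class, their reductions to the
    bases \<open>J0\<close> and \<open>J\<close> can be compared; \<open>y\<close> and \<mu>
    cancel.\<close>
  have "(\<lambda>i. s' \<otimes> v i \<ominus> s \<otimes> v' i) \<in> Rel"
  proof -
   have "(\<lambda>i. (s \<otimes> s') \<otimes> (y i \<ominus> \<mu> i) \<oplus> s \<otimes> (s' \<otimes> \<mu> i \<ominus> v' i)) \<in> Rel"
    using Rel_comb[OF y\<mu> s'(3)] s s' by auto
   from Rel_comb[OF this s(3), of \<one> "\<ominus> s'"]
   have "(\<lambda>i. \<one> \<otimes> ((s \<otimes> s') \<otimes> (y i \<ominus> \<mu> i) \<oplus> s \<otimes> (s' \<otimes> \<mu> i \<ominus> v' i)) \<oplus> (\<ominus> s') \<otimes> (s \<otimes> y i \<ominus> v i)) \<in> Rel"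
    using s' by auto
   moreover have "\<one> \<otimes> ((s \<otimes> s') \<otimes> (y i \<ominus> \<mu> i) \<oplus> s \<otimes> (s' \<otimes> \<mu> i \<ominus> v' i)) \<oplus> (\<ominus> s') \<otimes> (s \<otimes> y i \<ominus> v i)
    = s' \<otimes> v i \<ominus> s \<otimes> v' i" for i
   proof -
    have "s \<in> carrier R" "s' \<in> carrier R" "y i \<in> carrier R" "\<mu> i \<in> carrier R" "v i \<in> carrier R" "v' i \<in> carrier R"
     using s s' c by auto
    thus ?thesis by algebra
   qed
   ultimately show ?thesis by simp
  qed
  moreover have "{i. s' \<otimes> v i \<ominus> s \<otimes> v' i \<noteq> \<zero>} \<subseteq> J"
  proof clarify
   fix i assume ne: "s' \<otimes> v i \<ominus> s \<otimes> v' i \<noteq> \<zero>"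
   show "i \<in> J"
   proof (rule ccontr)
    assume "i \<notin> J"
    hence "v i = \<zero>" "v' i = \<zero>" using fin_suppD(3)[OF s(2), of i] fin_suppD(3)[OF s'(2), of i] J(2) by blast+
    thus False using ne s s' by (simp add: a_minus_def)
   qed
  qed
  ultimately have p: "s' \<otimes> v i \<ominus> s \<otimes> v' i \<in> m" for i
   using indepD[OF J(1), of "\<lambda>i. s' \<otimes> v i \<ominus> s \<otimes> v' i" i] m(2) by blast
  \<comment> \<open>Independence of \<open>J\<close> puts the difference in \<open>p0\<close>, hence
    in \<open>m\<close>; the coordinates of \<open>v'\<close> are in \<open>m\<close> by choice, and
    \<open>s'\<close> is not.\<close>
  have "v i \<in> m" for i
  proof -
   have cs: "s \<in> carrier R" "s' \<in> carrier R" "v i \<in> carrier R" "v' i \<in> carrier R" using s s' c by auto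
   have "s' \<otimes> v i = (s' \<otimes> v i \<ominus> s \<otimes> v' i) \<oplus> s \<otimes> v' i" using cs by algebra
   also have "\<dots> \<in> m" using p[of i] c cs by (intro m.a_closed m.I_l_closed) auto
   finally show ?thesis using m.I_prime[of s' "v i"] s' cs by auto
  qed
  moreover have "v i = \<zero>" if "i \<notin> I0" for i using fin_suppD(3)[OF s(2), of i] J0(2) that by blast
  ultimately have "v \<in> fin_supp I0 m"
   using fin_suppD(1,2)[OF s(2)] by (intro fin_suppI[of _ "{i. v i \<noteq> \<zero>}"]) simp_all
  thus ?thesis using s by blast
 qed
 hence "\<forall>m. primeideal m R \<and> p0 \<subseteq> m \<and> T \<inter> m = {} \<longrightarrow>
   (\<forall>y\<in>fin_supp I0 (carrier R). \<forall>\<mu>\<in>fin_supp I m. (\<lambda>i. y i \<ominus> \<mu> i) \<in> Rel \<longrightarrow>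
    (\<exists>s\<in>carrier R - m. \<exists>v\<in>fin_supp I0 m. (\<lambda>i. s \<otimes> y i \<ominus> v i) \<in> Rel))"
  by simp
 moreover have "countable T"
  unfolding T_def by (intro countable_Un countable_image I countable_subset[OF I0 I])
 moreover have "T \<subseteq> carrier R - p0"
  unfolding T_def by (rule Un_least; rule image_subsetI) (erule t0(1), erule t(1))
 ultimately show ?thesis by (intro exI[of _ T] conjI)
qed

end

end

section \<open>Prime ideals and the Zariski topology\<close>

lemma UN2_const:
 "A \<noteq> {} \<Longrightarrow> B \<noteq> {} \<Longrightarrow> (\<And>x y. x \<in> A \<Longrightarrow> y \<in> B \<Longrightarrow> f x y = K) \<Longrightarrow> (\<Union>x\<in>A. \<Union>y\<in>B. f x y) = K"
 by simp

lemma Units_hom: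
 assumes "ring R" "ring S" "h \<in> ring_hom R S" "a \<in> Units R"
 shows "h a \<in> Units S"
proof -
 from assms(4) obtain b where b: "a \<in> carrier R" "b \<in> carrier R" "b \<otimes>[R] a = \<one>[R]" "a \<otimes>[R] b = \<one>[R]"
  by (auto simp: Units_def)
 thus ?thesis
  using ring_hom_closed[OF assms(3)] ring_hom_mult[OF assms(3)] ring_hom_one[OF assms(3)]
  unfolding Units_def by (auto intro!: bexI[of _ "h b"]) metis+
qed

lemma prime_vimage:
 assumes R: "cring R" and S: "cring S" and h: "h \<in> ring_hom R S" and q: "primeideal q S"
 shows "primeideal {a \<in> carrier R. h a \<in> q} R"
proof -
 interpret h: ring_hom_ring R S h
  using R S h by (simp add: ring_hom_ringI2 cring.axioms(1))
 interpret q: primeideal q S by (rule q)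
 have id: "ideal {a \<in> carrier R. h a \<in> q} R" by (rule h.ideal_vimage) (rule q.is_ideal)
 show ?thesis
 proof (rule primeidealI[OF id R])
  have "h \<one>[R] \<notin> q" using q.one_imp_carrier q.I_notcarr by auto
  thus "carrier R \<noteq> {a \<in> carrier R. h a \<in> q}" using h.R.one_closed by blast
  fix a b assume "a \<in> carrier R" "b \<in> carrier R" "a \<otimes>[R] b \<in> {a \<in> carrier R. h a \<in> q}"
  thus "a \<in> {a \<in> carrier R. h a \<in> q} \<or> b \<in> {a \<in> carrier R. h a \<in> q}"
   using q.I_prime[of "h a" "h b"] by auto
 qed
qed

lemma (in primeideal) one_notin: "\<one> \<notin> I"
 using one_imp_carrier I_notcarr by blast

lemma (in primeideal) pow_notin: "f \<in> carrier R \<Longrightarrow> f \<notin> I \<Longrightarrow> f [^] (n::nat) \<notin> I"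
proof (induction n)
 case (Suc n)
 thus ?case using I_prime[of "f [^] n" f] by auto
qed (use one_notin in auto)

lemma (in primeideal) mult_notin: "a \<in> carrier R \<Longrightarrow> b \<in> carrier R \<Longrightarrow> a \<otimes> b \<notin> I \<longleftrightarrow> a \<notin> I \<and> b \<notin> I"
 using I_prime I_l_closed I_r_closed by blast

locale base_ring = cring R for R :: "'a ring" (structure)
begin

text \<open>The intersection of the primes over \<open>I\<close> is its radical: if no power of
  \<open>f\<close> were in \<open>I\<close>, some prime over \<open>I\<close> would miss all of
  them.\<close>

lemma pow_in_ideal:
 assumes I: "ideal I R" and f: "f \<in> carrier R" and pr: "\<And>p. primeideal p R \<Longrightarrow> I \<subseteq> p \<Longrightarrow> f \<in> p"
 shows "\<exists>n::nat. f [^] n \<in> I"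
proof (rule ccontr)
 assume "\<not> ?thesis"
 hence dis: "I \<inter> range (\<lambda>n::nat. f [^] n) = {}" by auto
 have "\<exists>p. primeideal p R \<and> I \<subseteq> p \<and> p \<inter> range (\<lambda>n::nat. f [^] n) = {}"
 proof (rule ideal_maximal_avoiding[OF I _ _ _ dis])
  show "range (\<lambda>n::nat. f [^] n) \<subseteq> carrier R" using f by auto
  show "\<one> \<in> range (\<lambda>n::nat. f [^] n)" by (rule range_eqI[of _ _ 0]) simp
  show "a \<otimes> b \<in> range (\<lambda>n::nat. f [^] n)"
   if "a \<in> range (\<lambda>n::nat. f [^] n)" "b \<in> range (\<lambda>n::nat. f [^] n)" for a b
   using that f by (auto simp: nat_pow_mult)
 qed blast
 then obtain p where p: "primeideal p R" "I \<subseteq> p" "p \<inter> range (\<lambda>n::nat. f [^] n) = {}" by blast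
 have "f [^] (1::nat) \<in> p" using pr[OF p(1,2)] f by simp
 thus False using p(3) by blast
qed

lemma annihilator_ideal:
 assumes a: "a \<in> carrier R"
 shows "ideal {t \<in> carrier R. t \<otimes> a = \<zero>} R"
proof (rule idealI[OF ring_axioms])
 show "subgroup {t \<in> carrier R. t \<otimes> a = \<zero>} (add_monoid R)"
  by (rule add.subgroupI) (use a in \<open>auto simp: l_distr l_minus a_inv_def[symmetric]\<close>)
 fix t x assume "t \<in> {t \<in> carrier R. t \<otimes> a = \<zero>}" and x: "x \<in> carrier R"
 hence t: "t \<in> carrier R" "t \<otimes> a = \<zero>" by auto
 hence "x \<otimes> t \<otimes> a = \<zero>" using a x by (simp add: m_assoc)
 thus "x \<otimes> t \<in> {t \<in> carrier R. t \<otimes> a = \<zero>}" "t \<otimes> x \<in> {t \<in> carrier R. t \<otimes> a = \<zero>}"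
  using t x by (auto simp: m_comm[of t x])
qed

definition D :: "'a \<Rightarrow> 'a set set" where
 "D f = {p. primeideal p R \<and> f \<notin> p}"

lemma D_mult: "a \<in> carrier R \<Longrightarrow> b \<in> carrier R \<Longrightarrow> D (a \<otimes> b) = D a \<inter> D b"
 using primeideal.mult_notin by (fastforce simp: D_def)

lemma D_one: "D \<one> = {p. primeideal p R}"
 using primeideal.one_notin by (auto simp: D_def)

lemma D_pow: "a \<in> carrier R \<Longrightarrow> D (a [^] Suc n) = D a"
 by (induction n) (auto simp: D_mult)

lemma openin_D: "f \<in> carrier R \<Longrightarrow> openin (Zariski R) (D f)"
 unfolding Zariski_def by (rule topology_generated_by_Basis) (auto simp: D_def)

text \<open>The generating sets are already a basis, because \<open>D f\<close> and
  \<open>D g\<close> intersect in \<open>D\<close> of the product.\<close>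

lemma openin_ZariskiD:
 assumes "openin (Zariski R) U"
 shows "U \<subseteq> {p. primeideal p R} \<and> (\<forall>p\<in>U. \<exists>f\<in>carrier R. p \<in> D f \<and> D f \<subseteq> U)"
proof -
 from assms have "generate_topology_on {{p. primeideal p R \<and> f \<notin> p} | f. f \<in> carrier R} U"
  by (simp add: Zariski_def openin_topology_generated_by_iff)
 thus ?thesis
 proof (induction rule: generate_topology_on.induct)
  case (Int a b)
  show ?case
  proof (intro conjI ballI)
   show "a \<inter> b \<subseteq> {p. primeideal p R}" using Int by auto
   fix p assume "p \<in> a \<inter> b"
   then obtain f g where "f \<in> carrier R" "p \<in> D f" "D f \<subseteq> a" "g \<in> carrier R" "p \<in> D g" "D g \<subseteq> b"
    using Int by (meson IntE)
   thus "\<exists>f\<in>carrier R. p \<in> D f \<and> D f \<subseteq> a \<inter> b"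
    by (intro bexI[of _ "f \<otimes> g"]) (auto simp: D_mult)
  qed
 next
  case (UN K)
  thus ?case by (meson Union_iff Sup_le_iff Sup_upper order_trans)
 next
  case (Basis s)
  thus ?case by (auto simp: D_def)
 qed auto
qed

lemma topspace_Zariski: "topspace (Zariski R) = {p. primeideal p R}"
proof
 show "topspace (Zariski R) \<subseteq> {p. primeideal p R}" using openin_ZariskiD openin_topspace by blast
 show "{p. primeideal p R} \<subseteq> topspace (Zariski R)"
  using openin_subset[OF openin_D[OF one_closed]] by (simp add: D_one)
qed

lemma openin_Zariski_iff:
 "openin (Zariski R) U \<longleftrightarrow> U \<subseteq> {p. primeideal p R} \<and> (\<forall>p\<in>U. \<exists>f\<in>carrier R. p \<in> D f \<and> D f \<subseteq> U)"
proof
 assume *: "U \<subseteq> {p. primeideal p R} \<and> (\<forall>p\<in>U. \<exists>f\<in>carrier R. p \<in> D f \<and> D f \<subseteq> U)"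
 hence "U = \<Union>{D f | f. f \<in> carrier R \<and> D f \<subseteq> U}" by blast
 moreover have "openin (Zariski R) (\<Union>{D f | f. f \<in> carrier R \<and> D f \<subseteq> U})"
  using openin_D by blast
 ultimately show "openin (Zariski R) U" by simp
qed (rule openin_ZariskiD)

subsection \<open>Localisation\<close>

context
 fixes p assumes p: "primeideal p R"
begin

interpretation p: primeideal p R by (rule p)

lemma frac_rel_equiv: "equiv (carrier R \<times> (carrier R - p)) (frac_rel R p)"
proof (rule equivI)
 show "frac_rel R p \<subseteq> (carrier R \<times> (carrier R - p)) \<times> (carrier R \<times> (carrier R - p))"
  by (auto simp: frac_rel_def)
 show "refl_on (carrier R \<times> (carrier R - p)) (frac_rel R p)"
  using p.one_notin by (auto simp: refl_on_def frac_rel_def a_minus_def r_neg intro!: bexI[of _ \<one>])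
 show "sym (frac_rel R p)"
 proof (rule symI, clarify)
  fix a b a' b' assume "((a, b), (a', b')) \<in> frac_rel R p"
  then obtain t where t: "a \<in> carrier R" "a' \<in> carrier R" "b \<in> carrier R - p" "b' \<in> carrier R - p" "t \<in> carrier R - p"
   "t \<otimes> (a \<otimes> b' \<ominus> a' \<otimes> b) = \<zero>" by (auto simp: frac_rel_def)
  have "t \<otimes> (a' \<otimes> b \<ominus> a \<otimes> b') = \<ominus> (t \<otimes> (a \<otimes> b' \<ominus> a' \<otimes> b))"
  proof -
   have "a \<in> carrier R" "a' \<in> carrier R" "b \<in> carrier R" "b' \<in> carrier R" "t \<in> carrier R" using t by auto
   thus ?thesis by algebra
  qed
  hence "t \<otimes> (a' \<otimes> b \<ominus> a \<otimes> b') = \<zero>" using t by simp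
  thus "((a', b'), (a, b)) \<in> frac_rel R p" using t by (auto simp: frac_rel_def)
 qed
 show "trans (frac_rel R p)"
 proof (rule transI, clarify)
  fix a b a' b' a'' b''
  assume "((a, b), (a', b')) \<in> frac_rel R p" "((a', b'), (a'', b'')) \<in> frac_rel R p"
  then obtain t u where t: "a \<in> carrier R" "a' \<in> carrier R" "a'' \<in> carrier R" "b \<in> carrier R - p" "b' \<in> carrier R - p"
   "b'' \<in> carrier R - p" "t \<in> carrier R - p" "u \<in> carrier R - p"
   "t \<otimes> (a \<otimes> b' \<ominus> a' \<otimes> b) = \<zero>" "u \<otimes> (a' \<otimes> b'' \<ominus> a'' \<otimes> b') = \<zero>" by (auto simp: frac_rel_def)
  have c: "a \<in> carrier R" "a' \<in> carrier R" "a'' \<in> carrier R" "b \<in> carrier R" "b' \<in> carrier R" "b'' \<in> carrier R"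
   "t \<in> carrier R" "u \<in> carrier R" using t by auto
  \<comment> \<open>The middle denominator \<open>b'\<close> has to be part of the multiplier, which
    is allowed since it is outside the prime.\<close>
  have "(t \<otimes> u \<otimes> b') \<otimes> (a \<otimes> b'' \<ominus> a'' \<otimes> b)
   = u \<otimes> b'' \<otimes> (t \<otimes> (a \<otimes> b' \<ominus> a' \<otimes> b)) \<oplus> t \<otimes> b \<otimes> (u \<otimes> (a' \<otimes> b'' \<ominus> a'' \<otimes> b'))"
   using c by algebra
  also have "\<dots> = \<zero>" using t(9,10) c by simp
  finally have "(t \<otimes> u \<otimes> b') \<otimes> (a \<otimes> b'' \<ominus> a'' \<otimes> b) = \<zero>" .
  moreover have "t \<otimes> u \<otimes> b' \<in> carrier R - p" using t p.mult_notin by auto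
  ultimately show "((a, b), (a'', b'')) \<in> frac_rel R p" using t by (auto simp: frac_rel_def)
 qed
qed

lemma frac_at_eq:
 assumes "a \<in> carrier R" "b \<in> carrier R - p" "a' \<in> carrier R" "b' \<in> carrier R - p"
 shows "frac_at R p a b = frac_at R p a' b' \<longleftrightarrow> (\<exists>t\<in>carrier R - p. t \<otimes> (a \<otimes> b' \<ominus> a' \<otimes> b) = \<zero>)"
proof -
 have "frac_at R p a b = frac_at R p a' b' \<longleftrightarrow> ((a, b), (a', b')) \<in> frac_rel R p"
  unfolding frac_at_def using assms by (intro eq_equiv_class_iff[OF frac_rel_equiv]) auto
 thus ?thesis using assms by (auto simp: frac_rel_def)
qed

lemma frac_at_eqI:
 assumes "a \<in> carrier R" "b \<in> carrier R - p" "a' \<in> carrier R" "b' \<in> carrier R - p" "a \<otimes> b' = a' \<otimes> b"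
 shows "frac_at R p a b = frac_at R p a' b'"
 using assms p.one_notin by (subst frac_at_eq) (auto intro!: bexI[of _ \<one>] simp: a_minus_def r_neg)

lemma frac_at_mem:
 "(c, d) \<in> frac_at R p a b \<longleftrightarrow> a \<in> carrier R \<and> c \<in> carrier R \<and> b \<in> carrier R - p \<and> d \<in> carrier R - p \<and>
  (\<exists>t\<in>carrier R - p. t \<otimes> (a \<otimes> d \<ominus> c \<otimes> b) = \<zero>)"
 by (auto simp: frac_at_def frac_rel_def)

lemma frac_at_self:
 assumes "a \<in> carrier R" "b \<in> carrier R - p" shows "(a, b) \<in> frac_at R p a b"
 using assms equiv_class_self[OF frac_rel_equiv] by (auto simp: frac_at_def)

text \<open>The product in \<open>local_ring\<close> is a union over all pairs of representatives;
  it collapses to one class because the class does not depend on the representatives.\<close>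

lemma local_mult:
 assumes "a \<in> carrier R" "b \<in> carrier R - p" "c \<in> carrier R" "d \<in> carrier R - p"
 shows "frac_at R p a b \<otimes>[local_ring R p] frac_at R p c d = frac_at R p (a \<otimes> c) (b \<otimes> d)"
  (is "?lhs = _")
proof -
 have key: "frac_at R p (a' \<otimes> c') (b' \<otimes> d') = frac_at R p (a \<otimes> c) (b \<otimes> d)"
  if "(a', b') \<in> frac_at R p a b" "(c', d') \<in> frac_at R p c d" for a' b' c' d'
 proof -
  from that obtain t u where t: "a' \<in> carrier R" "b' \<in> carrier R - p" "c' \<in> carrier R" "d' \<in> carrier R - p"
   "t \<in> carrier R - p" "u \<in> carrier R - p" "t \<otimes> (a \<otimes> b' \<ominus> a' \<otimes> b) = \<zero>" "u \<otimes> (c \<otimes> d' \<ominus> c' \<otimes> d) = \<zero>"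
   unfolding frac_at_mem by blast
  have c: "a \<in> carrier R" "b \<in> carrier R" "a' \<in> carrier R" "b' \<in> carrier R" "c \<in> carrier R" "d \<in> carrier R"
   "c' \<in> carrier R" "d' \<in> carrier R" "t \<in> carrier R" "u \<in> carrier R" using t assms by auto
  have "(t \<otimes> u) \<otimes> ((a \<otimes> c) \<otimes> (b' \<otimes> d') \<ominus> (a' \<otimes> c') \<otimes> (b \<otimes> d))
   = u \<otimes> c \<otimes> d' \<otimes> (t \<otimes> (a \<otimes> b' \<ominus> a' \<otimes> b)) \<oplus> t \<otimes> a' \<otimes> b \<otimes> (u \<otimes> (c \<otimes> d' \<ominus> c' \<otimes> d))"
   using c by algebra
  also have "\<dots> = \<zero>" using t c by simp
  finally have z: "(t \<otimes> u) \<otimes> ((a \<otimes> c) \<otimes> (b' \<otimes> d') \<ominus> (a' \<otimes> c') \<otimes> (b \<otimes> d)) = \<zero>" .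
  have m: "t \<otimes> u \<in> carrier R - p" "b \<otimes> d \<in> carrier R - p" "b' \<otimes> d' \<in> carrier R - p"
   using t assms p.mult_notin by auto
  have "frac_at R p (a \<otimes> c) (b \<otimes> d) = frac_at R p (a' \<otimes> c') (b' \<otimes> d')"
   by (subst frac_at_eq) (use m c z in blast)+
  thus ?thesis by simp
 qed
 have self: "(a, b) \<in> frac_at R p a b" "(c, d) \<in> frac_at R p c d" using assms frac_at_self by auto
 have "?lhs = (\<Union>x\<in>frac_at R p a b. \<Union>y\<in>frac_at R p c d. frac_at R p (fst x \<otimes> fst y) (snd x \<otimes> snd y))"
  by (simp add: local_ring_def case_prod_beta)
 also have "\<dots> = (frac_at R p (a \<otimes> c) (b \<otimes> d))"
 proof (rule UN2_const)
  fix x y assume "x \<in> frac_at R p a b" "y \<in> frac_at R p c d"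
  thus "frac_at R p (fst x \<otimes> fst y) (snd x \<otimes> snd y) = (frac_at R p (a \<otimes> c) (b \<otimes> d))"
   using key[of "fst x" "snd x" "fst y" "snd y"] by simp
 qed (use self in blast)+
 finally show ?thesis .
qed

lemma local_add:
 assumes "a \<in> carrier R" "b \<in> carrier R - p" "c \<in> carrier R" "d \<in> carrier R - p"
 shows "frac_at R p a b \<oplus>[local_ring R p] frac_at R p c d = frac_at R p (a \<otimes> d \<oplus> c \<otimes> b) (b \<otimes> d)"
  (is "?lhs = _")
proof -
 have key: "frac_at R p (a' \<otimes> d' \<oplus> c' \<otimes> b') (b' \<otimes> d') = frac_at R p (a \<otimes> d \<oplus> c \<otimes> b) (b \<otimes> d)"
  if "(a', b') \<in> frac_at R p a b" "(c', d') \<in> frac_at R p c d" for a' b' c' d'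
 proof -
  from that obtain t u where t: "a' \<in> carrier R" "b' \<in> carrier R - p" "c' \<in> carrier R" "d' \<in> carrier R - p"
   "t \<in> carrier R - p" "u \<in> carrier R - p" "t \<otimes> (a \<otimes> b' \<ominus> a' \<otimes> b) = \<zero>" "u \<otimes> (c \<otimes> d' \<ominus> c' \<otimes> d) = \<zero>"
   unfolding frac_at_mem by blast
  have c: "a \<in> carrier R" "b \<in> carrier R" "a' \<in> carrier R" "b' \<in> carrier R" "c \<in> carrier R" "d \<in> carrier R"
   "c' \<in> carrier R" "d' \<in> carrier R" "t \<in> carrier R" "u \<in> carrier R" using t assms by auto
  have "(t \<otimes> u) \<otimes> ((a \<otimes> d \<oplus> c \<otimes> b) \<otimes> (b' \<otimes> d') \<ominus> (a' \<otimes> d' \<oplus> c' \<otimes> b') \<otimes> (b \<otimes> d))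
   = u \<otimes> d \<otimes> d' \<otimes> (t \<otimes> (a \<otimes> b' \<ominus> a' \<otimes> b)) \<oplus> t \<otimes> b \<otimes> b' \<otimes> (u \<otimes> (c \<otimes> d' \<ominus> c' \<otimes> d))"
   using c by algebra
  also have "\<dots> = \<zero>" using t c by simp
  finally have z: "(t \<otimes> u) \<otimes> ((a \<otimes> d \<oplus> c \<otimes> b) \<otimes> (b' \<otimes> d') \<ominus> (a' \<otimes> d' \<oplus> c' \<otimes> b') \<otimes> (b \<otimes> d)) = \<zero>" .
  have m: "t \<otimes> u \<in> carrier R - p" "b \<otimes> d \<in> carrier R - p" "b' \<otimes> d' \<in> carrier R - p"
   using t assms p.mult_notin by auto
  have "frac_at R p (a \<otimes> d \<oplus> c \<otimes> b) (b \<otimes> d) = frac_at R p (a' \<otimes> d' \<oplus> c' \<otimes> b') (b' \<otimes> d')"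
   by (subst frac_at_eq) (use m c z in blast)+
  thus ?thesis by simp
 qed
 have self: "(a, b) \<in> frac_at R p a b" "(c, d) \<in> frac_at R p c d" using assms frac_at_self by auto
 have "?lhs = (\<Union>x\<in>frac_at R p a b. \<Union>y\<in>frac_at R p c d. frac_at R p (fst x \<otimes> snd y \<oplus> fst y \<otimes> snd x) (snd x \<otimes> snd y))"
  by (simp add: local_ring_def case_prod_beta)
 also have "\<dots> = (frac_at R p (a \<otimes> d \<oplus> c \<otimes> b) (b \<otimes> d))"
 proof (rule UN2_const)
  fix x y assume "x \<in> frac_at R p a b" "y \<in> frac_at R p c d"
  thus "frac_at R p (fst x \<otimes> snd y \<oplus> fst y \<otimes> snd x) (snd x \<otimes> snd y) = (frac_at R p (a \<otimes> d \<oplus> c \<otimes> b) (b \<otimes> d))"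
   using key[of "fst x" "snd x" "fst y" "snd y"] by simp
 qed (use self in blast)+
 finally show ?thesis .
qed

lemma local_carrier: "x \<in> carrier (local_ring R p) \<longleftrightarrow> (\<exists>a\<in>carrier R. \<exists>b\<in>carrier R - p. x = frac_at R p a b)"
 by (auto simp: local_ring_def quotient_def frac_at_def)

lemma local_one: "\<one>[local_ring R p] = frac_at R p \<one> \<one>"
 and local_zero: "\<zero>[local_ring R p] = frac_at R p \<zero> \<one>"
 by (simp_all add: local_ring_def)

end

subsection \<open>Sections over distinguished open sets\<close>

text \<open>A prime containing the annihilator of \<open>a\<close> cannot lie in \<open>D f\<close>,
  where the image of \<open>a\<close> vanishes; so \<open>f\<close> is in the radical of the
  annihilator.\<close>

lemma frac_zero_on_D:
 assumes a: "a \<in> carrier R" and f: "f \<in> carrier R"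
  and z: "\<And>q. q \<in> D f \<Longrightarrow> frac_at R q a \<one> = frac_at R q \<zero> \<one>"
 shows "\<exists>n::nat. f [^] n \<otimes> a = \<zero>"
proof -
 have "\<exists>n::nat. f [^] n \<in> {t \<in> carrier R. t \<otimes> a = \<zero>}"
 proof (rule pow_in_ideal[OF annihilator_ideal[OF a] f], rule ccontr)
  fix p assume p: "primeideal p R" "{t \<in> carrier R. t \<otimes> a = \<zero>} \<subseteq> p" "f \<notin> p"
  hence "frac_at R p a \<one> = frac_at R p \<zero> \<one>" using z by (auto simp: D_def)
  then obtain t where "t \<in> carrier R - p" "t \<otimes> (a \<otimes> \<one> \<ominus> \<zero> \<otimes> \<one>) = \<zero>"
   using frac_at_eq[OF p(1), of a \<one> \<zero> \<one>] a primeideal.one_notin[OF p(1)] by auto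
  thus False using p(2) a by (auto simp: a_minus_def)
 qed
 thus ?thesis by blast
qed

text \<open>The neighbourhood and the denominator are made to agree: a fraction \<open>a / b\<close>
  valid on \<open>D g\<close> is rewritten as \<open>g a / g b\<close> on
  \<open>D (g b)\<close>.\<close>

lemma section_local:
 assumes s: "s \<in> Spec_sections R (Zariski R) U" and p: "p \<in> U"
 shows "\<exists>a\<in>carrier R. \<exists>h\<in>carrier R. p \<in> D h \<and> D h \<subseteq> U \<and> (\<forall>q\<in>D h. s q = frac_at R q a h)"
proof -
 from s p obtain V a b where V: "openin (Zariski R) V" "p \<in> V" "V \<subseteq> U" "a \<in> carrier R" "b \<in> carrier R"
  "\<And>q. q \<in> V \<Longrightarrow> b \<notin> q \<and> s q = frac_at R q a b" by (force simp: Spec_sections_def)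
 obtain g where g: "g \<in> carrier R" "p \<in> D g" "D g \<subseteq> V" using openin_ZariskiD[OF V(1)] V(2) by blast
 have "p \<in> D b" using V(6)[OF V(2)] g(2) by (auto simp: D_def)
 hence "p \<in> D (g \<otimes> b)" using g V(5) by (simp add: D_mult)
 moreover have "D (g \<otimes> b) \<subseteq> U" using g V by (auto simp: D_mult)
 moreover have "s q = frac_at R q (g \<otimes> a) (g \<otimes> b)" if q: "q \<in> D (g \<otimes> b)" for q
 proof -
  have pq: "primeideal q R" using q by (simp add: D_def)
  have "q \<in> D g" "q \<in> D b" using q g V by (auto simp: D_mult)
  hence "s q = frac_at R q a b" using g V by auto
  also have "\<dots> = frac_at R q (g \<otimes> a) (g \<otimes> b)"
   by (rule frac_at_eqI[OF pq]) (use g V(4,5) q \<open>q \<in> D b\<close> in \<open>auto simp: D_def m_ac\<close>)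
  finally show ?thesis .
 qed
 ultimately show ?thesis using g V by (intro bexI[of _ "g \<otimes> a"] bexI[of _ "g \<otimes> b"]) auto
qed

text \<open>Quasi-compactness of \<open>D f\<close>. The elements whose distinguished set is covered
  by finitely many of the given sets form an ideal containing all \<open>g i\<close>; no prime in
  \<open>D f\<close> contains this ideal, so a power of \<open>f\<close> lies in it.\<close>

lemma finite_subcover:
 assumes f: "f \<in> carrier R" and g: "\<And>i. i \<in> H \<Longrightarrow> g i \<in> carrier R"
  and cov: "\<And>p. p \<in> D f \<Longrightarrow> \<exists>i\<in>H. p \<in> D (g i)"
 shows "\<exists>F. finite F \<and> F \<subseteq> H \<and> (\<forall>p\<in>D f. \<exists>i\<in>F. p \<in> D (g i))"
proof -
 define C where "C = {b \<in> carrier R. \<exists>F. finite F \<and> F \<subseteq> H \<and> (\<forall>p\<in>D b. \<exists>i\<in>F. p \<in> D (g i))}"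
 have sub: "a \<in> C" if "a \<in> carrier R" "b \<in> C" "D a \<subseteq> D b" for a b
 proof -
  from that obtain F where "finite F" "F \<subseteq> H" "\<forall>p\<in>D b. \<exists>i\<in>F. p \<in> D (g i)" by (auto simp: C_def)
  with that(1,3) show ?thesis unfolding C_def by (intro CollectI conjI exI[of _ F]) auto
 qed
 have id: "ideal C R"
 proof (rule idealI[OF ring_axioms])
  show "subgroup C (add_monoid R)"
  proof (rule add.subgroupI)
   show "C \<subseteq> carrier R" by (auto simp: C_def)
   have "\<zero> \<in> C"
    using additive_subgroup.zero_closed[OF ideal.axioms(1)[OF primeideal.axioms(1)]]
    by (auto simp: C_def D_def intro!: exI[of _ "{}"])
   thus "C \<noteq> {}" by auto
   fix a assume a: "a \<in> C"
   hence ac: "a \<in> carrier R" by (auto simp: C_def)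
   have "D (\<ominus> a) \<subseteq> D a"
    using ac D_mult[of "\<ominus> \<one>" a] by (simp add: l_minus)
   thus "\<ominus> a \<in> C" using sub a ac by auto
   fix b assume b: "b \<in> C"
   obtain F G where F: "finite F" "F \<subseteq> H" "\<forall>p\<in>D a. \<exists>i\<in>F. p \<in> D (g i)"
    and G: "finite G" "G \<subseteq> H" "\<forall>p\<in>D b. \<exists>i\<in>G. p \<in> D (g i)" using a b by (auto simp: C_def)
   have "D (a \<oplus> b) \<subseteq> D a \<union> D b"
   proof -
    have "a \<oplus> b \<in> p" if "primeideal p R" "a \<in> p" "b \<in> p" for p
     using that additive_subgroup.a_closed[OF ideal.axioms(1)[OF primeideal.axioms(1)]] by metis
    thus ?thesis by (auto simp: D_def)
   qed
   hence "\<forall>p\<in>D (a \<oplus> b). \<exists>i\<in>F \<union> G. p \<in> D (g i)" using F(3) G(3) by blast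
   moreover have "a \<oplus> b \<in> carrier R" using a b by (auto simp: C_def)
   ultimately show "a \<oplus> b \<in> C" unfolding C_def using F(1,2) G(1,2) by (intro CollectI conjI exI[of _ "F \<union> G"]) auto
  qed
  fix a x assume "a \<in> C" "x \<in> carrier R"
  moreover from this have "a \<in> carrier R" by (auto simp: C_def)
  ultimately show "x \<otimes> a \<in> C" "a \<otimes> x \<in> C" by (auto intro!: sub[of _ a] simp: D_mult)
 qed
 have gC: "g i \<in> C" if "i \<in> H" for i
  using that g[OF that] by (auto simp: C_def intro!: exI[of _ "{i}"])
 obtain n where "f [^] (n::nat) \<in> C"
 proof (rule exE[OF pow_in_ideal[OF id f]])
  fix p assume "primeideal p R" "C \<subseteq> p"
  thus "f \<in> p" using cov[of p] gC by (auto simp: D_def)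
 qed
 moreover have "D f \<subseteq> D (f [^] n)" using f by (auto simp: D_def primeideal.pow_notin)
 ultimately have "f \<in> C" using f sub by auto
 thus ?thesis by (simp add: C_def)
qed

text \<open>Sections over \<open>D f\<close> are fractions with a power of \<open>f\<close> as
  denominator. Finitely many local fractions suffice, and instead of writing a power of
  \<open>f\<close> as a combination of their denominators, the proof shows that all admissible
  denominators form an ideal.\<close>

lemma section_on_D:
 assumes f: "f \<in> carrier R" and s: "s \<in> Spec_sections R (Zariski R) (D f)"
 shows "\<exists>n::nat. \<exists>a\<in>carrier R. \<forall>q\<in>D f. s q = frac_at R q a (f [^] n)"
proof -
 define H where "H = {(a, h). a \<in> carrier R \<and> h \<in> carrier R \<and> D h \<subseteq> D f \<and> (\<forall>q\<in>D h. s q = frac_at R q a h)}"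
 have "\<exists>F. finite F \<and> F \<subseteq> H \<and> (\<forall>p\<in>D f. \<exists>i\<in>F. p \<in> D (snd i))"
 proof (rule finite_subcover[OF f])
  show "snd i \<in> carrier R" if "i \<in> H" for i using that by (auto simp: H_def)
  show "\<exists>i\<in>H. p \<in> D (snd i)" if pf: "p \<in> D f" for p
  proof -
   obtain a h where "a \<in> carrier R" "h \<in> carrier R" "p \<in> D h" "D h \<subseteq> D f" "\<forall>q\<in>D h. s q = frac_at R q a h"
    using section_local[OF s pf] by blast
   thus ?thesis by (intro bexI[of _ "(a, h)"]) (simp_all add: H_def)
  qed
 qed
 then obtain F where F: "finite F" "F \<subseteq> H" "\<And>p. p \<in> D f \<Longrightarrow> \<exists>i\<in>F. p \<in> D (snd i)" by blast
 have Fc: "fst i \<in> carrier R" "snd i \<in> carrier R" "D (snd i) \<subseteq> D f" "\<And>q. q \<in> D (snd i) \<Longrightarrow> s q = frac_at R q (fst i) (snd i)"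
  if "i \<in> F" for i
 proof -
  have "i \<in> H" using F(2) that by blast
  thus "fst i \<in> carrier R" "snd i \<in> carrier R" "D (snd i) \<subseteq> D f"
   "\<And>q. q \<in> D (snd i) \<Longrightarrow> s q = frac_at R q (fst i) (snd i)"
   unfolding H_def by (cases i, simp)+
 qed
 have "\<exists>n::nat. (snd i \<otimes> snd j) [^] n \<otimes> (fst i \<otimes> snd j \<ominus> fst j \<otimes> snd i) = \<zero>" if ij: "i \<in> F" "j \<in> F" for i j
 proof (rule frac_zero_on_D)
  fix q assume q: "q \<in> D (snd i \<otimes> snd j)"
  hence pq: "primeideal q R" and qi: "q \<in> D (snd i)" "q \<in> D (snd j)" using Fc[OF ij(1)] Fc[OF ij(2)] by (auto simp: D_mult) (auto simp: D_def)
  have "frac_at R q (fst i) (snd i) = frac_at R q (fst j) (snd j)"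
   using Fc(4)[OF ij(1) qi(1)] Fc(4)[OF ij(2) qi(2)] by simp
  then obtain t where "t \<in> carrier R - q" "t \<otimes> (fst i \<otimes> snd j \<ominus> fst j \<otimes> snd i) = \<zero>"
   using frac_at_eq[OF pq, of "fst i" "snd i" "fst j" "snd j"] Fc[OF ij(1)] Fc[OF ij(2)] qi by (auto simp: D_def)
  thus "frac_at R q (fst i \<otimes> snd j \<ominus> fst j \<otimes> snd i) \<one> = frac_at R q \<zero> \<one>"
   using Fc[OF ij(1)] Fc[OF ij(2)] primeideal.one_notin[OF pq]
   by (subst frac_at_eq[OF pq]) (auto simp: a_minus_def)
 qed (use Fc ij in auto)
 then obtain n0 :: "_ \<Rightarrow> _ \<Rightarrow> nat" where n0: "\<And>i j. i \<in> F \<Longrightarrow> j \<in> F \<Longrightarrow>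
   (snd i \<otimes> snd j) [^] n0 i j \<otimes> (fst i \<otimes> snd j \<ominus> fst j \<otimes> snd i) = \<zero>" by metis
 \<comment> \<open>One exponent for all pairs of the finite cover; the inserted 0 keeps the maximum
   defined when there are no pairs.\<close>
 define n where "n = Max (insert 0 ((\<lambda>(i, j). n0 i j) ` (F \<times> F)))"
 have le: "n0 i j \<le> n" if "i \<in> F" "j \<in> F" for i j
  unfolding n_def using F(1) that by (intro Max_ge) auto
 have n: "(snd i \<otimes> snd j) [^] n \<otimes> (fst i \<otimes> snd j \<ominus> fst j \<otimes> snd i) = \<zero>" if ij: "i \<in> F" "j \<in> F" for i j
 proof -
  have "(snd i \<otimes> snd j) [^] n = (snd i \<otimes> snd j) [^] (n - n0 i j) \<otimes> (snd i \<otimes> snd j) [^] n0 i j"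
   using le[OF ij] Fc[OF ij(1)] Fc[OF ij(2)] by (simp add: nat_pow_mult)
  thus ?thesis using n0[OF ij] Fc[OF ij(1)] Fc[OF ij(2)] by (simp add: m_assoc)
 qed
 \<comment> \<open>Expanding each fraction by a power of its denominator turns cross products that
   agree up to a factor into equal ones.\<close>
 define A where "A i = fst i \<otimes> snd i [^] n" for i :: "'a \<times> 'a"
 define B where "B i = snd i [^] Suc n" for i :: "'a \<times> 'a"
 have ABc: "A i \<in> carrier R" "B i \<in> carrier R" if "i \<in> F" for i using Fc[OF that] by (auto simp: A_def B_def)
 have AB: "A i \<otimes> B j = A j \<otimes> B i" if ij: "i \<in> F" "j \<in> F" for i j
 proof -
  have c: "fst i \<in> carrier R" "snd i \<in> carrier R" "fst j \<in> carrier R" "snd j \<in> carrier R"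
   "snd i [^] n \<in> carrier R" "snd j [^] n \<in> carrier R"
   using Fc[OF ij(1)] Fc[OF ij(2)] by auto
  have "A i \<otimes> B j \<ominus> A j \<otimes> B i = (snd i [^] n \<otimes> snd j [^] n) \<otimes> (fst i \<otimes> snd j \<ominus> fst j \<otimes> snd i)"
   unfolding A_def B_def nat_pow_Suc using c by algebra
  also have "\<dots> = \<zero>" using n[OF ij] c by (simp add: nat_pow_distrib)
  finally show ?thesis using ABc[OF ij(1)] ABc[OF ij(2)] by simp
 qed
 \<comment> \<open>The elements \<open>b\<close> for which \<open>b\<close> times the section is
   given by a single numerator \<open>a\<close>. The ideal contains every \<open>B i\<close>, hence
   a power of \<open>f\<close>.\<close>
 define J where "J = {b \<in> carrier R. \<exists>a\<in>carrier R. \<forall>j\<in>F. B j \<otimes> a = b \<otimes> A j}"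
 have id: "ideal J R"
 proof (rule idealI[OF ring_axioms])
  show "subgroup J (add_monoid R)"
  proof (rule add.subgroupI)
   show "J \<subseteq> carrier R" by (auto simp: J_def)
   have "\<zero> \<in> J" using ABc by (auto simp: J_def intro!: bexI[of _ \<zero>])
   thus "J \<noteq> {}" by auto
   fix b assume b: "b \<in> J"
   then obtain a where a: "b \<in> carrier R" "a \<in> carrier R" "\<forall>j\<in>F. B j \<otimes> a = b \<otimes> A j" by (auto simp: J_def)
   thus "\<ominus> b \<in> J" using ABc by (auto simp: J_def l_minus r_minus intro!: bexI[of _ "\<ominus> a"])
   fix b' assume "b' \<in> J"
   then obtain a' where "b' \<in> carrier R" "a' \<in> carrier R" "\<forall>j\<in>F. B j \<otimes> a' = b' \<otimes> A j" by (auto simp: J_def)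
   thus "b \<oplus> b' \<in> J" using a ABc by (auto simp: J_def l_distr r_distr intro!: bexI[of _ "a \<oplus> a'"])
  qed
  fix b x assume "b \<in> J" and x: "x \<in> carrier R"
  then obtain a where a: "b \<in> carrier R" "a \<in> carrier R" "\<forall>j\<in>F. B j \<otimes> a = b \<otimes> A j" by (auto simp: J_def)
  have "B j \<otimes> (x \<otimes> a) = (x \<otimes> b) \<otimes> A j" if j: "j \<in> F" for j
  proof -
   have "B j \<otimes> (x \<otimes> a) = x \<otimes> (B j \<otimes> a)" using ABc[OF j] a x by (simp add: m_lcomm)
   thus ?thesis using ABc[OF j] a x j by (simp add: m_assoc)
  qed
  thus "x \<otimes> b \<in> J" using a x by (auto simp: J_def intro!: bexI[of _ "x \<otimes> a"])
  thus "b \<otimes> x \<in> J" using a x by (simp add: m_comm)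
 qed
 have BJ: "B i \<in> J" if i: "i \<in> F" for i
  unfolding J_def using ABc[OF i] AB[OF i] ABc by (auto intro!: bexI[of _ "A i"] simp: m_comm)
 obtain N where N: "f [^] (N::nat) \<in> J"
 proof (rule exE[OF pow_in_ideal[OF id f]])
  fix p assume p: "primeideal p R" "J \<subseteq> p"
  show "f \<in> p"
  proof (rule ccontr)
   assume "f \<notin> p"
   then obtain i where i: "i \<in> F" "p \<in> D (snd i)" using F(3)[of p] p by (auto simp: D_def)
   hence "p \<in> D (B i)" using Fc(2)[OF i(1)] unfolding B_def by (subst D_pow) simp_all
   thus False using BJ[OF i(1)] p by (auto simp: D_def)
  qed
 qed
 then obtain a where a: "a \<in> carrier R" "\<And>j. j \<in> F \<Longrightarrow> B j \<otimes> a = f [^] N \<otimes> A j" by (auto simp: J_def)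
 have "s q = frac_at R q a (f [^] N)" if q: "q \<in> D f" for q
 proof -
  have pq: "primeideal q R" using q by (simp add: D_def)
  obtain i where i: "i \<in> F" "q \<in> D (snd i)" using F(3)[OF q] by blast
  have "s q = frac_at R q (fst i) (snd i)" using Fc[OF i(1)] i(2) by simp
  also have "\<dots> = frac_at R q (A i) (B i)"
   using Fc[OF i(1)] i(2) primeideal.pow_notin[OF pq, of "snd i" "Suc n"] unfolding A_def B_def
   by (intro frac_at_eqI[OF pq]) (auto simp: D_def m_ac)
  also have "\<dots> = frac_at R q a (f [^] N)"
   using ABc[OF i(1)] a(1) f q primeideal.pow_notin[OF pq] Fc[OF i(1)] i(2) a(2)[OF i(1)]
    primeideal.pow_notin[OF pq, of "snd i" "Suc n"]
   by (intro frac_at_eqI[OF pq]) (auto simp: D_def m_comm B_def simp del: nat_pow_Suc)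
  finally show ?thesis .
 qed
 thus ?thesis using a(1) by blast
qed

end

lemma (in cring) Units_factor:
 assumes "a \<in> carrier R" "b \<in> carrier R" "a \<otimes> b \<in> Units R"
 shows "a \<in> Units R" "b \<in> Units R"
proof -
 from assms obtain c where c: "c \<in> carrier R" "c \<otimes> (a \<otimes> b) = \<one>" by (auto simp: Units_def)
 hence "(c \<otimes> b) \<otimes> a = \<one>" "(c \<otimes> a) \<otimes> b = \<one>" using assms by (simp_all add: m_ac)
 thus "a \<in> Units R" "b \<in> Units R"
  using assms c m_comm[of "c \<otimes> b" a] m_comm[of "c \<otimes> a" b] m_closed unfolding Units_def by fastforce+
qed

section \<open>Restriction and gluing in a ringed space\<close>

locale ringed =
 fixes X :: "('p, 's) cspace"
 assumes rc: "ringed_cspace X"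
begin

abbreviation opn :: "'p set \<Rightarrow> bool" where "opn U \<equiv> openin (zar X) U"

abbreviation Sec :: "'p set \<Rightarrow> 's set" where "Sec U \<equiv> carrier (sec X U)"
abbreviation res :: "'p set \<Rightarrow> 'p set \<Rightarrow> 's \<Rightarrow> 's" where "res \<equiv> rest X"
abbreviation inv_at :: "'p set \<Rightarrow> 'p \<Rightarrow> 's \<Rightarrow> bool" where "inv_at \<equiv> invertible_at X"

lemma sec_cring: "opn U \<Longrightarrow> cring (sec X U)"
 and scal_hom: "opn U \<Longrightarrow> scal X U \<in> ring_hom CC (sec X U)"
 and rest_id: "opn U \<Longrightarrow> s \<in> Sec U \<Longrightarrow> res U U s = s"
 and rest_hom: "opn U \<Longrightarrow> opn V \<Longrightarrow> V \<subseteq> U \<Longrightarrow> res U V \<in> ring_hom (sec X U) (sec X V)"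
 and rest_scal: "opn U \<Longrightarrow> opn V \<Longrightarrow> V \<subseteq> U \<Longrightarrow> res U V (scal X U c) = scal X V c"
 and rest_rest: "opn U \<Longrightarrow> opn V \<Longrightarrow> opn W \<Longrightarrow> W \<subseteq> V \<Longrightarrow> V \<subseteq> U \<Longrightarrow> s \<in> Sec U \<Longrightarrow>
  res V W (res U V s) = res U W s"
proof -
 note r = rc[unfolded ringed_cspace_def]
 note r1 = r[THEN conjunct1, rule_format] and r2 = r[THEN conjunct2, THEN conjunct1, rule_format]
  and r3 = r[THEN conjunct2, THEN conjunct2, THEN conjunct1, rule_format]
 show "opn U \<Longrightarrow> cring (sec X U)" "opn U \<Longrightarrow> scal X U \<in> ring_hom CC (sec X U)"
  "opn U \<Longrightarrow> s \<in> Sec U \<Longrightarrow> res U U s = s" by (simp_all add: r1)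
 show "opn U \<Longrightarrow> opn V \<Longrightarrow> V \<subseteq> U \<Longrightarrow> res U V \<in> ring_hom (sec X U) (sec X V)"
  "opn U \<Longrightarrow> opn V \<Longrightarrow> V \<subseteq> U \<Longrightarrow> res U V (scal X U c) = scal X V c" by (simp_all add: r2)
 show "opn U \<Longrightarrow> opn V \<Longrightarrow> opn W \<Longrightarrow> W \<subseteq> V \<Longrightarrow> V \<subseteq> U \<Longrightarrow> s \<in> Sec U \<Longrightarrow>
  res V W (res U V s) = res U W s" by (rule r3) auto
qed

lemma glue:
 assumes "\<And>U. U \<in> \<U> \<Longrightarrow> opn U" "\<And>U. U \<in> \<U> \<Longrightarrow> s U \<in> Sec U"
  and "\<And>U V. U \<in> \<U> \<Longrightarrow> V \<in> \<U> \<Longrightarrow> res U (U \<inter> V) (s U) = res V (U \<inter> V) (s V)"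
 shows "\<exists>!t. t \<in> Sec (\<Union>\<U>) \<and> (\<forall>U\<in>\<U>. res (\<Union>\<U>) U t = s U)"
 by (rule rc[unfolded ringed_cspace_def, THEN conjunct2, THEN conjunct2, THEN conjunct2, THEN spec, THEN spec, THEN mp, of \<U> s])
  (intro conjI ballI assms; assumption)

lemma rest_closed: "opn U \<Longrightarrow> opn V \<Longrightarrow> V \<subseteq> U \<Longrightarrow> s \<in> Sec U \<Longrightarrow> res U V s \<in> Sec V"
 using ring_hom_closed[OF rest_hom] by blast

lemma rest_mult: "opn U \<Longrightarrow> opn V \<Longrightarrow> V \<subseteq> U \<Longrightarrow> s \<in> Sec U \<Longrightarrow> t \<in> Sec U \<Longrightarrow>
  res U V (s \<otimes>[sec X U] t) = res U V s \<otimes>[sec X V] res U V t"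
 using ring_hom_mult[OF rest_hom] by blast

lemma rest_add: "opn U \<Longrightarrow> opn V \<Longrightarrow> V \<subseteq> U \<Longrightarrow> s \<in> Sec U \<Longrightarrow> t \<in> Sec U \<Longrightarrow>
  res U V (s \<oplus>[sec X U] t) = res U V s \<oplus>[sec X V] res U V t"
 using ring_hom_add[OF rest_hom] by blast

lemma rest_one: "opn U \<Longrightarrow> opn V \<Longrightarrow> V \<subseteq> U \<Longrightarrow> res U V \<one>[sec X U] = \<one>[sec X V]"
 using ring_hom_one[OF rest_hom] by blast

lemma rest_ring_hom_ring: "opn U \<Longrightarrow> opn V \<Longrightarrow> V \<subseteq> U \<Longrightarrow> ring_hom_ring (sec X U) (sec X V) (res U V)"
 using rest_hom sec_cring by (simp add: ring_hom_ringI2 cring.axioms(1))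

lemma rest_zero: "opn U \<Longrightarrow> opn V \<Longrightarrow> V \<subseteq> U \<Longrightarrow> res U V \<zero>[sec X U] = \<zero>[sec X V]"
 using ring_hom_ring.axioms(1,2) ring_hom_zero[OF rest_hom] sec_cring cring.axioms(1) by blast

lemma rest_minus:
 assumes "opn U" "opn V" "V \<subseteq> U" "s \<in> Sec U" "t \<in> Sec U"
 shows "res U V (s \<ominus>[sec X U] t) = res U V s \<ominus>[sec X V] res U V t"
proof -
 interpret h: ring_hom_ring "sec X U" "sec X V" "res U V" by (rule rest_ring_hom_ring[OF assms(1-3)])
 show ?thesis using assms(4,5) by (simp add: a_minus_def)
qed

lemma rest_pow:
 assumes "opn U" "opn V" "V \<subseteq> U" "s \<in> Sec U"
 shows "res U V (s [^][sec X U] (n::nat)) = res U V s [^][sec X V] n"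
proof -
 interpret h: ring_hom_ring "sec X U" "sec X V" "res U V" by (rule rest_ring_hom_ring[OF assms(1-3)])
 show ?thesis using assms(4) by (induction n) simp_all
qed

text \<open>The gluing axiom, applied to all open sets on which the two sections agree, has a unique
  solution, and both are solutions.\<close>

lemma sec_eqI:
 assumes U: "opn U" and st: "s \<in> Sec U" "t \<in> Sec U"
  and loc: "\<And>x. x \<in> U \<Longrightarrow> \<exists>V. opn V \<and> x \<in> V \<and> V \<subseteq> U \<and> res U V s = res U V t"
 shows "s = t"
proof -
 define \<U> where "\<U> = {V. opn V \<and> V \<subseteq> U \<and> res U V s = res U V t}"
 have un: "\<Union>\<U> = U" using loc by (force simp: \<U>_def)
 have "\<exists>!r. r \<in> Sec (\<Union>\<U>) \<and> (\<forall>V\<in>\<U>. res (\<Union>\<U>) V r = res U V s)"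
 proof (rule glue)
  fix V W assume VW: "V \<in> \<U>" "W \<in> \<U>"
  thus "res V (V \<inter> W) (res U V s) = res W (V \<inter> W) (res U W s)"
   using U st by (subst (1 2) rest_rest) (auto simp: \<U>_def)
 qed (use rest_closed U st in \<open>auto simp: \<U>_def\<close>)
 thus ?thesis using st unfolding un by (auto simp: \<U>_def)
qed

text \<open>Gluing with data indexed by points. The sheaf axiom indexes them by open sets, so a
  point is chosen for each open set \<open>N x\<close>; equal neighbourhoods carry equal sections by
  the overlap condition.\<close>

lemma glue_local:
 assumes U: "opn U" and N: "\<And>x. x \<in> U \<Longrightarrow> opn (N x) \<and> x \<in> N x \<and> N x \<subseteq> U \<and> u x \<in> Sec (N x)"
  and ov: "\<And>x y. x \<in> U \<Longrightarrow> y \<in> U \<Longrightarrow> res (N x) (N x \<inter> N y) (u x) = res (N y) (N x \<inter> N y) (u y)"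
 shows "\<exists>t\<in>Sec U. \<forall>x\<in>U. res U (N x) t = u x"
proof -
 have same: "u x = u y" if "x \<in> U" "y \<in> U" "N x = N y" for x y
  using ov[OF that(1,2)] rest_id[of "N y" "u x"] rest_id[of "N y" "u y"] N[OF that(1)] N[OF that(2)] that(3) by auto
 define c where "c V = (SOME x. x \<in> U \<and> N x = V)" for V
 have c: "c V \<in> U \<and> N (c V) = V" if "V \<in> N ` U" for V
  unfolding c_def by (rule someI_ex) (use that in auto)
 have un: "\<Union>(N ` U) = U" using N by blast
 have "\<exists>!t. t \<in> Sec (\<Union>(N ` U)) \<and> (\<forall>V\<in>N ` U. res (\<Union>(N ` U)) V t = u (c V))"
 proof (rule glue)
  fix V assume V: "V \<in> N ` U"
  show "opn V" "u (c V) \<in> Sec V" using N[of "c V"] c[OF V] by auto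
  fix W assume W: "W \<in> N ` U"
  show "res V (V \<inter> W) (u (c V)) = res W (V \<inter> W) (u (c W))"
   using ov[of "c V" "c W"] c[OF V] c[OF W] by simp
 qed
 then obtain t where t: "t \<in> Sec U" "\<And>V. V \<in> N ` U \<Longrightarrow> res U V t = u (c V)"
  unfolding un by blast
 have "res U (N x) t = u x" if "x \<in> U" for x
  using t(2)[of "N x"] c[of "N x"] same[of "c (N x)" x] that by auto
 thus ?thesis using t(1) by blast
qed

subsection \<open>Invertible germs\<close>

lemma Units_rest:
 "opn U \<Longrightarrow> opn V \<Longrightarrow> V \<subseteq> U \<Longrightarrow> s \<in> Units (sec X U) \<Longrightarrow> res U V s \<in> Units (sec X V)"
 using Units_hom[OF _ _ rest_hom] sec_cring cring.axioms(1) by blast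

lemma invertible_rest:
 assumes "opn U" "opn V" "V \<subseteq> U" "x \<in> V" "s \<in> Sec U"
 shows "inv_at V x (res U V s) \<longleftrightarrow> inv_at U x s"
proof
 assume "inv_at V x (res U V s)"
 thus "inv_at U x s"
  unfolding invertible_at_def using rest_rest[OF assms(1,2) _ _ assms(3,5)] assms by (metis order_trans)
next
 assume "inv_at U x s"
 then obtain W where W: "opn W" "x \<in> W" "W \<subseteq> U" "res U W s \<in> Units (sec X W)"
  by (auto simp: invertible_at_def)
 have o: "opn (V \<inter> W)" using assms W by auto
 have "res V (V \<inter> W) (res U V s) = res W (V \<inter> W) (res U W s)"
  using assms W o by (subst (1 2) rest_rest) auto
 also have "\<dots> \<in> Units (sec X (V \<inter> W))" using Units_rest[OF W(1) o _ W(4)] by auto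
 finally show "inv_at V x (res U V s)" unfolding invertible_at_def using o assms W by blast
qed

lemma invertible_Units: "opn U \<Longrightarrow> x \<in> U \<Longrightarrow> s \<in> Units (sec X U) \<Longrightarrow> inv_at U x s"
 unfolding invertible_at_def using Units_rest by blast

definition DX :: "'p set \<Rightarrow> 's \<Rightarrow> 'p set" where
 "DX U s = {x \<in> U. inv_at U x s}"

lemma DX_sub: "DX U s \<subseteq> U" by (auto simp: DX_def)

lemma opn_DX: "opn U \<Longrightarrow> opn (DX U s)"
proof (subst openin_subopen, intro ballI)
 fix x assume "x \<in> DX U s"
 then obtain V where V: "opn V" "x \<in> V" "V \<subseteq> U" "res U V s \<in> Units (sec X V)"
  by (auto simp: DX_def invertible_at_def)
 hence "V \<subseteq> DX U s" by (auto simp: DX_def invertible_at_def)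
 thus "\<exists>T. opn T \<and> x \<in> T \<and> T \<subseteq> DX U s" using V by blast
qed

text \<open>Local inverses are unique, so they agree on overlaps and glue to an inverse.\<close>

lemma unit_local:
 assumes U: "opn U" and s: "s \<in> Sec U" and inv: "\<And>x. x \<in> U \<Longrightarrow> inv_at U x s"
 shows "s \<in> Units (sec X U)"
proof -
 interpret R: cring "sec X U" by (rule sec_cring[OF U])
 have "\<forall>x\<in>U. \<exists>V t. opn V \<and> x \<in> V \<and> V \<subseteq> U \<and> t \<in> Sec V \<and>
   res U V s \<otimes>[sec X V] t = \<one>[sec X V]"
  using inv by (fastforce simp: invertible_at_def Units_def)
 then obtain N u where N: "\<And>x. x \<in> U \<Longrightarrow> opn (N x) \<and> x \<in> N x \<and> N x \<subseteq> U \<and> u x \<in> Sec (N x)"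
  and N1: "\<And>x. x \<in> U \<Longrightarrow> res U (N x) s \<otimes>[sec X (N x)] u x = \<one>[sec X (N x)]" by metis
 have r1: "res U V s \<otimes>[sec X V] res (N x) V (u x) = \<one>[sec X V]"
  if x: "x \<in> U" and V: "opn V" "V \<subseteq> N x" for x V
 proof -
  have "res (N x) V (res U (N x) s \<otimes>[sec X (N x)] u x) = \<one>[sec X V]"
   using N1[OF x] N[OF x] V rest_one by simp
  thus ?thesis using N[OF x] V U s rest_mult rest_closed rest_rest by simp
 qed
 have "\<exists>t\<in>Sec U. \<forall>x\<in>U. res U (N x) t = u x"
 proof (rule glue_local[OF U N])
  fix x y assume xy: "x \<in> U" "y \<in> U"
  define V where "V = N x \<inter> N y"
  have V: "opn V" "V \<subseteq> N x" "V \<subseteq> N y" "V \<subseteq> U" using N[OF xy(1)] N[OF xy(2)] by (auto simp: V_def)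
  interpret S: cring "sec X V" by (rule sec_cring[OF V(1)])
  have c: "res U V s \<in> Sec V" "res (N x) V (u x) \<in> Sec V"
   "res (N y) V (u y) \<in> Sec V"
   using rest_closed U V s N[OF xy(1)] N[OF xy(2)] by auto
  show "res (N x) (N x \<inter> N y) (u x) = res (N y) (N x \<inter> N y) (u y)"
   using S.inv_unique[of "res (N x) V (u x)" "res U V s" "res (N y) V (u y)"]
    r1[OF xy(1) V(1,2)] r1[OF xy(2) V(1,3)] c unfolding V_def[symmetric]
   by (simp add: S.m_comm)
 qed
 then obtain t where t: "t \<in> Sec U" "\<And>x. x \<in> U \<Longrightarrow> res U (N x) t = u x" by blast
 have "s \<otimes>[sec X U] t = \<one>[sec X U]"
 proof (rule sec_eqI[OF U])
  fix x assume x: "x \<in> U"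
  have "res U (N x) (s \<otimes>[sec X U] t) = res U (N x) \<one>[sec X U]"
   using N[OF x] N1[OF x] t s U x by (simp add: rest_mult rest_one)
  thus "\<exists>V. opn V \<and> x \<in> V \<and> V \<subseteq> U \<and> res U V (s \<otimes>[sec X U] t) = res U V \<one>[sec X U]"
   using N[OF x] by blast
 qed (use s t in auto)
 thus ?thesis using s t(1) R.m_comm[OF t(1) s] unfolding Units_def by auto
qed

lemma DX_unit:
 assumes "opn U" "s \<in> Sec U" "opn V" "V \<subseteq> DX U s"
 shows "res U V s \<in> Units (sec X V)"
proof (rule unit_local[OF assms(3)])
 have VU: "V \<subseteq> U" using assms DX_sub by blast
 thus "res U V s \<in> Sec V" using assms rest_closed by blast
 fix x assume "x \<in> V"
 thus "inv_at V x (res U V s)"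
  using invertible_rest[OF assms(1,3) VU] assms by (auto simp: DX_def)
qed

lemma invertible_mult:
 assumes U: "opn U" and st: "s \<in> Sec U" "t \<in> Sec U" and x: "x \<in> U"
 shows "inv_at U x (s \<otimes>[sec X U] t) \<longleftrightarrow> inv_at U x s \<and> inv_at U x t"
proof
 assume "inv_at U x (s \<otimes>[sec X U] t)"
 then obtain V where V: "opn V" "x \<in> V" "V \<subseteq> U" "res U V (s \<otimes>[sec X U] t) \<in> Units (sec X V)"
  by (auto simp: invertible_at_def)
 interpret S: cring "sec X V" by (rule sec_cring[OF V(1)])
 have "res U V s \<in> Units (sec X V)" "res U V t \<in> Units (sec X V)"
  using V rest_mult[OF U V(1,3) st] rest_closed[OF U V(1,3)] st S.Units_factor by metis+
 thus "inv_at U x s \<and> inv_at U x t" using V by (auto simp: invertible_at_def)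
next
 assume *: "inv_at U x s \<and> inv_at U x t"
 define V where "V = DX U s \<inter> DX U t"
 have V: "opn V" "x \<in> V" "V \<subseteq> U" using opn_DX[OF U] * x by (auto simp: V_def DX_def)
 interpret S: cring "sec X V" by (rule sec_cring[OF V(1)])
 have "res U V s \<in> Units (sec X V)" "res U V t \<in> Units (sec X V)"
  using DX_unit[OF U _ V(1)] st by (auto simp: V_def)
 hence "res U V (s \<otimes>[sec X U] t) \<in> Units (sec X V)"
  using rest_mult[OF U V(1,3) st] by simp
 thus "inv_at U x (s \<otimes>[sec X U] t)" using V by (auto simp: invertible_at_def)
qed

lemma invertible_one: "opn U \<Longrightarrow> x \<in> U \<Longrightarrow> inv_at U x \<one>[sec X U]"
 using invertible_Units cring.cring_simprules(6) monoid.Units_one_closed[OF ring.axioms(2)[OF cring.axioms(1)[OF sec_cring]]] by blast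

lemma invertible_pow:
 assumes U: "opn U" and s: "s \<in> Sec U" and x: "x \<in> U" and "inv_at U x s"
 shows "inv_at U x (s [^][sec X U] (n::nat))"
proof -
 interpret S: cring "sec X U" by (rule sec_cring[OF U])
 show ?thesis using assms by (induction n) (auto simp: invertible_mult invertible_one)
qed

subsection \<open>A criterion for affine open sets\<close>

text \<open>The ideal of sections over \<open>U\<close> vanishing at \<open>x\<close>. For affine
  \<open>U\<close> this is the prime that corresponds to the point.\<close>

definition ptid :: "'p set \<Rightarrow> 'p \<Rightarrow> 's set" where
 "ptid U x = {s \<in> Sec U. \<not> inv_at U x s}"

text \<open>Affineness without an isomorphism: the points are the primes of the ring of sections,
  the sets \<open>DX U f\<close> are a basis, and the last two clauses say that the sections over
  \<open>DX U f\<close> are the localisation at \<open>f\<close>, injectivity and surjectivity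
  separately. In this form the identification with the spectrum is canonical and passes to smaller
  sets.\<close>

definition aff :: "'p set \<Rightarrow> bool" where
 "aff U \<longleftrightarrow> opn U \<and> bij_betw (ptid U) U {p. primeideal p (sec X U)} \<and>
  (\<forall>V x. opn V \<and> V \<subseteq> U \<and> x \<in> V \<longrightarrow> (\<exists>f\<in>Sec U. x \<in> DX U f \<and> DX U f \<subseteq> V)) \<and>
  (\<forall>f\<in>Sec U. \<forall>s\<in>Sec U. res U (DX U f) s = \<zero>[sec X (DX U f)] \<longrightarrow>
   (\<exists>n::nat. f [^][sec X U] n \<otimes>[sec X U] s = \<zero>[sec X U])) \<and>
  (\<forall>f\<in>Sec U. \<forall>\<sigma>\<in>Sec (DX U f). \<exists>n::nat. \<exists>a\<in>Sec U.
   res U (DX U f) (f [^][sec X U] n) \<otimes>[sec X (DX U f)] \<sigma> = res U (DX U f) a)"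

lemma affD:
 assumes "aff U"
 shows "opn U" "bij_betw (ptid U) U {p. primeideal p (sec X U)}"
  "opn V \<Longrightarrow> V \<subseteq> U \<Longrightarrow> x \<in> V \<Longrightarrow> \<exists>f\<in>Sec U. x \<in> DX U f \<and> DX U f \<subseteq> V"
  "f \<in> Sec U \<Longrightarrow> s \<in> Sec U \<Longrightarrow> res U (DX U f) s = \<zero>[sec X (DX U f)] \<Longrightarrow>
   \<exists>n::nat. f [^][sec X U] n \<otimes>[sec X U] s = \<zero>[sec X U]"
  "f \<in> Sec U \<Longrightarrow> \<sigma> \<in> Sec (DX U f) \<Longrightarrow> \<exists>n::nat. \<exists>a\<in>Sec U.
   res U (DX U f) (f [^][sec X U] n) \<otimes>[sec X (DX U f)] \<sigma> = res U (DX U f) a"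
 using assms unfolding aff_def by blast+

lemma aff_prime: "aff U \<Longrightarrow> x \<in> U \<Longrightarrow> primeideal (ptid U x) (sec X U)"
 using affD(2) bij_betwE by blast

lemma DX_mult: "opn U \<Longrightarrow> s \<in> Sec U \<Longrightarrow> t \<in> Sec U \<Longrightarrow>
  DX U (s \<otimes>[sec X U] t) = DX U s \<inter> DX U t"
 using invertible_mult by (auto simp: DX_def)

end

section \<open>From an abstract isomorphism with a spectrum to the criterion\<close>

lemma morphismD:
 assumes f: "morphism X Y (m, h)"
 shows "m \<in> extensional (topspace (zar X))" "continuous_map (zar X) (zar Y) m"
  "h \<in> extensional {U. openin (zar Y) U}"
  "openin (zar Y) U \<Longrightarrow> h U \<in> extensional (carrier (sec Y U))"
  "openin (zar Y) U \<Longrightarrow> h U \<in> ring_hom (sec Y U) (sec X (preim X m U))"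
  "openin (zar Y) U \<Longrightarrow> h U (scal Y U c) = scal X (preim X m U) c"
  "openin (zar Y) U \<Longrightarrow> openin (zar Y) V \<Longrightarrow> V \<subseteq> U \<Longrightarrow> s \<in> carrier (sec Y U) \<Longrightarrow>
   h V (rest Y U V s) = rest X (preim X m U) (preim X m V) (h U s)"
  "openin (zar Y) U \<Longrightarrow> s \<in> carrier (sec Y U) \<Longrightarrow> x \<in> preim X m U \<Longrightarrow>
   invertible_at X (preim X m U) x (h U s) \<Longrightarrow> invertible_at Y U (m x) s"
proof -
 note r = f[unfolded morphism_def prod.case]
 note r4 = r[THEN conjunct2, THEN conjunct2, THEN conjunct2]
 note r1 = r4[THEN conjunct1, rule_format] and r2 = r4[THEN conjunct2, THEN conjunct1, rule_format]
  and r3 = r4[THEN conjunct2, THEN conjunct2, rule_format]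
 show "m \<in> extensional (topspace (zar X))" "continuous_map (zar X) (zar Y) m"
  "h \<in> extensional {U. openin (zar Y) U}" using r by simp_all
 show "openin (zar Y) U \<Longrightarrow> h U \<in> extensional (carrier (sec Y U))"
  "openin (zar Y) U \<Longrightarrow> h U \<in> ring_hom (sec Y U) (sec X (preim X m U))"
  "openin (zar Y) U \<Longrightarrow> h U (scal Y U c) = scal X (preim X m U) c" by (simp_all add: r1)
 show "openin (zar Y) U \<Longrightarrow> openin (zar Y) V \<Longrightarrow> V \<subseteq> U \<Longrightarrow> s \<in> carrier (sec Y U) \<Longrightarrow>
   h V (rest Y U V s) = rest X (preim X m U) (preim X m V) (h U s)" by (rule r2) auto
 show "openin (zar Y) U \<Longrightarrow> s \<in> carrier (sec Y U) \<Longrightarrow> x \<in> preim X m U \<Longrightarrow>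
   invertible_at X (preim X m U) x (h U s) \<Longrightarrow> invertible_at Y U (m x) s" by (rule r3)
qed

lemma morphismI:
 assumes "m \<in> extensional (topspace (zar X))" "continuous_map (zar X) (zar Y) m"
  "h \<in> extensional {U. openin (zar Y) U}"
  "\<And>U. openin (zar Y) U \<Longrightarrow> h U \<in> extensional (carrier (sec Y U))"
  "\<And>U. openin (zar Y) U \<Longrightarrow> h U \<in> ring_hom (sec Y U) (sec X (preim X m U))"
  "\<And>U c. openin (zar Y) U \<Longrightarrow> h U (scal Y U c) = scal X (preim X m U) c"
  "\<And>U V s. openin (zar Y) U \<Longrightarrow> openin (zar Y) V \<Longrightarrow> V \<subseteq> U \<Longrightarrow> s \<in> carrier (sec Y U) \<Longrightarrow>
   h V (rest Y U V s) = rest X (preim X m U) (preim X m V) (h U s)"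
  "\<And>U s x. openin (zar Y) U \<Longrightarrow> s \<in> carrier (sec Y U) \<Longrightarrow> x \<in> preim X m U \<Longrightarrow>
   invertible_at X (preim X m U) x (h U s) \<Longrightarrow> invertible_at Y U (m x) s"
 shows "morphism X Y (m, h)"
 unfolding morphism_def prod.case
 by (intro conjI allI impI ballI; (elim conjE)?; (rule assms; assumption))

lemma preim_open_subspace: "openin (zar X) U \<Longrightarrow> preim (open_subspace X U) m V = {x \<in> U. m x \<in> V}"
 using openin_subset by (fastforce simp: preim_def open_subspace_def)

lemma (in base_ring) Spec_const_section:
 assumes "openin (Zariski R) V" "a \<in> carrier R" "b \<in> carrier R" "\<And>q. q \<in> V \<Longrightarrow> b \<notin> q"
 shows "(\<lambda>q\<in>V. frac_at R q a b) \<in> Spec_sections R (Zariski R) V"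
proof -
 have pr: "primeideal q R" if "q \<in> V" for q using openin_ZariskiD[OF assms(1)] that by auto
 have "frac_at R q a b \<in> carrier (local_ring R q)" if "q \<in> V" for q
  using local_carrier[OF pr[OF that]] assms that by blast
 moreover have "\<exists>W. openin (Zariski R) W \<and> p \<in> W \<and> W \<subseteq> V \<and>
   (\<exists>c\<in>carrier R. \<exists>d\<in>carrier R. \<forall>q\<in>W. d \<notin> q \<and> (\<lambda>q\<in>V. frac_at R q a b) q = frac_at R q c d)"
  if "p \<in> V" for p
  using assms that by (intro exI[of _ V] conjI bexI[of _ a] bexI[of _ b]) auto
 ultimately show ?thesis unfolding Spec_sections_def by simp
qed

context ringed
begin

text \<open>The given isomorphism identifies \<open>U\<close> with the spectrum of its own ring
  \<open>A\<close>, but its effect on global sections is some automorphism \<open>w\<close> of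
  \<open>A\<close>. Every clause is proved for elements \<open>w a\<close>, which is enough because
  \<open>w\<close> is bijective.\<close>

lemma affine_open_imp_aff:
 assumes aff: "affine_open X U"
 shows "aff U"
proof -
 define A where "A = sec X U"
 define S where "S = Spec A (scal X U)"
 define X' where "X' = open_subspace X U"
 obtain m h where oU: "opn U" and iso: "isomorphism X' S (m, h)"
  using aff by (auto simp: affine_open_def S_def A_def X'_def)
 interpret A: base_ring A using sec_cring[OF oU] by (simp add: base_ring_def A_def)
 define P where "P V = {x \<in> U. m x \<in> V}" for V
 have pre: "preim X' m V = P V" for V using preim_open_subspace[OF oU] by (simp add: P_def X'_def)
 have zX': "zar X' = subtopology (zar X) U" and sX': "sec X' = sec X" and rX': "rest X' = res"
  by (auto simp: X'_def open_subspace_def)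
 have tX': "topspace (zar X') = U" using oU openin_subset by (auto simp: zX')
 have zS: "zar S = Zariski A" and rS: "rest S = (\<lambda>U V s. restrict s V)"
  and sS: "carrier (sec S V) = Spec_sections A (Zariski A) V"
   "\<one>[sec S V] = (\<lambda>p\<in>V. \<one>[local_ring A p])" "\<zero>[sec S V] = (\<lambda>p\<in>V. \<zero>[local_ring A p])"
   "s \<otimes>[sec S V] t = (\<lambda>p\<in>V. s p \<otimes>[local_ring A p] t p)"
   "s \<oplus>[sec S V] t = (\<lambda>p\<in>V. s p \<oplus>[local_ring A p] t p)" for V s t
  by (simp_all add: S_def Spec_def)
 note isod = iso[unfolded isomorphism_def fst_conv snd_conv]
 note mor = morphismD[OF isod[THEN conjunct1], unfolded pre zS sX' rX' tX']
 have cont: "continuous_map (zar X') (Zariski A) m" by (rule mor(2))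
 have hhom: "h V \<in> ring_hom (sec S V) (sec X (P V))" if "openin (Zariski A) V" for V
  using mor(5)[OF that] .
 have nat: "h V (restrict s V) = res (P W) (P V) (h W s)"
  if "openin (Zariski A) W" "openin (Zariski A) V" "V \<subseteq> W" "s \<in> Spec_sections A (Zariski A) W" for V W s
  using mor(7)[OF that(1-3), of s] that(4) by (simp add: sS rS)
 have loc: "invertible_at S V (m x) s"
  if "openin (Zariski A) V" "s \<in> Spec_sections A (Zariski A) V" "x \<in> P V" "invertible_at X' (P V) x (h V s)" for V s x
  using mor(8)[OF that(1), of s x] that(2-4) by (simp add: sS)
 have homeo: "homeomorphic_map (zar X') (Zariski A) m" using isod by (simp add: zS)
 have bij: "bij_betw (h V) (Spec_sections A (Zariski A) V) (Sec (P V))"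
  if "openin (Zariski A) V" for V
  using isod[THEN conjunct2, THEN conjunct2, rule_format, unfolded zS, OF that] by (simp add: sS pre sX')
 define T where "T = {p. primeideal p A}"
 have tZ: "topspace (Zariski A) = T" by (simp add: T_def A.topspace_Zariski)
 have oT: "openin (Zariski A) T" using tZ openin_topspace by metis
 have bijm: "bij_betw m U T" using homeomorphic_map_maps homeo tX' tZ
  by (metis bij_betw_def homeomorphic_imp_injective_map homeomorphic_imp_surjective_map)
 have PT: "P T = U" using bijm bij_betwE by (fastforce simp: P_def)
 have mpr: "primeideal (m x) A" if "x \<in> U" for x using bijm bij_betwE that by (fastforce simp: T_def)
 have oP: "opn (P V)" if "openin (Zariski A) V" for V
 proof -
  have "openin (zar X') {x \<in> topspace (zar X'). m x \<in> V}" using cont that by (simp add: continuous_map)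
  hence "openin (zar X') (P V)" unfolding tX' P_def .
  thus ?thesis unfolding zX' using openin_trans_full[OF _ oU] by blast
 qed
 have PU: "P V \<subseteq> U" for V by (auto simp: P_def)
 \<comment> \<open>The element \<open>a\<close> as the section a/1 over \<open>V\<close>.\<close>
 define cs where "cs V a = (\<lambda>p\<in>V. frac_at A p a \<one>[A])" for V a
 have cs_sec: "cs V a \<in> Spec_sections A (Zariski A) V" if "openin (Zariski A) V" "a \<in> carrier A" for V a
  unfolding cs_def
 proof (rule A.Spec_const_section[OF that])
  fix q assume "q \<in> V"
  hence "primeideal q A" using A.openin_ZariskiD[OF that(1)] by auto
  thus "\<one>[A] \<notin> q" by (rule primeideal.one_notin)
 qed simp
 have cs_mult: "cs V (a \<otimes>[A] b) = cs V a \<otimes>[sec S V] cs V b"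
  and cs_add: "cs V (a \<oplus>[A] b) = cs V a \<oplus>[sec S V] cs V b"
  if "openin (Zariski A) V" "a \<in> carrier A" "b \<in> carrier A" for V a b
 proof -
  have "frac_at A q (a \<otimes>[A] b) \<one>[A] = frac_at A q a \<one>[A] \<otimes>[local_ring A q] frac_at A q b \<one>[A]"
   "frac_at A q (a \<oplus>[A] b) \<one>[A] = frac_at A q a \<one>[A] \<oplus>[local_ring A q] frac_at A q b \<one>[A]"
   if "q \<in> V" for q
  proof -
   have q: "primeideal q A" using A.openin_ZariskiD[OF \<open>openin (Zariski A) V\<close>] that by auto
   show "frac_at A q (a \<otimes>[A] b) \<one>[A] = frac_at A q a \<one>[A] \<otimes>[local_ring A q] frac_at A q b \<one>[A]"
    "frac_at A q (a \<oplus>[A] b) \<one>[A] = frac_at A q a \<one>[A] \<oplus>[local_ring A q] frac_at A q b \<one>[A]"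
    using \<open>a \<in> carrier A\<close> \<open>b \<in> carrier A\<close> primeideal.one_notin[OF q]
    by (simp_all add: A.local_mult[OF q] A.local_add[OF q])
  qed
  thus "cs V (a \<otimes>[A] b) = cs V a \<otimes>[sec S V] cs V b"
   "cs V (a \<oplus>[A] b) = cs V a \<oplus>[sec S V] cs V b"
   by (auto simp: cs_def sS intro!: restrict_ext)
 qed
 have cs_one: "cs V \<one>[A] = \<one>[sec S V]" and cs_zero: "cs V \<zero>[A] = \<zero>[sec S V]"
  if "openin (Zariski A) V" for V
  using A.openin_ZariskiD[OF that] A.local_one A.local_zero by (auto simp: cs_def sS intro!: restrict_ext)
 have cs_restrict: "restrict (cs W a) V = cs V a" if "V \<subseteq> W" for V W a
  using that by (auto simp: cs_def restrict_def fun_eq_iff)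
 \<comment> \<open>The automorphism of \<open>A\<close> on global sections; it need not be the
   identity.\<close>
 define w where "w a = h T (cs T a)" for a
 note hT = hhom[OF oT, unfolded PT, folded A_def]
 have whom: "w \<in> ring_hom A A"
 proof (rule ring_hom_memI)
  fix a assume a: "a \<in> carrier A"
  show "w a \<in> carrier A" using ring_hom_closed[OF hT] cs_sec[OF oT a] by (simp add: w_def sS)
  fix b assume b: "b \<in> carrier A"
  show "w (a \<otimes>[A] b) = w a \<otimes>[A] w b" "w (a \<oplus>[A] b) = w a \<oplus>[A] w b"
   using ring_hom_mult[OF hT] ring_hom_add[OF hT] cs_sec[OF oT] a b
   by (simp_all add: w_def cs_mult[OF oT] cs_add[OF oT] sS(1))
 next
  show "w \<one>[A] = \<one>[A]" using ring_hom_one[OF hT] by (simp add: w_def cs_one[OF oT])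
 qed
 interpret w: ring_hom_ring A A w using whom A.ring_axioms by (simp add: ring_hom_ringI2)
 have D1: "A.D \<one>[A] = T" by (simp add: T_def A.D_one)
 have h_zero: "h V \<zero>[sec S V] = \<zero>[sec X (P V)]" if V: "openin (Zariski A) V" for V
 proof -
  interpret B: cring "sec X (P V)" by (rule sec_cring[OF oP[OF V]])
  have z: "cs V \<zero>[A] \<in> carrier (sec S V)" using cs_sec[OF V] by (simp add: sS)
  have "h V (cs V \<zero>[A]) = h V (cs V (\<zero>[A] \<oplus>[A] \<zero>[A]))" by simp
  also have "\<dots> = h V (cs V \<zero>[A]) \<oplus>[sec X (P V)] h V (cs V \<zero>[A])"
   using cs_add[OF V A.zero_closed A.zero_closed] ring_hom_add[OF hhom[OF V] z z] by metis
  finally show ?thesis using ring_hom_closed[OF hhom[OF V] z] unfolding cs_zero[OF V] by simp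
 qed
 have rest_w: "res U (P V) (w a) = h V (cs V a)" if "openin (Zariski A) V" "a \<in> carrier A" for V a
 proof -
  have "V \<subseteq> T" using A.openin_ZariskiD[OF that(1)] by (auto simp: T_def)
  thus ?thesis using nat[OF oT that(1) _ cs_sec[OF oT that(2)]] cs_restrict PT by (simp add: w_def)
 qed
 \<comment> \<open>Injectivity of the localisation map, transported from the spectrum by
   \<open>h\<close>; with \<open>b\<close> equal to one it also gives injectivity of
   \<open>w\<close>.\<close>
 have ann: "\<exists>n::nat. b [^][A] n \<otimes>[A] a = \<zero>[A]"
  if ab: "a \<in> carrier A" "b \<in> carrier A" and z: "res U (P (A.D b)) (w a) = \<zero>[sec X (P (A.D b))]" for a b
 proof (rule A.frac_zero_on_D[OF ab])
  have o: "openin (Zariski A) (A.D b)" by (rule A.openin_D[OF ab(2)])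
  have "h (A.D b) (cs (A.D b) a) = h (A.D b) (cs (A.D b) \<zero>[A])"
   using z rest_w[OF o ab(1)] h_zero[OF o] cs_zero[OF o] by simp
  hence "cs (A.D b) a = cs (A.D b) \<zero>[A]"
   using bij[OF o] cs_sec[OF o] ab by (meson A.zero_closed bij_betw_imp_inj_on inj_onD)
  thus "frac_at A q a \<one>[A] = frac_at A q \<zero>[A] \<one>[A]" if "q \<in> A.D b" for q
   using that by (metis cs_def restrict_apply')
 qed
 have winj: "inj_on w (carrier A)"
 proof (rule inj_onI)
  have ker: "a = \<zero>[A]" if a: "a \<in> carrier A" "w a = \<zero>[A]" for a
  proof -
   have "\<exists>n::nat. \<one>[A] [^][A] n \<otimes>[A] a = \<zero>[A]"
    by (rule ann) (use a rest_zero[OF oU oU subset_refl, folded A_def] in \<open>simp_all add: D1 PT A_def[symmetric]\<close>)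
   thus ?thesis using a by simp
  qed
  fix a b assume ab: "a \<in> carrier A" "b \<in> carrier A" "w a = w b"
  have "w (a \<ominus>[A] b) = w a \<ominus>[A] w b" using ab(1,2) by (simp add: A.minus_eq)
  also have "\<dots> = \<zero>[A]" unfolding ab(3) using w.hom_closed[OF ab(2)] by simp
  finally have "a \<ominus>[A] b = \<zero>[A]" by (rule ker[OF A.minus_closed[OF ab(1,2)]])
  thus "a = b" using ab by simp
 qed
 \<comment> \<open>Surjectivity of localisation, transported likewise; with \<open>b\<close> equal
   to one it gives surjectivity of \<open>w\<close>.\<close>
 have frac_of: "\<exists>n::nat. \<exists>a\<in>carrier A. h (A.D b) (cs (A.D b) (b [^][A] n)) \<otimes>[sec X (P (A.D b))] u = h (A.D b) (cs (A.D b) a)"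
  if b: "b \<in> carrier A" and u: "u \<in> Sec (P (A.D b))" for b u
 proof -
  have o: "openin (Zariski A) (A.D b)" by (rule A.openin_D[OF b])
  obtain g where g: "g \<in> Spec_sections A (Zariski A) (A.D b)" "u = h (A.D b) g"
   using bij[OF o] u by (auto simp: bij_betw_def)
  obtain n :: nat and a where a: "a \<in> carrier A" "\<And>q. q \<in> A.D b \<Longrightarrow> g q = frac_at A q a (b [^][A] n)"
   using A.section_on_D[OF b g(1)] by blast
  have "cs (A.D b) (b [^][A] n) \<otimes>[sec S (A.D b)] g = cs (A.D b) a"
   unfolding sS cs_def
  proof (rule restrict_ext)
   fix q assume q: "q \<in> A.D b"
   hence pq: "primeideal q A" and bq: "b [^][A] n \<notin> q"
    using b by (auto simp: A.D_def primeideal.pow_notin)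
   have "frac_at A q (b [^][A] n) \<one>[A] \<otimes>[local_ring A q] g q
    = frac_at A q (b [^][A] n \<otimes>[A] a) (\<one>[A] \<otimes>[A] b [^][A] n)"
    using a q b bq primeideal.one_notin[OF pq] by (simp only: a(2)[OF q], subst A.local_mult[OF pq]) auto
   also have "\<dots> = frac_at A q a \<one>[A]"
    using a b bq primeideal.one_notin[OF pq] by (intro A.frac_at_eqI[OF pq]) (auto simp: A.m_comm)
   finally show "(\<lambda>p\<in>A.D b. frac_at A p (b [^][A] n) \<one>[A]) q \<otimes>[local_ring A q] g q = frac_at A q a \<one>[A]"
    using q by simp
  qed
  hence "h (A.D b) (cs (A.D b) (b [^][A] n)) \<otimes>[sec X (P (A.D b))] u = h (A.D b) (cs (A.D b) a)"
   using ring_hom_mult[OF hhom[OF o], of "cs (A.D b) (b [^][A] n)" g] cs_sec[OF o, of "b [^][A] n"] b g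
   by (simp add: sS(1))
  thus ?thesis using a(1) by blast
 qed
 have wsurj: "w ` carrier A = carrier A"
 proof
  show "carrier A \<subseteq> w ` carrier A"
  proof
   fix u assume u: "u \<in> carrier A"
   then obtain n :: nat and a where a: "a \<in> carrier A"
    "h T (cs T (\<one>[A] [^][A] n)) \<otimes>[A] u = h T (cs T a)"
    using frac_of[of "\<one>[A]" u] unfolding D1 PT A_def[symmetric] by auto
   hence "u = w a" using u by (simp add: w_def[symmetric])
   thus "u \<in> w ` carrier A" using a by blast
  qed
 qed auto
 have wpow: "w (a [^][A] (n::nat)) = w a [^][A] n" if "a \<in> carrier A" for a n
  using that by (induction n) auto
 \<comment> \<open>One direction is locality of the morphism: invertibility of \<open>w a\<close> at
   \<open>x\<close> makes a/1 a unit at the prime \<open>m x\<close>. For the other, 1/a is an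
   inverse on \<open>D a\<close>, and its image is one near \<open>x\<close>.\<close>
 have inv_iff: "inv_at U x (w a) \<longleftrightarrow> a \<notin> m x" if x: "x \<in> U" and a: "a \<in> carrier A" for x a
 proof
  assume "inv_at U x (w a)"
  then obtain V where V: "opn V" "x \<in> V" "V \<subseteq> U" "res U V (w a) \<in> Units (sec X V)"
   by (auto simp: invertible_at_def)
  hence "invertible_at X' U x (w a)"
   unfolding invertible_at_def zX' rX' sX' using oU by (auto simp: openin_open_subtopology)
  hence "invertible_at S T (m x) (cs T a)"
   using loc[OF oT cs_sec[OF oT a], of x] x PT by (simp add: w_def)
  then obtain W where W: "openin (Zariski A) W" "m x \<in> W" "W \<subseteq> T" "restrict (cs T a) W \<in> Units (sec S W)"
   by (auto simp: invertible_at_def zS rS)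
  then obtain g where g: "g \<in> Spec_sections A (Zariski A) W" "cs W a \<otimes>[sec S W] g = \<one>[sec S W]"
   unfolding Units_def sS(1) cs_restrict[OF W(3)] by blast
  define q where "q = m x"
  have pq: "primeideal q A" using mpr[OF x] by (simp add: q_def)
  interpret q: primeideal q A by (rule pq)
  have "g q \<in> carrier (local_ring A q)" using g(1) W(2) by (auto simp: Spec_sections_def q_def)
  then obtain c d where cd: "c \<in> carrier A" "d \<in> carrier A - q" "g q = frac_at A q c d"
   using A.local_carrier[OF pq] by auto
  have "frac_at A q a \<one>[A] \<otimes>[local_ring A q] g q = \<one>[local_ring A q]"
   using fun_cong[OF g(2), of q] W(2) by (simp add: sS cs_def q_def)
  hence "frac_at A q (a \<otimes>[A] c) (\<one>[A] \<otimes>[A] d) = frac_at A q \<one>[A] \<one>[A]"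
   using cd a q.one_notin A.local_mult[OF pq, of a "\<one>[A]" c d] A.local_one[OF pq] by simp
  then obtain t where t: "t \<in> carrier A - q" "t \<otimes>[A] (a \<otimes>[A] c \<otimes>[A] \<one>[A] \<ominus>[A] \<one>[A] \<otimes>[A] (\<one>[A] \<otimes>[A] d)) = \<zero>[A]"
   using A.frac_at_eq[OF pq, of "a \<otimes>[A] c" "\<one>[A] \<otimes>[A] d" "\<one>[A]" "\<one>[A]"] cd a q.one_notin by auto
  have "a \<notin> q"
  proof
   assume aq: "a \<in> q"
   have cc: "t \<in> carrier A" "d \<in> carrier A" using t cd by auto
   have "t \<otimes>[A] d = t \<otimes>[A] c \<otimes>[A] a \<ominus>[A] t \<otimes>[A] (a \<otimes>[A] c \<otimes>[A] \<one>[A] \<ominus>[A] \<one>[A] \<otimes>[A] (\<one>[A] \<otimes>[A] d))"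
    using cc cd(1) a by algebra
   also have "\<dots> = t \<otimes>[A] c \<otimes>[A] a" unfolding t(2) using cc cd(1) a by (simp add: A.minus_eq)
   also have "\<dots> \<in> q" using aq cc cd(1) by (intro q.I_l_closed) auto
   finally show False using q.mult_notin[of t d] t cd by auto
  qed
  thus "a \<notin> m x" by (simp add: q_def)
 next
  assume am: "a \<notin> m x"
  have o: "openin (Zariski A) (A.D a)" by (rule A.openin_D[OF a])
  have xD: "x \<in> P (A.D a)" using am x mpr[OF x] by (simp add: P_def A.D_def)
  interpret B: cring "sec X (P (A.D a))" by (rule sec_cring[OF oP[OF o]])
  define g where "g = (\<lambda>q\<in>A.D a. frac_at A q \<one>[A] a)"
  have g: "g \<in> Spec_sections A (Zariski A) (A.D a)"
   unfolding g_def by (rule A.Spec_const_section[OF o]) (use a in \<open>auto simp: A.D_def\<close>)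
  have "cs (A.D a) a \<otimes>[sec S (A.D a)] g = \<one>[sec S (A.D a)]"
   unfolding sS cs_def g_def
  proof (rule restrict_ext)
   fix q assume q: "q \<in> A.D a"
   hence pq: "primeideal q A" and aq: "a \<notin> q" by (auto simp: A.D_def)
   show "(\<lambda>p\<in>A.D a. frac_at A p a \<one>[A]) q \<otimes>[local_ring A q] (\<lambda>q\<in>A.D a. frac_at A q \<one>[A] a) q = \<one>[local_ring A q]"
   proof -
    have "frac_at A q a \<one>[A] \<otimes>[local_ring A q] frac_at A q \<one>[A] a = frac_at A q (a \<otimes>[A] \<one>[A]) (\<one>[A] \<otimes>[A] a)"
     by (rule A.local_mult[OF pq]) (use a aq primeideal.one_notin[OF pq] in auto)
    also have "\<dots> = frac_at A q \<one>[A] \<one>[A]"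
     by (rule A.frac_at_eqI[OF pq]) (use a aq primeideal.one_notin[OF pq] in auto)
    finally show ?thesis using q by (simp add: A.local_one[OF pq])
   qed
  qed
  hence "h (A.D a) (cs (A.D a) a) \<otimes>[sec X (P (A.D a))] h (A.D a) g = \<one>[sec X (P (A.D a))]"
   using ring_hom_mult[OF hhom[OF o]] ring_hom_one[OF hhom[OF o]] cs_sec[OF o a] g by (metis sS(1))
  moreover have "h (A.D a) (cs (A.D a) a) \<in> Sec (P (A.D a))" "h (A.D a) g \<in> Sec (P (A.D a))"
   using ring_hom_closed[OF hhom[OF o]] cs_sec[OF o a] g by (simp_all add: sS)
  ultimately have "h (A.D a) (cs (A.D a) a) \<in> Units (sec X (P (A.D a)))"
   unfolding Units_def using B.m_comm by auto
  thus "inv_at U x (w a)"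
   unfolding invertible_at_def using rest_w[OF o a] oP[OF o] xD PU by metis
 qed
 have DP: "DX U (w a) = P (A.D a)" if "a \<in> carrier A" for a
  using inv_iff that mpr by (auto simp: DX_def P_def A.D_def)
 \<comment> \<open>The prime attached to \<open>x\<close> is the image under \<open>w\<close> of the
   prime given by the isomorphism, not that prime itself.\<close>
 have ptid_eq: "ptid U x = w ` m x" if x: "x \<in> U" for x
 proof -
  interpret q: primeideal "m x" A by (rule mpr[OF x])
  have "ptid U x = {s \<in> w ` carrier A. \<not> inv_at U x s}"
   unfolding ptid_def wsurj by (simp add: A_def)
  also have "\<dots> = w ` m x" using inv_iff[OF x] q.Icarr by auto
  finally show ?thesis .
 qed
 have "w \<in> ring_iso A A" by (simp add: ring_iso_def bij_betw_def whom winj wsurj)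
 hence "inv_into (carrier A) w \<in> ring_iso A A" by (rule ring_iso_set_sym[OF A.ring_axioms])
 hence invhom: "inv_into (carrier A) w \<in> ring_hom A A" by (simp add: ring_iso_def)
 have wprime: "primeideal (w ` q) A" if q: "primeideal q A" for q
 proof -
  interpret q: primeideal q A by (rule q)
  have "w ` q = {a \<in> carrier A. inv_into (carrier A) w a \<in> q}"
  proof safe
   fix a assume "a \<in> q"
   thus "w a \<in> carrier A" "inv_into (carrier A) w (w a) \<in> q" using winj q.Icarr by auto
  next
   fix a assume "a \<in> carrier A" "inv_into (carrier A) w a \<in> q"
   moreover from this have "a = w (inv_into (carrier A) w a)"
    using f_inv_into_f[of a w "carrier A"] wsurj by simp
   ultimately show "a \<in> w ` q" by (intro image_eqI)
  qed
  thus ?thesis using prime_vimage[OF A.cring_axioms A.cring_axioms invhom q] by simp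
 qed
 have bijT: "bij_betw (\<lambda>q. w ` q) T T"
  unfolding bij_betw_def
 proof
  show "inj_on (\<lambda>q. w ` q) T"
  proof (rule inj_onI)
   fix p q assume "p \<in> T" "q \<in> T" "w ` p = w ` q"
   moreover from this have "p \<subseteq> carrier A" "q \<subseteq> carrier A"
    using ideal.Icarr[OF primeideal.axioms(1)] by (auto simp: T_def)
   ultimately show "p = q" using inj_on_image_eq_iff[OF winj] by blast
  qed
  show "(\<lambda>q. w ` q) ` T = T"
  proof
   show "(\<lambda>q. w ` q) ` T \<subseteq> T" using wprime by (auto simp: T_def)
   show "T \<subseteq> (\<lambda>q. w ` q) ` T"
   proof
    fix q assume q: "q \<in> T"
    hence prq: "primeideal {a \<in> carrier A. w a \<in> q} A"
     using prime_vimage[OF A.cring_axioms A.cring_axioms whom] by (simp add: T_def)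
    have "q \<subseteq> carrier A" using q ideal.Icarr[OF primeideal.axioms(1)] by (auto simp: T_def)
    have "w ` {a \<in> carrier A. w a \<in> q} = q"
    proof
     show "q \<subseteq> w ` {a \<in> carrier A. w a \<in> q}"
     proof
      fix s assume s: "s \<in> q"
      hence "s \<in> w ` carrier A" using \<open>q \<subseteq> carrier A\<close> wsurj by auto
      thus "s \<in> w ` {a \<in> carrier A. w a \<in> q}" using s by auto
     qed
    qed auto
    with prq show "q \<in> (\<lambda>q. w ` q) ` T" unfolding T_def by (intro image_eqI[of _ _ "{a \<in> carrier A. w a \<in> q}"]) auto
   qed
  qed
 qed
 have bijp: "bij_betw (ptid U) U T"
  using bij_betw_trans[OF bijm bijT] ptid_eq by (simp add: bij_betw_cong[of U "ptid U"] comp_def)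
 show ?thesis
  unfolding aff_def A_def[symmetric] T_def[symmetric]
 proof (intro conjI allI impI ballI oU bijp; (elim conjE)?)
  fix V x assume V: "opn V" "V \<subseteq> U" "x \<in> V"
  have "openin (zar X') V" unfolding zX' using oU V by (simp add: openin_open_subtopology)
  hence "openin (Zariski A) (m ` V)" using homeo homeomorphic_imp_open_map open_map_def by metis
  then obtain a where a: "a \<in> carrier A" "m x \<in> A.D a" "A.D a \<subseteq> m ` V"
   using A.openin_ZariskiD[THEN conjunct2, rule_format, of "m ` V" "m x"] V(3) by blast
  have "P (A.D a) \<subseteq> V"
  proof
   fix y assume "y \<in> P (A.D a)"
   hence "y \<in> U" "m y \<in> m ` V" using a by (auto simp: P_def)
   thus "y \<in> V" using bijm V(2) unfolding bij_betw_def by (metis imageE inj_onD subsetD)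
  qed
  moreover have "x \<in> P (A.D a)" using a V by (auto simp: P_def)
  ultimately show "\<exists>f\<in>carrier A. x \<in> DX U f \<and> DX U f \<subseteq> V"
   using DP[OF a(1)] a(1) by (intro bexI[of _ "w a"]) auto
 next
  fix f s assume fs: "f \<in> carrier A" "s \<in> carrier A" and z: "res U (DX U f) s = \<zero>[sec X (DX U f)]"
  obtain b where b: "b \<in> carrier A" "f = w b" using fs(1) wsurj[symmetric] by auto
  obtain a where a: "a \<in> carrier A" "s = w a" using fs(2) wsurj[symmetric] by auto
  note ab = b(1) a(1) b(2) a(2)
  obtain n :: nat where "b [^][A] n \<otimes>[A] a = \<zero>[A]" using ann[OF ab(2,1)] z ab DP by auto
  hence "w (b [^][A] n \<otimes>[A] a) = \<zero>[A]" using w.hom_zero by simp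
  thus "\<exists>n::nat. f [^][A] n \<otimes>[A] s = \<zero>[A]" using ab wpow by auto
 next
  fix f u assume f: "f \<in> carrier A" and u: "u \<in> Sec (DX U f)"
  obtain b where b: "b \<in> carrier A" "f = w b" using f wsurj[symmetric] by auto
  have o: "openin (Zariski A) (A.D b)" by (rule A.openin_D[OF b(1)])
  obtain n :: nat and a where "a \<in> carrier A"
   "h (A.D b) (cs (A.D b) (b [^][A] n)) \<otimes>[sec X (P (A.D b))] u = h (A.D b) (cs (A.D b) a)"
   using frac_of[OF b(1)] u b DP by metis
  thus "\<exists>n::nat. \<exists>a\<in>carrier A. res U (DX U f) (f [^][A] n) \<otimes>[sec X (DX U f)] u = res U (DX U f) a"
   using rest_w[OF o] wpow[OF b(1)] b DP[OF b(1)]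
   by (intro exI[of _ n] bexI[of _ "w a"]) (simp_all flip: wpow)
 qed
qed

end

section \<open>Germs as fractions of sections over an affine open set\<close>

context ringed
begin

text \<open>The difference vanishes on some \<open>DX U g\<close> around \<open>x\<close>, so a
  power of \<open>g\<close> kills it, and this power is invertible at \<open>x\<close>.\<close>

lemma eq_near:
 assumes U: "aff U" and ab: "a \<in> Sec U" "b \<in> Sec U"
  and N: "opn N" "x \<in> N" "N \<subseteq> U" "res U N a = res U N b"
 shows "\<exists>f\<in>Sec U. inv_at U x f \<and> f \<otimes>[sec X U] a = f \<otimes>[sec X U] b"
proof -
 have oU: "opn U" by (rule affD(1)[OF U])
 interpret R: cring "sec X U" by (rule sec_cring[OF oU])
 obtain g where g: "g \<in> Sec U" "x \<in> DX U g" "DX U g \<subseteq> N" using affD(3)[OF U N(1,3,2)] by blast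
 have o: "opn (DX U g)" by (rule opn_DX[OF oU])
 interpret B: cring "sec X (DX U g)" by (rule sec_cring[OF o])
 have "res U (DX U g) (a \<ominus>[sec X U] b) = res U (DX U g) a \<ominus>[sec X (DX U g)] res U (DX U g) b"
  using rest_minus[OF oU o DX_sub ab] .
 also have "res U (DX U g) a = res U (DX U g) b"
  using rest_rest[OF oU N(1) o g(3) N(3) ab(1)] rest_rest[OF oU N(1) o g(3) N(3) ab(2)] N(4) by simp
 also have "res U (DX U g) b \<ominus>[sec X (DX U g)] res U (DX U g) b = \<zero>[sec X (DX U g)]"
  using rest_closed[OF oU o DX_sub ab(2)] by (simp add: B.minus_eq B.r_neg)
 finally obtain n :: nat where n: "g [^][sec X U] n \<otimes>[sec X U] (a \<ominus>[sec X U] b) = \<zero>[sec X U]"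
  using affD(4)[OF U g(1), of "a \<ominus>[sec X U] b"] ab by auto
 define f where "f = g [^][sec X U] n"
 have f: "f \<in> Sec U" using g by (simp add: f_def)
 have "f \<otimes>[sec X U] a \<ominus>[sec X U] f \<otimes>[sec X U] b = f \<otimes>[sec X U] (a \<ominus>[sec X U] b)"
  using f ab by algebra
 also have "\<dots> = \<zero>[sec X U]" using n by (simp add: f_def)
 finally have "f \<otimes>[sec X U] a = f \<otimes>[sec X U] b" using f ab by simp
 moreover have "inv_at U x f"
  unfolding f_def using g N by (intro invertible_pow[OF oU g(1)]) (auto simp: DX_def)
 ultimately show ?thesis using f by blast
qed

lemma Units_cancel:
 assumes "cring A" "u \<in> Units A" "a \<in> carrier A" "b \<in> carrier A" "u \<otimes>[A] a = u \<otimes>[A] b"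
 shows "a = b"
 using assms monoid.Units_l_cancel[OF ring.is_monoid[OF cring.axioms(1)[OF assms(1)]]] by blast

lemma near_eq:
 assumes U: "opn U" and c: "f \<in> Sec U" "a \<in> Sec U" "b \<in> Sec U"
  and eq: "f \<otimes>[sec X U] a = f \<otimes>[sec X U] b" and V: "opn V" "V \<subseteq> DX U f"
 shows "res U V a = res U V b"
proof (rule Units_cancel[OF sec_cring[OF V(1)] DX_unit[OF U c(1) V]])
 have VU: "V \<subseteq> U" using V DX_sub by blast
 show "res U V a \<in> Sec V" "res U V b \<in> Sec V"
  using rest_closed[OF U V(1) VU] c by auto
 show "res U V f \<otimes>[sec X V] res U V a = res U V f \<otimes>[sec X V] res U V b"
  using eq rest_mult[OF U V(1) VU c(1)] c by metis
qed

text \<open>The germ of \<open>u\<close> at \<open>x\<close> as a fraction of sections over \<open>U\<close>, that is, the class of all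
 \<open>(a, b)\<close> with \<open>b u = a\<close> near \<open>x\<close>.\<close>

definition germ_frac :: "'p set \<Rightarrow> 'p set \<Rightarrow> 'p \<Rightarrow> 's \<Rightarrow> ('s \<times> 's) set" where
 "germ_frac U W x u = {(a, b). a \<in> Sec U \<and> b \<in> Sec U \<and> inv_at U x b \<and>
  (\<exists>N. opn N \<and> x \<in> N \<and> N \<subseteq> W \<and> res U N b \<otimes>[sec X N] res W N u = res U N a)}"

context
 fixes U W assumes U: "aff U" and W: "opn W" "W \<subseteq> U"
begin

lemma oU: "opn U" by (rule affD(1)[OF U])

lemma cringU: "cring (sec X U)" by (rule sec_cring[OF oU])

lemma base_ringU: "base_ring (sec X U)" by (rule base_ring.intro[OF cringU])

lemma invertible_ptid: "b \<in> Sec U \<Longrightarrow> inv_at U x b \<longleftrightarrow> b \<in> Sec U - ptid U x"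
 by (auto simp: ptid_def)

lemma germ_frac_shrink:
 assumes "opn N" "N \<subseteq> W" "opn N'" "N' \<subseteq> N" "a \<in> Sec U" "b \<in> Sec U" "u \<in> Sec W"
  "res U N b \<otimes>[sec X N] res W N u = res U N a"
 shows "res U N' b \<otimes>[sec X N'] res W N' u = res U N' a"
proof -
 have NU: "N \<subseteq> U" using assms(2) W by auto
 have "res N N' (res U N b \<otimes>[sec X N] res W N u) = res N N' (res U N a)" using assms(8) by simp
 thus ?thesis
  using rest_mult[OF assms(1,3,4), of "res U N b" "res W N u"] rest_closed[OF oU assms(1) NU]
   rest_closed[OF W(1) assms(1,2,7)] rest_rest[OF oU assms(1,3,4) NU] rest_rest[OF W(1) assms(1,3,4,2,7)] assms(5,6)
  by simp
qed

text \<open>Agreement of sections near \<open>x\<close> is the same as equality after multiplication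
  by a section invertible at \<open>x\<close>. So the set of all fractions for a germ is literally
  an element of the local ring at \<open>ptid U x\<close>, with no choice of an isomorphism of
  stalks.\<close>

lemma germ_frac_eq:
 assumes x: "x \<in> W" and u: "u \<in> Sec W" and ab: "(a, b) \<in> germ_frac U W x u"
 shows "germ_frac U W x u = frac_at (sec X U) (ptid U x) a b"
proof -
 interpret R: base_ring "sec X U" by (rule base_ringU)
 have pr: "primeideal (ptid U x) (sec X U)" using aff_prime[OF U] x W by auto
 obtain N where abc: "a \<in> Sec U" "b \<in> Sec U" "inv_at U x b"
  and N: "opn N" "x \<in> N" "N \<subseteq> W" "res U N b \<otimes>[sec X N] res W N u = res U N a"
  using ab by (auto simp: germ_frac_def)
 have key: "(\<exists>M. opn M \<and> x \<in> M \<and> M \<subseteq> W \<and> res U M d \<otimes>[sec X M] res W M u = res U M c) \<longleftrightarrow>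
   (\<exists>t\<in>Sec U. inv_at U x t \<and> t \<otimes>[sec X U] (a \<otimes>[sec X U] d) = t \<otimes>[sec X U] (c \<otimes>[sec X U] b))"
  (is "?l \<longleftrightarrow> ?r") if cd: "c \<in> Sec U" "d \<in> Sec U" for c d
 proof
  assume ?l
  then obtain M where M: "opn M" "x \<in> M" "M \<subseteq> W" "res U M d \<otimes>[sec X M] res W M u = res U M c" by blast
  define V where "V = M \<inter> N"
  have V: "opn V" "x \<in> V" "V \<subseteq> U" "V \<subseteq> W" "V \<subseteq> M" "V \<subseteq> N" using M N W by (auto simp: V_def)
  interpret B: cring "sec X V" by (rule sec_cring[OF V(1)])
  have e1: "res U V d \<otimes>[sec X V] res W V u = res U V c"
   by (rule germ_frac_shrink[OF M(1,3) V(1,5) cd u M(4)])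
  have e2: "res U V b \<otimes>[sec X V] res W V u = res U V a"
   by (rule germ_frac_shrink[OF N(1,3) V(1,6) abc(1,2) u N(4)])
  have cl: "res W V u \<in> Sec V" "\<And>s. s \<in> Sec U \<Longrightarrow> res U V s \<in> Sec V"
   using rest_closed W V oU u by auto
  have "res U V (a \<otimes>[sec X U] d) = (res U V b \<otimes>[sec X V] res W V u) \<otimes>[sec X V] res U V d"
   using rest_mult[OF oU V(1,3)] abc cd e2 by simp
  also have "\<dots> = (res U V d \<otimes>[sec X V] res W V u) \<otimes>[sec X V] res U V b"
   using cl abc cd by (simp add: B.m_ac)
  also have "\<dots> = res U V (c \<otimes>[sec X U] b)" using rest_mult[OF oU V(1,3)] abc cd e1 by simp
  finally show ?r using eq_near[OF U _ _ V(1,2,3)] abc cd by auto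
 next
  assume ?r
  then obtain t where t: "t \<in> Sec U" "inv_at U x t"
   "t \<otimes>[sec X U] (a \<otimes>[sec X U] d) = t \<otimes>[sec X U] (c \<otimes>[sec X U] b)" by blast
  define V where "V = N \<inter> DX U t \<inter> DX U b"
  have "opn V" unfolding V_def by (intro openin_Int N(1) opn_DX[OF oU])
  hence V: "opn V" "x \<in> V" "V \<subseteq> U" "V \<subseteq> W" "V \<subseteq> N" "V \<subseteq> DX U t" "V \<subseteq> DX U b"
   using N W t abc x by (auto simp: V_def DX_def)
  interpret B: cring "sec X V" by (rule sec_cring[OF V(1)])
  have cl: "res W V u \<in> Sec V" "\<And>s. s \<in> Sec U \<Longrightarrow> res U V s \<in> Sec V"
   using rest_closed W V oU u by auto
  have e2: "res U V b \<otimes>[sec X V] res W V u = res U V a"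
   by (rule germ_frac_shrink[OF N(1,3) V(1,5) abc(1,2) u N(4)])
  have "res U V (a \<otimes>[sec X U] d) = res U V (c \<otimes>[sec X U] b)"
   by (rule near_eq[OF oU t(1) _ _ t(3) V(1,6)]) (use abc cd in auto)
  hence e3: "res U V a \<otimes>[sec X V] res U V d = res U V c \<otimes>[sec X V] res U V b"
   using rest_mult[OF oU V(1,3)] abc cd by simp
  have "res U V b \<otimes>[sec X V] (res U V d \<otimes>[sec X V] res W V u)
   = (res U V b \<otimes>[sec X V] res W V u) \<otimes>[sec X V] res U V d"
   using cl abc cd by (simp add: B.m_ac)
  also have "\<dots> = res U V b \<otimes>[sec X V] res U V c"
   unfolding e2 e3 using cl abc cd by (simp add: B.m_comm)
  finally have "res U V d \<otimes>[sec X V] res W V u = res U V c"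
   by (rule Units_cancel[OF sec_cring[OF V(1)] DX_unit[OF oU abc(2) V(1,7)], rotated 2]) (use cl cd in auto)
  thus ?l using V by blast
 qed
 have sw: "(t \<otimes>[sec X U] (a \<otimes>[sec X U] d \<ominus>[sec X U] c \<otimes>[sec X U] b) = \<zero>[sec X U]) \<longleftrightarrow>
   t \<otimes>[sec X U] (a \<otimes>[sec X U] d) = t \<otimes>[sec X U] (c \<otimes>[sec X U] b)"
  if "t \<in> Sec U" "c \<in> Sec U" "d \<in> Sec U" for t c d
 proof -
  have "t \<otimes>[sec X U] (a \<otimes>[sec X U] d \<ominus>[sec X U] c \<otimes>[sec X U] b)
   = t \<otimes>[sec X U] (a \<otimes>[sec X U] d) \<ominus>[sec X U] t \<otimes>[sec X U] (c \<otimes>[sec X U] b)"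
   using that abc by algebra
  thus ?thesis using that abc by simp
 qed
 have "(c, d) \<in> germ_frac U W x u \<longleftrightarrow> (c, d) \<in> frac_at (sec X U) (ptid U x) a b" for c d
 proof (cases "c \<in> Sec U \<and> d \<in> Sec U")
  case True
  have "(\<exists>t\<in>Sec U - ptid U x. t \<otimes>[sec X U] (a \<otimes>[sec X U] d \<ominus>[sec X U] c \<otimes>[sec X U] b) = \<zero>[sec X U]) \<longleftrightarrow>
   (\<exists>t\<in>Sec U. inv_at U x t \<and> t \<otimes>[sec X U] (a \<otimes>[sec X U] d) = t \<otimes>[sec X U] (c \<otimes>[sec X U] b))"
   unfolding Bex_def using sw[of _ c d] True by (auto simp: ptid_def)
  thus ?thesis
   unfolding R.frac_at_mem[OF pr] germ_frac_def
   using key[of c d] True abc invertible_ptid[of b x] invertible_ptid[of d x] by simp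
 qed (auto simp: R.frac_at_mem[OF pr] germ_frac_def)
 thus ?thesis by auto
qed

text \<open>The same fraction represents the germs at all points of a basic open set. This
  uniformity is what the local condition in \<open>Spec_sections\<close> asks for.\<close>

lemma germ_frac_exists:
 assumes x: "x \<in> W" and u: "u \<in> Sec W"
 shows "\<exists>f\<in>Sec U. \<exists>a\<in>Sec U. \<exists>b\<in>Sec U. x \<in> DX U f \<and> DX U f \<subseteq> W \<and>
  (\<forall>y\<in>DX U f. inv_at U y b \<and> (a, b) \<in> germ_frac U W y u)"
proof -
 obtain f where f: "f \<in> Sec U" "x \<in> DX U f" "DX U f \<subseteq> W" using affD(3)[OF U W x] by blast
 have o: "opn (DX U f)" by (rule opn_DX[OF oU])
 interpret R: cring "sec X U" by (rule cringU)
 obtain n :: nat and a where a: "a \<in> Sec U"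
  "res U (DX U f) (f [^][sec X U] n) \<otimes>[sec X (DX U f)] res W (DX U f) u = res U (DX U f) a"
  using affD(5)[OF U f(1) rest_closed[OF W(1) o f(3) u]] by blast
 have inv: "inv_at U y (f [^][sec X U] n)" if "y \<in> DX U f" for y
  using that by (intro invertible_pow[OF oU f(1)]) (auto simp: DX_def)
 have "(a, f [^][sec X U] n) \<in> germ_frac U W y u" if "y \<in> DX U f" for y
  unfolding germ_frac_def using that a f o inv by auto
 thus ?thesis using f a inv by (meson R.nat_pow_closed)
qed

lemma germ_frac_mult:
 assumes x: "x \<in> W" and st: "u \<in> Sec W" "w \<in> Sec W"
  and ab: "(a, b) \<in> germ_frac U W x u" "(c, d) \<in> germ_frac U W x w"
 shows "(a \<otimes>[sec X U] c, b \<otimes>[sec X U] d) \<in> germ_frac U W x (u \<otimes>[sec X W] w)"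
  and "(a \<otimes>[sec X U] d \<oplus>[sec X U] c \<otimes>[sec X U] b, b \<otimes>[sec X U] d) \<in> germ_frac U W x (u \<oplus>[sec X W] w)"
proof -
 interpret R: cring "sec X U" by (rule cringU)
 obtain N where abc: "a \<in> Sec U" "b \<in> Sec U" "inv_at U x b"
  and N: "opn N" "x \<in> N" "N \<subseteq> W" "res U N b \<otimes>[sec X N] res W N u = res U N a"
  using ab by (auto simp: germ_frac_def)
 obtain M where cdc: "c \<in> Sec U" "d \<in> Sec U" "inv_at U x d"
  and M: "opn M" "x \<in> M" "M \<subseteq> W" "res U M d \<otimes>[sec X M] res W M w = res U M c"
  using ab by (auto simp: germ_frac_def)
 define V where "V = M \<inter> N"
 have V: "opn V" "x \<in> V" "V \<subseteq> U" "V \<subseteq> W" "V \<subseteq> M" "V \<subseteq> N" using M N W by (auto simp: V_def)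
 interpret B: cring "sec X V" by (rule sec_cring[OF V(1)])
 have e1: "res U V d \<otimes>[sec X V] res W V w = res U V c"
  by (rule germ_frac_shrink[OF M(1,3) V(1,5) cdc(1,2) st(2) M(4)])
 have e2: "res U V b \<otimes>[sec X V] res W V u = res U V a"
  by (rule germ_frac_shrink[OF N(1,3) V(1,6) abc(1,2) st(1) N(4)])
 have cl: "res W V u \<in> Sec V" "res W V w \<in> Sec V"
  "res U V a \<in> Sec V" "res U V b \<in> Sec V" "res U V c \<in> Sec V" "res U V d \<in> Sec V"
  using rest_closed W V oU st abc cdc by auto
 have inv: "inv_at U x (b \<otimes>[sec X U] d)"
  using invertible_mult[OF oU abc(2) cdc(2)] abc cdc x W by auto
 have "(res U V b \<otimes>[sec X V] res U V d) \<otimes>[sec X V] (res W V u \<otimes>[sec X V] res W V w)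
  = (res U V b \<otimes>[sec X V] res W V u) \<otimes>[sec X V] (res U V d \<otimes>[sec X V] res W V w)"
  using cl by (simp add: B.m_ac)
 hence "res U V (b \<otimes>[sec X U] d) \<otimes>[sec X V] res W V (u \<otimes>[sec X W] w) = res U V (a \<otimes>[sec X U] c)"
  using e1 e2 rest_mult[OF oU V(1,3)] rest_mult[OF W(1) V(1,4)] abc cdc st by simp
 thus "(a \<otimes>[sec X U] c, b \<otimes>[sec X U] d) \<in> germ_frac U W x (u \<otimes>[sec X W] w)"
  unfolding germ_frac_def using V abc cdc inv by auto
 have "(res U V b \<otimes>[sec X V] res U V d) \<otimes>[sec X V] (res W V u \<oplus>[sec X V] res W V w)
  = (res U V b \<otimes>[sec X V] res W V u) \<otimes>[sec X V] res U V d \<oplus>[sec X V] (res U V d \<otimes>[sec X V] res W V w) \<otimes>[sec X V] res U V b"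
  using cl by (simp add: B.m_ac B.r_distr)
 hence "res U V (b \<otimes>[sec X U] d) \<otimes>[sec X V] res W V (u \<oplus>[sec X W] w)
   = res U V (a \<otimes>[sec X U] d \<oplus>[sec X U] c \<otimes>[sec X U] b)"
  using e1 e2 rest_mult[OF oU V(1,3)] rest_add[OF oU V(1,3)] rest_add[OF W(1) V(1,4)] abc cdc st by simp
 thus "(a \<otimes>[sec X U] d \<oplus>[sec X U] c \<otimes>[sec X U] b, b \<otimes>[sec X U] d) \<in> germ_frac U W x (u \<oplus>[sec X W] w)"
  unfolding germ_frac_def using V abc cdc inv by auto
qed

lemma germ_frac_const:
 assumes x: "x \<in> W" and a: "a \<in> Sec U"
 shows "(a, \<one>[sec X U]) \<in> germ_frac U W x (res U W a)"
proof -
 interpret R: cring "sec X U" by (rule cringU)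
 interpret B: cring "sec X W" by (rule sec_cring[OF W(1)])
 have "res U W \<one>[sec X U] \<otimes>[sec X W] res W W (res U W a) = res U W a"
  using rest_one[OF oU W] rest_closed[OF oU W a] rest_id[OF W(1)] by simp
 thus ?thesis
  unfolding germ_frac_def using a x W oU invertible_one[OF oU] by auto
qed

lemma germ_frac_rest:
 assumes x: "x \<in> V" and V: "opn V" "V \<subseteq> W" and u: "u \<in> Sec W" and ab: "(a, b) \<in> germ_frac U W x u"
 shows "(a, b) \<in> germ_frac U V x (res W V u)"
proof -
 obtain N where abc: "a \<in> Sec U" "b \<in> Sec U" "inv_at U x b"
  and N: "opn N" "x \<in> N" "N \<subseteq> W" "res U N b \<otimes>[sec X N] res W N u = res U N a"
  using ab by (auto simp: germ_frac_def)
 have o: "opn (N \<inter> V)" using N V by auto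
 have "res U (N \<inter> V) b \<otimes>[sec X (N \<inter> V)] res W (N \<inter> V) u = res U (N \<inter> V) a"
  by (rule germ_frac_shrink[OF N(1,3) o _ abc(1,2) u N(4)]) auto
 hence "res U (N \<inter> V) b \<otimes>[sec X (N \<inter> V)] res V (N \<inter> V) (res W V u) = res U (N \<inter> V) a"
  using rest_rest[OF W(1) V(1) o _ V(2) u] by simp
 thus ?thesis unfolding germ_frac_def using abc N x o by blast
qed

lemma germ_frac_inj:
 assumes st: "u \<in> Sec W" "w \<in> Sec W"
  and eq: "\<And>x. x \<in> W \<Longrightarrow> germ_frac U W x u = germ_frac U W x w"
 shows "u = w"
proof (rule sec_eqI[OF W(1) st])
 fix x assume x: "x \<in> W"
 obtain a b where "(a, b) \<in> germ_frac U W x u" using germ_frac_exists[OF x st(1)] by blast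
 moreover from this have "(a, b) \<in> germ_frac U W x w" using eq[OF x] by simp
 ultimately obtain N M where abc: "a \<in> Sec U" "b \<in> Sec U" "inv_at U x b"
  and N: "opn N" "x \<in> N" "N \<subseteq> W" "res U N b \<otimes>[sec X N] res W N u = res U N a"
  and M: "opn M" "x \<in> M" "M \<subseteq> W" "res U M b \<otimes>[sec X M] res W M w = res U M a"
  by (auto simp: germ_frac_def)
 define V where "V = M \<inter> N \<inter> DX U b"
 have V: "opn V" "x \<in> V" "V \<subseteq> W" "V \<subseteq> M" "V \<subseteq> N" "V \<subseteq> DX U b"
  using M N W opn_DX[OF oU] abc x by (auto simp: V_def DX_def)
 have "res W V u = res W V w"
 proof (rule Units_cancel[OF sec_cring[OF V(1)] DX_unit[OF oU abc(2) V(1,6)]])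
  show "res W V u \<in> Sec V" "res W V w \<in> Sec V" using rest_closed W V st by auto
  show "res U V b \<otimes>[sec X V] res W V u = res U V b \<otimes>[sec X V] res W V w"
   using germ_frac_shrink[OF N(1,3) V(1,5) abc(1,2) st(1) N(4)] germ_frac_shrink[OF M(1,3) V(1,4) abc(1,2) st(2) M(4)] by simp
 qed
 thus "\<exists>V. opn V \<and> x \<in> V \<and> V \<subseteq> W \<and> res W V u = res W V w" using V by blast
qed

end

end

section \<open>From the criterion back to an isomorphism with the spectrum\<close>

context ringed
begin

lemma ring_homI_fun:
 assumes "\<And>x. x \<in> carrier A \<Longrightarrow> f x \<in> carrier B"
  and "\<And>x y. x \<in> carrier A \<Longrightarrow> y \<in> carrier A \<Longrightarrow> f (x \<otimes>[A] y) = f x \<otimes>[B] f y"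
  and "\<And>x y. x \<in> carrier A \<Longrightarrow> y \<in> carrier A \<Longrightarrow> f (x \<oplus>[A] y) = f x \<oplus>[B] f y"
  and "f \<one>[A] = \<one>[B]"
 shows "f \<in> ring_hom A B"
 using assms by (intro ring_hom_memI)

text \<open>A section is sent to the function that takes a prime to the germ of the section at the
  corresponding point, written as a class of fractions. These maps \<open>j\<close> are bijective
  ring homomorphisms, compatible with restriction; their inverses are the maps on sections of the
  isomorphism.\<close>

lemma aff_imp_affine_open:
 assumes U: "aff U"
 shows "affine_open X U"
proof -
 define R where "R = sec X U"
 define S where "S = Spec R (scal X U)"
 define X' where "X' = open_subspace X U"
 have oU: "opn U" by (rule affD(1)[OF U])
 interpret R: base_ring R unfolding R_def by (rule base_ring.intro[OF sec_cring[OF oU]])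
 have zX': "zar X' = subtopology (zar X) U" and sX': "sec X' = sec X" and rX': "rest X' = res" and cX': "scal X' = scal X"
  by (auto simp: X'_def open_subspace_def)
 have tX': "topspace (zar X') = U" using oU openin_subset by (auto simp: zX')
 have zS: "zar S = Zariski R" and rS: "rest S = (\<lambda>U V s. restrict s V)"
  and cS: "scal S V c = (\<lambda>p\<in>V. frac_at R p (scal X U c) \<one>[R])"
  and sS: "carrier (sec S V) = Spec_sections R (Zariski R) V"
   "\<one>[sec S V] = (\<lambda>p\<in>V. \<one>[local_ring R p])"
   "s \<otimes>[sec S V] t = (\<lambda>p\<in>V. s p \<otimes>[local_ring R p] t p)"
   "s \<oplus>[sec S V] t = (\<lambda>p\<in>V. s p \<oplus>[local_ring R p] t p)" for V s t c
  by (simp_all add: S_def Spec_def)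
 define pt where "pt = inv_into U (ptid U)"
 have bij: "bij_betw (ptid U) U {p. primeideal p R}" using affD(2)[OF U] by (simp add: R_def)
 have pt1: "pt (ptid U x) = x" if "x \<in> U" for x
  using bij that by (simp add: pt_def bij_betw_def)
 have pt2: "pt q \<in> U" "ptid U (pt q) = q" if "primeideal q R" for q
 proof -
  have "q \<in> ptid U ` U" using bij that by (simp add: bij_betw_def)
  thus "pt q \<in> U" "ptid U (pt q) = q" unfolding pt_def by (rule inv_into_into, rule f_inv_into_f)
 qed
 have inv_iff: "inv_at U x f \<longleftrightarrow> f \<notin> ptid U x" if "f \<in> carrier R" for x f
  using that by (auto simp: ptid_def R_def)
 have prx: "primeideal (ptid U x) R" if "x \<in> U" for x using aff_prime[OF U that] by (simp add: R_def)
 \<comment> \<open>The open set of \<open>U\<close> that corresponds to the open set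
   \<open>V\<close> of the spectrum.\<close>
 define W where "W V = {x \<in> U. ptid U x \<in> V}" for V
 have WU: "W V \<subseteq> U" for V by (auto simp: W_def)
 have prV: "primeideal q R" if "openin (Zariski R) V" "q \<in> V" for q V using R.openin_ZariskiD[OF that(1)] that(2) by auto
 have DW: "DX U f = W (R.D f)" if "f \<in> carrier R" for f
  using inv_iff[OF that] prx by (auto simp: DX_def W_def R.D_def)
 have Wmono: "V \<subseteq> V' \<Longrightarrow> W V \<subseteq> W V'" for V V' by (auto simp: W_def)
 have oW: "opn (W V)" if V: "openin (Zariski R) V" for V
 proof (subst openin_subopen, intro ballI)
  fix x assume x: "x \<in> W V"
  then obtain f where f: "f \<in> carrier R" "ptid U x \<in> R.D f" "R.D f \<subseteq> V"
   using R.openin_ZariskiD[OF V] by (auto simp: W_def)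
  have "x \<in> DX U f" "DX U f \<subseteq> W V" using x f DW[OF f(1)] Wmono[OF f(3)] by (auto simp: W_def)
  thus "\<exists>T. opn T \<and> x \<in> T \<and> T \<subseteq> W V" using opn_DX[OF oU] by blast
 qed
 have openim: "openin (Zariski R) (ptid U ` G)" if G: "opn G" "G \<subseteq> U" for G
  unfolding R.openin_Zariski_iff
 proof (intro conjI ballI)
  show "ptid U ` G \<subseteq> {p. primeideal p R}" using G prx by auto
  fix q assume "q \<in> ptid U ` G"
  then obtain x where x: "x \<in> G" "q = ptid U x" by auto
  obtain f where f: "f \<in> carrier R" "x \<in> DX U f" "DX U f \<subseteq> G" using affD(3)[OF U G x(1)] by (auto simp: R_def)
  have "R.D f \<subseteq> ptid U ` G"
  proof
   fix p assume p: "p \<in> R.D f"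
   hence pp: "primeideal p R" by (simp add: R.D_def)
   have "pt p \<in> DX U f" using DW[OF f(1)] pt2[OF pp] p by (auto simp: W_def)
   thus "p \<in> ptid U ` G" using pt2[OF pp] f(3) by (metis image_eqI subsetD)
  qed
  moreover have "q \<in> R.D f" using f DW[OF f(1)] x by (auto simp: W_def)
  ultimately show "\<exists>f\<in>carrier R. q \<in> R.D f \<and> R.D f \<subseteq> ptid U ` G" using f by blast
 qed
 have Wim: "W (ptid U ` G) = G" if "G \<subseteq> U" for G
  using that bij unfolding W_def bij_betw_def by (auto dest: inj_onD)
 have ptW: "pt q \<in> W V" if "openin (Zariski R) V" "q \<in> V" for q V
  using pt2[OF prV[OF that]] that by (auto simp: W_def)
 \<comment> \<open>Functions into the local rings, extensional on \<open>V\<close> as the sections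
   of the spectrum are.\<close>
 define j where "j V w = (\<lambda>q\<in>V. germ_frac U (W V) (pt q) w)" for V w
 have j_eq: "j V w q = frac_at R q a b"
  if "openin (Zariski R) V" "q \<in> V" "w \<in> Sec (W V)" "(a, b) \<in> germ_frac U (W V) (pt q) w" for V q w a b
  using germ_frac_eq[OF U oW[OF that(1)] WU ptW[OF that(1,2)] that(3,4)] that(2) pt2[OF prV[OF that(1,2)]]
  by (simp add: j_def R_def)
 have gex: "\<exists>f\<in>carrier R. \<exists>a\<in>carrier R. \<exists>b\<in>carrier R. q \<in> R.D f \<and> R.D f \<subseteq> V \<and>
   (\<forall>p\<in>R.D f. b \<notin> p \<and> (a, b) \<in> germ_frac U (W V) (pt p) w)"
  if V: "openin (Zariski R) V" "q \<in> V" "w \<in> Sec (W V)" for V q w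
 proof -
  obtain f a b where f: "f \<in> carrier R" "a \<in> carrier R" "b \<in> carrier R" "pt q \<in> DX U f" "DX U f \<subseteq> W V"
   "\<forall>y\<in>DX U f. inv_at U y b \<and> (a, b) \<in> germ_frac U (W V) y w"
   using germ_frac_exists[OF U oW[OF V(1)] WU ptW[OF V(1,2)] V(3)] unfolding R_def by blast
  have D: "pt p \<in> DX U f" if p: "p \<in> R.D f" for p
  proof -
   have "primeideal p R" using p by (simp add: R.D_def)
   from pt2[OF this] show ?thesis using DW[OF f(1)] p by (auto simp: W_def)
  qed
  have "q \<in> R.D f" using f(4) DW[OF f(1)] pt2[OF prV[OF V(1,2)]] by (auto simp: W_def)
  moreover have "R.D f \<subseteq> V"
  proof
   fix p assume p: "p \<in> R.D f"
   hence "primeideal p R" by (simp add: R.D_def)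
   thus "p \<in> V" using D[OF p] f(5) pt2(2)[of p] by (auto simp: W_def)
  qed
  moreover have "\<forall>p\<in>R.D f. b \<notin> p \<and> (a, b) \<in> germ_frac U (W V) (pt p) w"
  proof
   fix p assume p: "p \<in> R.D f"
   hence "primeideal p R" by (simp add: R.D_def)
   thus "b \<notin> p \<and> (a, b) \<in> germ_frac U (W V) (pt p) w"
    using D[OF p] f(6) pt2(2)[of p] inv_iff[OF f(3), of "pt p"] by auto
  qed
  ultimately show ?thesis using f(1-3) by blast
 qed
 have j_sec: "j V w \<in> Spec_sections R (Zariski R) V"
  if V: "openin (Zariski R) V" "w \<in> Sec (W V)" for V w
  unfolding Spec_sections_def
 proof (intro CollectI conjI ballI)
  have loc: "\<exists>f\<in>carrier R. \<exists>a\<in>carrier R. \<exists>b\<in>carrier R. q \<in> R.D f \<and> R.D f \<subseteq> V \<and>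
   (\<forall>p\<in>R.D f. b \<notin> p \<and> j V w p = frac_at R p a b)" if q: "q \<in> V" for q
  proof -
   obtain f a b where "f \<in> carrier R" "a \<in> carrier R" "b \<in> carrier R" "q \<in> R.D f" "R.D f \<subseteq> V"
    "\<forall>p\<in>R.D f. b \<notin> p \<and> (a, b) \<in> germ_frac U (W V) (pt p) w" using gex[OF V(1) q V(2)] by blast
   moreover from this have "\<forall>p\<in>R.D f. b \<notin> p \<and> j V w p = frac_at R p a b"
    using j_eq[OF V(1) _ V(2)] by blast
   ultimately show ?thesis by blast
  qed
  show "j V w \<in> (\<Pi>\<^sub>E p\<in>V. carrier (local_ring R p))"
  proof (rule PiE_I)
   fix q assume q: "q \<in> V"
   from loc[OF q] obtain f a b where "a \<in> carrier R" "b \<in> carrier R" "q \<in> R.D f" "\<forall>p\<in>R.D f. b \<notin> p \<and> j V w p = frac_at R p a b"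
    by blast
   thus "j V w q \<in> carrier (local_ring R q)" using R.local_carrier[OF prV[OF V(1) q]] by blast
  qed (simp add: j_def)
  fix q assume q: "q \<in> V"
  from loc[OF q] obtain f a b where "f \<in> carrier R" "a \<in> carrier R" "b \<in> carrier R" "q \<in> R.D f" "R.D f \<subseteq> V"
   "\<forall>p\<in>R.D f. b \<notin> p \<and> j V w p = frac_at R p a b" by blast
  thus "\<exists>Va. openin (Zariski R) Va \<and> q \<in> Va \<and> Va \<subseteq> V \<and>
   (\<exists>a\<in>carrier R. \<exists>b\<in>carrier R. \<forall>q\<in>Va. b \<notin> q \<and> j V w q = frac_at R q a b)"
   using R.openin_D by blast
 qed
 have j_const: "j V (res U (W V) a) = (\<lambda>q\<in>V. frac_at R q a \<one>[R])"
  if V: "openin (Zariski R) V" and a: "a \<in> carrier R" for V a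
 proof -
  have "j V (res U (W V) a) q = frac_at R q a \<one>[R]" if q: "q \<in> V" for q
   unfolding R_def
   by (rule j_eq[unfolded R_def, OF V[unfolded R_def] q rest_closed[OF oU oW[OF V] WU a[unfolded R_def]]
      germ_frac_const[OF U oW[OF V] WU ptW[OF V q] a[unfolded R_def]]])
  thus ?thesis by (auto simp: j_def fun_eq_iff restrict_def)
 qed
 have j_hom: "j V \<in> ring_hom (sec X (W V)) (sec S V)" if V: "openin (Zariski R) V" for V
 proof (rule ring_homI_fun)
  fix w assume s: "w \<in> Sec (W V)"
  show "j V w \<in> carrier (sec S V)" using j_sec[OF V s] by (simp add: sS)
  fix g assume t: "g \<in> Sec (W V)"
  interpret B: cring "sec X (W V)" by (rule sec_cring[OF oW[OF V]])
  have "j V (w \<otimes>[sec X (W V)] g) q = j V w q \<otimes>[local_ring R q] j V g q \<and>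
    j V (w \<oplus>[sec X (W V)] g) q = j V w q \<oplus>[local_ring R q] j V g q" if q: "q \<in> V" for q
  proof -
   have pq: "primeideal q R" by (rule prV[OF V q])
   obtain f a b where ab: "a \<in> carrier R" "b \<in> carrier R" "b \<notin> q" "(a, b) \<in> germ_frac U (W V) (pt q) w"
    using gex[OF V q s] by blast
   obtain f c d where cd: "c \<in> carrier R" "d \<in> carrier R" "d \<notin> q" "(c, d) \<in> germ_frac U (W V) (pt q) g"
    using gex[OF V q t] by blast
   note m = germ_frac_mult[OF U oW[OF V] WU ptW[OF V q] s t ab(4) cd(4), folded R_def]
   show ?thesis
    using j_eq[OF V q B.m_closed[OF s t] m(1)] j_eq[OF V q B.a_closed[OF s t] m(2)]
     j_eq[OF V q s ab(4)] j_eq[OF V q t cd(4)] R.local_mult[OF pq, of a b c d] R.local_add[OF pq, of a b c d] ab cd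
    by simp
  qed
  thus "j V (w \<otimes>[sec X (W V)] g) = j V w \<otimes>[sec S V] j V g"
   "j V (w \<oplus>[sec X (W V)] g) = j V w \<oplus>[sec S V] j V g"
   by (auto simp: sS fun_eq_iff restrict_def) (auto simp: j_def)
 next
  have "j V \<one>[sec X (W V)] = j V (res U (W V) \<one>[R])" using rest_one[OF oU oW[OF V] WU] by (simp add: R_def)
  also have "\<dots> = \<one>[sec S V]"
   unfolding j_const[OF V R.one_closed] sS using R.local_one[OF prV[OF V]] by (auto intro!: restrict_ext)
  finally show "j V \<one>[sec X (W V)] = \<one>[sec S V]" .
 qed
 have j_inj: "inj_on (j V) (Sec (W V))" if V: "openin (Zariski R) V" for V
 proof (rule inj_onI)
  fix w g assume st: "w \<in> Sec (W V)" "g \<in> Sec (W V)" "j V w = j V g"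
  show "w = g"
  proof (rule germ_frac_inj[OF U oW[OF V] WU st(1,2)])
   fix x assume x: "x \<in> W V"
   hence "ptid U x \<in> V" "pt (ptid U x) = x" using pt1 by (auto simp: W_def)
   thus "germ_frac U (W V) x w = germ_frac U (W V) x g"
    using fun_cong[OF st(3), of "ptid U x"] by (simp add: j_def)
  qed
 qed
 \<comment> \<open>Near each point the given section is a fraction a/h. On \<open>DX U (h x)\<close>
   the section \<open>h x\<close> is a unit, so the equation h w = a has a solution there, and these
   solutions are glued.\<close>
 have j_surj: "\<exists>w\<in>Sec (W V). j V w = s"
  if V: "openin (Zariski R) V" and s: "s \<in> Spec_sections R (Zariski R) V" for V s
 proof -
  have "\<forall>x\<in>W V. \<exists>a h. a \<in> carrier R \<and> h \<in> carrier R \<and> ptid U x \<in> R.D h \<and> R.D h \<subseteq> V \<and>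
    (\<forall>q\<in>R.D h. s q = frac_at R q a h)"
  proof
   fix x assume "x \<in> W V"
   hence "ptid U x \<in> V" by (simp add: W_def)
   from R.section_local[OF s this] show "\<exists>a h. a \<in> carrier R \<and> h \<in> carrier R \<and> ptid U x \<in> R.D h \<and> R.D h \<subseteq> V \<and>
    (\<forall>q\<in>R.D h. s q = frac_at R q a h)" by blast
  qed
  then obtain a h where ah: "\<And>x. x \<in> W V \<Longrightarrow> a x \<in> carrier R" "\<And>x. x \<in> W V \<Longrightarrow> h x \<in> carrier R"
   "\<And>x. x \<in> W V \<Longrightarrow> ptid U x \<in> R.D (h x)" "\<And>x. x \<in> W V \<Longrightarrow> R.D (h x) \<subseteq> V"
   "\<And>x q. x \<in> W V \<Longrightarrow> q \<in> R.D (h x) \<Longrightarrow> s q = frac_at R q (a x) (h x)" by metis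
  define N where "N x = DX U (h x)" for x
  have oN: "opn (N x)" for x unfolding N_def by (rule opn_DX[OF oU])
  have NU: "N x \<subseteq> U" for x unfolding N_def by (rule DX_sub)
  have N: "x \<in> N x" "N x \<subseteq> W V" if "x \<in> W V" for x
   using ah[OF that] DW[OF ah(2)[OF that]] Wmono[OF ah(4)[OF that]] that by (auto simp: N_def W_def)
  have "\<forall>x\<in>W V. \<exists>w. w \<in> Sec (N x) \<and> res U (N x) (h x) \<otimes>[sec X (N x)] w = res U (N x) (a x)"
  proof
   fix x assume x: "x \<in> W V"
   interpret B: cring "sec X (N x)" by (rule sec_cring[OF oN])
   have u: "res U (N x) (h x) \<in> Units (sec X (N x))"
    using DX_unit[OF oU _ oN] ah(2)[OF x] by (auto simp: N_def R_def)
   have ac: "res U (N x) (a x) \<in> Sec (N x)" using rest_closed[OF oU oN NU] ah(1)[OF x] by (simp add: R_def)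
   have "res U (N x) (h x) \<otimes>[sec X (N x)] (inv\<^bsub>sec X (N x)\<^esub> res U (N x) (h x) \<otimes>[sec X (N x)] res U (N x) (a x))
    = res U (N x) (a x)"
    using u ac by (simp add: B.m_assoc[symmetric] B.Units_closed)
   thus "\<exists>w. w \<in> Sec (N x) \<and> res U (N x) (h x) \<otimes>[sec X (N x)] w = res U (N x) (a x)"
    using u ac by (intro exI conjI) auto
  qed
  then obtain w where w: "\<And>x. x \<in> W V \<Longrightarrow> w x \<in> Sec (N x)"
   "\<And>x. x \<in> W V \<Longrightarrow> res U (N x) (h x) \<otimes>[sec X (N x)] w x = res U (N x) (a x)" by metis
  have wr: "res U M (h x) \<otimes>[sec X M] res (N x) M (w x) = res U M (a x)"
   if x: "x \<in> W V" and M: "opn M" "M \<subseteq> N x" for x M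
  proof -
   have "res (N x) M (res U (N x) (h x) \<otimes>[sec X (N x)] w x) = res (N x) M (res U (N x) (a x))"
    using w(2)[OF x] by simp
   thus ?thesis
    using rest_mult[OF oN M _ w(1)[OF x]] rest_closed[OF oU oN NU] rest_rest[OF oU oN M(1) M(2) NU] ah(1,2)[OF x]
    by (simp add: R_def)
  qed
  have "\<exists>t\<in>Sec (W V). \<forall>x\<in>W V. res (W V) (N x) t = w x"
  proof (rule glue_local[OF oW[OF V]])
   fix x y assume xy: "x \<in> W V" "y \<in> W V"
   define M where "M = N x \<inter> N y"
   have M: "opn M" "M \<subseteq> N x" "M \<subseteq> N y" using oN by (auto simp: M_def)
   show "res (N x) (N x \<inter> N y) (w x) = res (N y) (N x \<inter> N y) (w y)"
    unfolding M_def[symmetric]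
   proof (rule sec_eqI[OF M(1)])
    show "res (N x) M (w x) \<in> Sec M" "res (N y) M (w y) \<in> Sec M"
     using rest_closed[OF oN M(1)] M w(1) xy by auto
    fix z assume z: "z \<in> M"
    hence zU: "z \<in> U" using M(2) NU by auto
    define q where "q = ptid U z"
    have pq: "primeideal q R" using prx[OF zU] by (simp add: q_def)
    have qD: "q \<in> R.D (h x)" "q \<in> R.D (h y)"
     using z M DW[OF ah(2)[OF xy(1)]] DW[OF ah(2)[OF xy(2)]] by (auto simp: N_def W_def q_def)
    have "frac_at R q (a x) (h x) = frac_at R q (a y) (h y)"
     using ah(5)[OF xy(1) qD(1)] ah(5)[OF xy(2) qD(2)] by simp
    then obtain t where t: "t \<in> carrier R - q" "t \<otimes>[R] (a x \<otimes>[R] h y \<ominus>[R] a y \<otimes>[R] h x) = \<zero>[R]"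
     using R.frac_at_eq[OF pq, of "a x" "h x" "a y" "h y"] ah(1,2)[OF xy(1)] ah(1,2)[OF xy(2)] qD by (auto simp: R.D_def)
    have c: "a x \<in> carrier R" "a y \<in> carrier R" "h x \<in> carrier R" "h y \<in> carrier R" "t \<in> carrier R"
     using ah(1,2)[OF xy(1)] ah(1,2)[OF xy(2)] t by auto
    have "t \<otimes>[R] (a x \<otimes>[R] h y) \<ominus>[R] t \<otimes>[R] (a y \<otimes>[R] h x) = t \<otimes>[R] (a x \<otimes>[R] h y \<ominus>[R] a y \<otimes>[R] h x)"
     using c by algebra
    hence eq: "t \<otimes>[R] (a x \<otimes>[R] h y) = t \<otimes>[R] (a y \<otimes>[R] h x)" unfolding t(2) using c by simp
    \<comment> \<open>The two fractions agree at \<open>q\<close> up to a factor \<open>t\<close>;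
      on \<open>K\<close> this factor is a unit, so the cross products, and with them the two
      solutions, agree there.\<close>
    define K where "K = M \<inter> DX U t"
    have zK: "z \<in> K" using z t inv_iff[OF c(5), of z] zU by (auto simp: K_def DX_def q_def)
    have K: "opn K" "K \<subseteq> M" "K \<subseteq> N x" "K \<subseteq> N y" "K \<subseteq> DX U t" "K \<subseteq> U"
     using M opn_DX[OF oU] NU[of x] by (auto simp: K_def)
    interpret B: cring "sec X K" by (rule sec_cring[OF K(1)])
    have r: "\<And>s. s \<in> carrier R \<Longrightarrow> res U K s \<in> Sec K" using rest_closed[OF oU K(1,6)] by (simp add: R_def)
    have s1: "res (N x) K (w x) \<in> Sec K" and s2: "res (N y) K (w y) \<in> Sec K"
     using rest_closed[OF oN K(1)] K(3,4) w(1) xy by auto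
    have "res U K (a x \<otimes>[R] h y) = res U K (a y \<otimes>[R] h x)"
     by (rule near_eq[OF oU, folded R_def, OF _ _ _ eq K(1,5)]) (use c in auto)
    hence e: "res U K (a x) \<otimes>[sec X K] res U K (h y) = res U K (a y) \<otimes>[sec X K] res U K (h x)"
     using rest_mult[OF oU K(1,6)] c by (simp add: R_def)
    have ux: "res U K (h x) \<in> Units (sec X K)" and uy: "res U K (h y) \<in> Units (sec X K)"
     using DX_unit[OF oU _ K(1)] c K(3,4) by (auto simp: N_def R_def)
    have "(res U K (h x) \<otimes>[sec X K] res U K (h y)) \<otimes>[sec X K] res (N x) K (w x)
     = (res U K (h x) \<otimes>[sec X K] res (N x) K (w x)) \<otimes>[sec X K] res U K (h y)"
     using r c s1 by (simp add: B.m_ac)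
    also have "\<dots> = res U K (a y) \<otimes>[sec X K] res U K (h x)" using wr[OF xy(1) K(1,3)] e by simp
    also have "\<dots> = (res U K (h y) \<otimes>[sec X K] res (N y) K (w y)) \<otimes>[sec X K] res U K (h x)"
     using wr[OF xy(2) K(1,4)] by simp
    also have "\<dots> = (res U K (h x) \<otimes>[sec X K] res U K (h y)) \<otimes>[sec X K] res (N y) K (w y)"
     using r c s2 by (simp add: B.m_ac)
    finally have "res (N x) K (w x) = res (N y) K (w y)"
     using Units_cancel[OF sec_cring[OF K(1)] B.Units_m_closed[OF ux uy] s1 s2] by simp
    hence "res M K (res (N x) M (w x)) = res M K (res (N y) M (w y))"
     using rest_rest[OF oN M(1) K(1,2) M(2) w(1)[OF xy(1)]] rest_rest[OF oN M(1) K(1,2) M(3) w(1)[OF xy(2)]] by simp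
    thus "\<exists>V. opn V \<and> z \<in> V \<and> V \<subseteq> M \<and> res M V (res (N x) M (w x)) = res M V (res (N y) M (w y))"
     using K zK by blast
   qed
  qed (use oN N w in auto)
  then obtain t where t: "t \<in> Sec (W V)" "\<And>x. x \<in> W V \<Longrightarrow> res (W V) (N x) t = w x" by blast
  have "j V t q = s q" if q: "q \<in> V" for q
  proof -
   define x where "x = pt q"
   have x: "x \<in> W V" "ptid U x = q" using ptW[OF V q] pt2[OF prV[OF V q]] by (auto simp: x_def)
   have "(a x, h x) \<in> germ_frac U (W V) x t"
    unfolding germ_frac_def using ah(1-3)[OF x(1)] N[OF x(1)] oN[of x] t(2)[OF x(1)] w(2)[OF x(1)] inv_iff[of "h x" x]
    by (auto simp: R_def R.D_def[unfolded R_def])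
   hence "j V t q = frac_at R q (a x) (h x)" using j_eq[OF V q t(1)] by (simp add: x_def)
   thus ?thesis using ah(5)[OF x(1), of q] ah(3)[OF x(1)] x by simp
  qed
  moreover have "s \<in> extensional V" "j V t \<in> extensional V" using s by (auto simp: Spec_sections_def j_def PiE_def)
  ultimately have "j V t = s" by (auto intro: extensionalityI)
  thus ?thesis using t(1) by blast
 qed
 have j_bij: "bij_betw (j V) (Sec (W V)) (Spec_sections R (Zariski R) V)" if V: "openin (Zariski R) V" for V
  unfolding bij_betw_def using j_inj[OF V] j_surj[OF V] j_sec[OF V] by (auto simp: image_iff)
 have j_rest: "j V' (res (W V) (W V') w) = restrict (j V w) V'"
  if V: "openin (Zariski R) V" "openin (Zariski R) V'" "V' \<subseteq> V" and w: "w \<in> Sec (W V)" for V V' w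
 proof -
  have "j V' (res (W V) (W V') w) q = j V w q" if q: "q \<in> V'" for q
  proof -
   have qV: "q \<in> V" using q V by auto
   obtain f a b where ab: "a \<in> carrier R" "b \<in> carrier R" "(a, b) \<in> germ_frac U (W V) (pt q) w"
    using gex[OF V(1) qV w] by blast
   have "(a, b) \<in> germ_frac U (W V') (pt q) (res (W V) (W V') w)"
    by (rule germ_frac_rest[OF U oW[OF V(1)] WU ptW[OF V(2) q] oW[OF V(2)] Wmono[OF V(3)] w ab(3)])
   thus ?thesis
    using j_eq[OF V(2) q rest_closed[OF oW[OF V(1)] oW[OF V(2)] Wmono[OF V(3)] w]] j_eq[OF V(1) qV w ab(3)] by simp
  qed
  thus ?thesis by (auto simp: j_def restrict_def fun_eq_iff)
 qed
 define m where "m = (\<lambda>x\<in>U. ptid U x)"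
 define hh where "hh V = inv_into (Sec (W V)) (j V)" for V
 \<comment> \<open>Restricted in both arguments, because \<open>morphism\<close> requires
   extensional maps.\<close>
 define h where "h = (\<lambda>V\<in>{V. openin (Zariski R) V}. \<lambda>s\<in>Spec_sections R (Zariski R) V. hh V s)"
 have pre: "preim X' m V = W V" for V
  using preim_open_subspace[OF oU, of m V] by (auto simp: X'_def m_def W_def)
 have hh: "hh V s \<in> Sec (W V)" "j V (hh V s) = s"
  if "openin (Zariski R) V" "s \<in> Spec_sections R (Zariski R) V" for V s
  using j_bij[OF that(1)] that(2) unfolding hh_def bij_betw_def
  by (metis inv_into_into f_inv_into_f)+
 have h_apply: "h V s = hh V s" if "openin (Zariski R) V" "s \<in> Spec_sections R (Zariski R) V" for V s
  using that by (simp add: h_def)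
 have h_eq: "h V s = w" if "openin (Zariski R) V" "w \<in> Sec (W V)" "s = j V w" for V s w
  using that j_inj[OF that(1)] j_sec[OF that(1,2)] by (simp add: h_apply hh_def)
 have mc: "continuous_map (zar X') (zar S) m"
  unfolding continuous_map zS tX'
 proof (intro conjI allI impI)
  show "m ` U \<subseteq> topspace (Zariski R)" using prx by (auto simp: m_def R.topspace_Zariski)
  fix V assume V: "openin (Zariski R) V"
  have "{x \<in> U. m x \<in> V} = W V" by (auto simp: m_def W_def)
  thus "openin (zar X') {x \<in> U. m x \<in> V}" using oW[OF V] WU oU by (simp add: zX' openin_open_subtopology)
 qed
 have "morphism X' S (m, h)"
 proof (rule morphismI; unfold pre zS tX' sX' rX' rS cX' sS(1))
  show "m \<in> extensional U" by (simp add: m_def)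
  show "continuous_map (zar X') (Zariski R) m" using mc by (simp add: zS)
  show "h \<in> extensional {U. openin (Zariski R) U}" by (simp add: h_def)
 next
  fix V assume V: "openin (Zariski R) V"
  show "h V \<in> extensional (Spec_sections R (Zariski R) V)" using V by (simp add: h_def)
  show "h V \<in> ring_hom (sec S V) (sec X (W V))"
  proof (rule ring_homI_fun; (unfold sS(1))?)
   interpret B: cring "sec X (W V)" by (rule sec_cring[OF oW[OF V]])
   fix s assume s: "s \<in> Spec_sections R (Zariski R) V"
   show "h V s \<in> Sec (W V)" using hh[OF V s] h_apply[OF V s] by simp
   fix t assume t: "t \<in> Spec_sections R (Zariski R) V"
   show "h V (s \<otimes>[sec S V] t) = h V s \<otimes>[sec X (W V)] h V t"
    using hh[OF V s] hh[OF V t] h_apply[OF V s] h_apply[OF V t] ring_hom_mult[OF j_hom[OF V]]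
    by (intro h_eq[OF V]) auto
   show "h V (s \<oplus>[sec S V] t) = h V s \<oplus>[sec X (W V)] h V t"
    using hh[OF V s] hh[OF V t] h_apply[OF V s] h_apply[OF V t] ring_hom_add[OF j_hom[OF V]]
    by (intro h_eq[OF V]) auto
  next
   interpret B: cring "sec X (W V)" by (rule sec_cring[OF oW[OF V]])
   show "h V \<one>[sec S V] = \<one>[sec X (W V)]" using ring_hom_one[OF j_hom[OF V]] by (intro h_eq[OF V]) auto
  qed
  fix c
  have sc: "scal X U c \<in> carrier R" using ring_hom_closed[OF scal_hom[OF oU], of c] by (simp add: R_def)
  have "scal X (W V) c \<in> Sec (W V)" using ring_hom_closed[OF scal_hom[OF oW[OF V]], of c] by simp
  moreover have "scal S V c = j V (scal X (W V) c)"
   using j_const[OF V sc] rest_scal[OF oU oW[OF V] WU, of c] by (simp add: cS)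
  ultimately show "h V (scal S V c) = scal X (W V) c" by (intro h_eq[OF V])
 next
  fix V V' s assume V: "openin (Zariski R) V" "openin (Zariski R) V'" "V' \<subseteq> V" and s: "s \<in> Spec_sections R (Zariski R) V"
  show "h V' (restrict s V') = res (W V) (W V') (h V s)"
   using j_rest[OF V] hh[OF V(1) s] h_apply[OF V(1) s] rest_closed[OF oW[OF V(1)] oW[OF V(2)] Wmono[OF V(3)]]
   by (intro h_eq[OF V(2)]) auto
 next
  fix V s x assume V: "openin (Zariski R) V" and s: "s \<in> Spec_sections R (Zariski R) V" and x: "x \<in> W V"
   and inv: "invertible_at X' (W V) x (h V s)"
  then obtain G where G: "opn G" "x \<in> G" "G \<subseteq> W V" "res (W V) G (h V s) \<in> Units (sec X G)"
   unfolding invertible_at_def zX' rX' sX' using oU by (auto simp: openin_open_subtopology)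
  have OU: "G \<subseteq> U" using G WU by auto
  \<comment> \<open>Invertibility at \<open>x\<close> is witnessed on an open set \<open>G\<close>
    of the space; its image is open in the spectrum, and \<open>j\<close> carries the inverse
    over.\<close>
  define V' where "V' = ptid U ` G"
  have V': "openin (Zariski R) V'" "W V' = G" using openim[OF G(1) OU] Wim[OF OU] by (auto simp: V'_def)
  have V'V: "V' \<subseteq> V" using G(3) by (auto simp: V'_def W_def)
  have "j V' (res (W V) G (h V s)) = restrict s V'"
   using j_rest[OF V V'(1) V'V hh(1)[OF V s]] hh[OF V s] h_apply[OF V s] V'(2) by simp
  moreover obtain g where g: "g \<in> Sec G" "res (W V) G (h V s) \<in> Sec G"
   "g \<otimes>[sec X G] res (W V) G (h V s) = \<one>[sec X G]" "res (W V) G (h V s) \<otimes>[sec X G] g = \<one>[sec X G]"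
   using G(4) by (auto simp: Units_def)
  note kh = j_hom[OF V'(1), unfolded V'(2)]
  ultimately have "restrict s V' \<in> Units (sec S V')"
   using ring_hom_mult[OF kh g(1,2)] ring_hom_mult[OF kh g(2,1)] ring_hom_one[OF kh]
    ring_hom_closed[OF kh g(1)] ring_hom_closed[OF kh g(2)] g(3,4)
   unfolding Units_def by (auto intro!: bexI[of _ "j V' g"])
  moreover have "m x \<in> V'" using G(2) OU by (auto simp: m_def V'_def)
  ultimately show "invertible_at S V (m x) s"
   unfolding invertible_at_def zS rS using V'(1) V'V by blast
 qed
 moreover have "homeomorphic_map (zar X') (zar S) m"
 proof (rule bijective_open_imp_homeomorphic_map[OF mc])
  have mm: "m ` G = ptid U ` G" if "G \<subseteq> U" for G using that by (auto simp: m_def)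
  show "open_map (zar X') (zar S) m"
   unfolding open_map_def zS zX' using openim mm oU by (auto simp: openin_open_subtopology)
  show "m ` topspace (zar X') = topspace (zar S)"
   unfolding tX' zS mm[OF subset_refl] R.topspace_Zariski using bij by (simp add: bij_betw_def)
  show "inj_on m (topspace (zar X'))"
   unfolding tX' using bij by (auto simp: m_def bij_betw_def inj_on_def)
 qed
 moreover have "bij_betw (h V) (carrier (sec S V)) (carrier (sec X' (preim X' m V)))" if V: "openin (zar S) V" for V
 proof -
  have V': "openin (Zariski R) V" using V by (simp add: zS)
  have "bij_betw (hh V) (Spec_sections R (Zariski R) V) (Sec (W V))"
   unfolding hh_def by (rule bij_betw_inv_into[OF j_bij[OF V']])
  thus ?thesis unfolding pre sS sX' using h_apply[OF V'] by (simp cong: bij_betw_cong)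
 qed
 ultimately have "isomorphism X' S (m, h)" by (simp add: isomorphism_def)
 thus ?thesis unfolding affine_open_def X'_def S_def R_def using oU by blast
qed

theorem affine_open_iff_aff: "affine_open X U \<longleftrightarrow> aff U"
 using affine_open_imp_aff aff_imp_affine_open by blast

end

section \<open>Basic open subsets of affine open sets\<close>

context ringed
begin

lemma ptid_iff: "s \<in> ptid U x \<longleftrightarrow> s \<in> Sec U \<and> \<not> inv_at U x s"
 by (simp add: ptid_def)

lemma aff_cring: "aff U \<Longrightarrow> cring (sec X U)"
 using affD(1) sec_cring by blast

lemma DX_rest:
 assumes U: "opn U" and V: "opn V" "V \<subseteq> U" and s: "s \<in> Sec U"
 shows "DX V (res U V s) = V \<inter> DX U s"
 using invertible_rest[OF U V _ s] V by (auto simp: DX_def)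

text \<open>A section over \<open>DX U f\<close> becomes the restriction of a section over
  \<open>U\<close> after multiplication by a power of \<open>f\<close>, and that power restricts to
  a unit. Each clause of the criterion is thereby reduced to the same clause for
  \<open>U\<close>.\<close>

lemma aff_DX:
 assumes U: "aff U" and f: "f \<in> Sec U"
 shows "aff (DX U f)"
proof -
 have oU: "opn U" by (rule affD(1)[OF U])
 define V where "V = DX U f"
 have V: "opn V" "V \<subseteq> U" using opn_DX[OF oU] DX_sub by (auto simp: V_def)
 interpret A: cring "sec X U" by (rule sec_cring[OF oU])
 interpret B: cring "sec X V" by (rule sec_cring[OF V(1)])
 let ?r = "res U V"
 have rc: "s \<in> Sec U \<Longrightarrow> ?r s \<in> Sec V" for s using rest_closed[OF oU V] .
 have fu: "?r f \<in> Units (sec X V)" using DX_unit[OF oU f V(1)] by (simp add: V_def)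
 have fnu: "?r (f [^][sec X U] n) \<in> Units (sec X V)" for n :: nat
  using B.Units_pow_closed[OF fu] rest_pow[OF oU V f] by simp
 have frac: "\<exists>n::nat. \<exists>a\<in>Sec U. ?r (f [^][sec X U] n) \<otimes>[sec X V] s = ?r a"
  if "s \<in> Sec V" for s
  using affD(5)[OF U f, folded V_def, OF that] .
 have DXu: "DX V s = V \<inter> DX U a"
  if "s \<in> Sec V" "a \<in> Sec U" "?r (f [^][sec X U] (n::nat)) \<otimes>[sec X V] s = ?r a" for s a n
 proof -
  have "DX V (?r (f [^][sec X U] n) \<otimes>[sec X V] s) = DX V (?r (f [^][sec X U] n)) \<inter> DX V s"
   using DX_mult[OF V(1)] rc f that(1) by simp
  moreover have "DX V (?r (f [^][sec X U] n)) = V" using invertible_Units[OF V(1) _ fnu] by (auto simp: DX_def)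
  ultimately show ?thesis using DX_rest[OF oU V that(2)] that(3) DX_sub[of V s] by auto
 qed
 have pt: "ptid U x = {a \<in> Sec U. ?r a \<in> ptid V x}" if "x \<in> V" for x
  using invertible_rest[OF oU V that] rc by (auto simp: ptid_def)
 \<comment> \<open>The prime of \<open>x\<close> in the smaller ring is the extension of its prime
   in the larger one; closure under addition is read off from this description.\<close>
 have pt': "ptid V x = {s \<in> Sec V. \<exists>n::nat. \<exists>a\<in>ptid U x. ?r (f [^][sec X U] n) \<otimes>[sec X V] s = ?r a}"
  if x: "x \<in> V" for x
 proof -
  have "s \<in> ptid V x \<longleftrightarrow> (\<exists>n::nat. \<exists>a\<in>ptid U x. ?r (f [^][sec X U] n) \<otimes>[sec X V] s = ?r a)"
   if s: "s \<in> Sec V" for s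
  proof
   assume sp: "s \<in> ptid V x"
   obtain n :: nat and a where a: "a \<in> Sec U" "?r (f [^][sec X U] n) \<otimes>[sec X V] s = ?r a"
    using frac[OF s] by blast
   have "x \<notin> DX U a" using DXu[OF s a] sp x by (auto simp: ptid_def DX_def)
   hence "a \<in> ptid U x" using a x V by (auto simp: ptid_def DX_def)
   thus "\<exists>n::nat. \<exists>a\<in>ptid U x. ?r (f [^][sec X U] n) \<otimes>[sec X V] s = ?r a" using a by blast
  next
   assume "\<exists>n::nat. \<exists>a\<in>ptid U x. ?r (f [^][sec X U] n) \<otimes>[sec X V] s = ?r a"
   then obtain n :: nat and a where a: "a \<in> ptid U x" "?r (f [^][sec X U] n) \<otimes>[sec X V] s = ?r a" by blast
   hence "x \<notin> DX V s" using DXu[OF s _ a(2)] by (auto simp: ptid_def DX_def)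
   thus "s \<in> ptid V x" using s x by (auto simp: ptid_def DX_def)
  qed
  thus ?thesis by (auto simp: ptid_def)
 qed
 have bij: "bij_betw (ptid V) V {p. primeideal p (sec X V)}"
  unfolding bij_betw_def
 proof
  show "inj_on (ptid V) V"
  proof (rule inj_onI)
   fix x y assume xy: "x \<in> V" "y \<in> V" "ptid V x = ptid V y"
   hence "ptid U x = ptid U y" using pt by simp
   thus "x = y" using affD(2)[OF U] xy V by (meson bij_betw_imp_inj_on inj_onD subsetD)
  qed
  have pr: "primeideal (ptid V x) (sec X V)" if x: "x \<in> V" for x
  proof -
   interpret p: primeideal "ptid U x" "sec X U" using aff_prime[OF U] x V by auto
   have id: "ideal (ptid V x) (sec X V)"
   proof (rule idealI[OF B.ring_axioms])
    show "subgroup (ptid V x) (add_monoid (sec X V))"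
    proof (rule B.add.subgroupI)
     show "ptid V x \<subseteq> Sec V" by (auto simp: ptid_def)
     have "?r \<zero>[sec X U] = \<zero>[sec X V]" using rest_zero[OF oU V] .
     moreover have "\<zero>[sec X U] \<in> {a \<in> Sec U. ?r a \<in> ptid V x}"
      unfolding pt[OF x, symmetric] by (rule additive_subgroup.zero_closed[OF ideal.axioms(1)[OF p.is_ideal]])
     ultimately have "\<zero>[sec X V] \<in> ptid V x" by simp
     thus "ptid V x \<noteq> {}" by auto
     fix s assume s: "s \<in> ptid V x"
     hence sc: "s \<in> Sec V" by (simp add: ptid_def)
     have mo: "\<ominus>[sec X V] s = (\<ominus>[sec X V] \<one>[sec X V]) \<otimes>[sec X V] s" using sc by (simp add: B.l_minus)
     show "\<ominus>[sec X V] s \<in> ptid V x"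
      using s sc invertible_mult[OF V(1) _ sc x, of "\<ominus>[sec X V] \<one>[sec X V]"] unfolding ptid_iff mo by simp
     fix t assume t: "t \<in> ptid V x"
     hence tc: "t \<in> Sec V" by (simp add: ptid_def)
     obtain n :: nat and a where a: "a \<in> ptid U x" "?r (f [^][sec X U] n) \<otimes>[sec X V] s = ?r a" using s pt'[OF x] by blast
     obtain m :: nat and b where b: "b \<in> ptid U x" "?r (f [^][sec X U] m) \<otimes>[sec X V] t = ?r b" using t pt'[OF x] by blast
     have ac: "a \<in> Sec U" "b \<in> Sec U" using a b p.Icarr by auto
     let ?c = "f [^][sec X U] m \<otimes>[sec X U] a \<oplus>[sec X U] f [^][sec X U] n \<otimes>[sec X U] b"
     have cc: "?c \<in> ptid U x"
      by (rule additive_subgroup.a_closed[OF ideal.axioms(1)[OF p.is_ideal]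
       p.I_l_closed[OF a(1) A.nat_pow_closed[OF f]] p.I_l_closed[OF b(1) A.nat_pow_closed[OF f]]])
     have fn: "?r (f [^][sec X U] k) \<in> Sec V" for k :: nat using rc f by simp
     have "?r ?c = ?r (f [^][sec X U] m) \<otimes>[sec X V] ?r a \<oplus>[sec X V] ?r (f [^][sec X U] n) \<otimes>[sec X V] ?r b"
      using ac f by (simp add: rest_add[OF oU V] rest_mult[OF oU V])
     also have "\<dots> = (?r (f [^][sec X U] n) \<otimes>[sec X V] ?r (f [^][sec X U] m)) \<otimes>[sec X V] (s \<oplus>[sec X V] t)"
      unfolding a(2)[symmetric] b(2)[symmetric] using fn sc tc by (simp add: B.r_distr B.l_distr B.m_ac)
     also have "\<dots> = ?r (f [^][sec X U] (n + m)) \<otimes>[sec X V] (s \<oplus>[sec X V] t)"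
      using f by (simp add: rest_mult[OF oU V, symmetric] A.nat_pow_mult)
     finally have e: "?r (f [^][sec X U] (n + m)) \<otimes>[sec X V] (s \<oplus>[sec X V] t) = ?r ?c" by (rule sym)
     show "s \<oplus>[sec X V] t \<in> ptid V x" unfolding pt'[OF x] using B.a_closed[OF sc tc] cc e by blast
    qed
    fix s y assume "s \<in> ptid V x" "y \<in> Sec V"
    thus "y \<otimes>[sec X V] s \<in> ptid V x" "s \<otimes>[sec X V] y \<in> ptid V x"
     using invertible_mult[OF V(1) _ _ x] by (auto simp: ptid_def)
   qed
   show ?thesis
   proof (rule primeidealI[OF id B.cring_axioms])
    show "Sec V \<noteq> ptid V x" using invertible_one[OF V(1) x] by (auto simp: ptid_def)
    fix s t assume "s \<in> Sec V" "t \<in> Sec V" "s \<otimes>[sec X V] t \<in> ptid V x"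
    thus "s \<in> ptid V x \<or> t \<in> ptid V x" using invertible_mult[OF V(1) _ _ x] by (auto simp: ptid_def)
   qed
  qed
  show "ptid V ` V = {p. primeideal p (sec X V)}"
  proof
   show "ptid V ` V \<subseteq> {p. primeideal p (sec X V)}" using pr by auto
   show "{p. primeideal p (sec X V)} \<subseteq> ptid V ` V"
   proof
    fix q assume "q \<in> {p. primeideal p (sec X V)}"
    then interpret q: primeideal q "sec X V" by simp
    \<comment> \<open>The contraction of \<open>q\<close> to \<open>U\<close> is the prime of some
      point \<open>x\<close>; it does not contain \<open>f\<close>, which restricts to a unit, so
      \<open>x\<close> lies in the basic open set.\<close>
    have "primeideal {a \<in> Sec U. ?r a \<in> q} (sec X U)"
     by (rule prime_vimage[OF A.cring_axioms B.cring_axioms rest_hom[OF oU V] q.primeideal])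
    then obtain x where x: "x \<in> U" "ptid U x = {a \<in> Sec U. ?r a \<in> q}"
     using affD(2)[OF U] unfolding bij_betw_def by (metis (mono_tags, lifting) imageE mem_Collect_eq)
    have unit_notin: "u \<notin> q" if un: "u \<in> Units (sec X V)" for u
    proof
     assume uq: "u \<in> q"
     obtain y where y: "y \<in> Sec V" "u \<otimes>[sec X V] y = \<one>[sec X V]"
      using un by (auto simp: Units_def)
     from q.I_r_closed[OF uq y(1)] show False unfolding y(2) using q.one_notin by blast
    qed
    have "f \<notin> ptid U x" using x unit_notin[OF fu] by auto
    hence xV: "x \<in> V" using x f by (auto simp: V_def DX_def ptid_def)
    have mem: "s \<in> ptid V x \<longleftrightarrow> s \<in> q" if s: "s \<in> Sec V" for s
    proof -
     obtain n :: nat and a where a: "a \<in> Sec U" "?r (f [^][sec X U] n) \<otimes>[sec X V] s = ?r a"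
      using frac[OF s] by blast
     have "s \<in> q \<longleftrightarrow> ?r a \<in> q"
      using q.mult_notin[of "?r (f [^][sec X U] n)" s] unit_notin[OF fnu[of n]] B.Units_closed[OF fnu[of n]] s a(2) by auto
     also have "\<dots> \<longleftrightarrow> a \<in> ptid U x" using x a by auto
     also have "\<dots> \<longleftrightarrow> s \<in> ptid V x" using DXu[OF s a] xV s a V by (auto simp: ptid_def DX_def)
     finally show ?thesis by simp
    qed
    have "ptid V x = q"
    proof (rule Set.set_eqI)
     fix s show "s \<in> ptid V x \<longleftrightarrow> s \<in> q"
      by (cases "s \<in> Sec V") (use mem in blast, use ptid_iff q.Icarr in blast)
    qed
    thus "q \<in> ptid V ` V" using xV by auto
   qed
  qed
 qed
 show ?thesis
  unfolding aff_def V_def[symmetric]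
 proof (intro conjI allI impI ballI V(1) bij; (elim conjE)?)
  fix W x assume W: "opn W" "W \<subseteq> V" "x \<in> W"
  then obtain g where g: "g \<in> Sec U" "x \<in> DX U g" "DX U g \<subseteq> W"
   using affD(3)[OF U W(1)] V by blast
  thus "\<exists>f\<in>Sec V. x \<in> DX V f \<and> DX V f \<subseteq> W"
   using DX_rest[OF oU V g(1)] rc W by (intro bexI[of _ "?r g"]) auto
 next
  fix g s assume gs: "g \<in> Sec V" "s \<in> Sec V" and z: "res V (DX V g) s = \<zero>[sec X (DX V g)]"
  obtain n :: nat and a where a: "a \<in> Sec U" "?r (f [^][sec X U] n) \<otimes>[sec X V] g = ?r a"
   using frac[OF gs(1)] by blast
  obtain m :: nat and b where b: "b \<in> Sec U" "?r (f [^][sec X U] m) \<otimes>[sec X V] s = ?r b"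
   using frac[OF gs(2)] by blast
  define W where "W = DX V g"
  have W: "opn W" "W \<subseteq> V" "W \<subseteq> U" using opn_DX[OF V(1)] DX_sub[of V g] V(2) by (auto simp: W_def)
  interpret C: cring "sec X W" by (rule sec_cring[OF W(1)])
  \<comment> \<open>\<open>a\<close> is \<open>g\<close> times a power of \<open>f\<close>, so a
    basic open set of \<open>V\<close> is also one of \<open>U\<close>.\<close>
  have WD: "W = DX U (f \<otimes>[sec X U] a)"
   using DXu[OF gs(1) a] DX_mult[OF oU f a(1)] by (simp add: W_def V_def)
  have "res U W b = res V W (?r (f [^][sec X U] m) \<otimes>[sec X V] s)"
   unfolding b(2) using rest_rest[OF oU V(1) W(1,2) V(2) b(1)] by simp
  also have "\<dots> = res V W (?r (f [^][sec X U] m)) \<otimes>[sec X W] \<zero>[sec X W]"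
   using rest_mult[OF V(1) W(1,2)] rc f gs z by (simp add: W_def)
  also have "\<dots> = \<zero>[sec X W]" using rest_closed[OF V(1) W(1,2)] rc f by simp
  finally obtain k :: nat where k: "(f \<otimes>[sec X U] a) [^][sec X U] k \<otimes>[sec X U] b = \<zero>[sec X U]"
   using affD(4)[OF U, of "f \<otimes>[sec X U] a" b] f a b WD by auto
  have "?r ((f \<otimes>[sec X U] a) [^][sec X U] k \<otimes>[sec X U] b) = \<zero>[sec X V]" unfolding k by (rule rest_zero[OF oU V])
  hence e: "(?r f \<otimes>[sec X V] ?r a) [^][sec X V] k \<otimes>[sec X V] ?r b = \<zero>[sec X V]"
   using f a b by (simp add: rest_mult[OF oU V] rest_pow[OF oU V])
  \<comment> \<open>The unit factors by which the relation over \<open>U\<close> differs from the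
    one wanted for \<open>g\<close> and \<open>s\<close>.\<close>
  define u where "u = (?r f \<otimes>[sec X V] ?r (f [^][sec X U] n)) [^][sec X V] k \<otimes>[sec X V] ?r (f [^][sec X U] m)"
  have uu: "u \<in> Units (sec X V)"
   unfolding u_def using fu fnu by (intro B.Units_m_closed B.Units_pow_closed)
  have cl: "?r f \<in> Sec V" "?r (f [^][sec X U] n) \<in> Sec V" "?r (f [^][sec X U] m) \<in> Sec V"
   using rc f by auto
  have "u \<otimes>[sec X V] (g [^][sec X V] k \<otimes>[sec X V] s) = \<zero>[sec X V]"
  proof -
   have "u \<otimes>[sec X V] (g [^][sec X V] k \<otimes>[sec X V] s)
    = ((?r f \<otimes>[sec X V] ?r (f [^][sec X U] n)) [^][sec X V] k \<otimes>[sec X V] g [^][sec X V] k) \<otimes>[sec X V] (?r (f [^][sec X U] m) \<otimes>[sec X V] s)"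
    unfolding u_def using cl gs by (simp add: B.m_ac)
   also have "(?r f \<otimes>[sec X V] ?r (f [^][sec X U] n)) [^][sec X V] k \<otimes>[sec X V] g [^][sec X V] k
    = (?r f \<otimes>[sec X V] (?r (f [^][sec X U] n) \<otimes>[sec X V] g)) [^][sec X V] k"
    using cl gs by (simp add: B.nat_pow_distrib B.m_assoc)
   finally show ?thesis unfolding a(2) b(2) using e by simp
  qed
  hence "u \<otimes>[sec X V] (g [^][sec X V] k \<otimes>[sec X V] s) = u \<otimes>[sec X V] \<zero>[sec X V]" using B.Units_closed[OF uu] by simp
  hence "g [^][sec X V] k \<otimes>[sec X V] s = \<zero>[sec X V]"
   by (rule Units_cancel[OF B.cring_axioms uu, rotated 2]) (use gs in auto)
  thus "\<exists>n::nat. g [^][sec X V] n \<otimes>[sec X V] s = \<zero>[sec X V]" by blast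
 next
  fix g w assume g: "g \<in> Sec V" and w: "w \<in> Sec (DX V g)"
  obtain n :: nat and a where a: "a \<in> Sec U" "?r (f [^][sec X U] n) \<otimes>[sec X V] g = ?r a"
   using frac[OF g] by blast
  define W where "W = DX V g"
  have W: "opn W" "W \<subseteq> V" "W \<subseteq> U" using opn_DX[OF V(1)] DX_sub[of V g] V(2) by (auto simp: W_def)
  interpret C: cring "sec X W" by (rule sec_cring[OF W(1)])
  have WD: "W = DX U (f \<otimes>[sec X U] a)"
   using DXu[OF g a] DX_mult[OF oU f a(1)] by (simp add: W_def V_def)
  have fa: "f \<otimes>[sec X U] a \<in> Sec U" using f a by simp
  have wW: "w \<in> Sec W" using w by (simp add: W_def)
  obtain k :: nat and b where b: "b \<in> Sec U"
   "res U W ((f \<otimes>[sec X U] a) [^][sec X U] k) \<otimes>[sec X W] w = res U W b"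
   using affD(5)[OF U fa, folded WD, OF wW] by blast
  define u where "u = (?r f \<otimes>[sec X V] ?r (f [^][sec X U] n)) [^][sec X V] k"
  have uu: "u \<in> Units (sec X V)"
   unfolding u_def using fu fnu by (intro B.Units_m_closed B.Units_pow_closed)
  have cl: "?r f \<in> Sec V" "?r (f [^][sec X U] n) \<in> Sec V" "u \<in> Sec V"
   using rc f uu by auto
  have eq: "?r ((f \<otimes>[sec X U] a) [^][sec X U] k) = u \<otimes>[sec X V] g [^][sec X V] k"
  proof -
   have "?r ((f \<otimes>[sec X U] a) [^][sec X U] k) = (?r f \<otimes>[sec X V] (?r (f [^][sec X U] n) \<otimes>[sec X V] g)) [^][sec X V] k"
    using f a by (simp add: rest_pow[OF oU V] rest_mult[OF oU V])
   also have "\<dots> = u \<otimes>[sec X V] g [^][sec X V] k"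
    unfolding u_def using cl g by (simp add: B.nat_pow_distrib B.m_assoc)
   finally show ?thesis .
  qed
  define v where "v = inv\<^bsub>sec X V\<^esub> u"
  have v: "v \<in> Sec V" "v \<otimes>[sec X V] u = \<one>[sec X V]" using uu by (auto simp: v_def)
  have gk: "g [^][sec X V] k = v \<otimes>[sec X V] ?r ((f \<otimes>[sec X U] a) [^][sec X U] k)"
   unfolding eq using v cl g by (simp add: B.m_assoc[symmetric])
  have "res V W (g [^][sec X V] k) \<otimes>[sec X W] w
   = res V W v \<otimes>[sec X W] (res U W ((f \<otimes>[sec X U] a) [^][sec X U] k) \<otimes>[sec X W] w)"
   unfolding gk using v rc fa wW rest_closed[OF V(1) W(1,2)] rest_closed[OF oU W(1,3)]
   by (simp add: rest_mult[OF V(1) W(1,2)] rest_rest[OF oU V(1) W(1,2) V(2)] C.m_assoc)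
  also have "\<dots> = res V W (v \<otimes>[sec X V] ?r b)"
   unfolding b(2) using v rc b(1) by (simp add: rest_mult[OF V(1) W(1,2)] rest_rest[OF oU V(1) W(1,2) V(2)])
  finally show "\<exists>n::nat. \<exists>a\<in>Sec V. res V (DX V g) (g [^][sec X V] n) \<otimes>[sec X (DX V g)] w = res V (DX V g) a"
   unfolding W_def[symmetric] using v rc b(1) by (intro exI[of _ k] bexI[of _ "v \<otimes>[sec X V] ?r b"]) auto
 qed
qed

lemma affine_basis:
 assumes "aff U" "opn V" "x \<in> U" "x \<in> V"
 shows "\<exists>W. aff W \<and> x \<in> W \<and> W \<subseteq> U \<and> W \<subseteq> V"
proof -
 obtain f where "f \<in> Sec U" "x \<in> DX U f" "DX U f \<subseteq> U \<inter> V"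
  using affD(3)[OF assms(1), of "U \<inter> V" x] affD(1)[OF assms(1)] assms by auto
 thus ?thesis using aff_DX[OF assms(1)] by blast
qed

subsection \<open>Values at complex points\<close>

lemma germ_frac_invertible:
 assumes U: "aff U" and W: "opn W" "W \<subseteq> U" and x: "x \<in> W" and u: "u \<in> Sec W"
  and ab: "(a, b) \<in> germ_frac U W x u"
 shows "inv_at W x u \<longleftrightarrow> inv_at U x a"
proof -
 have oU: "opn U" by (rule affD(1)[OF U])
 obtain N where abc: "a \<in> Sec U" "b \<in> Sec U" "inv_at U x b"
  and N: "opn N" "x \<in> N" "N \<subseteq> W" "res U N b \<otimes>[sec X N] res W N u = res U N a"
  using ab by (auto simp: germ_frac_def)
 have NU: "N \<subseteq> U" using N W by auto
 have "inv_at U x a \<longleftrightarrow> inv_at N x (res U N b \<otimes>[sec X N] res W N u)"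
  unfolding N(4) using invertible_rest[OF oU N(1) NU N(2) abc(1)] by simp
 also have "\<dots> \<longleftrightarrow> inv_at N x (res W N u)"
  using invertible_mult[OF N(1) rest_closed[OF oU N(1) NU abc(2)] rest_closed[OF W(1) N(1,3) u] N(2)]
   invertible_rest[OF oU N(1) NU N(2) abc(2)] abc(3) by simp
 also have "\<dots> \<longleftrightarrow> inv_at W x u" by (rule invertible_rest[OF W(1) N(1,3,2) u])
 finally show ?thesis by simp
qed

text \<open>The stalk is local: on a small affine neighbourhood the sections that are not units at
  \<open>x\<close> form the prime ideal of \<open>x\<close>.\<close>

lemma nonunit_add:
 assumes U: "aff U" "x \<in> U" and W: "opn W" "x \<in> W" and st: "u \<in> Sec W" "w \<in> Sec W"
  and ni: "\<not> inv_at W x u" "\<not> inv_at W x w"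
 shows "\<not> inv_at W x (u \<oplus>[sec X W] w)"
proof -
 obtain V where V: "aff V" "x \<in> V" "V \<subseteq> W" using affine_basis[OF U(1) W(1) U(2) W(2)] by blast
 have oV: "opn V" by (rule affD(1)[OF V(1)])
 interpret p: primeideal "ptid V x" "sec X V" by (rule aff_prime[OF V(1,2)])
 interpret W: cring "sec X W" by (rule sec_cring[OF W(1)])
 have "res W V u \<in> ptid V x"
  unfolding ptid_iff using rest_closed[OF W(1) oV V(3) st(1)] invertible_rest[OF W(1) oV V(3,2) st(1)] ni(1) by simp
 moreover have "res W V w \<in> ptid V x"
  unfolding ptid_iff using rest_closed[OF W(1) oV V(3) st(2)] invertible_rest[OF W(1) oV V(3,2) st(2)] ni(2) by simp
 ultimately have "res W V (u \<oplus>[sec X W] w) \<in> ptid V x"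
  using rest_add[OF W(1) oV V(3) st] p.a_closed by simp
 thus ?thesis using invertible_rest[OF W(1) oV V(3,2) W.a_closed[OF st]] unfolding ptid_iff by simp
qed

text \<open>Points with complex residue field. The condition is tested on a single affine
  neighbourhood; \<open>value_ex1\<close> extends it to every neighbourhood.\<close>

definition cpoint :: "'p \<Rightarrow> bool" where
 "cpoint x \<longleftrightarrow> (\<exists>U. aff U \<and> x \<in> U \<and> (\<forall>s\<in>Sec U. \<exists>c. \<not> inv_at U x (s \<ominus>[sec X U] scal X U c)))"

lemma scal_closed: "opn U \<Longrightarrow> scal X U c \<in> Sec U"
 using ring_hom_closed[OF scal_hom, of U c] by simp

lemma scal_algebra: "opn U \<Longrightarrow> C_algebra (sec X U) (scal X U)"
 by (simp add: C_algebra_def C_algebra_axioms_def sec_cring scal_hom)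

lemma scal_invertible: "opn U \<Longrightarrow> x \<in> U \<Longrightarrow> c \<noteq> 0 \<Longrightarrow> inv_at U x (scal X U c)"
proof -
 assume U: "opn U" "x \<in> U" "c \<noteq> 0"
 interpret C_algebra "sec X U" "scal X U" by (rule scal_algebra[OF U(1)])
 have "scal X U c \<otimes>[sec X U] scal X U (inverse c) = \<one>[sec X U]"
  using U(3) by (simp flip: k_mult)
 hence "scal X U c \<in> Units (sec X U)" unfolding Units_def using m_comm[of "scal X U c" "scal X U (inverse c)"] by auto
 thus ?thesis by (rule invertible_Units[OF U(1,2)])
qed

context
 fixes x assumes x: "cpoint x"
begin

lemma cpoint_aff: "\<exists>U. aff U \<and> x \<in> U" using x by (auto simp: cpoint_def)

lemma nonunit_add': "opn W \<Longrightarrow> x \<in> W \<Longrightarrow> \<sigma> \<in> Sec W \<Longrightarrow> \<tau> \<in> Sec W \<Longrightarrow>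
  \<not> inv_at W x \<sigma> \<Longrightarrow> \<not> inv_at W x \<tau> \<Longrightarrow> \<not> inv_at W x (\<sigma> \<oplus>[sec X W] \<tau>)"
 using cpoint_aff nonunit_add by blast

text \<open>For uniqueness, two values would make a nonzero constant a nonunit at \<open>x\<close>.
  For existence, the section is a fraction a/b near \<open>x\<close> with numerator and denominator
  on the neighbourhood where values are known to exist.\<close>

lemma value_ex1:
 assumes W: "opn W" "x \<in> W" and u: "u \<in> Sec W"
 shows "\<exists>!c. \<not> inv_at W x (u \<ominus>[sec X W] scal X W c)"
proof (rule ex_ex1I)
 interpret W: C_algebra "sec X W" "scal X W" by (rule scal_algebra[OF W(1)])
 show "c = c'" if "\<not> inv_at W x (u \<ominus>[sec X W] scal X W c)" "\<not> inv_at W x (u \<ominus>[sec X W] scal X W c')" for c c'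
 proof (rule ccontr)
  assume ne: "c \<noteq> c'"
  have cl: "u \<ominus>[sec X W] scal X W c' \<in> Sec W" "u \<ominus>[sec X W] scal X W c \<in> Sec W"
   using u by auto
  have mo: "\<ominus>[sec X W] s = scal X W (-1) \<otimes>[sec X W] s" if "s \<in> Sec W" for s
   using that by (simp add: W.k_minus W.l_minus)
  have "\<not> inv_at W x (\<ominus>[sec X W] (u \<ominus>[sec X W] scal X W c'))"
   unfolding mo[OF cl(1)] using invertible_mult[OF W(1) _ cl(1) W(2), of "scal X W (-1)"] that by simp
  hence "\<not> inv_at W x ((u \<ominus>[sec X W] scal X W c) \<oplus>[sec X W] \<ominus>[sec X W] (u \<ominus>[sec X W] scal X W c'))"
   using that(1) cl by (intro nonunit_add' W) auto
  moreover have "(u \<ominus>[sec X W] scal X W c) \<oplus>[sec X W] \<ominus>[sec X W] (u \<ominus>[sec X W] scal X W c') = scal X W (c' - c)"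
  proof -
   have "scal X W c \<in> Sec W" "scal X W c' \<in> Sec W" by auto
   hence "(u \<ominus>[sec X W] scal X W c) \<oplus>[sec X W] \<ominus>[sec X W] (u \<ominus>[sec X W] scal X W c') = scal X W c' \<ominus>[sec X W] scal X W c"
    using u by algebra
   thus ?thesis by (simp add: W.k_diff)
  qed
  ultimately show False using scal_invertible[OF W] ne by simp
 qed
 obtain U where U: "aff U" "x \<in> U" "\<And>s. s\<in>Sec U \<Longrightarrow> \<exists>c. \<not> inv_at U x (s \<ominus>[sec X U] scal X U c)"
  using x by (auto simp: cpoint_def)
 have oU: "opn U" by (rule affD(1)[OF U(1)])
 interpret p: primeideal "ptid U x" "sec X U" by (rule aff_prime[OF U(1,2)])
 interpret U: C_algebra "sec X U" "scal X U" by (rule scal_algebra[OF oU])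
 define V where "V = U \<inter> W"
 have V: "opn V" "V \<subseteq> U" "V \<subseteq> W" "x \<in> V" using oU W U by (auto simp: V_def)
 interpret V: C_algebra "sec X V" "scal X V" by (rule scal_algebra[OF V(1)])
 define w where "w = res W V u"
 have w: "w \<in> Sec V" unfolding w_def by (rule rest_closed[OF W(1) V(1,3) u])
 obtain a b where ab: "(a, b) \<in> germ_frac U V x w" using germ_frac_exists[OF U(1) V(1,2,4) w] U(2)
  by (meson V(2) invertible_one)
 hence abc: "a \<in> Sec U" "b \<in> Sec U" "inv_at U x b" by (auto simp: germ_frac_def)
 obtain ca where ca: "\<not> inv_at U x (a \<ominus>[sec X U] scal X U ca)" using U(3)[OF abc(1)] by blast
 obtain cb where cb: "\<not> inv_at U x (b \<ominus>[sec X U] scal X U cb)" using U(3)[OF abc(2)] by blast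
 have "cb \<noteq> 0" using cb abc by (auto simp: a_minus_def)
 \<comment> \<open>The value of the fraction is the quotient of the values; that of the denominator
   is nonzero because \<open>b\<close> is invertible at \<open>x\<close>.\<close>
 define c where "c = ca / cb"
 have cst: "(scal X U (- c), \<one>[sec X U]) \<in> germ_frac U V x (scal X V (- c))"
  using germ_frac_const[OF U(1) V(1,2,4) U.k_closed[of "- c"]] rest_scal[OF oU V(1,2)] by simp
 have g: "(a \<otimes>[sec X U] \<one>[sec X U] \<oplus>[sec X U] scal X U (- c) \<otimes>[sec X U] b, b \<otimes>[sec X U] \<one>[sec X U])
   \<in> germ_frac U V x (w \<oplus>[sec X V] scal X V (- c))"
  by (rule germ_frac_mult(2)[OF U(1) V(1,2,4) w V.k_closed ab cst])
 have "a \<otimes>[sec X U] \<one>[sec X U] \<oplus>[sec X U] scal X U (- c) \<otimes>[sec X U] b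
  = (a \<ominus>[sec X U] scal X U ca) \<oplus>[sec X U] scal X U (- c) \<otimes>[sec X U] (b \<ominus>[sec X U] scal X U cb)"
 proof -
  have e: "scal X U ca = scal X U c \<otimes>[sec X U] scal X U cb" using \<open>cb \<noteq> 0\<close> by (simp add: c_def flip: U.k_mult)
  have "scal X U c \<in> Sec U" "scal X U cb \<in> Sec U" by auto
  thus ?thesis unfolding e U.k_minus using abc by algebra
 qed
 also have "\<dots> \<in> ptid U x"
 proof (rule additive_subgroup.a_closed[OF ideal.axioms(1)[OF p.is_ideal]])
  show "a \<ominus>[sec X U] scal X U ca \<in> ptid U x" unfolding ptid_iff using ca abc by simp
  have "b \<ominus>[sec X U] scal X U cb \<in> ptid U x" unfolding ptid_iff using cb abc by simp
  thus "scal X U (- c) \<otimes>[sec X U] (b \<ominus>[sec X U] scal X U cb) \<in> ptid U x"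
   by (rule p.I_l_closed[OF _ U.k_closed])
 qed
 finally have "\<not> inv_at V x (w \<oplus>[sec X V] scal X V (- c))"
  using germ_frac_invertible[OF U(1) V(1,2,4) V.a_closed[OF w V.k_closed] g] ptid_iff by blast
 moreover have "w \<oplus>[sec X V] scal X V (- c) = res W V (u \<ominus>[sec X W] scal X W c)"
  using rest_minus[OF W(1) V(1,3) u] rest_scal[OF W(1) V(1,3)] by (simp add: w_def V.k_minus V.minus_eq)
 ultimately have "\<not> inv_at W x (u \<ominus>[sec X W] scal X W c)"
  using invertible_rest[OF W(1) V(1,3,4), of "u \<ominus>[sec X W] scal X W c"] u by simp
 thus "\<exists>c. \<not> inv_at W x (u \<ominus>[sec X W] scal X W c)" by blast
qed

lemma value_nonunit:
 assumes W: "opn W" "x \<in> W" and u: "u \<in> Sec W"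
 shows "\<not> inv_at W x (u \<ominus>[sec X W] scal X W (value_at X W x u))"
 unfolding value_at_def by (rule theI'[OF value_ex1[OF assms]])

lemma nonunit_zero:
 assumes W: "opn W" "x \<in> W"
 shows "\<not> inv_at W x \<zero>[sec X W]"
proof
 interpret W: C_algebra "sec X W" "scal X W" by (rule scal_algebra[OF W(1)])
 assume inv: "inv_at W x \<zero>[sec X W]"
 define t where "t = \<zero>[sec X W] \<ominus>[sec X W] scal X W (value_at X W x \<zero>[sec X W])"
 have t: "t \<in> Sec W" "\<not> inv_at W x t"
  using value_nonunit[OF W W.zero_closed] by (auto simp: t_def)
 have "inv_at W x (\<zero>[sec X W] \<otimes>[sec X W] t)" using inv t(1) by simp
 thus False using invertible_mult[OF W(1) W.zero_closed t(1) W(2)] t(2) by blast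
qed

lemma value_eqI:
 assumes W: "opn W" "x \<in> W" and u: "u \<in> Sec W" and "\<not> inv_at W x (u \<ominus>[sec X W] scal X W c)"
 shows "value_at X W x u = c"
 using value_ex1[OF W u] value_nonunit[OF W u] assms(4) by blast

lemma value_zero_iff:
 assumes W: "opn W" "x \<in> W" and u: "u \<in> Sec W"
 shows "value_at X W x u = 0 \<longleftrightarrow> \<not> inv_at W x u"
proof -
 interpret W: C_algebra "sec X W" "scal X W" by (rule scal_algebra[OF W(1)])
 have "u \<ominus>[sec X W] scal X W 0 = u" using u by (simp add: W.minus_eq)
 thus ?thesis using value_nonunit[OF W u] value_eqI[OF W u, of 0] by metis
qed

lemma value_hom:
 assumes W: "opn W" "x \<in> W"
 shows "value_at X W x \<in> ring_hom (sec X W) CC"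
proof (rule ring_hom_memI; simp)
 interpret W: C_algebra "sec X W" "scal X W" by (rule scal_algebra[OF W(1)])
 let ?v = "value_at X W x"
 fix s t assume st: "s \<in> Sec W" "t \<in> Sec W"
 define a b where "a = scal X W (?v s)" and "b = scal X W (?v t)"
 have ab: "a \<in> Sec W" "b \<in> Sec W" by (auto simp: a_def b_def)
 have ns: "\<not> inv_at W x (s \<ominus>[sec X W] a)" "\<not> inv_at W x (t \<ominus>[sec X W] b)"
  using value_nonunit[OF W] st by (auto simp: a_def b_def)
 have "(s \<oplus>[sec X W] t) \<ominus>[sec X W] (a \<oplus>[sec X W] b) = (s \<ominus>[sec X W] a) \<oplus>[sec X W] (t \<ominus>[sec X W] b)"
  using st ab by algebra
 hence "\<not> inv_at W x ((s \<oplus>[sec X W] t) \<ominus>[sec X W] scal X W (?v s + ?v t))"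
  using nonunit_add'[OF W _ _ ns] st ab by (simp add: W.k_add a_def b_def)
 thus "?v (s \<oplus>[sec X W] t) = ?v s + ?v t" using st by (intro value_eqI[OF W]) auto
 have "(s \<otimes>[sec X W] t) \<ominus>[sec X W] (a \<otimes>[sec X W] b) = (s \<ominus>[sec X W] a) \<otimes>[sec X W] t \<oplus>[sec X W] a \<otimes>[sec X W] (t \<ominus>[sec X W] b)"
  using st ab by algebra
 moreover have "\<not> inv_at W x ((s \<ominus>[sec X W] a) \<otimes>[sec X W] t)" "\<not> inv_at W x (a \<otimes>[sec X W] (t \<ominus>[sec X W] b))"
  using invertible_mult[OF W(1) _ _ W(2)] st ab ns by auto
 ultimately have "\<not> inv_at W x ((s \<otimes>[sec X W] t) \<ominus>[sec X W] scal X W (?v s * ?v t))"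
  using nonunit_add'[OF W] st ab by (simp add: W.k_mult a_def b_def)
 thus "?v (s \<otimes>[sec X W] t) = ?v s * ?v t" using st by (intro value_eqI[OF W]) auto
next
 interpret W: C_algebra "sec X W" "scal X W" by (rule scal_algebra[OF W(1)])
 have e: "\<one>[sec X W] \<ominus>[sec X W] scal X W 1 = \<zero>[sec X W]" by simp
 have "\<not> inv_at W x (\<one>[sec X W] \<ominus>[sec X W] scal X W 1)" unfolding e by (rule nonunit_zero[OF W])
 thus "value_at X W x \<one>[sec X W] = 1" by (intro value_eqI[OF W]) auto
qed

lemma value_rest:
 assumes W: "opn W" "x \<in> V" and V: "opn V" "V \<subseteq> W" and u: "u \<in> Sec W"
 shows "value_at X V x (res W V u) = value_at X W x u"
proof (rule value_eqI[OF V(1) W(2) rest_closed[OF W(1) V u]])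
 interpret W: C_algebra "sec X W" "scal X W" by (rule scal_algebra[OF W(1)])
 have xW: "x \<in> W" using W V by auto
 have "res W V u \<ominus>[sec X V] scal X V c = res W V (u \<ominus>[sec X W] scal X W c)" for c
  using rest_minus[OF W(1) V u] rest_scal[OF W(1) V] by simp
 thus "\<not> inv_at V x (res W V u \<ominus>[sec X V] scal X V (value_at X W x u))"
  using value_nonunit[OF W(1) xW u] invertible_rest[OF W(1) V W(2)] u by simp
qed

lemma value_scal:
 assumes W: "opn W" "x \<in> W"
 shows "value_at X W x (scal X W c) = c"
proof (rule value_eqI[OF W])
 interpret W: C_algebra "sec X W" "scal X W" by (rule scal_algebra[OF W(1)])
 have e: "scal X W c \<ominus>[sec X W] scal X W c = \<zero>[sec X W]" by simp
 show "\<not> inv_at W x (scal X W c \<ominus>[sec X W] scal X W c)" unfolding e by (rule nonunit_zero[OF W])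
 show "scal X W c \<in> Sec W" by simp
qed

end

text \<open>As every section has a value at \<open>x\<close>, the ideal of \<open>x\<close> on an
  affine set is maximal. Another point \<open>y\<close> of that set is therefore separated from
  \<open>x\<close> by a section vanishing at \<open>x\<close> and not at \<open>y\<close>, which
  gives a neighbourhood of \<open>y\<close> without \<open>x\<close>.\<close>

lemma cpoint_closed:
 assumes x: "cpoint x" and cov: "\<And>y. y \<in> topspace (zar X) \<Longrightarrow> \<exists>U. aff U \<and> y \<in> U"
 shows "closed_point X x"
proof -
 have xt: "x \<in> topspace (zar X)" using x affD(1) openin_subset unfolding cpoint_def by blast
 have "opn (topspace (zar X) - {x})"
 proof (subst openin_subopen, intro ballI)
  fix y assume y: "y \<in> topspace (zar X) - {x}"
  then obtain V where V: "aff V" "y \<in> V" using cov by auto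
  have oV: "opn V" by (rule affD(1)[OF V(1)])
  show "\<exists>T. opn T \<and> y \<in> T \<and> T \<subseteq> topspace (zar X) - {x}"
  proof (cases "x \<in> V")
   case False
   thus ?thesis using oV V openin_subset[OF oV] by blast
  next
   case xV: True
   interpret V: C_algebra "sec X V" "scal X V" by (rule scal_algebra[OF oV])
   have "\<not> ptid V x \<subseteq> ptid V y"
   proof
    assume sub: "ptid V x \<subseteq> ptid V y"
    interpret py: primeideal "ptid V y" "sec X V" by (rule aff_prime[OF V(1,2)])
    have "ptid V y \<subseteq> ptid V x"
    proof
     fix s assume s: "s \<in> ptid V y"
     hence sc: "s \<in> Sec V" using ptid_iff by blast
     define c where "c = value_at X V x s"
     have "s \<ominus>[sec X V] scal X V c \<in> ptid V y"
      using value_nonunit[OF x oV xV sc] V.minus_closed[OF sc V.k_closed] sub ptid_iff unfolding c_def by blast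
     hence "scal X V (-1) \<otimes>[sec X V] (s \<ominus>[sec X V] scal X V c) \<oplus>[sec X V] s \<in> ptid V y"
      using s by (intro py.a_closed py.I_l_closed) auto
     moreover have "scal X V (-1) \<otimes>[sec X V] (s \<ominus>[sec X V] scal X V c) \<oplus>[sec X V] s = scal X V c"
     proof -
      have cc: "scal X V c \<in> Sec V" by simp
      have "(\<ominus>[sec X V] \<one>[sec X V]) \<otimes>[sec X V] (s \<ominus>[sec X V] scal X V c) \<oplus>[sec X V] s = scal X V c"
       using sc cc by algebra
      thus ?thesis by (simp add: V.k_minus)
     qed
     ultimately have "scal X V c \<in> ptid V y" by simp
     hence "c = 0" using scal_invertible[OF oV V(2), of c] ptid_iff by blast
     thus "s \<in> ptid V x" using value_zero_iff[OF x oV xV sc] sc ptid_iff unfolding c_def by blast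
    qed
    hence "x = y" using sub affD(2)[OF V(1)] xV V(2) by (metis bij_betw_imp_inj_on inj_onD subset_antisym)
    thus False using y by simp
   qed
   then obtain f where f: "f \<in> Sec V" "f \<in> ptid V x" "f \<notin> ptid V y" by (auto simp: ptid_def)
   hence "y \<in> DX V f" "x \<notin> DX V f" using V by (auto simp: DX_def ptid_def)
   moreover have "opn (DX V f)" "DX V f \<subseteq> topspace (zar X)"
    using opn_DX[OF oV] openin_subset[OF opn_DX[OF oV, of f]] by auto
   ultimately show ?thesis by blast
  qed
 qed
 thus ?thesis unfolding closed_point_def closedin_def using xt by auto
qed

end

section \<open>Noetherian topologies and their irreducible components\<close>

lemma irreducible_in_Union:
 assumes "irreducible_in T L" "finite \<F>" "\<And>B. B \<in> \<F> \<Longrightarrow> closedin T B" "L \<subseteq> \<Union>\<F>"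
 shows "\<exists>B\<in>\<F>. L \<subseteq> B"
 using assms(2-4)
proof (induction \<F> rule: finite_induct)
 case empty
 thus ?case using assms(1) by (auto simp: irreducible_in_def)
next
 case (insert B \<F>)
 have "closedin T B" "closedin T (\<Union>\<F>)" "L \<subseteq> B \<union> \<Union>\<F>"
  using insert.prems insert.hyps by (auto intro!: closedin_Union)
 hence "L \<subseteq> B \<or> L \<subseteq> \<Union>\<F>" using assms(1) by (auto simp: irreducible_in_def)
 thus ?case using insert by auto
qed

text \<open>A single stationary step is enough, since the condition is applied to exclude strictly
  descending sequences.\<close>

definition noetherian_top :: "'a topology \<Rightarrow> bool" where
 "noetherian_top T \<longleftrightarrow> (\<forall>C :: nat \<Rightarrow> 'a set. (\<forall>n. closedin T (C n)) \<and> (\<forall>n. C (Suc n) \<subseteq> C n) \<longrightarrow>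
  (\<exists>n. C (Suc n) = C n))"

text \<open>A closed set without such a decomposition is reducible, and one of its two pieces again
  has none; repeating this gives a strictly descending sequence.\<close>

lemma noetherian_decomposition:
 assumes N: "noetherian_top T" and C: "closedin T C"
 shows "\<exists>\<F>. finite \<F> \<and> (\<forall>B\<in>\<F>. closedin T B \<and> irreducible_in T B) \<and> C = \<Union>\<F>"
proof (rule ccontr)
 define good where "good C \<longleftrightarrow> (\<exists>\<F>. finite \<F> \<and> (\<forall>B\<in>\<F>. closedin T B \<and> irreducible_in T B) \<and> C = \<Union>\<F>)" for C
 assume "\<not> ?thesis"
 hence bad: "\<not> good C" by (simp add: good_def)
 have step: "\<exists>B. (closedin T B \<and> \<not> good B) \<and> B \<subset> A" if A: "closedin T A \<and> \<not> good A" for A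
 proof -
  have "A \<noteq> {}" using A by (force simp: good_def)
  moreover have "\<not> irreducible_in T A"
  proof
   assume "irreducible_in T A"
   hence "good A" using A unfolding good_def by (intro exI[of _ "{A}"]) auto
   thus False using A by simp
  qed
  ultimately obtain B B' where B: "closedin T B" "closedin T B'" "A \<subseteq> B \<union> B'" "\<not> A \<subseteq> B" "\<not> A \<subseteq> B'"
   using A closedin_subset[of T A] by (auto simp: irreducible_in_def)
  have c: "closedin T (A \<inter> B)" "closedin T (A \<inter> B')" using A B by auto
  have "\<not> (good (A \<inter> B) \<and> good (A \<inter> B'))"
  proof
   assume "good (A \<inter> B) \<and> good (A \<inter> B')"
   then obtain F F' where F: "finite F" "\<forall>B\<in>F. closedin T B \<and> irreducible_in T B" "A \<inter> B = \<Union>F"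
    "finite F'" "\<forall>B\<in>F'. closedin T B \<and> irreducible_in T B" "A \<inter> B' = \<Union>F'" by (auto simp: good_def)
   have "A = \<Union>(F \<union> F')" using B(3) F(3,6) by blast
   hence "good A" using F unfolding good_def by (intro exI[of _ "F \<union> F'"]) auto
   thus False using A by simp
  qed
  thus ?thesis using c B by blast
 qed
 obtain f where f: "\<And>n. closedin T (f n) \<and> \<not> good (f n)" "\<And>n. f (Suc n) \<subset> f n"
  using dependent_nat_choice[of "\<lambda>_ A. closedin T A \<and> \<not> good A" "\<lambda>_ A B. B \<subset> A"] C bad step by metis
 hence "\<exists>n. f (Suc n) = f n" using N unfolding noetherian_top_def by blast
 thus False using f(2) by blast
qed

lemma noetherian_components:
 assumes N: "noetherian_top T"
 shows "finite {L. irreducible_component T L}" "irreducible_component T L \<Longrightarrow> closedin T L"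
proof -
 obtain \<F> where F0: "finite \<F> \<and> (\<forall>B\<in>\<F>. closedin T B \<and> irreducible_in T B) \<and> topspace T = \<Union>\<F>"
  using noetherian_decomposition[OF N closedin_topspace] by (elim exE)
 have F: "finite \<F>" "\<And>B. B \<in> \<F> \<Longrightarrow> closedin T B \<and> irreducible_in T B" "topspace T = \<Union>\<F>"
  using F0 by simp_all
 have mem: "L \<in> \<F>" if "irreducible_component T L" for L
 proof -
  have L: "irreducible_in T L" "\<And>A. irreducible_in T A \<Longrightarrow> L \<subseteq> A \<Longrightarrow> A = L"
   using that by (auto simp: irreducible_component_def)
  have "L \<subseteq> \<Union>\<F>" using L(1) F(3) by (auto simp: irreducible_in_def)
  then obtain B where "B \<in> \<F>" "L \<subseteq> B" using irreducible_in_Union[OF L(1) F(1)] F(2) by blast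
  thus ?thesis using L(2)[of B] F(2) by auto
 qed
 show "finite {L. irreducible_component T L}" by (rule finite_subset[OF _ F(1)]) (use mem in auto)
 show "closedin T L" if "irreducible_component T L" using mem[OF that] F(2) by blast
qed

section \<open>Schemes of finite type\<close>

locale ft_scheme = ringed X for X :: "('p, 's) cspace" +
 assumes ft: "finite_type_scheme X"
begin

lemma ft_cover:
 "x \<in> topspace (zar X) \<Longrightarrow> \<exists>U. aff U \<and> x \<in> U \<and> finite_type_algebra (sec X U) (scal X U)"
 using ft affine_open_iff_aff unfolding finite_type_scheme_def by blast

lemma ptid_prime_ideal: "aff U \<Longrightarrow> x \<in> U \<Longrightarrow> ideal (ptid U x) (sec X U)"
 using aff_prime primeideal.axioms(1) by blast

definition vanishing :: "'p set \<Rightarrow> 'p set \<Rightarrow> 's set" where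
 "vanishing U C = {s \<in> Sec U. \<forall>x\<in>C \<inter> U. s \<in> ptid U x}"

lemma vanishing_iff:
 assumes U: "aff U" and C: "closedin (zar X) C" and y: "y \<in> U"
 shows "y \<in> C \<longleftrightarrow> vanishing U C \<subseteq> ptid U y"
proof
 assume sub: "vanishing U C \<subseteq> ptid U y"
 show "y \<in> C"
 proof (rule ccontr)
  assume "y \<notin> C"
  have oU: "opn U" by (rule affD(1)[OF U])
  have "opn (U - C)" using oU C by (rule openin_diff)
  then obtain f where f: "f \<in> Sec U" "y \<in> DX U f" "DX U f \<subseteq> U - C"
   using affD(3)[OF U, of "U - C" y] y \<open>y \<notin> C\<close> by blast
  hence "f \<in> vanishing U C" by (auto simp: vanishing_def ptid_def DX_def)
  thus False using sub f(2) by (auto simp: ptid_def DX_def)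
 qed
qed (use y in \<open>auto simp: vanishing_def\<close>)

lemma vanishing_sideal:
 assumes U: "aff U"
 shows "cring.sideal (sec X U) (Sec U) (vanishing U C)"
proof -
 have oU: "opn U" by (rule affD(1)[OF U])
 interpret A: cring "sec X U" by (rule sec_cring[OF oU])
 have add: "a \<oplus>[sec X U] b \<in> ptid U x" if "x \<in> U" "a \<in> ptid U x" "b \<in> ptid U x" for a b x
  using additive_subgroup.a_closed[OF ideal.axioms(1)[OF ptid_prime_ideal[OF U that(1)]] that(2,3)] .
 have z: "\<zero>[sec X U] \<in> ptid U x" if "x \<in> U" for x
  using additive_subgroup.zero_closed[OF ideal.axioms(1)[OF ptid_prime_ideal[OF U that]]] .
 have mu: "s \<otimes>[sec X U] a \<in> ptid U x" if "x \<in> U" "a \<in> ptid U x" "s \<in> Sec U" for a s x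
  using ideal.I_l_closed[OF ptid_prime_ideal[OF U that(1)] that(2,3)] .
 show ?thesis unfolding A.sideal_def vanishing_def using add z mu by auto
qed

text \<open>A closed set is determined by its ideals on a finite affine cover by finite type
  algebras, and there ascending chains of ideals stop by Hilbert's basis theorem.\<close>

lemma noetherian_zar: "noetherian_top (zar X)"
 unfolding noetherian_top_def
proof (intro allI impI, elim conjE)
 fix C :: "nat \<Rightarrow> 'p set"
 assume cl: "\<forall>n. closedin (zar X) (C n)" and dec: "\<forall>n. C (Suc n) \<subseteq> C n"
 define \<U> where "\<U> = {U. aff U \<and> finite_type_algebra (sec X U) (scal X U)}"
 have "\<exists>\<F>. finite \<F> \<and> \<F> \<subseteq> \<U> \<and> topspace (zar X) \<subseteq> \<Union>\<F>"
 proof -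
  have "compact_space (zar X)" using ft by (simp add: finite_type_scheme_def)
  moreover have "\<forall>U\<in>\<U>. opn U" using affD(1) by (auto simp: \<U>_def)
  moreover have "topspace (zar X) \<subseteq> \<Union>\<U>" using ft_cover by (fastforce simp: \<U>_def)
  ultimately show ?thesis unfolding compact_space_def compactin_def by blast
 qed
 then obtain \<F> where F: "finite \<F>" "\<F> \<subseteq> \<U>" "topspace (zar X) \<subseteq> \<Union>\<F>" by blast
 have stab: "\<exists>N. \<forall>n\<ge>N. vanishing U (C n) = vanishing U (C N)" if U: "U \<in> \<F>" for U
 proof -
  have U': "aff U" "finite_type_algebra (sec X U) (scal X U)" using U F(2) by (auto simp: \<U>_def)
  have oU: "opn U" by (rule affD(1)[OF U'(1)])
  interpret A: cring "sec X U" by (rule sec_cring[OF oU])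
  have sa: "A.sacc (Sec U)" by (rule sacc_finite_type[OF A.cring_axioms scal_hom[OF oU] U'(2)])
  have inc: "vanishing U (C n) \<subseteq> vanishing U (C (Suc n))" for n using dec by (auto simp: vanishing_def)
  show ?thesis
   by (rule sa[unfolded A.sacc_def, THEN spec, THEN mp, of "\<lambda>n. vanishing U (C n)"])
    (intro conjI allI vanishing_sideal[OF U'(1)] inc)
 qed
 then obtain N where N: "\<And>U n. U \<in> \<F> \<Longrightarrow> n \<ge> N U \<Longrightarrow> vanishing U (C n) = vanishing U (C (N U))" by metis
 define M where "M = Max (insert 0 (N ` \<F>))"
 have M: "N U \<le> M" if "U \<in> \<F>" for U using F(1) that by (auto simp: M_def)
 have "C M \<subseteq> C (Suc M)"
 proof
  fix y assume y: "y \<in> C M"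
  hence "y \<in> topspace (zar X)" using cl closedin_subset by blast
  then obtain U where U: "U \<in> \<F>" "y \<in> U" using F(3) by blast
  have aU: "aff U" using U F(2) by (auto simp: \<U>_def)
  have "vanishing U (C (Suc M)) = vanishing U (C M)"
   using N[OF U(1) M[OF U(1)]] N[OF U(1), of "Suc M"] M[OF U(1)] by simp
  thus "y \<in> C (Suc M)" using vanishing_iff[OF aU _ U(2)] cl y by metis
 qed
 thus "\<exists>n. C (Suc n) = C n" using dec by blast
qed

text \<open>The Nullstellensatz, obtained from \<open>point_avoiding_countable\<close> with nothing
  to avoid: it gives a point \<open>y\<close> with complex residue field whose ideal contains that
  of \<open>x\<close>. Since \<open>x\<close> is closed, \<open>y\<close> equals
  \<open>x\<close>.\<close>

lemma closed_imp_cpoint: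
 assumes "closed_point X x"
 shows "cpoint x"
proof -
 have cl: "closedin (zar X) {x}" using assms by (simp add: closed_point_def)
 hence "x \<in> topspace (zar X)" using closedin_subset by blast
 then obtain U where U: "aff U" "x \<in> U" "finite_type_algebra (sec X U) (scal X U)" using ft_cover by blast
 have oU: "opn U" by (rule affD(1)[OF U(1)])
 interpret A: C_algebra "sec X U" "scal X U" by (rule scal_algebra[OF oU])
 obtain m where m: "primeideal m (sec X U)" "ptid U x \<subseteq> m"
  "\<And>a. a \<in> Sec U \<Longrightarrow> \<exists>c. a \<ominus>[sec X U] scal X U c \<in> m"
  by (rule A.point_avoiding_countable[OF A.countable_dim_finite_type[OF U(3)] aff_prime[OF U(1,2)], of "{}"]) auto
 then obtain y where y: "y \<in> U" "ptid U y = m"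
  using affD(2)[OF U(1)] unfolding bij_betw_def by (metis (mono_tags, lifting) imageE mem_Collect_eq)
 have "vanishing U {x} \<subseteq> ptid U x" using U by (auto simp: vanishing_def)
 hence "y \<in> {x}" using vanishing_iff[OF U(1) cl y(1)] m(2) y(2) by blast
 hence "y = x" by simp
 thus ?thesis unfolding cpoint_def using U m(3) y by (intro exI[of _ U]) (auto simp: ptid_def)
qed

lemma cpoint_iff_closed: "cpoint x \<longleftrightarrow> closed_point X x"
 using closed_imp_cpoint cpoint_closed ft_cover by blast

subsection \<open>Generically reduced components\<close>

text \<open>\<open>p0\<close> is the ideal of \<open>L\<close> on a chart. It is a minimal prime
  because \<open>L\<close> is a component, and reducedness at its generic point then makes the local
  ring at \<open>p0\<close> a field; the fourth conclusion says this with elements. The last one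
  supplies closed points of \<open>L\<close> that avoid \<B> and any countable set of hypersurfaces
  not containing \<open>L\<close>.\<close>

lemma generically_reduced_chart:
 assumes L: "irreducible_component (zar X) L" and nr: "\<not> generically_nonreduced X L"
  and B: "finite \<B>" "\<And>B. B \<in> \<B> \<Longrightarrow> closedin (subtopology (zar X) L) B \<and> B \<noteq> L"
 obtains U p0 where "aff U" "finite_type_algebra (sec X U) (scal X U)" "primeideal p0 (sec X U)"
  "\<And>a. a \<in> p0 \<Longrightarrow> \<exists>t\<in>Sec U - p0. t \<otimes>[sec X U] a = \<zero>[sec X U]"
  "\<And>T. countable T \<Longrightarrow> T \<subseteq> Sec U - p0 \<Longrightarrow>
   \<exists>x\<in>U. x \<in> L - \<Union>\<B> \<and> closed_point X x \<and> p0 \<subseteq> ptid U x \<and> T \<inter> ptid U x = {}"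
proof -
 define W where "W = interior_component (zar X) L"
 have Lirr: "irreducible_in (zar X) L" and Lmax: "\<And>A. irreducible_in (zar X) A \<Longrightarrow> L \<subseteq> A \<Longrightarrow> A = L"
  using L by (auto simp: irreducible_component_def)
 note comp = noetherian_components[OF noetherian_zar]
 have Lcl: "closedin (zar X) L" by (rule comp(2)[OF L])
 define \<O> where "\<O> = {L'. irreducible_component (zar X) L' \<and> L' \<noteq> L}"
 have fO: "finite \<O>" by (rule finite_subset[OF _ comp(1)]) (auto simp: \<O>_def)
 have Ocl: "closedin (zar X) L'" if "L' \<in> \<O>" for L' using comp(2) that by (simp add: \<O>_def)
 have Wdef: "W = topspace (zar X) - \<Union>\<O>" by (simp add: W_def interior_component_def \<O>_def)
 have oW: "opn W" unfolding Wdef using fO Ocl by (intro openin_diff openin_topspace closedin_Union) auto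
 obtain V where V: "openin (subtopology (zar X) L) V" "V \<noteq> {}" "\<And>x. x \<in> V \<Longrightarrow> closure_reduced_at X W x"
  using nr unfolding generically_nonreduced_def W_def by blast
 obtain Q where Q: "opn Q" "V = Q \<inter> L" using V(1) by (auto simp: openin_subtopology)
 have Bcl: "closedin (zar X) B" "B \<subseteq> L" "B \<noteq> L" if "B \<in> \<B>" for B
  using B(2)[OF that] Lcl closedin_trans_full by (blast, auto simp: closedin_subtopology)
 \<comment> \<open>The open set where \<open>L\<close> is the only component, its closure scheme is
   reduced, and no exceptional set is met. Irreducibility of \<open>L\<close> ensures that it still
   meets \<open>L\<close>.\<close>
 define G where "G = Q \<inter> W - \<Union>\<B>"
 have oG: "opn G" unfolding G_def using Q(1) oW B(1) Bcl by (intro openin_diff openin_Int closedin_Union) auto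
 have "\<not> L \<subseteq> \<Union>({topspace (zar X) - Q} \<union> \<O> \<union> \<B>)"
 proof
  assume "L \<subseteq> \<Union>({topspace (zar X) - Q} \<union> \<O> \<union> \<B>)"
  then obtain C where C: "C \<in> {topspace (zar X) - Q} \<union> \<O> \<union> \<B>" "L \<subseteq> C"
   using irreducible_in_Union[OF Lirr, of "{topspace (zar X) - Q} \<union> \<O> \<union> \<B>"] fO B(1) Ocl Bcl(1) Q(1)
   by (metis (no_types, lifting) UnE closedin_diff closedin_topspace finite.emptyI finite.insertI finite_UnI singletonD)
  consider "C = topspace (zar X) - Q" | "C \<in> \<O>" | "C \<in> \<B>" using C(1) by blast
  thus False
  proof cases
   case 1
   thus False using C(2) V(2) Q(2) by auto
  next
   case 2
   hence "irreducible_in (zar X) C" "C \<noteq> L" by (auto simp: \<O>_def irreducible_component_def)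
   thus False using Lmax C(2) by blast
  next
   case 3
   thus False using Bcl C(2) by blast
  qed
 qed
 then obtain z where zL: "z \<in> L" and zn: "z \<notin> \<Union>({topspace (zar X) - Q} \<union> \<O> \<union> \<B>)" by (meson subsetI)
 have zt: "z \<in> topspace (zar X)" using closedin_subset[OF Lcl] zL by (rule subsetD)
 have "z \<in> G" unfolding G_def Wdef using zn zt by simp
 hence z: "z \<in> L" "z \<in> G" using zL by auto
 have "z \<in> topspace (zar X)" by (rule zt)
 then obtain U where U: "aff U" "z \<in> U" "finite_type_algebra (sec X U) (scal X U)" using ft_cover by blast
 have oU: "opn U" by (rule affD(1)[OF U(1)])
 interpret A: C_algebra "sec X U" "scal X U" by (rule scal_algebra[OF oU])
 interpret Ab: base_ring "sec X U" by (simp add: base_ring_def A.cring_axioms)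
 define p0 where "p0 = vanishing U L"
 have p0z: "p0 \<subseteq> ptid U z" using z U by (auto simp: p0_def vanishing_def)
 have sid: "p0 \<subseteq> Sec U" "\<zero>[sec X U] \<in> p0" "\<And>a b. a \<in> p0 \<Longrightarrow> b \<in> p0 \<Longrightarrow> a \<oplus>[sec X U] b \<in> p0"
  "\<And>s a. s \<in> Sec U \<Longrightarrow> a \<in> p0 \<Longrightarrow> s \<otimes>[sec X U] a \<in> p0"
  using vanishing_sideal[OF U(1), of L] unfolding A.sideal_def p0_def by blast+
 have id: "ideal p0 (sec X U)"
 proof (rule idealI[OF A.ring_axioms])
  show "subgroup p0 (add_monoid (sec X U))"
  proof (rule A.add.subgroupI)
   fix a assume a: "a \<in> p0"
   hence "(\<ominus>[sec X U] \<one>[sec X U]) \<otimes>[sec X U] a \<in> p0" using sid(4) by simp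
   thus "\<ominus>[sec X U] a \<in> p0" using a sid(1) by (auto simp: A.l_minus subset_iff)
  qed (use sid in auto)
  fix a s assume as: "a \<in> p0" "s \<in> Sec U"
  thus "s \<otimes>[sec X U] a \<in> p0" using sid by auto
  thus "a \<otimes>[sec X U] s \<in> p0" using as sid(1) A.m_comm[of a s] by auto
 qed
 have p0: "primeideal p0 (sec X U)"
 proof (rule primeidealI[OF id A.cring_axioms])
  show "Sec U \<noteq> p0" using p0z invertible_one[OF oU U(2)] by (auto simp: ptid_def)
  fix a b assume ab: "a \<in> Sec U" "b \<in> Sec U" "a \<otimes>[sec X U] b \<in> p0"
  define Ba where "Ba = topspace (zar X) - DX U a"
  define Bb where "Bb = topspace (zar X) - DX U b"
  have "closedin (zar X) Ba" "closedin (zar X) Bb" unfolding Ba_def Bb_def using opn_DX[OF oU] by auto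
  moreover have "L \<subseteq> Ba \<union> Bb"
  proof
   fix x assume x: "x \<in> L"
   hence xt: "x \<in> topspace (zar X)" using Lcl closedin_subset by blast
   show "x \<in> Ba \<union> Bb"
   proof (cases "x \<in> U")
    case True
    hence "a \<otimes>[sec X U] b \<in> ptid U x" using ab x by (auto simp: p0_def vanishing_def)
    hence "x \<notin> DX U a \<inter> DX U b" using DX_mult[OF oU ab(1,2)] by (auto simp: ptid_def DX_def)
    thus ?thesis using xt by (auto simp: Ba_def Bb_def)
   qed (use xt DX_sub in \<open>auto simp: Ba_def\<close>)
  qed
  ultimately have "L \<subseteq> Ba \<or> L \<subseteq> Bb" using Lirr by (auto simp: irreducible_in_def)
  thus "a \<in> p0 \<or> b \<in> p0"
   using ab(1,2) by (auto simp: p0_def vanishing_def ptid_def Ba_def Bb_def DX_def subset_iff)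
 qed
 have inL: "x \<in> L \<longleftrightarrow> p0 \<subseteq> ptid U x" if "x \<in> U" for x
  unfolding p0_def by (rule vanishing_iff[OF U(1) Lcl that])
 obtain f0 where f0: "f0 \<in> Sec U" "z \<in> DX U f0" "DX U f0 \<subseteq> U \<inter> G"
  using affD(3)[OF U(1), of "U \<inter> G" z] oU oG U(2) z(2) by auto
 have f0p: "f0 \<notin> p0" using f0(2) p0z by (auto simp: ptid_def DX_def)
 have ptex: "\<exists>y\<in>U. ptid U y = q" if "primeideal q (sec X U)" for q
  using affD(2)[OF U(1)] that unfolding bij_betw_def by (metis (mono_tags, lifting) imageE mem_Collect_eq)
 \<comment> \<open>The generic point of \<open>L\<close>, available since every prime of the ring of
   a chart is a point.\<close>
 obtain \<eta> where \<eta>: "\<eta> \<in> U" "ptid U \<eta> = p0" using ptex[OF p0] by blast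
 have \<eta>D: "\<eta> \<in> DX U f" if "f \<in> Sec U" "f \<notin> p0" for f
  using that \<eta> by (auto simp: ptid_def DX_def)
 have \<eta>L: "\<eta> \<in> L" using inL[OF \<eta>(1)] \<eta>(2) by simp
 have \<eta>G: "\<eta> \<in> G" using \<eta>D[OF f0(1) f0p] f0(3) by auto
 have red: "\<exists>t\<in>Sec U - p0. t \<otimes>[sec X U] a = \<zero>[sec X U]" if a: "a \<in> p0" for a
 proof -
  have ac: "a \<in> Sec U" using a sid(1) by auto
  interpret P: primeideal p0 "sec X U" by (rule p0)
  \<comment> \<open>If zero is not in \<open>S\<close>, there is a prime inside \<open>p0\<close>
    that misses \<open>a\<close>. The closure of its point is irreducible and contains
    \<open>L\<close>, hence equals \<open>L\<close>; but then \<open>a\<close> vanishes at that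
    point.\<close>
  define S where "S = {t \<otimes>[sec X U] a [^][sec X U] n | t n. t \<in> Sec U - p0 \<and> n \<in> (UNIV :: nat set)}"
  have "\<zero>[sec X U] \<in> S"
  proof (rule ccontr)
   assume "\<zero>[sec X U] \<notin> S"
   hence dis: "{\<zero>[sec X U]} \<inter> S = {}" by auto
   have S1: "S \<subseteq> Sec U" using ac by (auto simp: S_def)
   have pS: "t \<in> S" if "t \<in> Sec U" "t \<notin> p0" for t
    unfolding S_def using that by (intro CollectI exI[of _ t] exI[of _ 0]) auto
   have aS: "a \<in> S"
    unfolding S_def using ac P.one_notin by (intro CollectI exI[of _ "\<one>[sec X U]"] exI[of _ 1]) auto
   have S2: "x \<otimes>[sec X U] y \<in> S" if "x \<in> S" "y \<in> S" for x y
   proof -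
    from that obtain t u n m where "x = t \<otimes>[sec X U] a [^][sec X U] (n::nat)" "y = u \<otimes>[sec X U] a [^][sec X U] (m::nat)"
     and tu: "t \<in> Sec U - p0" "u \<in> Sec U - p0" by (auto simp: S_def)
    hence "x \<otimes>[sec X U] y = (t \<otimes>[sec X U] u) \<otimes>[sec X U] a [^][sec X U] (n + m)"
     using ac by (simp add: A.nat_pow_mult[symmetric] A.m_ac)
    moreover have "t \<otimes>[sec X U] u \<in> Sec U - p0" using tu P.mult_notin by auto
    ultimately show ?thesis unfolding S_def by blast
   qed
   have "\<exists>q. primeideal q (sec X U) \<and> q \<inter> S = {}"
    by (rule A.ideal_maximal_avoiding[OF A.zeroideal S1 pS[OF A.one_closed P.one_notin] S2 dis]) blast+
   then obtain q where q: "primeideal q (sec X U)" "q \<inter> S = {}" by blast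
   have qp: "q \<subseteq> p0" using q(2) pS ideal.Icarr[OF primeideal.axioms(1)[OF q(1)]] by blast
   obtain \<xi> where \<xi>: "\<xi> \<in> U" "ptid U \<xi> = q" using ptex[OF q(1)] by blast
   have \<xi>t: "\<xi> \<in> topspace (zar X)" using \<xi> oU openin_subset by blast
   define K where "K = zar X closure_of {\<xi>}"
   have Kirr: "irreducible_in (zar X) K"
    unfolding irreducible_in_def
   proof (intro conjI allI impI)
    show "K \<noteq> {}" using closure_of_subset[of "{\<xi>}" "zar X"] \<xi>t by (auto simp: K_def)
    show "K \<subseteq> topspace (zar X)" unfolding K_def by (rule closure_of_subset_topspace)
    fix B C assume BC: "closedin (zar X) B \<and> closedin (zar X) C \<and> K \<subseteq> B \<union> C"
    have "\<xi> \<in> K" using closure_of_subset[of "{\<xi>}" "zar X"] \<xi>t by (auto simp: K_def)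
    hence "\<xi> \<in> B \<or> \<xi> \<in> C" using BC by blast
    thus "K \<subseteq> B \<or> K \<subseteq> C" unfolding K_def using BC closure_of_minimal[of "{\<xi>}" _ "zar X"] by blast
   qed
   have "L \<subseteq> (topspace (zar X) - U) \<union> K"
   proof
    fix y assume y: "y \<in> L"
    hence yt: "y \<in> topspace (zar X)" using Lcl closedin_subset by blast
    show "y \<in> (topspace (zar X) - U) \<union> K"
    proof (cases "y \<in> U")
     case True
     have "vanishing U K \<subseteq> ptid U \<xi>"
      using \<xi> closure_of_subset[of "{\<xi>}" "zar X"] \<xi>t by (auto simp: vanishing_def K_def)
     also have "\<dots> \<subseteq> ptid U y" using inL[OF True] y qp \<xi>(2) by blast
     finally show ?thesis using vanishing_iff[OF U(1) _ True, of K] by (simp add: K_def)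
    qed (use yt in auto)
   qed
   moreover have "\<not> L \<subseteq> topspace (zar X) - U" using z U by auto
   moreover have "closedin (zar X) (topspace (zar X) - U)" "closedin (zar X) K" using oU by (auto simp: K_def)
   ultimately have "L \<subseteq> K" using Lirr unfolding irreducible_in_def by blast
   hence "K = L" by (rule Lmax[OF Kirr])
   hence "\<xi> \<in> L" using closure_of_subset[of "{\<xi>}" "zar X"] \<xi>t by (auto simp: K_def)
   hence "a \<in> q" using inL[OF \<xi>(1)] \<xi>(2) a by auto
   thus False using q(2) aS by auto
  qed
  then obtain t n where t: "t \<in> Sec U - p0" "t \<otimes>[sec X U] a [^][sec X U] (n::nat) = \<zero>[sec X U]"
   unfolding S_def by auto
  \<comment> \<open>Nilpotent: its power with exponent \<open>Suc n\<close> contains the factor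
    \<open>t \<otimes> a [^] n\<close>, which is zero.\<close>
  define s where "s = t \<otimes>[sec X U] a"
  have sc: "s \<in> Sec U" using t ac by (simp add: s_def)
  have "s [^][sec X U] Suc n = (t [^][sec X U] n \<otimes>[sec X U] a) \<otimes>[sec X U] (t \<otimes>[sec X U] a [^][sec X U] n)"
   unfolding s_def using t(1) ac by (simp add: A.nat_pow_distrib A.m_ac)
  also have "\<dots> = \<zero>[sec X U]" unfolding t(2) using t(1) ac by simp
  finally have sn: "s [^][sec X U] Suc n = \<zero>[sec X U]" .
  have "closure_ideal X W \<eta> U (s [^][sec X U] Suc n)"
   unfolding closure_ideal_def sn using oU \<eta>(1) oW rest_zero[OF oU, of "U \<inter> W"] by (intro exI[of _ U]) auto
  moreover have "closure_reduced_at X W \<eta>" using V(3) \<eta>L \<eta>G Q(2) by (auto simp: G_def)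
  ultimately have "closure_ideal X W \<eta> U s" unfolding closure_reduced_at_def using oU \<eta>(1) sc by blast
  then obtain N where N: "opn N" "\<eta> \<in> N" "N \<subseteq> U" "res U (N \<inter> W) s = \<zero>[sec X (N \<inter> W)]"
   by (auto simp: closure_ideal_def)
  \<comment> \<open>The closure ideal only gives vanishing on \<open>N \<inter> W\<close>; as \<eta>
    lies in \<open>W\<close>, this is a neighbourhood of \<eta>.\<close>
  have NW: "opn (N \<inter> W)" "\<eta> \<in> N \<inter> W" "N \<inter> W \<subseteq> U" using N oW \<eta>G by (auto simp: G_def)
  have "res U (N \<inter> W) s = res U (N \<inter> W) \<zero>[sec X U]" using N(4) rest_zero[OF oU NW(1,3)] by simp
  then obtain f where f: "f \<in> Sec U" "inv_at U \<eta> f" "f \<otimes>[sec X U] s = f \<otimes>[sec X U] \<zero>[sec X U]"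
   using eq_near[OF U(1) sc A.zero_closed NW] by blast
  have fp: "f \<notin> p0" using f(2) \<eta>(2) by (auto simp: ptid_def)
  have "(f \<otimes>[sec X U] t) \<otimes>[sec X U] a = \<zero>[sec X U]" using f(1,3) t(1) ac by (simp add: s_def A.m_assoc)
  moreover have "f \<otimes>[sec X U] t \<in> Sec U - p0" using P.mult_notin[of f t] f(1) t(1) fp by auto
  ultimately show ?thesis by blast
 qed
 have pts: "\<exists>x\<in>U. x \<in> L - \<Union>\<B> \<and> closed_point X x \<and> p0 \<subseteq> ptid U x \<and> T \<inter> ptid U x = {}"
  if T: "countable T" "T \<subseteq> Sec U - p0" for T
 proof -
  \<comment> \<open>Adding \<open>f0\<close> to the elements to be avoided keeps the point inside
    \<open>G\<close>, and thus off the exceptional sets.\<close>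
  obtain m where m: "primeideal m (sec X U)" "p0 \<subseteq> m" "insert f0 T \<inter> m = {}"
   "\<And>a. a \<in> Sec U \<Longrightarrow> \<exists>c. a \<ominus>[sec X U] scal X U c \<in> m"
   by (rule A.point_avoiding_countable[OF A.countable_dim_finite_type[OF U(3)] p0, of "insert f0 T"])
    (use T f0(1) f0p in auto)
  obtain x where x: "x \<in> U" "ptid U x = m" using ptex[OF m(1)] by blast
  have "cpoint x" unfolding cpoint_def using U x m(4) by (intro exI[of _ U]) (auto simp: ptid_def)
  moreover have "x \<in> L" using inL[OF x(1)] x(2) m(2) by simp
  moreover have "x \<in> G" using f0 m(3) x by (auto simp: ptid_def DX_def)
  ultimately show ?thesis using x m(2,3) cpoint_iff_closed by (intro bexI[of _ x]) (auto simp: G_def)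
 qed
 show ?thesis by (rule that[OF U(1,3) p0 red pts])
qed

end

section \<open>One-point schemes of local algebras\<close>

definition trivial_ring :: "'a \<Rightarrow> 'a ring" where
 "trivial_ring z = \<lparr>carrier = {z}, mult = (\<lambda>_ _. z), one = z, zero = z, add = (\<lambda>_ _. z)\<rparr>"

lemma trivial_ring_simps [simp]:
 "carrier (trivial_ring z) = {z}" "x \<otimes>[trivial_ring z] y = z" "\<one>[trivial_ring z] = z"
 "\<zero>[trivial_ring z] = z" "x \<oplus>[trivial_ring z] y = z"
 by (simp_all add: trivial_ring_def)

lemma singleton_cring:
 assumes "carrier R = {z}" "z \<otimes>[R] z = z" "\<one>[R] = z" "\<zero>[R] = z" "z \<oplus>[R] z = z"
 shows "cring R"
proof (rule cringI)
 show "abelian_group R" by (rule abelian_groupI) (use assms in auto)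
 show "Group.comm_monoid R" by (rule comm_monoidI) (use assms in auto)
qed (use assms in auto)

lemma cring_trivial_ring: "cring (trivial_ring z)"
 by (rule singleton_cring) auto

text \<open>The spectrum of a local algebra with a single prime, whose point is the number 0. The
  empty set receives the zero ring on the zero of \<open>A\<close>, so that all sections are complex
  numbers as the test schemes require.\<close>

definition point_scheme :: "complex ring \<Rightarrow> (complex \<Rightarrow> complex) \<Rightarrow> (complex, complex) cspace" where
 "point_scheme A k = \<lparr>zar = discrete_topology {0},
  sec = (\<lambda>U. if 0 \<in> U then A else trivial_ring \<zero>[A]),
  rest = (\<lambda>U V s. if 0 \<in> V then s else \<zero>[A]),
  scal = (\<lambda>U c. if 0 \<in> U then k c else \<zero>[A])\<rparr>"

text \<open>Local algebras with residue map \<open>v\<close> onto the complex numbers whose maximal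
  ideal consists of elements of square zero; the instances are the complex numbers and the dual
  numbers.\<close>

locale point_algebra = cring A for A :: "complex ring" (structure) +
 fixes k v :: "complex \<Rightarrow> complex"
 assumes k: "k \<in> ring_hom CC A" and v: "v \<in> ring_hom A CC" and vk: "\<And>c. v (k c) = c"
  and unit: "\<And>a. a \<in> carrier A \<Longrightarrow> v a \<noteq> 0 \<Longrightarrow> a \<in> Units A"
  and nil: "\<And>a. a \<in> carrier A \<Longrightarrow> v a = 0 \<Longrightarrow> a \<otimes> a = \<zero>"
  and ft: "finite_type_algebra A k"
begin

abbreviation T :: "(complex, complex) cspace" where "T \<equiv> point_scheme A k"

lemma zarT: "zar T = discrete_topology {0}"
 by (simp add: point_scheme_def)

lemma T_simps [simp]:
 "0 \<in> U \<Longrightarrow> sec T U = A" "0 \<notin> U \<Longrightarrow> sec T U = trivial_ring \<zero>"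
 "0 \<in> V \<Longrightarrow> rest T U V s = s" "0 \<notin> V \<Longrightarrow> rest T U V s = \<zero>"
 "0 \<in> U \<Longrightarrow> scal T U c = k c" "0 \<notin> U \<Longrightarrow> scal T U c = \<zero>"
 by (simp_all add: point_scheme_def)

lemma openT: "openin (zar T) U \<longleftrightarrow> U = {} \<or> U = {0}"
 by (auto simp: zarT)

lemma v_zero: "v \<zero> = 0"
 using ring_hom_zero[OF v ring_axioms cring.axioms(1)[OF cring_CC]] by simp

lemma v_one: "v \<one> = 1" using ring_hom_one[OF v] by simp

lemma unit_iff: "a \<in> carrier A \<Longrightarrow> a \<in> Units A \<longleftrightarrow> v a \<noteq> 0"
proof
 assume "a \<in> Units A"
 then obtain b where b: "b \<in> carrier A" "a \<in> carrier A" "b \<otimes> a = \<one>" by (auto simp: Units_def)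
 hence "v b * v a = 1" using ring_hom_mult[OF v b(1,2)] v_one by simp
 thus "v a \<noteq> 0" by auto
qed (rule unit)

lemma ringed_T: "ringed_cspace T"
 unfolding ringed_cspace_def
proof (intro conjI allI impI; (elim conjE)?)
 fix U assume U: "openin (zar T) U"
 show "cring (sec T U)" using U cring_axioms cring_trivial_ring by (auto simp: openT)
 show "scal T U \<in> ring_hom CC (sec T U)"
  using U k by (auto simp: openT intro!: ring_hom_memI simp: ring_hom_closed[OF k] ring_hom_mult[OF k, simplified]
    ring_hom_add[OF k, simplified] ring_hom_one[OF k, simplified])
 show "\<forall>s\<in>carrier (sec T U). rest T U U s = s" using U by (auto simp: openT)
next
 fix U V assume U: "openin (zar T) U" "openin (zar T) V" "V \<subseteq> U"
 have c: "V = {} \<or> V = {0} \<and> U = {0}" using U unfolding openT by blast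
 show "rest T U V \<in> ring_hom (sec T U) (sec T V)"
 proof (cases "V = {}")
  case False
  hence "V = {0}" "U = {0}" using c by auto
  thus ?thesis by (intro ring_hom_memI) simp_all
 qed (intro ring_hom_memI, simp_all)
 show "rest T U V (scal T U c) = scal T V c" for c
 proof (cases "V = {}")
  case False
  hence "V = {0}" "U = {0}" using c by auto
  thus ?thesis by simp
 qed simp
next
 fix U V W assume "openin (zar T) U" "openin (zar T) V" "openin (zar T) W" "W \<subseteq> V" "V \<subseteq> U"
 hence c: "W = {} \<or> W = {0} \<and> V = {0} \<and> U = {0}" unfolding openT by blast
 show "\<forall>s\<in>carrier (sec T U). rest T V W (rest T U V s) = rest T U W s"
 proof (cases "W = {}")
  case False
  hence "W = {0}" "V = {0}" "U = {0}" using c by auto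
  thus ?thesis by simp
 qed simp
next
 fix \<U> s
 assume a: "\<forall>U\<in>\<U>. openin (zar T) U \<and> s U \<in> carrier (sec T U)"
 have sub: "U = {} \<or> U = {0}" if "U \<in> \<U>" for U using a that openT by blast
 show "\<exists>!t. t \<in> carrier (sec T (\<Union>\<U>)) \<and> (\<forall>U\<in>\<U>. rest T (\<Union>\<U>) U t = s U)"
 proof (cases "{0} \<in> \<U>")
  case True
  hence un: "\<Union>\<U> = {0}" using sub by blast
  have e: "s {} = \<zero>" if "{} \<in> \<U>" using a that by fastforce
  have z: "s {0} \<in> carrier A" using a True by fastforce
  show ?thesis
   unfolding un
  proof (rule ex1I[of _ "s {0}"], intro conjI ballI)
   show "s {0} \<in> carrier (sec T {0})" using z by simp
   fix U assume U: "U \<in> \<U>"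
   from sub[OF U] show "rest T {0} U (s {0}) = s U"
   proof
    assume "U = {}"
    thus ?thesis using e U by simp
   qed simp
  next
   fix t assume "t \<in> carrier (sec T {0}) \<and> (\<forall>U\<in>\<U>. rest T {0} U t = s U)"
   hence "rest T {0} {0} t = s {0}" using True by blast
   thus "t = s {0}" by simp
  qed
 next
  case False
  hence "0 \<notin> \<Union>\<U>" using sub by blast
  moreover have "s U = \<zero>" "0 \<notin> U" if "U \<in> \<U>" for U using a sub[OF that] False that by fastforce+
  ultimately show ?thesis by (intro ex1I[of _ "\<zero>"]) auto
 qed
qed

sublocale ringed T by (simp add: ringed_def ringed_T)

lemma invertible_T: "s \<in> carrier A \<Longrightarrow> invertible_at T {0} 0 s \<longleftrightarrow> v s \<noteq> 0"
 unfolding invertible_at_def openT using unit_iff[of s] by (simp add: conj_disj_distribR ex_disj_distrib)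

lemma ptid_T: "ptid {0} 0 = {a \<in> carrier A. v a = 0}"
 using invertible_T by (auto simp: ptid_def)

lemma DX_T: "f \<in> carrier A \<Longrightarrow> DX {0} f = (if v f = 0 then {} else {0})"
 using invertible_T by (auto simp: DX_def)

text \<open>Elements of the kernel of \<open>v\<close> have square zero and lie in every prime; all
  other elements are units.\<close>

lemma primes_A: "primeideal p A \<longleftrightarrow> p = {a \<in> carrier A. v a = 0}"
proof
 assume p: "primeideal p A"
 interpret p: primeideal p A by (rule p)
 have "a \<in> p" if "a \<in> carrier A" "v a = 0" for a
  using p.I_prime[of a a] nil[OF that] that additive_subgroup.zero_closed[OF ideal.axioms(1)[OF p.is_ideal]] by auto
 moreover have "v a = 0" if a: "a \<in> p" for a
 proof (rule ccontr)
  assume "v a \<noteq> 0"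
  then obtain b where "b \<in> carrier A" "b \<otimes> a = \<one>" using unit p.Icarr[OF a] by (auto simp: Units_def)
  thus False using p.I_l_closed[OF a, of b] p.one_notin by simp
 qed
 ultimately show "p = {a \<in> carrier A. v a = 0}" using p.Icarr by blast
next
 interpret C: cring CC by (rule cring_CC)
 have "primeideal {0} CC"
 proof (rule primeidealI)
  show "ideal {0} CC" using C.zeroideal by simp
  show "cring CC" by (rule cring_CC)
  have "(1::complex) \<notin> {0}" by simp
  thus "carrier CC \<noteq> {0}" by (metis CC_simps(1) UNIV_I)
 qed auto
 from prime_vimage[OF cring_axioms cring_CC v this] show "p = {a \<in> carrier A. v a = 0} \<Longrightarrow> primeideal p A" by simp
qed

lemma aff_T: "aff {0}"
 unfolding aff_def
proof (intro conjI allI impI ballI; (elim conjE)?)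
 show "opn {0}" by (simp add: openT)
 show "bij_betw (ptid {0}) {0} {p. primeideal p (sec T {0})}"
  by (simp add: primes_A ptid_T bij_betw_def)
next
 fix V x assume "opn V" "V \<subseteq> {0}" "x \<in> V"
 hence "V = {0}" "x = 0" by (auto simp: openT)
 thus "\<exists>f\<in>carrier (sec T {0}). x \<in> DX {0} f \<and> DX {0} f \<subseteq> V"
  using DX_T[of \<one>] v_one by (intro bexI[of _ \<one>]) auto
next
 fix f s assume f: "f \<in> carrier (sec T {0})" "s \<in> carrier (sec T {0})"
  and z: "rest T {0} (DX {0} f) s = \<zero>[sec T (DX {0} f)]"
 show "\<exists>n::nat. f [^][sec T {0}] n \<otimes>[sec T {0}] s = \<zero>[sec T {0}]"
 proof (cases "v f = 0")
  case True
  \<comment> \<open>Here \<open>DX {0} f\<close> is empty, and the exponent 2 works for every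
    \<open>s\<close> because \<open>f\<close> has square zero.\<close>
  hence "f [^] (2::nat) = \<zero>" using nil f by (simp add: numeral_2_eq_2)
  thus ?thesis using f by (intro exI[of _ 2]) simp
 next
  case False
  hence "s = \<zero>" using z f by (simp add: DX_T)
  thus ?thesis using f by (intro exI[of _ "0::nat"]) simp
 qed
next
 fix f u assume f: "f \<in> carrier (sec T {0})" and u: "u \<in> carrier (sec T (DX {0} f))"
 show "\<exists>n::nat. \<exists>a\<in>carrier (sec T {0}). rest T {0} (DX {0} f) (f [^][sec T {0}] n) \<otimes>[sec T (DX {0} f)] u = rest T {0} (DX {0} f) a"
 proof (cases "v f = 0")
  case True
  thus ?thesis using f u by (intro exI[of _ "0::nat"] bexI[of _ "\<zero>"]) (simp_all add: DX_T)
 next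
  case False
  thus ?thesis using f u by (intro exI[of _ "0::nat"] bexI[of _ u]) (simp_all add: DX_T)
 qed
qed

text \<open>The zero ring has no primes. The empty set has to be treated because a family assigns an
  ideal to every affine open set.\<close>

lemma aff_empty: "aff {}"
proof -
 have "\<not> primeideal p (trivial_ring \<zero>)" for p
 proof
  assume "primeideal p (trivial_ring \<zero>)"
  then interpret p: primeideal p "trivial_ring \<zero>" .
  show False using p.one_notin additive_subgroup.zero_closed[OF ideal.axioms(1)[OF p.is_ideal]] by simp
 qed
 thus ?thesis by (simp add: aff_def bij_betw_def DX_def openT)
qed

lemma affine_T: "affine_open T U \<longleftrightarrow> U = {} \<or> U = {0}"
 using affine_open_iff_aff aff_T aff_empty affD(1) openT by metis

lemma finite_type_T: "finite_type_scheme T"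
 unfolding finite_type_scheme_def
proof (intro conjI ballI)
 show "compact_space (zar T)" by (simp add: zarT compact_space_discrete_topology)
 show "\<exists>U. affine_open T U \<and> x \<in> U \<and> finite_type_algebra (sec T U) (scal T U)" if "x \<in> topspace (zar T)" for x
 proof -
  have "scal T {0} = k" by (auto simp: fun_eq_iff)
  thus ?thesis using that affine_T ft by (intro exI[of _ "{0}"]) (auto simp: zarT)
 qed
qed (rule ringed_T)

lemma value_T: "s \<in> carrier A \<Longrightarrow> value_at T {0} 0 s = v s"
proof -
 assume s: "s \<in> carrier A"
 have kc: "k c \<in> carrier A" for c using ring_hom_closed[OF k, of c] by simp
 interpret v: ring_hom_ring A CC v using v ring_axioms cring_CC by (simp add: ring_hom_ringI2 cring.axioms(1))
 have "v (s \<ominus> k c) = v s - c" for c using s kc vk[of c] by (simp add: a_minus_def)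
 hence "\<not> invertible_at T {0} 0 (s \<ominus> k c) \<longleftrightarrow> c = v s" for c
  using invertible_T[of "s \<ominus> k c"] s kc[of c] by auto
 thus ?thesis unfolding value_at_def by simp
qed

lemma closed_point_T: "closed_point T t \<longleftrightarrow> t = 0"
 by (auto simp: closed_point_def zarT)

end

subsection \<open>Laurent polynomials over a ring\<close>

lemma exponents_mono: "F \<subseteq> G \<Longrightarrow> exponents F n \<subseteq> exponents G n"
 by (auto simp: exponents_def)

lemma forms_mono: "F \<subseteq> G \<Longrightarrow> forms R F n \<subseteq> forms R G n"
proof
 fix p assume "F \<subseteq> G" "p \<in> forms R F n"
 hence "(\<forall>e. p e \<in> carrier R) \<and> finite {e. p e \<noteq> \<zero>[R]}" "{e. p e \<noteq> \<zero>[R]} \<subseteq> exponents G n"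
  using order_trans[OF _ exponents_mono[of F G n]] by (simp_all add: forms_def)
 thus "p \<in> forms R G n" by (simp add: forms_def)
qed

lemma exponents_add: "a \<in> exponents F n \<Longrightarrow> b \<in> exponents F m \<Longrightarrow> a + b \<in> exponents F (n + m)"
 by (auto simp: exponents_def sum.distrib)

lemma P3_ring_simps [simp]:
 "carrier (P3_ring R F) = forms R F 0" "p \<otimes>[P3_ring R F] q = laurent_mult R p q"
 "\<one>[P3_ring R F] = laurent_const R \<one>[R]" "\<zero>[P3_ring R F] = laurent_const R \<zero>[R]"
 "p \<oplus>[P3_ring R F] q = (\<lambda>e. p e \<oplus>[R] q e)"
 by (simp_all add: P3_ring_def)

lemma laurent_const_zero: "laurent_const R \<zero>[R] = (\<lambda>e. \<zero>[R])"
 by (auto simp: laurent_const_def)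

lemma formsD:
 assumes "p \<in> forms R F n"
 shows "p e \<in> carrier R" "finite {e. p e \<noteq> \<zero>[R]}" "e \<notin> exponents F n \<Longrightarrow> p e = \<zero>[R]"
 using assms by (auto simp: forms_def)

lemma formsI:
 assumes "\<And>e. p e \<in> carrier R" "finite B" "\<And>e. e \<notin> B \<Longrightarrow> p e = \<zero>[R]" "\<And>e. e \<notin> exponents F n \<Longrightarrow> p e = \<zero>[R]"
 shows "p \<in> forms R F n"
proof -
 have "{e. p e \<noteq> \<zero>[R]} \<subseteq> B" using assms(3) by auto
 hence "finite {e. p e \<noteq> \<zero>[R]}" by (rule finite_subset) (rule assms(2))
 thus ?thesis using assms(1,4) by (auto simp: forms_def)
qed

lemma laurent_const_form: "r \<in> carrier R \<Longrightarrow> \<zero>[R] \<in> carrier R \<Longrightarrow> laurent_const R r \<in> forms R F 0"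
 by (rule formsI[of _ _ "{0}"]) (auto simp: laurent_const_def exponents_def)

context base_ring
begin

lemma laurent_mult_superset:
 assumes "p \<in> forms R F n" "q \<in> forms R G m" "finite B" "{e. p e \<noteq> \<zero>} \<subseteq> B"
 shows "laurent_mult R p q e = (\<Oplus>a\<in>B. p a \<otimes> q (e - a))"
 unfolding laurent_mult_def
 by (rule add.finprod_mono_neutral_cong_left[OF assms(3,4)]) (use formsD(1)[OF assms(1)] formsD(1)[OF assms(2)] in auto)

lemma laurent_mult_form:
 assumes p: "p \<in> forms R F n" and q: "q \<in> forms R F m"
 shows "laurent_mult R p q \<in> forms R F (n + m)"
proof (rule formsI[where B = "(\<lambda>(a, b). a + b) ` ({e. p e \<noteq> \<zero>} \<times> {e. q e \<noteq> \<zero>})"])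
 show "laurent_mult R p q e \<in> carrier R" for e
  unfolding laurent_mult_def using formsD(1)[OF p] formsD(1)[OF q] by (intro finsum_closed) auto
 show "finite ((\<lambda>(a, b). a + b) ` ({e. p e \<noteq> \<zero>} \<times> {e. q e \<noteq> \<zero>}))"
  using formsD(2)[OF p] formsD(2)[OF q] by blast
 show "laurent_mult R p q e = \<zero>" if "e \<notin> (\<lambda>(a, b). a + b) ` ({e. p e \<noteq> \<zero>} \<times> {e. q e \<noteq> \<zero>})" for e
  unfolding laurent_mult_def
 proof (rule add.finprod_one_eqI)
  fix a assume a: "a \<in> {e. p e \<noteq> \<zero>}"
  have "q (e - a) = \<zero>"
  proof (rule ccontr)
   assume "q (e - a) \<noteq> \<zero>"
   hence "(\<lambda>(a, b). a + b) (a, e - a) \<in> (\<lambda>(a, b). a + b) ` ({e. p e \<noteq> \<zero>} \<times> {e. q e \<noteq> \<zero>})" using a by blast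
   thus False using that by simp
  qed
  thus "p a \<otimes> q (e - a) = \<zero>" using formsD(1)[OF p] by simp
 qed
 show "laurent_mult R p q e = \<zero>" if e: "e \<notin> exponents F (n + m)" for e
  unfolding laurent_mult_def
 proof (rule add.finprod_one_eqI)
  fix a assume a: "a \<in> {e. p e \<noteq> \<zero>}"
  hence "a \<in> exponents F n" using formsD(3)[OF p] by blast
  moreover have "e = a + (e - a)" by simp
  ultimately have "e - a \<notin> exponents F m" using e exponents_add by metis
  thus "p a \<otimes> q (e - a) = \<zero>" using formsD(1)[OF p] formsD(3)[OF q] by simp
 qed
qed

lemma forms_add: "p \<in> forms R F n \<Longrightarrow> q \<in> forms R F n \<Longrightarrow> (\<lambda>e. p e \<oplus> q e) \<in> forms R F n"
 by (rule formsI[where B = "{e. p e \<noteq> \<zero>} \<union> {e. q e \<noteq> \<zero>}"]) (auto simp: formsD)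

lemma forms_smult: "p \<in> forms R F n \<Longrightarrow> a \<in> carrier R \<Longrightarrow> (\<lambda>e. a \<otimes> p e) \<in> forms R F n"
 by (rule formsI[where B = "{e. p e \<noteq> \<zero>}"]) (auto simp: formsD)

lemma laurent_const_mult:
 assumes "a \<in> carrier R" "q \<in> forms R F n"
 shows "laurent_mult R (laurent_const R a) q = (\<lambda>e. a \<otimes> q e)"
proof
 fix e
 have "laurent_mult R (laurent_const R a) q e = (\<Oplus>b\<in>{0}. laurent_const R a b \<otimes> q (e - b))"
  by (rule laurent_mult_superset[OF laurent_const_form assms(2)]) (use assms in \<open>auto simp: laurent_const_def split: if_splits\<close>)
 also have "\<dots> = a \<otimes> q e" using assms formsD(1)[OF assms(2)] by (simp add: laurent_const_def)
 finally show "laurent_mult R (laurent_const R a) q e = a \<otimes> q e" .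
qed

end

lemma forms_hom:
 assumes "ring R" "ring S" "h \<in> ring_hom R S" "p \<in> forms R F n"
 shows "(\<lambda>e. h (p e)) \<in> forms S F n"
proof (rule formsI[where B = "{e. p e \<noteq> \<zero>[R]}"])
 have "h \<zero>[R] = \<zero>[S]" by (rule ring_hom_zero[OF assms(3,1,2)])
 thus "\<And>e. e \<notin> {e. p e \<noteq> \<zero>[R]} \<Longrightarrow> h (p e) = \<zero>[S]" "\<And>e. e \<notin> exponents F n \<Longrightarrow> h (p e) = \<zero>[S]"
  using formsD(3)[OF assms(4)] by auto
qed (use formsD[OF assms(4)] ring_hom_closed[OF assms(3)] in auto)

text \<open>As \<open>h\<close> may send coefficients to zero, the product of the images is computed
  over the support of \<open>p\<close>, which may exceed that of its image.\<close>

lemma P3_ring_hom: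
 assumes R: "cring R" and S: "cring S" and h: "h \<in> ring_hom R S"
 shows "(\<lambda>p e. h (p e)) \<in> ring_hom (P3_ring R F) (P3_ring S F)"
proof (rule ring_hom_memI; simp)
 interpret R: base_ring R by (rule base_ring.intro[OF R])
 interpret S: base_ring S by (rule base_ring.intro[OF S])
 interpret h: ring_hom_cring R S h using R S h by (simp add: ring_hom_cring.intro ring_hom_cring_axioms.intro)
 fix p assume p: "p \<in> forms R F 0"
 thus "(\<lambda>e. h (p e)) \<in> forms S F 0" using forms_hom[OF R.ring_axioms S.ring_axioms h] by blast
 fix q assume q: "q \<in> forms R F 0"
 show "(\<lambda>e. h (p e \<oplus>[R] q e)) = (\<lambda>e. h (p e) \<oplus>[S] h (q e))" using formsD(1)[OF p] formsD(1)[OF q] by auto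
 show "(\<lambda>e. h (laurent_mult R p q e)) = laurent_mult S (\<lambda>e. h (p e)) (\<lambda>e. h (q e))"
 proof
  fix e
  have "h (laurent_mult R p q e) = (\<Oplus>\<^bsub>S\<^esub>a\<in>{e. p e \<noteq> \<zero>[R]}. h (p a) \<otimes>[S] h (q (e - a)))"
   unfolding laurent_mult_def using formsD(1)[OF p] formsD(1)[OF q]
   by (subst h.hom_finsum) (auto intro!: S.finsum_cong' simp: comp_def)
  also have "\<dots> = laurent_mult S (\<lambda>e. h (p e)) (\<lambda>e. h (q e)) e"
   by (rule S.laurent_mult_superset[symmetric, OF forms_hom[OF R.ring_axioms S.ring_axioms h p]
     forms_hom[OF R.ring_axioms S.ring_axioms h q]]) (use formsD(2)[OF p] in auto)
  finally show "h (laurent_mult R p q e) = laurent_mult S (\<lambda>e. h (p e)) (\<lambda>e. h (q e)) e" .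
 qed
next
 show "(\<lambda>e. h (laurent_const R \<one>[R] e)) = laurent_const S \<one>[S]"
  using ring_hom_one[OF h] ring_hom_zero[OF h cring.axioms(1)[OF R] cring.axioms(1)[OF S]] by (auto simp: laurent_const_def)
qed

subsection \<open>Complex Laurent polynomials\<close>

lemma CC_finsum: "finite B \<Longrightarrow> finsum CC f B = sum f B"
proof -
 interpret cring CC by (rule cring_CC)
 show "finite B \<Longrightarrow> finsum CC f B = sum f B" by (induction B rule: finite_induct) (auto simp: Pi_iff)
qed

abbreviation lmul :: "complex laurent \<Rightarrow> complex laurent \<Rightarrow> complex laurent" where
 "lmul \<equiv> laurent_mult CC"

lemma lmul_eq:
 assumes "finite B" "{e. p e \<noteq> 0} \<subseteq> B"
 shows "lmul p q e = (\<Sum>a\<in>B. p a * q (e - a))"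
proof -
 have "finite {e. p e \<noteq> 0}" using assms finite_subset by blast
 hence "lmul p q e = (\<Sum>a | p a \<noteq> 0. p a * q (e - a))" by (simp add: laurent_mult_def CC_finsum)
 also have "\<dots> = (\<Sum>a\<in>B. p a * q (e - a))" by (rule sum.mono_neutral_left) (use assms in auto)
 finally show ?thesis .
qed

lemma lmul_comm:
 assumes "finite {e. p e \<noteq> 0}" "finite {e. q e \<noteq> 0}"
 shows "lmul p q = lmul q p"
proof
 fix e
 have "lmul p q e = (\<Sum>a | p a \<noteq> 0 \<and> q (e - a) \<noteq> 0. p a * q (e - a))"
  unfolding lmul_eq[OF assms(1) subset_refl] by (rule sum.mono_neutral_right) (use assms in auto)
 also have "\<dots> = (\<Sum>b | q b \<noteq> 0 \<and> p (e - b) \<noteq> 0. q b * p (e - b))"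
  by (rule sum.reindex_bij_witness[of _ "\<lambda>b. e - b" "\<lambda>b. e - b"]) auto
 also have "\<dots> = lmul q p e"
  unfolding lmul_eq[OF assms(2) subset_refl] by (rule sum.mono_neutral_left) (use assms in auto)
 finally show "lmul p q e = lmul q p e" .
qed

lemma lmul_finite:
 assumes "finite {e. p e \<noteq> 0}" "finite {e. q e \<noteq> 0}"
 shows "finite {e. lmul p q e \<noteq> 0}"
proof (rule finite_subset)
 show "{e. lmul p q e \<noteq> 0} \<subseteq> (\<lambda>(a, b). a + b) ` ({e. p e \<noteq> 0} \<times> {e. q e \<noteq> 0})"
 proof
  fix e assume "e \<in> {e. lmul p q e \<noteq> 0}"
  then obtain a where "p a * q (e - a) \<noteq> 0"
   unfolding lmul_eq[OF assms(1) subset_refl] by (auto elim: sum.not_neutral_contains_not_neutral)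
  thus "e \<in> (\<lambda>(a, b). a + b) ` ({e. p e \<noteq> 0} \<times> {e. q e \<noteq> 0})"
   by (intro image_eqI[of _ _ "(a, e - a)"]) auto
 qed
qed (use assms in blast)

lemma lmul_assoc:
 assumes "finite {e. p e \<noteq> 0}" "finite {e. q e \<noteq> 0}" "finite {e. r e \<noteq> 0}"
 shows "lmul (lmul p q) r = lmul p (lmul q r)"
proof
 fix e
 let ?P = "{e. p e \<noteq> 0}" and ?Q = "{e. q e \<noteq> 0}"
 let ?B = "(\<lambda>(a, b). a + b) ` (?P \<times> ?Q)"
 have fB: "finite ?B" using assms by blast
 have sub: "{e. lmul p q e \<noteq> 0} \<subseteq> ?B"
 proof
  fix e assume "e \<in> {e. lmul p q e \<noteq> 0}"
  then obtain a where "p a * q (e - a) \<noteq> 0"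
   unfolding lmul_eq[OF assms(1) subset_refl] by (auto elim: sum.not_neutral_contains_not_neutral)
  thus "e \<in> ?B" by (intro image_eqI[of _ _ "(a, e - a)"]) auto
 qed
 have inner: "(\<Sum>c\<in>?B. q (c - a) * r (e - c)) = (\<Sum>b\<in>?Q. q b * r (e - a - b))" if a: "a \<in> ?P" for a
 proof -
  have "(\<Sum>c\<in>?B. q (c - a) * r (e - c)) = (\<Sum>c\<in>(\<lambda>b. a + b) ` ?Q. q (c - a) * r (e - c))"
  proof (rule sum.mono_neutral_right[OF fB])
   show "(\<lambda>b. a + b) ` ?Q \<subseteq> ?B" using a by force
   show "\<forall>c\<in>?B - (\<lambda>b. a + b) ` ?Q. q (c - a) * r (e - c) = 0"
   proof
    fix c assume c: "c \<in> ?B - (\<lambda>b. a + b) ` ?Q"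
    have "c = a + (c - a)" by simp
    hence "q (c - a) = 0" using c by blast
    thus "q (c - a) * r (e - c) = 0" by simp
   qed
  qed
  also have "\<dots> = (\<Sum>b\<in>?Q. q b * r (e - a - b))"
   by (subst sum.reindex) (auto simp: inj_on_def diff_diff_eq intro!: sum.cong)
  finally show ?thesis .
 qed
 have "lmul (lmul p q) r e = (\<Sum>c\<in>?B. (\<Sum>a\<in>?P. p a * q (c - a)) * r (e - c))"
  unfolding lmul_eq[OF fB sub] lmul_eq[OF assms(1) subset_refl] by simp
 also have "\<dots> = (\<Sum>c\<in>?B. \<Sum>a\<in>?P. p a * (q (c - a) * r (e - c)))"
  by (simp add: sum_distrib_right mult.assoc)
 also have "\<dots> = (\<Sum>a\<in>?P. \<Sum>c\<in>?B. p a * (q (c - a) * r (e - c)))"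
  by (rule sum.swap)
 also have "\<dots> = (\<Sum>a\<in>?P. p a * (\<Sum>c\<in>?B. q (c - a) * r (e - c)))"
  by (simp add: sum_distrib_left)
 also have "\<dots> = (\<Sum>a\<in>?P. p a * (\<Sum>b\<in>?Q. q b * r (e - a - b)))"
  by (rule sum.cong) (use inner in auto)
 also have "\<dots> = lmul p (lmul q r) e"
  unfolding lmul_eq[OF assms(1) subset_refl] lmul_eq[OF assms(2) subset_refl] by simp
 finally show "lmul (lmul p q) r e = lmul p (lmul q r) e" .
qed

lemma lmul_add_right: "lmul p (\<lambda>e. q e + r e) = (\<lambda>e. lmul p q e + lmul p r e)" if "finite {e. p e \<noteq> 0}"
 unfolding fun_eq_iff lmul_eq[OF that subset_refl] by (simp add: distrib_left sum.distrib)

lemma lmul_add_left: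
 assumes "finite {e. p e \<noteq> 0}" "finite {e. q e \<noteq> 0}" "finite {e. r e \<noteq> 0}"
 shows "lmul (\<lambda>e. q e + r e) p = (\<lambda>e. lmul q p e + lmul r p e)"
proof -
 have "finite {e. q e + r e \<noteq> 0}" by (rule finite_subset[of _ "{e. q e \<noteq> 0} \<union> {e. r e \<noteq> 0}"]) (use assms in auto)
 thus ?thesis using lmul_add_right[OF assms(1), of q r] lmul_comm assms by metis
qed

lemma cring_P3_CC: "cring (P3 F)"
proof -
 interpret C: base_ring CC by (rule base_ring.intro[OF cring_CC])
 have fin: "finite {e. p e \<noteq> 0}" if "p \<in> forms CC F n" for p n using formsD(2)[OF that] by simp
 have one: "laurent_const CC 1 \<in> forms CC F 0" "laurent_const CC 0 \<in> forms CC F 0"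
  using laurent_const_form[of _ CC F] by auto
 show ?thesis
 proof (rule cringI)
  show "abelian_group (P3 F)"
  proof (rule abelian_groupI; simp)
   fix x assume x: "x \<in> forms CC F 0"
   show "\<exists>y\<in>forms CC F 0. (\<lambda>e. y e + x e) = laurent_const CC 0"
    using C.forms_smult[OF x, of "-1"] by (intro bexI[of _ "\<lambda>e. - x e"]) (auto simp: laurent_const_def)
  qed (use C.forms_add one in \<open>auto simp: laurent_const_def add_ac\<close>)
  show "Group.comm_monoid (P3 F)"
  proof (rule comm_monoidI; simp)
   show "\<And>x y. x \<in> forms CC F 0 \<Longrightarrow> y \<in> forms CC F 0 \<Longrightarrow> lmul x y \<in> forms CC F 0"
    using C.laurent_mult_form[of _ F 0 _ 0] by simp
   show "laurent_const CC 1 \<in> forms CC F 0" by (rule one)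
   show "\<And>x y z. x \<in> forms CC F 0 \<Longrightarrow> y \<in> forms CC F 0 \<Longrightarrow> z \<in> forms CC F 0 \<Longrightarrow> lmul (lmul x y) z = lmul x (lmul y z)"
    using lmul_assoc fin by blast
   show "\<And>x. x \<in> forms CC F 0 \<Longrightarrow> lmul (laurent_const CC 1) x = x" using C.laurent_const_mult[of 1] by simp
   show "\<And>x y. x \<in> forms CC F 0 \<Longrightarrow> y \<in> forms CC F 0 \<Longrightarrow> lmul x y = lmul y x" using lmul_comm fin by blast
  qed
  show "\<And>x y z. x \<in> carrier (P3 F) \<Longrightarrow> y \<in> carrier (P3 F) \<Longrightarrow> z \<in> carrier (P3 F) \<Longrightarrow>
   (x \<oplus>[P3 F] y) \<otimes>[P3 F] z = x \<otimes>[P3 F] z \<oplus>[P3 F] y \<otimes>[P3 F] z"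
   using lmul_add_left fin by simp
 qed
qed

text \<open>The product of the leading monomials for a lexicographic order does not cancel.\<close>

lemma lmul_no_zero_divisors:
 assumes p: "p \<in> forms CC F n" and q: "q \<in> forms CC G m" and z: "lmul p q = (\<lambda>e. 0)"
 shows "p = (\<lambda>e. 0) \<or> q = (\<lambda>e. 0)"
proof (rule ccontr)
 assume "\<not> ?thesis"
 hence ne: "{e. p e \<noteq> 0} \<noteq> {}" "{e. q e \<noteq> 0} \<noteq> {}" by (auto simp: fun_eq_iff)
 have fin: "finite {e. p e \<noteq> 0}" "finite {e. q e \<noteq> 0}" using formsD(2)[OF p] formsD(2)[OF q] by auto
 define S where "S = insert 0 ((\<lambda>(e, k). \<bar>e k\<bar>) ` (({e. p e \<noteq> 0} \<union> {e. q e \<noteq> 0}) \<times> {..<4::nat}))"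
 define M where "M = Max S"
 \<comment> \<open>Exponents are bounded by \<open>M\<close> in absolute value, so differences of
   exponents are bounded by \<open>2 * M\<close>; a base larger than that makes the digits
   unique.\<close>
 define N where "N = 4 * M + 1"
 \<comment> \<open>The lexicographic order encoded as an additive integer weight, the four exponents
   being its digits in base \<open>N\<close>.\<close>
 define w where "w e = (e 0 + N * (e 1 + N * (e 2 + N * e 3)))" for e :: "nat \<Rightarrow> int"
 have M0: "M \<ge> 0" and Mb: "\<bar>e k\<bar> \<le> M" if "p e \<noteq> 0 \<or> q e \<noteq> 0" "k < 4" for e k
 proof -
  have fS: "finite S" using fin by (auto simp: S_def)
  have "0 \<in> S" by (simp add: S_def)
  from Max_ge[OF fS this] show "M \<ge> 0" by (simp add: M_def)
  have "(\<lambda>(e, k). \<bar>e k\<bar>) (e, k) \<in> (\<lambda>(e, k). \<bar>e k\<bar>) ` (({e. p e \<noteq> 0} \<union> {e. q e \<noteq> 0}) \<times> {..<4::nat})"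
   by (rule imageI) (use that in auto)
  hence "\<bar>e k\<bar> \<in> S" by (simp add: S_def)
  from Max_ge[OF fS this] show "\<bar>e k\<bar> \<le> M" by (simp add: M_def)
 qed
 have w_add: "w (a + b) = w a + w b" for a b by (simp add: w_def algebra_simps)
 have digit: "x = 0 \<and> y = 0" if "x + N * y = 0" "\<bar>x\<bar> \<le> 2 * M" for x y :: int
 proof -
  have "y = 0"
  proof (rule ccontr)
   assume "y \<noteq> 0"
   have N0: "N > 0" using that(2) by (simp add: N_def)
   have "\<bar>x\<bar> = N * \<bar>y\<bar>" using that(1) N0 by (metis abs_minus_cancel abs_mult abs_of_pos eq_neg_iff_add_eq_0)
   moreover have "N * \<bar>y\<bar> \<ge> N * 1" using \<open>y \<noteq> 0\<close> N0 by (intro mult_left_mono) auto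
   ultimately have "N \<le> \<bar>x\<bar>" by simp
   thus False using that(2) unfolding N_def by linarith
  qed
  thus ?thesis using that by simp
 qed
 have w_inj: "a = b" if ab: "w a = w b" "p a \<noteq> 0 \<or> q a \<noteq> 0" "p b \<noteq> 0 \<or> q b \<noteq> 0" for a b
 proof -
  define c where "c k = a k - b k" for k
  have c: "\<bar>c k\<bar> \<le> 2 * M" if "k < 4" for k using Mb[OF ab(2) that] Mb[OF ab(3) that] by (simp add: c_def)
  have "c 0 + N * (c 1 + N * (c 2 + N * c 3)) = 0" using ab(1) by (simp add: w_def c_def algebra_simps)
  from digit[OF this c] have 0: "c 0 = 0" "c 1 + N * (c 2 + N * c 3) = 0" by auto
  from digit[OF 0(2) c] have 1: "c 1 = 0" "c 2 + N * c 3 = 0" by auto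
  from digit[OF 1(2) c] have 2: "c 2 = 0" "c 3 = 0" by auto
  have ge: "a k = 0" "b k = 0" if "k \<ge> 4" for k
  proof -
   have "e k = 0" if "p e \<noteq> 0 \<or> q e \<noteq> 0" for e
    using that formsD(3)[OF p, of e] formsD(3)[OF q, of e] \<open>k \<ge> 4\<close> by (auto simp: exponents_def)
   thus "a k = 0" "b k = 0" using ab by auto
  qed
  show "a = b"
  proof
   fix k :: nat
   consider "k = 0" | "k = 1" | "k = 2" | "k = 3" | "k \<ge> 4" by linarith
   thus "a k = b k" by cases (use 0 1 2 ge in \<open>auto simp: c_def\<close>)
  qed
 qed
 obtain a0 where a0: "p a0 \<noteq> 0" "\<And>a. p a \<noteq> 0 \<Longrightarrow> w a \<le> w a0"
  using Max_in[of "w ` {e. p e \<noteq> 0}"] Max_ge[of "w ` {e. p e \<noteq> 0}"] fin(1) ne(1) by fastforce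
 obtain b0 where b0: "q b0 \<noteq> 0" "\<And>a. q a \<noteq> 0 \<Longrightarrow> w a \<le> w b0"
  using Max_in[of "w ` {e. q e \<noteq> 0}"] Max_ge[of "w ` {e. q e \<noteq> 0}"] fin(2) ne(2) by fastforce
 have "lmul p q (a0 + b0) = (\<Sum>a\<in>{e. p e \<noteq> 0}. p a * q (a0 + b0 - a))" by (rule lmul_eq[OF fin(1) subset_refl])
 also have "\<dots> = (\<Sum>a\<in>{a0}. p a * q (a0 + b0 - a))"
 proof (rule sum.mono_neutral_right[OF fin(1)])
  show "\<forall>a\<in>{e. p e \<noteq> 0} - {a0}. p a * q (a0 + b0 - a) = 0"
  proof
   fix a assume a: "a \<in> {e. p e \<noteq> 0} - {a0}"
   have "q (a0 + b0 - a) = 0"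
   proof (rule ccontr)
    assume nz: "q (a0 + b0 - a) \<noteq> 0"
    \<comment> \<open>Weights add up and neither summand exceeds its maximum, so both maxima are
      attained; distinct exponents have distinct weights.\<close>
    have "w (a0 + b0 - a) + w a = w a0 + w b0" using w_add[of "a0 + b0 - a" a] w_add[of a0 b0] by simp
    hence "w a = w a0" using b0(2)[OF nz] a0(2)[of a] a by auto
    thus False using w_inj[of a a0] a a0(1) by auto
   qed
   thus "p a * q (a0 + b0 - a) = 0" by simp
  qed
 qed (use a0 in auto)
 also have "\<dots> = p a0 * q b0" by simp
 finally show False using z a0 b0 by simp
qed

subsection \<open>Families over one-point schemes\<close>

lemma closed_subscheme_ideal: "closed_subscheme R Y \<Longrightarrow> F \<in> charts \<Longrightarrow> ideal (Y F) (P3_ring R F)"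
 unfolding closed_subscheme_def by blast

lemma closed_subscheme_sub: "closed_subscheme R Y \<Longrightarrow> F \<in> charts \<Longrightarrow> Y F \<subseteq> forms R F 0"
 using ideal.Icarr[OF closed_subscheme_ideal] by fastforce

lemma forms_trivial: "forms (trivial_ring z) F n = {\<lambda>_. z}"
 by (auto simp: forms_def)

lemma laurent_const_trivial [simp]: "laurent_const (trivial_ring z) z = (\<lambda>_. z)"
 by (auto simp: laurent_const_def)

lemma cring_P3_trivial: "cring (P3_ring (trivial_ring z) F)"
proof (rule singleton_cring)
 interpret cring "trivial_ring z" by (rule cring_trivial_ring)
 show "carrier (P3_ring (trivial_ring z) F) = {\<lambda>_. z}" by (simp add: forms_trivial)
 have "finsum (trivial_ring z) (\<lambda>a. z) {} = z" by (simp add: finsum_empty)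
 thus "(\<lambda>_. z) \<otimes>[P3_ring (trivial_ring z) F] (\<lambda>_. z) = (\<lambda>_. z)" by (simp add: laurent_mult_def)
qed (auto simp: laurent_const_def)

lemma ideal_P3_trivial: "ideal I (P3_ring (trivial_ring z) F) \<longleftrightarrow> I = {\<lambda>_. z}"
proof -
 interpret cring "P3_ring (trivial_ring z) F" by (rule cring_P3_trivial)
 show ?thesis
 proof
  assume I: "ideal I (P3_ring (trivial_ring z) F)"
  hence "\<zero>[P3_ring (trivial_ring z) F] \<in> I" by (rule additive_subgroup.zero_closed[OF ideal.axioms(1)])
  hence "(\<lambda>_. z) \<in> I" by simp
  moreover have "I \<subseteq> {\<lambda>_. z}" using ideal.Icarr[OF I] by (auto simp: forms_trivial)
  ultimately show "I = {\<lambda>_. z}" by auto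
 next
  have "ideal {\<zero>[P3_ring (trivial_ring z) F]} (P3_ring (trivial_ring z) F)" by (rule zeroideal)
  thus "I = {\<lambda>_. z} \<Longrightarrow> ideal I (P3_ring (trivial_ring z) F)" by simp
 qed
qed

lemma genideal_P3_trivial: "S \<subseteq> {\<lambda>_. z} \<Longrightarrow> genideal (P3_ring (trivial_ring z) F) S = {\<lambda>_. z}"
 unfolding genideal_def ideal_P3_trivial by auto

lemma closed_subscheme_trivial: "closed_subscheme (trivial_ring z) (\<lambda>F. {\<lambda>_. z})"
 unfolding closed_subscheme_def ideal_P3_trivial by (simp add: genideal_P3_trivial)

text \<open>All elements of the quotient are zero, so they are combinations of the empty
  family.\<close>

lemma flat_trivial:
 "flat_hom (trivial_ring z) (P3_ring (trivial_ring z) F Quot {\<lambda>_. z}) h"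
 unfolding flat_hom_def
proof (intro allI impI, elim conjE)
 fix n :: nat and r m
 let ?P = "P3_ring (trivial_ring z) F"
 let ?Q = "?P Quot {\<lambda>_. z}"
 interpret P: cring ?P by (rule cring_P3_trivial)
 interpret I: ideal "{\<lambda>_. z}" ?P by (simp add: ideal_P3_trivial)
 interpret Q: ring ?Q by (rule I.quotient_is_ring)
 interpret Z: cring "trivial_ring z" by (rule cring_trivial_ring)
 assume m: "m \<in> {..<n} \<rightarrow> carrier ?Q"
 have "x = \<zero>[?Q]" if xc: "x \<in> carrier ?Q" for x
 proof -
  obtain y where "y \<in> carrier ?P" "x = {\<lambda>_. z} +>[?P] y" using xc by (auto simp: FactRing_def A_RCOSETS_def')
  hence "x = {\<lambda>_. z} +>[?P] \<zero>[?P]" by (simp add: forms_trivial)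
  also have "\<dots> = {\<lambda>_. z}"
   by (rule P.a_coset_join2[OF _ additive_subgroup.a_subgroup[OF I.is_additive_subgroup]]) (simp_all add: forms_trivial)
  finally show ?thesis by (simp add: FactRing_def)
 qed
 hence "\<forall>i<n. m i = (\<Oplus>\<^bsub>?Q\<^esub>j\<in>{..<0::nat}. h (undefined i j) \<otimes>[?Q] undefined j)" using m by auto
 thus "\<exists>(k::nat) a y. (\<forall>i<n. \<forall>j<k. a i j \<in> carrier (trivial_ring z)) \<and> y \<in> {..<k} \<rightarrow> carrier ?Q \<and>
     (\<forall>i<n. m i = (\<Oplus>\<^bsub>?Q\<^esub>j\<in>{..<k}. h (a i j) \<otimes>[?Q] y j)) \<and>
     (\<forall>j<k. (\<Oplus>\<^bsub>trivial_ring z\<^esub>i\<in>{..<n}. r i \<otimes>[trivial_ring z] a i j) = \<zero>[trivial_ring z])"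
  by (intro exI[of _ "0::nat"]) auto
qed

context point_algebra
begin

text \<open>The family over the one-point scheme with ideal \<open>Y\<close>. On the empty set it
  takes the only ideal that the zero ring offers.\<close>

definition fam :: "complex subscheme \<Rightarrow> complex set \<Rightarrow> complex subscheme" where
 "fam Y U F = (if 0 \<in> U then Y F else {\<lambda>_. \<zero>})"

lemma fam_simps [simp]: "0 \<in> U \<Longrightarrow> fam Y U = Y" "0 \<notin> U \<Longrightarrow> fam Y U = (\<lambda>F. {\<lambda>_. \<zero>})"
 by (auto simp: fam_def)

lemma relative_fam:
 assumes Y: "closed_subscheme A Y"
 shows "relative_subscheme T (fam Y)"
 unfolding relative_subscheme_def
proof (intro conjI allI impI ballI; (elim conjE)?)
 show "closed_subscheme (sec T U) (fam Y U)" if "affine_open T U" for U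
  using that Y closed_subscheme_trivial by (auto simp: affine_T)
 fix U V F assume U: "affine_open T U" "affine_open T V" "V \<subseteq> U" "F \<in> charts"
 show "fam Y V F = genideal (P3_ring (sec T V) F) ((\<lambda>p e. rest T U V (p e)) ` fam Y U F)"
 proof (cases "V = {}")
  case True
  thus ?thesis by (simp add: genideal_P3_trivial image_subset_iff)
 next
  case False
  hence V: "V = {0}" "U = {0}" using U by (auto simp: affine_T)
  have I: "ideal (Y F) (P3_ring A F)" by (rule closed_subscheme_ideal[OF Y U(4)])
  then interpret I: ideal "Y F" "P3_ring A F" .
  have "Y F \<subseteq> carrier (P3_ring A F)" using I.Icarr by blast
  hence "genideal (P3_ring A F) (Y F) = Y F"
   using I.genideal_self I.genideal_minimal[OF I] by blast
  thus ?thesis by (simp add: V)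
 qed
qed

lemma fibre_fam:
 assumes Y: "closed_subscheme A Y" and F: "F \<in> charts"
 shows "fibre T (fam Y) 0 F = (\<lambda>p e. v (p e)) ` Y F"
proof -
 have "Y F \<subseteq> forms A F 0" by (rule closed_subscheme_sub[OF Y F])
 hence val: "(\<lambda>e. value_at T {0} 0 (p e)) = (\<lambda>e. v (p e))" if "p \<in> Y F" for p
  using that value_T formsD(1) by (metis subsetD)
 show ?thesis
 proof (intro Set.equalityI subsetI)
  fix q assume "q \<in> fibre T (fam Y) 0 F"
  then obtain U p where "q = (\<lambda>e. value_at T U 0 (p e))" "affine_open T U" "0 \<in> U" "p \<in> fam Y U F"
   by (auto simp: fibre_def)
  hence "q = (\<lambda>e. value_at T {0} 0 (p e))" "p \<in> Y F" by (auto simp: affine_T)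
  thus "q \<in> (\<lambda>p e. v (p e)) ` Y F" using val by auto
 next
  fix q assume "q \<in> (\<lambda>p e. v (p e)) ` Y F"
  then obtain p where "p \<in> Y F" "q = (\<lambda>e. value_at T {0} 0 (p e))" using val by auto
  thus "q \<in> fibre T (fam Y) 0 F"
   unfolding fibre_def by (intro CollectI exI[of _ "{0}"] exI[of _ p]) (auto simp: affine_T)
 qed
qed

text \<open>The Hilbert polynomial depends on the four standard charts only. This is needed because
  a fibre and the given curve are known to agree on charts, not as functions.\<close>

lemma hilbert_poly_cong:
 assumes "\<And>i. i < 4 \<Longrightarrow> Y {i} = Y' {i}" "has_hilbert_poly Y P"
 shows "has_hilbert_poly Y' P"
proof -
 have "form_ideal Y' n = form_ideal Y n" for n using assms(1) by (auto simp: form_ideal_def)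
 thus ?thesis using assms(2) by (simp add: has_hilbert_poly_def)
qed

lemma hilbert_family_fam:
 assumes Y: "closed_subscheme A Y"
  and fl: "\<And>F. F \<in> charts \<Longrightarrow> flat_hom A (P3_ring A F Quot Y F) (\<lambda>r. Y F +>[P3_ring A F] laurent_const A r)"
  and P: "has_hilbert_poly C P" and C: "\<And>F. F \<in> charts \<Longrightarrow> (\<lambda>p e. v (p e)) ` Y F = C F"
 shows "hilbert_family P T (fam Y)"
 unfolding hilbert_family_def
proof (intro conjI allI impI; (elim conjE)?)
 show "relative_subscheme T (fam Y)" by (rule relative_fam[OF Y])
 fix U F assume "affine_open T U" "F \<in> charts"
 thus "flat_hom (sec T U) (P3_ring (sec T U) F Quot fam Y U F)
   (\<lambda>r. fam Y U F +>[P3_ring (sec T U) F] laurent_const (sec T U) r)"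
  using fl flat_trivial by (auto simp: affine_T)
next
 fix t assume "closed_point T t"
 hence t: "t = 0" by (simp add: closed_point_T)
 have "C {i} = fibre T (fam Y) 0 {i}" if "i < 4" for i
  using that fibre_fam[OF Y, of "{i}"] C[of "{i}"] by (auto simp: charts_def)
 thus "has_hilbert_poly (fibre T (fam Y) t) P" unfolding t using hilbert_poly_cong P by metis
qed

text \<open>A morphism from a one-point scheme is a point \<open>x\<close> with a local homomorphism
  from the stalk at \<open>x\<close>. The stalk is replaced by a family \<open>\<rho>\<close> on the
  neighbourhoods of \<open>x\<close>, compatible with restriction; over open sets without
  \<open>x\<close> the target is the zero ring, hence the default value.\<close>

lemma point_morphism:
 fixes H :: "('q, 's) cspace"
 assumes H: "ringed_cspace H" and x: "x \<in> topspace (zar H)"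
  and hom: "\<And>W. openin (zar H) W \<Longrightarrow> x \<in> W \<Longrightarrow> \<rho> W \<in> ring_hom (sec H W) A"
  and scal: "\<And>W c. openin (zar H) W \<Longrightarrow> x \<in> W \<Longrightarrow> \<rho> W (scal H W c) = k c"
  and rest: "\<And>W V s. openin (zar H) W \<Longrightarrow> openin (zar H) V \<Longrightarrow> V \<subseteq> W \<Longrightarrow> x \<in> V \<Longrightarrow> s \<in> carrier (sec H W) \<Longrightarrow>
   \<rho> V (rest H W V s) = \<rho> W s"
  and loc: "\<And>W s. openin (zar H) W \<Longrightarrow> x \<in> W \<Longrightarrow> s \<in> carrier (sec H W) \<Longrightarrow> v (\<rho> W s) \<noteq> 0 \<Longrightarrow> invertible_at H W x s"
 shows "morphism T H (\<lambda>t\<in>{0}. x, \<lambda>U\<in>{U. openin (zar H) U}. \<lambda>s\<in>carrier (sec H U). if x \<in> U then \<rho> U s else \<zero>)"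
proof -
 have pre: "preim T (\<lambda>t\<in>{0}. x) U = (if x \<in> U then {0} else {})" for U by (auto simp: preim_def zarT)
 interpret H: ringed H by (simp add: ringed_def H)
 show ?thesis
 proof (rule morphismI; (unfold pre)?)
  show "(\<lambda>t\<in>{0}. x) \<in> extensional (topspace (zar T))" by (simp add: zarT)
  show "continuous_map (zar T) (zar H) (\<lambda>t\<in>{0}. x)" using x by (auto simp: continuous_map zarT openT)
  fix U assume U: "openin (zar H) U"
  interpret R: cring "sec H U" by (rule H.sec_cring[OF U])
  show "(\<lambda>U\<in>{U. openin (zar H) U}. \<lambda>s\<in>carrier (sec H U). if x \<in> U then \<rho> U s else \<zero>) U
    \<in> ring_hom (sec H U) (sec T (if x \<in> U then {0} else {}))"
  proof (cases "x \<in> U")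
   case True
   note h = hom[OF U True]
   show ?thesis using True U ring_hom_closed[OF h] ring_hom_mult[OF h] ring_hom_add[OF h] ring_hom_one[OF h]
    by (intro ring_hom_memI) auto
  qed (use U in \<open>auto intro!: ring_hom_memI\<close>)
  show "(\<lambda>U\<in>{U. openin (zar H) U}. \<lambda>s\<in>carrier (sec H U). if x \<in> U then \<rho> U s else \<zero>) U (scal H U c)
    = scal T (if x \<in> U then {0} else {}) c" for c
   using U scal[OF U] H.scal_closed[OF U] by auto
 next
  fix U V s assume UV: "openin (zar H) U" "openin (zar H) V" "V \<subseteq> U" "s \<in> carrier (sec H U)"
  hence "rest H U V s \<in> carrier (sec H V)" using H.rest_closed by blast
  moreover have "x \<in> V \<Longrightarrow> x \<in> U" using UV by auto
  ultimately show "(\<lambda>U\<in>{U. openin (zar H) U}. \<lambda>s\<in>carrier (sec H U). if x \<in> U then \<rho> U s else \<zero>) V (rest H U V s)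
   = rest T (if x \<in> U then {0} else {}) (if x \<in> V then {0} else {})
    ((\<lambda>U\<in>{U. openin (zar H) U}. \<lambda>s\<in>carrier (sec H U). if x \<in> U then \<rho> U s else \<zero>) U s)"
   using UV rest[OF UV(1,2,3) _ UV(4)] by simp
 next
  fix U s t assume *: "openin (zar H) U" "s \<in> carrier (sec H U)" "t \<in> (if x \<in> U then {0::complex} else {})"
   "invertible_at T (if x \<in> U then {0} else {}) t
    ((\<lambda>U\<in>{U. openin (zar H) U}. \<lambda>s\<in>carrier (sec H U). if x \<in> U then \<rho> U s else \<zero>) U s)"
  hence t: "x \<in> U" "t = 0" by (auto split: if_splits)
  have "v (\<rho> U s) \<noteq> 0"
   using *(1,2,4) t invertible_T[of "\<rho> U s"] ring_hom_closed[OF hom[OF *(1) t(1)] *(2)] by simp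
  thus "invertible_at H U ((\<lambda>t\<in>{0}. x) t) s" using loc[OF *(1) t(1) *(2)] t by simp
 qed auto
qed

lemma point_pullback:
 fixes H :: "('q, 's) cspace"
 assumes Zc: "\<And>U F. affine_open H U \<Longrightarrow> F \<in> charts \<Longrightarrow> Z U F \<subseteq> forms (sec H U) F 0"
  and gen: "\<And>U F. affine_open H U \<Longrightarrow> x \<in> U \<Longrightarrow> F \<in> charts \<Longrightarrow>
   genideal (P3_ring A F) ((\<lambda>p e. \<rho> U (p e)) ` Z U F) = Y F"
 shows "is_pullback T H (\<lambda>t\<in>{0}. x, \<lambda>U\<in>{U. openin (zar H) U}. \<lambda>s\<in>carrier (sec H U). if x \<in> U then \<rho> U s else \<zero>) Z (fam Y)"
 unfolding is_pullback_def fst_conv snd_conv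
proof (intro allI impI ballI, elim conjE)
 have pre: "preim T (\<lambda>t\<in>{0}. x) U = (if x \<in> U then {0} else {})" for U by (auto simp: preim_def zarT)
 let ?h = "\<lambda>U\<in>{U. openin (zar H) U}. \<lambda>s\<in>carrier (sec H U). if x \<in> U then \<rho> U s else \<zero>"
 fix U V F assume U: "affine_open H U" "affine_open T V" "(\<lambda>t\<in>{0}. x) ` V \<subseteq> U" and F: "F \<in> charts"
 have oU: "openin (zar H) U" using U(1) by (simp add: affine_open_def)
 show "fam Y V F = genideal (P3_ring (sec T V) F) ((\<lambda>p e. rest T (preim T (\<lambda>t\<in>{0}. x) U) V (?h U (p e))) ` Z U F)"
 proof (cases "V = {}")
  case True
  thus ?thesis by (simp add: genideal_P3_trivial image_subset_iff)
 next
  case False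
  hence V: "V = {0}" "x \<in> U" using U by (auto simp: affine_T)
  have "(\<lambda>p e. rest T (preim T (\<lambda>t\<in>{0}. x) U) V (?h U (p e))) ` Z U F = (\<lambda>p e. \<rho> U (p e)) ` Z U F"
   using V oU Zc[OF U(1) F] formsD(1) by (intro image_cong refl) fastforce
  thus ?thesis using gen[OF U(1) V(2) F] V by simp
 qed
qed

end

subsection \<open>Fibres\<close>

lemma relative_subscheme_sub:
 "relative_subscheme X Z \<Longrightarrow> affine_open X U \<Longrightarrow> F \<in> charts \<Longrightarrow> ideal (Z U F) (P3_ring (sec X U) F)"
 unfolding relative_subscheme_def by (blast intro: closed_subscheme_ideal)

lemma relative_subscheme_forms:
 "relative_subscheme X Z \<Longrightarrow> affine_open X U \<Longrightarrow> F \<in> charts \<Longrightarrow> Z U F \<subseteq> forms (sec X U) F 0"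
 using ideal.Icarr[OF relative_subscheme_sub] by fastforce

context ringed
begin

definition fib :: "('p set \<Rightarrow> 's subscheme) \<Rightarrow> 'p \<Rightarrow> 'p set \<Rightarrow> complex subscheme" where
 "fib Z x U F = (\<lambda>p e. value_at X U x (p e)) ` Z U F"

context
 fixes Z x
 assumes Z: "relative_subscheme X Z" and x: "cpoint x"
begin

lemma value_P3_hom: "aff U \<Longrightarrow> x \<in> U \<Longrightarrow> (\<lambda>p e. value_at X U x (p e)) \<in> ring_hom (P3_ring (sec X U) F) (P3 F)"
 using P3_ring_hom[OF aff_cring cring_CC value_hom[OF x affD(1)]] by blast

text \<open>The image of an ideal under evaluation is an ideal because evaluation is onto: a complex
  Laurent polynomial lifts to one with constant coefficients.\<close>

lemma fib_ideal:
 assumes U: "aff U" "x \<in> U" and F: "F \<in> charts"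
 shows "ideal (fib Z x U F) (P3 F)"
proof -
 have aU: "affine_open X U" using U affine_open_iff_aff by simp
 have oU: "opn U" by (rule affD(1)[OF U(1)])
 note h = value_P3_hom[OF U, of F]
 interpret C: cring "P3 F" by (rule cring_P3_CC)
 interpret I: ideal "Z U F" "P3_ring (sec X U) F" by (rule relative_subscheme_sub[OF Z aU F])
 interpret A: C_algebra "sec X U" "scal X U" by (rule scal_algebra[OF oU])
 interpret h: ring_hom_ring "P3_ring (sec X U) F" "P3 F" "\<lambda>p e. value_at X U x (p e)"
  using h I.ring_axioms C.ring_axioms by (simp add: ring_hom_ringI2)
 have lift: "\<exists>r'\<in>carrier (P3_ring (sec X U) F). r = (\<lambda>e. value_at X U x (r' e))" if r: "r \<in> carrier (P3 F)" for r
 proof (intro bexI)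
  show "r = (\<lambda>e. value_at X U x (scal X U (r e)))" using value_scal[OF x oU U(2)] by auto
  show "(\<lambda>e. scal X U (r e)) \<in> carrier (P3_ring (sec X U) F)"
   using forms_hom[OF cring.axioms(1)[OF cring_CC] A.ring_axioms scal_hom[OF oU], of r F 0] r by simp
 qed
 show ?thesis
 proof (rule idealI[OF C.ring_axioms])
  show "subgroup (fib Z x U F) (add_monoid (P3 F))"
  proof (rule C.add.subgroupI)
   show "fib Z x U F \<subseteq> carrier (P3 F)" unfolding fib_def using h.hom_closed I.Icarr by blast
   show "fib Z x U F \<noteq> {}" unfolding fib_def using additive_subgroup.zero_closed[OF ideal.axioms(1)[OF I.is_ideal]] by blast
   fix a assume "a \<in> fib Z x U F"
   then obtain a' where a: "a' \<in> Z U F" "a = (\<lambda>e. value_at X U x (a' e))" by (auto simp: fib_def)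
   have "\<ominus>[P3 F] a = (\<lambda>e. value_at X U x ((\<ominus>[P3_ring (sec X U) F] a') e))"
    using h.hom_a_inv[OF I.Icarr[OF a(1)]] a(2) by simp
   moreover have "\<ominus>[P3_ring (sec X U) F] a' \<in> Z U F"
    by (rule additive_subgroup.a_inv_closed[OF ideal.axioms(1)[OF I.is_ideal] a(1)])
   ultimately show "\<ominus>[P3 F] a \<in> fib Z x U F" by (simp add: fib_def)
   fix b assume "b \<in> fib Z x U F"
   then obtain b' where b: "b' \<in> Z U F" "b = (\<lambda>e. value_at X U x (b' e))" by (auto simp: fib_def)
   have "a \<oplus>[P3 F] b = (\<lambda>e. value_at X U x ((a' \<oplus>[P3_ring (sec X U) F] b') e))"
    using h.hom_add[OF I.Icarr[OF a(1)] I.Icarr[OF b(1)]] a(2) b(2) by simp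
   moreover have "a' \<oplus>[P3_ring (sec X U) F] b' \<in> Z U F"
    by (rule additive_subgroup.a_closed[OF ideal.axioms(1)[OF I.is_ideal] a(1) b(1)])
   ultimately show "a \<oplus>[P3 F] b \<in> fib Z x U F" unfolding fib_def by blast
  qed
  fix a r assume "a \<in> fib Z x U F" and r: "r \<in> carrier (P3 F)"
  then obtain a' where a: "a' \<in> Z U F" "a = (\<lambda>e. value_at X U x (a' e))" by (auto simp: fib_def)
  obtain r' where r': "r' \<in> carrier (P3_ring (sec X U) F)" "r = (\<lambda>e. value_at X U x (r' e))" using lift[OF r] by blast
  show "r \<otimes>[P3 F] a \<in> fib Z x U F"
   unfolding a(2) r'(2) h.hom_mult[OF r'(1) I.Icarr[OF a(1)], symmetric] fib_def
   by (rule imageI[OF I.I_l_closed[OF a(1) r'(1)]])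
  show "a \<otimes>[P3 F] r \<in> fib Z x U F"
   unfolding a(2) r'(2) h.hom_mult[OF I.Icarr[OF a(1)] r'(1), symmetric] fib_def
   by (rule imageI[OF I.I_r_closed[OF a(1) r'(1)]])
 qed
qed

text \<open>The ideal on the smaller set is generated by restrictions, which have the same values.
  Pulling \<open>fib Z x U F\<close> back along evaluation gives an ideal that contains these
  generators.\<close>

lemma fib_rest:
 assumes U: "aff U" and V: "aff V" "x \<in> V" "V \<subseteq> U" and F: "F \<in> charts"
 shows "fib Z x V F = fib Z x U F"
proof -
 have aU: "affine_open X U" "affine_open X V" using U V affine_open_iff_aff by auto
 have oU: "opn U" "opn V" using affD(1) U V by auto
 have xU: "x \<in> U" using V by auto
 have Zsub: "Z U F \<subseteq> forms (sec X U) F 0" by (rule relative_subscheme_forms[OF Z aU(1) F])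
 have ZV: "Z V F = genideal (P3_ring (sec X V) F) ((\<lambda>p e. res U V (p e)) ` Z U F)"
  using Z aU V(3) F by (auto simp: relative_subscheme_def)
 have val: "(\<lambda>e. value_at X V x (res U V (p e))) = (\<lambda>e. value_at X U x (p e))" if "p \<in> Z U F" for p
  using value_rest[OF x oU(1) V(2) oU(2) V(3)] that Zsub formsD(1) by (metis subsetD)
 interpret IV: ideal "Z V F" "P3_ring (sec X V) F" by (rule relative_subscheme_sub[OF Z aU(2) F])
 interpret C: cring "P3 F" by (rule cring_P3_CC)
 interpret h: ring_hom_ring "P3_ring (sec X V) F" "P3 F" "\<lambda>p e. value_at X V x (p e)"
  using value_P3_hom[OF V(1,2)] IV.ring_axioms C.ring_axioms by (simp add: ring_hom_ringI2)
 have im: "(\<lambda>p e. res U V (p e)) ` Z U F \<subseteq> carrier (P3_ring (sec X V) F)"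
  using forms_hom[OF cring.axioms(1)[OF sec_cring[OF oU(1)]] cring.axioms(1)[OF sec_cring[OF oU(2)]] rest_hom[OF oU V(3)]] Zsub
  by auto
 show ?thesis
 proof
  define J where "J = {q \<in> carrier (P3_ring (sec X V) F). (\<lambda>e. value_at X V x (q e)) \<in> fib Z x U F}"
  have "ideal J (P3_ring (sec X V) F)" unfolding J_def by (rule h.ideal_vimage[OF fib_ideal[OF U xU F]])
  moreover have "(\<lambda>p e. res U V (p e)) ` Z U F \<subseteq> J"
   using im val by (auto simp: J_def fib_def)
  ultimately have "Z V F \<subseteq> J" unfolding ZV by (rule IV.genideal_minimal)
  thus "fib Z x V F \<subseteq> fib Z x U F" by (auto simp: J_def fib_def)
  show "fib Z x U F \<subseteq> fib Z x V F"
  proof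
   fix q assume "q \<in> fib Z x U F"
   then obtain p where p: "p \<in> Z U F" "q = (\<lambda>e. value_at X U x (p e))" by (auto simp: fib_def)
   have "(\<lambda>e. res U V (p e)) \<in> Z V F" unfolding ZV using IV.genideal_self[OF im] p(1) by blast
   hence "(\<lambda>e. value_at X V x (res U V (p e))) \<in> fib Z x V F" by (simp add: fib_def)
   thus "q \<in> fib Z x V F" using val[OF p(1)] p(2) by simp
  qed
 qed
qed

text \<open>\<open>fibre\<close> takes the union over all affine neighbourhoods; any two of them
  contain a common smaller one, so all terms coincide.\<close>

lemma fibre_eq_fib:
 assumes U: "aff U" "x \<in> U" and F: "F \<in> charts"
 shows "fibre X Z x F = fib Z x U F"
proof -
 have "fib Z x U' F = fib Z x U F" if U': "aff U'" "x \<in> U'" for U'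
 proof -
  obtain V where V: "aff V" "x \<in> V" "V \<subseteq> U" "V \<subseteq> U'"
   using affine_basis[OF U(1) affD(1)[OF U'(1)] U(2) U'(2)] by blast
  show ?thesis using fib_rest[OF U(1) V(1,2,3) F] fib_rest[OF U'(1) V(1,2,4) F] by simp
 qed
 moreover have "fibre X Z x F = \<Union>{fib Z x U' F | U'. aff U' \<and> x \<in> U'}"
  by (auto simp: fibre_def fib_def affine_open_iff_aff)
 ultimately show ?thesis using U by blast
qed

end

end

subsection \<open>Dual numbers\<close>

text \<open>Pairs of complex numbers are coded by complex numbers, so that the ring has the type required of test schemes.\<close>

definition enc :: "complex \<times> complex \<Rightarrow> complex" where
 "enc = (SOME f. bij f)"

lemma bij_enc: "bij enc"
proof -
 have "\<exists>f. bij_betw f (UNIV \<times> UNIV :: (complex \<times> complex) set) (UNIV :: complex set)"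
  unfolding card_of_ordIso UNIV_Times_UNIV[symmetric] by (rule card_of_Times_same_infinite) (rule infinite_UNIV_char_0)
 hence "\<exists>f :: complex \<times> complex \<Rightarrow> complex. bij f" by simp
 thus ?thesis unfolding enc_def by (rule someI_ex)
qed

definition pr0 :: "complex \<Rightarrow> complex" where "pr0 x = fst (inv_into UNIV enc x)"
definition pr1 :: "complex \<Rightarrow> complex" where "pr1 x = snd (inv_into UNIV enc x)"

lemma pr_enc [simp]: "pr0 (enc (a, b)) = a" "pr1 (enc (a, b)) = b"
 using bij_enc by (auto simp: pr0_def pr1_def bij_def)

lemma enc_pr [simp]: "enc (pr0 x, pr1 x) = x"
 using bij_enc by (simp add: pr0_def pr1_def bij_def surj_f_inv_f)

lemma dual_eq_iff: "x = y \<longleftrightarrow> pr0 x = pr0 y \<and> pr1 x = pr1 y"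
 by (metis enc_pr)

text \<open>\<open>enc (a, b)\<close> stands for a + b eps with eps squared equal to zero.\<close>

definition dual :: "complex ring" where
 "dual = \<lparr>carrier = UNIV, mult = (\<lambda>x y. enc (pr0 x * pr0 y, pr0 x * pr1 y + pr1 x * pr0 y)),
  one = enc (1, 0), zero = enc (0, 0), add = (\<lambda>x y. enc (pr0 x + pr0 y, pr1 x + pr1 y))\<rparr>"

lemma dual_simps [simp]:
 "carrier dual = UNIV" "x \<otimes>[dual] y = enc (pr0 x * pr0 y, pr0 x * pr1 y + pr1 x * pr0 y)"
 "\<one>[dual] = enc (1, 0)" "\<zero>[dual] = enc (0, 0)" "x \<oplus>[dual] y = enc (pr0 x + pr0 y, pr1 x + pr1 y)"
 by (simp_all add: dual_def)

lemma cring_dual: "cring dual"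
proof (rule cringI)
 show "abelian_group dual"
 proof (rule abelian_groupI)
  fix x assume "x \<in> carrier dual"
  show "\<exists>y\<in>carrier dual. y \<oplus>[dual] x = \<zero>[dual]"
   by (rule bexI[of _ "enc (- pr0 x, - pr1 x)"]) auto
 qed (auto simp: add_ac)
 show "Group.comm_monoid dual" by (rule comm_monoidI) (auto simp: algebra_simps)
qed (auto simp: algebra_simps)

lemma dual_a_inv: "\<ominus>[dual] x = enc (- pr0 x, - pr1 x)"
proof -
 interpret cring dual by (rule cring_dual)
 show ?thesis using minus_equality[of "enc (- pr0 x, - pr1 x)" x] by simp
qed

abbreviation kd :: "complex \<Rightarrow> complex" where "kd c \<equiv> enc (c, 0)"

lemma kd_hom: "kd \<in> ring_hom CC dual"
 by (rule ring_hom_memI) auto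

lemma pr0_hom: "pr0 \<in> ring_hom dual CC"
 by (rule ring_hom_memI) auto

lemma point_algebra_dual: "point_algebra dual kd pr0"
proof -
 interpret cring dual by (rule cring_dual)
 have unit: "a \<in> Units dual" if "pr0 a \<noteq> 0" for a
 proof -
  \<comment> \<open>The inverse of a + b eps is 1/a - (b/a^2) eps.\<close>
  have "enc (1 / pr0 a, - pr1 a / (pr0 a)\<^sup>2) \<otimes>[dual] a = \<one>[dual]" "a \<otimes>[dual] enc (1 / pr0 a, - pr1 a / (pr0 a)\<^sup>2) = \<one>[dual]"
   using that by (simp_all add: power2_eq_square)
  thus ?thesis unfolding Units_def
   by (intro CollectI conjI bexI[of _ "enc (1 / pr0 a, - pr1 a / (pr0 a)\<^sup>2)"]) (simp_all del: dual_simps(2,3))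
 qed
 have "x \<in> generate_ring dual (range kd \<union> {enc (0, 1)})" for x
 proof -
  have "x = kd (pr0 x) \<oplus>[dual] kd (pr1 x) \<otimes>[dual] enc (0, 1)" by simp
  moreover have "kd (pr0 x) \<oplus>[dual] kd (pr1 x) \<otimes>[dual] enc (0, 1) \<in> generate_ring dual (range kd \<union> {enc (0, 1)})"
   by (intro generate_ring.eng_add generate_ring.eng_mult generate_ring.incl) auto
  ultimately show ?thesis by (rule ssubst)
 qed
 hence "finite_type_algebra dual kd"
  unfolding finite_type_algebra_def by (intro exI[of _ "{enc (0, 1)}"]) auto
 thus ?thesis
  using cring_dual kd_hom pr0_hom unit by (simp add: point_algebra_def point_algebra_axioms_def)
qed

lemma point_algebra_CC: "point_algebra CC (\<lambda>c. c) (\<lambda>c. c)"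
proof -
 interpret cring CC by (rule cring_CC)
 have "a \<in> Units CC" if "a \<noteq> 0" for a
  using that unfolding Units_def by (intro CollectI conjI bexI[of _ "inverse a"]) auto
 moreover have "generate_ring CC UNIV = UNIV" using generate_ring.incl[of _ UNIV CC] by blast
 hence "finite_type_algebra CC (\<lambda>c. c)"
  unfolding finite_type_algebra_def by (intro exI[of _ "{}"]) simp
 moreover have "(\<lambda>c. c) \<in> ring_hom CC CC" by (rule ring_hom_memI) auto
 ultimately show ?thesis using cring_CC by (simp add: point_algebra_def point_algebra_axioms_def)
qed

interpretation dual: point_algebra dual kd pr0 by (rule point_algebra_dual)
interpretation cpt: point_algebra CC "\<lambda>c. c" "\<lambda>c. c" by (rule point_algebra_CC)

subsection \<open>Flatness over the dual numbers\<close>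

lemma finsum_remove:
 assumes "abelian_monoid G" "i \<in> {..<n::nat}" "\<And>j. j < n \<Longrightarrow> f j \<in> carrier G"
 shows "(\<Oplus>\<^bsub>G\<^esub>j\<in>{..<n}. f j) = f i \<oplus>[G] (\<Oplus>\<^bsub>G\<^esub>j\<in>{..<n} - {i}. f j)"
proof -
 interpret abelian_monoid G by (rule assms)
 have "{..<n} = insert i ({..<n} - {i})" using assms(2) by auto
 hence "(\<Oplus>\<^bsub>G\<^esub>j\<in>{..<n}. f j) = (\<Oplus>\<^bsub>G\<^esub>j\<in>insert i ({..<n} - {i}). f j)" by simp
 also have "\<dots> = f i \<oplus>[G] (\<Oplus>\<^bsub>G\<^esub>j\<in>{..<n} - {i}. f j)"
  by (rule finsum_insert) (use assms in auto)
 finally show ?thesis .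
qed

text \<open>One generator is eliminated: \<open>w\<close> inverts \<open>\<beta> i0\<close>, so the
  relation between the \<open>\<beta> i\<close> expresses \<open>m i0\<close> by \<open>c\<close>
  and the other \<open>m j\<close>. The factor \<open>e\<close> is zero when some coefficient is
  invertible, and eps when all coefficients are multiples of eps.\<close>

lemma flat_dual_relation:
 fixes R :: "'a ring" and Q :: "'b ring" and n :: nat
 assumes R: "cring R" and Q: "ring Q" and h: "h \<in> ring_hom R Q"
  and r: "\<And>i. i < n \<Longrightarrow> r i \<in> carrier R" and m: "\<And>i. i < n \<Longrightarrow> m i \<in> carrier Q"
  and \<beta>: "\<And>i. i < n \<Longrightarrow> \<beta> i \<in> carrier R" and w: "w \<in> carrier R" and e: "e \<in> carrier R" and c: "c \<in> carrier Q"
  and i0: "i0 < n" "w \<otimes>[R] \<beta> i0 = \<one>[R]"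
  and sum: "(\<Oplus>\<^bsub>Q\<^esub>i\<in>{..<n}. h (\<beta> i) \<otimes>[Q] m i) = h e \<otimes>[Q] c"
  and rb: "\<And>j. j < n \<Longrightarrow> r j = r i0 \<otimes>[R] (w \<otimes>[R] \<beta> j)" and re: "r i0 \<otimes>[R] (w \<otimes>[R] e) = \<zero>[R]"
 shows "\<exists>(k::nat) a y. (\<forall>i<n. \<forall>j<k. a i j \<in> carrier R) \<and> y \<in> {..<k} \<rightarrow> carrier Q \<and>
     (\<forall>i<n. m i = (\<Oplus>\<^bsub>Q\<^esub>j\<in>{..<k}. h (a i j) \<otimes>[Q] y j)) \<and>
     (\<forall>j<k. (\<Oplus>\<^bsub>R\<^esub>i\<in>{..<n}. r i \<otimes>[R] a i j) = \<zero>[R])"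
proof -
 interpret R: cring R by (rule R)
 interpret Q: ring Q by (rule Q)
 interpret h: ring_hom_ring R Q h using R Q h by (simp add: ring_hom_ringI2 cring.axioms(1))
 define y where "y j = (if j = i0 then c else m j)" for j
 \<comment> \<open>The identity matrix except for row \<open>i0\<close>, which carries the solution
   for \<open>m i0\<close>; correspondingly \<open>y\<close> has \<open>c\<close> in place of
   \<open>m i0\<close>.\<close>
 define a where "a i j = (if i = i0 then (if j = i0 then w \<otimes>[R] e else \<ominus>[R] (w \<otimes>[R] \<beta> j))
  else (if i = j then \<one>[R] else \<zero>[R]))" for i j
 have ac: "a i j \<in> carrier R" if "j < n" for i j using that w e \<beta> by (auto simp: a_def)
 have yc: "y j \<in> carrier Q" if "j < n" for j using that c m by (auto simp: y_def)
 have am: "abelian_monoid Q" "abelian_monoid R" by unfold_locales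
 define s where "s = (\<Oplus>\<^bsub>Q\<^esub>j\<in>{..<n} - {i0}. h (\<beta> j) \<otimes>[Q] m j)"
 have sc: "s \<in> carrier Q" unfolding s_def using \<beta> m by (intro Q.finsum_closed) auto
 have sm: "h (\<beta> i0) \<otimes>[Q] m i0 \<oplus>[Q] s = h e \<otimes>[Q] c"
  unfolding s_def sum[symmetric] by (rule finsum_remove[symmetric]) (use am i0 \<beta> m in auto)
 have bc: "h (\<beta> i0) \<in> carrier Q" "m i0 \<in> carrier Q" "h w \<in> carrier Q" "h e \<in> carrier Q" using \<beta> m i0 w e by auto
 have "h w \<otimes>[Q] (h (\<beta> i0) \<otimes>[Q] m i0) = h (w \<otimes>[R] \<beta> i0) \<otimes>[Q] m i0"
  using w \<beta>[OF i0(1)] bc by (simp add: Q.m_assoc)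
 also have "\<dots> = m i0" unfolding i0(2) using bc by simp
 finally have mi0: "m i0 = h w \<otimes>[Q] (h (\<beta> i0) \<otimes>[Q] m i0)" by simp
 have "h (\<beta> i0) \<otimes>[Q] m i0 = h e \<otimes>[Q] c \<oplus>[Q] \<ominus>[Q] s"
  using sm[symmetric] sc bc by (simp add: Q.a_assoc Q.r_neg)
 hence mi0': "m i0 = h w \<otimes>[Q] (h e \<otimes>[Q] c) \<oplus>[Q] \<ominus>[Q] (h w \<otimes>[Q] s)"
  using mi0 sc c bc by (simp add: Q.r_distr Q.r_minus)
 have hs: "\<ominus>[Q] (h w \<otimes>[Q] s) = (\<Oplus>\<^bsub>Q\<^esub>j\<in>{..<n} - {i0}. h (\<ominus>[R] (w \<otimes>[R] \<beta> j)) \<otimes>[Q] m j)"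
 proof -
  have "\<ominus>[Q] (h w \<otimes>[Q] s) = (\<ominus>[Q] h w) \<otimes>[Q] s" using sc bc by (simp add: Q.l_minus)
  also have "\<dots> = (\<Oplus>\<^bsub>Q\<^esub>j\<in>{..<n} - {i0}. (\<ominus>[Q] h w) \<otimes>[Q] (h (\<beta> j) \<otimes>[Q] m j))"
   unfolding s_def by (rule Q.finsum_rdistr) (use \<beta> m bc in auto)
  also have "\<dots> = (\<Oplus>\<^bsub>Q\<^esub>j\<in>{..<n} - {i0}. h (\<ominus>[R] (w \<otimes>[R] \<beta> j)) \<otimes>[Q] m j)"
   by (rule Q.finsum_cong') (use \<beta> m bc w in \<open>auto simp: Q.m_assoc Q.l_minus\<close>)
  finally show ?thesis .
 qed
 have "m i = (\<Oplus>\<^bsub>Q\<^esub>j\<in>{..<n}. h (a i j) \<otimes>[Q] y j)" if i: "i < n" for i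
 proof (cases "i = i0")
  case True
  have "(\<Oplus>\<^bsub>Q\<^esub>j\<in>{..<n}. h (a i0 j) \<otimes>[Q] y j) = h (a i0 i0) \<otimes>[Q] y i0 \<oplus>[Q] (\<Oplus>\<^bsub>Q\<^esub>j\<in>{..<n} - {i0}. h (a i0 j) \<otimes>[Q] y j)"
   by (rule finsum_remove) (use am i0 ac yc in auto)
  also have "(\<Oplus>\<^bsub>Q\<^esub>j\<in>{..<n} - {i0}. h (a i0 j) \<otimes>[Q] y j) = \<ominus>[Q] (h w \<otimes>[Q] s)"
   unfolding hs by (rule Q.finsum_cong') (use \<beta> m w in \<open>auto simp: a_def y_def\<close>)
  also have "h (a i0 i0) \<otimes>[Q] y i0 = h w \<otimes>[Q] (h e \<otimes>[Q] c)" using w e c bc by (simp add: a_def y_def Q.m_assoc)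
  finally show ?thesis using mi0' True by simp
 next
  case False
  have "(\<Oplus>\<^bsub>Q\<^esub>j\<in>{..<n}. h (a i j) \<otimes>[Q] y j) = (\<Oplus>\<^bsub>Q\<^esub>j\<in>{..<n}. if i = j then m j else \<zero>[Q])"
   by (rule Q.finsum_cong') (use False m yc in \<open>auto simp: a_def y_def\<close>)
  also have "\<dots> = m i" by (rule Q.finsum_singleton) (use i m in auto)
  finally show ?thesis by simp
 qed
 moreover have "(\<Oplus>\<^bsub>R\<^esub>i\<in>{..<n}. r i \<otimes>[R] a i j) = \<zero>[R]" if j: "j < n" for j
 proof -
  have "(\<Oplus>\<^bsub>R\<^esub>i\<in>{..<n}. r i \<otimes>[R] a i j) = r i0 \<otimes>[R] a i0 j \<oplus>[R] (\<Oplus>\<^bsub>R\<^esub>i\<in>{..<n} - {i0}. r i \<otimes>[R] a i j)"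
   by (rule finsum_remove) (use am i0 ac r j in auto)
  also have "(\<Oplus>\<^bsub>R\<^esub>i\<in>{..<n} - {i0}. r i \<otimes>[R] a i j) = (if j = i0 then \<zero>[R] else r j)"
  proof (cases "j = i0")
   case True
   thus ?thesis by (auto intro!: R.add.finprod_one_eqI simp: a_def r split: if_splits)
  next
   case False
   have "(\<Oplus>\<^bsub>R\<^esub>i\<in>{..<n} - {i0}. r i \<otimes>[R] a i j) = (\<Oplus>\<^bsub>R\<^esub>i\<in>{..<n} - {i0}. if j = i then r i else \<zero>[R])"
    by (rule R.finsum_cong') (use r in \<open>auto simp: a_def\<close>)
   also have "\<dots> = r j" by (rule R.finsum_singleton) (use j False r in auto)
   finally show ?thesis using False by simp
  qed
  also have "r i0 \<otimes>[R] a i0 j \<oplus>[R] (if j = i0 then \<zero>[R] else r j) = \<zero>[R]"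
  proof (cases "j = i0")
   case True
   thus ?thesis using re by (simp add: a_def)
  next
   case False
   have cl: "r i0 \<in> carrier R" "w \<otimes>[R] \<beta> j \<in> carrier R" using r i0 w \<beta> j by auto
   have "r i0 \<otimes>[R] \<ominus>[R] (w \<otimes>[R] \<beta> j) \<oplus>[R] r i0 \<otimes>[R] (w \<otimes>[R] \<beta> j) = \<zero>[R]"
    using cl by (simp add: R.r_minus R.l_neg)
   thus ?thesis using False rb[OF j] by (simp add: a_def)
  qed
  finally show ?thesis .
 qed
 ultimately show ?thesis using ac yc by (intro exI[of _ n] exI[of _ a] exI[of _ y]) auto
qed

lemma flat_zero_relation:
 fixes R :: "'a ring" and Q :: "'b ring" and n :: nat
 assumes R: "cring R" and Q: "ring Q" and h: "h \<in> ring_hom R Q"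
  and r: "\<And>i. i < n \<Longrightarrow> r i = \<zero>[R]" and m: "\<And>i. i < n \<Longrightarrow> m i \<in> carrier Q"
 shows "\<exists>(k::nat) a y. (\<forall>i<n. \<forall>j<k. a i j \<in> carrier R) \<and> y \<in> {..<k} \<rightarrow> carrier Q \<and>
     (\<forall>i<n. m i = (\<Oplus>\<^bsub>Q\<^esub>j\<in>{..<k}. h (a i j) \<otimes>[Q] y j)) \<and>
     (\<forall>j<k. (\<Oplus>\<^bsub>R\<^esub>i\<in>{..<n}. r i \<otimes>[R] a i j) = \<zero>[R])"
proof -
 interpret R: cring R by (rule R)
 interpret Q: ring Q by (rule Q)
 interpret h: ring_hom_ring R Q h using R Q h by (simp add: ring_hom_ringI2 cring.axioms(1))
 have rel1: "m i = (\<Oplus>\<^bsub>Q\<^esub>j\<in>{..<n}. h (if i = j then \<one>[R] else \<zero>[R]) \<otimes>[Q] m j)" if i: "i < n" for i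
 proof -
  have "(\<Oplus>\<^bsub>Q\<^esub>j\<in>{..<n}. h (if i = j then \<one>[R] else \<zero>[R]) \<otimes>[Q] m j) = (\<Oplus>\<^bsub>Q\<^esub>j\<in>{..<n}. if i = j then m j else \<zero>[Q])"
   by (intro Q.finsum_cong') (use m in auto)
  also have "\<dots> = m i" by (rule Q.finsum_singleton) (use i m in auto)
  finally show ?thesis by simp
 qed
 have rel2: "(\<Oplus>\<^bsub>R\<^esub>i\<in>{..<n}. r i \<otimes>[R] (if i = j then \<one>[R] else \<zero>[R])) = \<zero>[R]" for j
  by (rule R.add.finprod_one_eqI) (use r in auto)
 show ?thesis
  by (rule exI[of _ n], rule exI[of _ "\<lambda>i j. if i = j then \<one>[R] else \<zero>[R]"], rule exI[of _ m])
   (intro conjI allI impI rel1 rel2 Pi_I; simp add: m)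
qed

text \<open>Over the dual numbers flatness comes down to one condition: what eps kills is a multiple
  of eps.\<close>

lemma flat_dual:
 assumes Q: "ring (Q :: 'b ring)" and h: "h \<in> ring_hom dual Q"
  and tor: "\<And>b. b \<in> carrier Q \<Longrightarrow> h (enc (0, 1)) \<otimes>[Q] b = \<zero>[Q] \<Longrightarrow> \<exists>c\<in>carrier Q. b = h (enc (0, 1)) \<otimes>[Q] c"
 shows "flat_hom dual Q h"
 unfolding flat_hom_def
proof (intro allI impI, elim conjE)
 fix n :: nat and r m
 assume m: "m \<in> {..<n} \<rightarrow> carrier Q" and s: "(\<Oplus>\<^bsub>Q\<^esub>i\<in>{..<n}. h (r i) \<otimes>[Q] m i) = \<zero>[Q]"
 interpret Q: ring Q by (rule Q)
 interpret h: ring_hom_ring dual Q h using dual.ring_axioms Q h by (simp add: ring_hom_ringI2)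
 have mc: "m i \<in> carrier Q" if "i < n" for i using m that by auto
 have hc: "h x \<in> carrier Q" for x using h.hom_closed[of x] by simp
 note rel = flat_dual_relation[OF cring_dual Q h]
 \<comment> \<open>A relation is trivial, has an invertible coefficient, or has all coefficients in
   the ideal of eps.\<close>
 consider "\<forall>i<n. r i = \<zero>[dual]" | i where "i < n" "pr0 (r i) \<noteq> 0"
  | i where "\<forall>j<n. pr0 (r j) = 0" "i < n" "r i \<noteq> \<zero>[dual]" by blast
 thus "\<exists>(k::nat) a y. (\<forall>i<n. \<forall>j<k. a i j \<in> carrier dual) \<and> y \<in> {..<k} \<rightarrow> carrier Q \<and>
     (\<forall>i<n. m i = (\<Oplus>\<^bsub>Q\<^esub>j\<in>{..<k}. h (a i j) \<otimes>[Q] y j)) \<and>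
     (\<forall>j<k. (\<Oplus>\<^bsub>dual\<^esub>i\<in>{..<n}. r i \<otimes>[dual] a i j) = \<zero>[dual])"
 proof cases
  case 1
  thus ?thesis by (intro flat_zero_relation[OF cring_dual Q h _ mc]) blast+
 next
  case 2
  then obtain w where w: "w \<otimes>[dual] r i = \<one>[dual]" using dual.unit[of "r i"] by (auto simp: Units_def)
  have rw: "r i \<otimes>[dual] w = \<one>[dual]" using w dual.m_comm[of w "r i"] by (simp del: dual_simps(2,3))
  show ?thesis
  proof (rule rel[where \<beta> = r and w = w and e = "\<zero>[dual]" and c = "\<zero>[Q]" and ?i0.0 = i])
   show "(\<Oplus>\<^bsub>Q\<^esub>i\<in>{..<n}. h (r i) \<otimes>[Q] m i) = h \<zero>[dual] \<otimes>[Q] \<zero>[Q]" using s hc by simp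
   show "r j = r i \<otimes>[dual] (w \<otimes>[dual] r j)" for j
    using rw dual.m_assoc[of "r i" w "r j"] dual.l_one[of "r j"] by (simp del: dual_simps(2,3))
  qed (use 2 mc w in auto)
 next
  case 3
  \<comment> \<open>All coefficients are eps times constants. With eps factored out, the remaining
    sum is killed by eps and is therefore eps times some \<open>c\<close>.\<close>
  define \<beta> where "\<beta> j = kd (pr1 (r j))" for j
  define w where "w = kd (1 / pr1 (r i))"
  have nz: "pr1 (r i) \<noteq> 0" using 3 dual_eq_iff[of "r i" "enc (0, 0)"] by simp
  have r\<beta>: "r j = enc (0, 1) \<otimes>[dual] \<beta> j" if "j < n" for j
   using 3 that by (simp add: \<beta>_def dual_eq_iff[of "r j"])
  define b where "b = (\<Oplus>\<^bsub>Q\<^esub>j\<in>{..<n}. h (\<beta> j) \<otimes>[Q] m j)"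
  have bc: "b \<in> carrier Q" unfolding b_def using mc hc by (intro Q.finsum_closed) auto
  have "h (enc (0, 1)) \<otimes>[Q] b = (\<Oplus>\<^bsub>Q\<^esub>j\<in>{..<n}. h (enc (0, 1)) \<otimes>[Q] (h (\<beta> j) \<otimes>[Q] m j))"
   unfolding b_def by (rule Q.finsum_rdistr) (use mc hc in auto)
  also have "\<dots> = (\<Oplus>\<^bsub>Q\<^esub>j\<in>{..<n}. h (r j) \<otimes>[Q] m j)"
  proof (rule Q.finsum_cong')
   fix j assume "j \<in> {..<n}"
   hence j: "j < n" by simp
   have "h (r j) = h (enc (0, 1)) \<otimes>[Q] h (\<beta> j)" unfolding r\<beta>[OF j] by (rule h.hom_mult) auto
   thus "h (enc (0, 1)) \<otimes>[Q] (h (\<beta> j) \<otimes>[Q] m j) = h (r j) \<otimes>[Q] m j"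
    using mc[OF j] hc by (simp add: Q.m_assoc)
  qed (use mc hc in auto)
  also have "\<dots> = \<zero>[Q]" by (rule s)
  finally obtain c where c: "c \<in> carrier Q" "b = h (enc (0, 1)) \<otimes>[Q] c" using tor[OF bc] by blast
  show ?thesis
  proof (rule rel[where \<beta> = \<beta> and w = w and e = "enc (0, 1)" and c = c and ?i0.0 = i])
   show "(\<Oplus>\<^bsub>Q\<^esub>i\<in>{..<n}. h (\<beta> i) \<otimes>[Q] m i) = h (enc (0, 1)) \<otimes>[Q] c" using c(2) by (simp add: b_def)
   show "r j = r i \<otimes>[dual] (w \<otimes>[dual] \<beta> j)" if "j < n" for j
    using 3(1,2) that nz by (simp add: w_def \<beta>_def dual_eq_iff[of "r j"])
   show "r i \<otimes>[dual] (w \<otimes>[dual] enc (0, 1)) = \<zero>[dual]" using 3(1,2) by (simp add: w_def)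
   show "w \<otimes>[dual] \<beta> i = \<one>[dual]" using nz by (simp add: w_def \<beta>_def)
  qed (use 3 mc c in auto)
 qed
qed

subsection \<open>Laurent polynomials over the dual numbers\<close>

lemma forms_dual:
 "p \<in> forms dual F n \<longleftrightarrow> (\<lambda>e. pr0 (p e)) \<in> forms CC F n \<and> (\<lambda>e. pr1 (p e)) \<in> forms CC F n"
proof -
 have nz: "p e \<noteq> enc (0, 0) \<longleftrightarrow> pr0 (p e) \<noteq> 0 \<or> pr1 (p e) \<noteq> 0" for e
  using dual_eq_iff[of "p e" "enc (0, 0)"] by simp
 have "{e. p e \<noteq> enc (0, 0)} = {e. pr0 (p e) \<noteq> 0} \<union> {e. pr1 (p e) \<noteq> 0}" using nz by auto
 thus ?thesis unfolding forms_def by auto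
qed

lemma dual_finsum:
 "finite B \<Longrightarrow> pr0 (finsum dual f B) = (\<Sum>a\<in>B. pr0 (f a)) \<and> pr1 (finsum dual f B) = (\<Sum>a\<in>B. pr1 (f a))"
proof -
 interpret cring dual by (rule cring_dual)
 show "finite B \<Longrightarrow> ?thesis" by (induction B rule: finite_induct) (auto simp: Pi_iff)
qed

lemma dual_lmul:
 assumes p: "p \<in> forms dual F n" and q: "q \<in> forms dual G m"
 shows "(\<lambda>e. pr0 (laurent_mult dual p q e)) = lmul (\<lambda>e. pr0 (p e)) (\<lambda>e. pr0 (q e))"
  and "(\<lambda>e. pr1 (laurent_mult dual p q e))
   = (\<lambda>e. lmul (\<lambda>e. pr0 (p e)) (\<lambda>e. pr1 (q e)) e + lmul (\<lambda>e. pr1 (p e)) (\<lambda>e. pr0 (q e)) e)"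
proof -
 define B where "B = {e. p e \<noteq> \<zero>[dual]}"
 have B: "finite B" using formsD(2)[OF p] by (simp add: B_def)
 have sub: "{e. pr0 (p e) \<noteq> 0} \<subseteq> B" "{e. pr1 (p e) \<noteq> 0} \<subseteq> B" by (auto simp: B_def)
 note e = lmul_eq[OF B sub(1)] lmul_eq[OF B sub(2)]
 have lm: "laurent_mult dual p q e = finsum dual (\<lambda>a. p a \<otimes>[dual] q (e - a)) B" for e
  by (simp add: laurent_mult_def B_def)
 show "(\<lambda>e. pr0 (laurent_mult dual p q e)) = lmul (\<lambda>e. pr0 (p e)) (\<lambda>e. pr0 (q e))"
  unfolding fun_eq_iff lm e using dual_finsum[OF B] by simp
 show "(\<lambda>e. pr1 (laurent_mult dual p q e))
   = (\<lambda>e. lmul (\<lambda>e. pr0 (p e)) (\<lambda>e. pr1 (q e)) e + lmul (\<lambda>e. pr1 (p e)) (\<lambda>e. pr0 (q e)) e)"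
  unfolding fun_eq_iff lm e using dual_finsum[OF B] by (simp add: sum.distrib)
qed

lemma laurent_dual_eqI:
 assumes "(\<lambda>e. pr0 (p e)) = (\<lambda>e. pr0 (q e))" "(\<lambda>e. pr1 (p e)) = (\<lambda>e. pr1 (q e))"
 shows "p = q"
proof
 show "p e = q e" for e using fun_cong[OF assms(1), of e] fun_cong[OF assms(2), of e] dual_eq_iff by blast
qed

lemma forms_CC_fin: "p \<in> forms CC F n \<Longrightarrow> finite {e. p e \<noteq> 0}"
 using formsD(2)[of p CC] by simp

lemma ring_P3_dual: "ring (P3_ring dual F)"
proof -
 interpret D: base_ring dual by (rule base_ring.intro[OF cring_dual])
 interpret C: base_ring CC by (rule base_ring.intro[OF cring_CC])
 have one: "laurent_const dual \<one>[dual] \<in> forms dual F 0" "laurent_const dual \<zero>[dual] \<in> forms dual F 0"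
  using laurent_const_form[of _ dual F] by auto
 have cl: "laurent_mult dual x y \<in> forms dual F 0" if "x \<in> forms dual F 0" "y \<in> forms dual F 0" for x y
  using D.laurent_mult_form[OF that] by simp
 have f: "finite {e. pr0 (x e) \<noteq> 0}" "finite {e. pr1 (x e) \<noteq> 0}" if "x \<in> forms dual F 0" for x
  using that forms_CC_fin unfolding forms_dual by blast+
 show ?thesis
 proof (rule ringI)
  show "abelian_group (P3_ring dual F)"
  proof (rule abelian_groupI; (simp del: dual_simps)?)
   fix x assume x: "x \<in> forms dual F 0"
   show "\<exists>y\<in>forms dual F 0. (\<lambda>e. y e \<oplus>[dual] x e) = laurent_const dual \<zero>[dual]"
    using D.forms_smult[OF x, of "\<ominus>[dual] \<one>[dual]"]
    by (intro bexI[of _ "\<lambda>e. (\<ominus>[dual] \<one>[dual]) \<otimes>[dual] x e"]) (auto simp: laurent_const_def dual_a_inv)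
  qed (use D.forms_add one in \<open>auto simp: laurent_const_def add_ac\<close>)
  show "Group.monoid (P3_ring dual F)"
  proof (rule monoidI; (simp del: dual_simps)?)
   show "\<And>x y. x \<in> forms dual F 0 \<Longrightarrow> y \<in> forms dual F 0 \<Longrightarrow> laurent_mult dual x y \<in> forms dual F 0" by (rule cl)
   show "laurent_const dual \<one>[dual] \<in> forms dual F 0" by (rule one)
   fix x assume x: "x \<in> forms dual F 0"
   show "laurent_mult dual (laurent_const dual \<one>[dual]) x = x"
    using D.laurent_const_mult[of "\<one>[dual]" x F 0] x by simp
   have l1: "lmul (laurent_const CC 1) y = y" if "y \<in> forms CC F 0" for y
    using C.laurent_const_mult[of 1 y F 0] that by simp
   have r1: "lmul y (laurent_const CC 1) = y" "lmul y (\<lambda>e. 0) = (\<lambda>e. 0)" if "y \<in> forms CC F 0" for y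
    using l1[OF that] lmul_comm[of y "laurent_const CC 1"] forms_CC_fin[OF that]
     forms_CC_fin[OF laurent_const_form[of 1 CC F]] by (auto simp: lmul_eq[OF _ subset_refl])
   have c0: "(\<lambda>e. pr0 (laurent_const dual (enc (1, 0)) e)) = laurent_const CC 1"
    "(\<lambda>e. pr1 (laurent_const dual (enc (1, 0)) e)) = (\<lambda>e. 0)"
    by (auto simp: laurent_const_def)
   show "laurent_mult dual x (laurent_const dual \<one>[dual]) = x"
    by (rule laurent_dual_eqI; subst dual_lmul[OF x one(1)]) (use x r1 c0 in \<open>auto simp: forms_dual\<close>)
   fix y z assume y: "y \<in> forms dual F 0" and z: "z \<in> forms dual F 0"
   note fx = f[OF x] and fy = f[OF y] and fz = f[OF z]
   show "laurent_mult dual (laurent_mult dual x y) z = laurent_mult dual x (laurent_mult dual y z)"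
    by (rule laurent_dual_eqI)
     (simp_all add: dual_lmul[OF cl[OF x y] z] dual_lmul[OF x y] dual_lmul[OF x cl[OF y z]] dual_lmul[OF y z]
      lmul_assoc lmul_add_right lmul_add_left lmul_finite fx fy fz add_ac)
  qed
  fix x y z assume "x \<in> carrier (P3_ring dual F)" "y \<in> carrier (P3_ring dual F)" "z \<in> carrier (P3_ring dual F)"
  hence x: "x \<in> forms dual F 0" and y: "y \<in> forms dual F 0" and z: "z \<in> forms dual F 0" by auto
  note fx = f[OF x] and fy = f[OF y] and fz = f[OF z]
  have a: "(\<lambda>e. x e \<oplus>[dual] y e) \<in> forms dual F 0" by (rule D.forms_add[OF x y])
  show "(x \<oplus>[P3_ring dual F] y) \<otimes>[P3_ring dual F] z = x \<otimes>[P3_ring dual F] z \<oplus>[P3_ring dual F] y \<otimes>[P3_ring dual F] z"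
   unfolding P3_ring_simps
   by (rule laurent_dual_eqI; unfold dual_lmul[OF a z])
    (simp_all add: fun_eq_iff lmul_add_left fx fy fz dual_lmul[OF x z, unfolded fun_eq_iff, rule_format]
     dual_lmul[OF y z, unfolded fun_eq_iff, rule_format])
  have a': "(\<lambda>e. x e \<oplus>[dual] y e) \<in> forms dual F 0" by (rule D.forms_add[OF x y])
  show "z \<otimes>[P3_ring dual F] (x \<oplus>[P3_ring dual F] y) = z \<otimes>[P3_ring dual F] x \<oplus>[P3_ring dual F] z \<otimes>[P3_ring dual F] y"
   unfolding P3_ring_simps
   by (rule laurent_dual_eqI; unfold dual_lmul[OF z a'])
    (simp_all add: fun_eq_iff lmul_add_right fx fy fz dual_lmul[OF z x, unfolded fun_eq_iff, rule_format]
     dual_lmul[OF z y, unfolded fun_eq_iff, rule_format])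
 qed
qed

subsection \<open>Ideals and cosets of complex Laurent polynomials\<close>

lemma lmul_form: "p \<in> forms CC F n \<Longrightarrow> q \<in> forms CC F m \<Longrightarrow> lmul p q \<in> forms CC F (n + m)"
 using base_ring.laurent_mult_form[OF base_ring.intro[OF cring_CC]] .

lemma forms_CC_const: "laurent_const CC c \<in> forms CC F 0"
 by (rule laurent_const_form) auto

lemma forms_CC_add: "p \<in> forms CC F n \<Longrightarrow> q \<in> forms CC F n \<Longrightarrow> (\<lambda>e. p e + q e) \<in> forms CC F n"
 using base_ring.forms_add[OF base_ring.intro[OF cring_CC], of p F n q] by simp

lemma lmul_const: "q \<in> forms CC F n \<Longrightarrow> lmul (laurent_const CC c) q = (\<lambda>e. c * q e)"
 using base_ring.laurent_const_mult[OF base_ring.intro[OF cring_CC], of c q F n] by simp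

lemma lmul_zero_right [simp]: "finite {e. p e \<noteq> 0} \<Longrightarrow> lmul p (\<lambda>e. 0) = (\<lambda>e. 0)"
 by (auto simp: lmul_eq[OF _ subset_refl])

lemma lmul_zero_left [simp]: "lmul (\<lambda>e. 0) p = (\<lambda>e. 0)"
 by (auto simp: lmul_eq[of "{}"])

lemma forms_CC_zero: "(\<lambda>e. 0) \<in> forms CC F n"
 by (rule formsI[where B = "{}"]) auto

lemma ideal_P3_CC_I:
 assumes sub: "K \<subseteq> forms CC F 0" and z: "(\<lambda>e. 0) \<in> K"
  and add: "\<And>a b. a \<in> K \<Longrightarrow> b \<in> K \<Longrightarrow> (\<lambda>e. a e + b e) \<in> K"
  and mult: "\<And>r a. r \<in> forms CC F 0 \<Longrightarrow> a \<in> K \<Longrightarrow> lmul r a \<in> K"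
 shows "ideal K (P3 F)"
proof -
 interpret P: cring "P3 F" by (rule cring_P3_CC)
 show ?thesis
 proof (rule idealI[OF P.ring_axioms])
  show "subgroup K (add_monoid (P3 F))"
  proof (rule P.add.subgroupI)
   show "K \<subseteq> carrier (P3 F)" using sub by simp
   show "K \<noteq> {}" using z by auto
   fix a b assume a: "a \<in> K" and b: "b \<in> K"
   show "a \<oplus>[P3 F] b \<in> K" using add[OF a b] by simp
   have af: "a \<in> forms CC F 0" using a sub by auto
   have "(\<lambda>e. - a e) = lmul (laurent_const CC (- 1)) a" using lmul_const[OF af] by simp
   hence n: "(\<lambda>e. - a e) \<in> K" using mult[OF forms_CC_const a] by simp
   hence "\<ominus>[P3 F] a = (\<lambda>e. - a e)"
    using sub af by (intro P.minus_equality) (auto simp: laurent_const_def)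
   thus "\<ominus>[P3 F] a \<in> K" using n by simp
  qed
  fix a x assume a: "a \<in> K" and x: "x \<in> carrier (P3 F)"
  thus "x \<otimes>[P3 F] a \<in> K" using mult by simp
  thus "a \<otimes>[P3 F] x \<in> K" using P.m_comm[OF x, of a] a sub by auto
 qed
qed

context
 fixes K F assumes K: "ideal K (P3 F)"
begin

lemma ideal_P3_sub: "a \<in> K \<Longrightarrow> a \<in> forms CC F 0"
 using ideal.Icarr[OF K] by simp

lemma ideal_P3_add: "a \<in> K \<Longrightarrow> b \<in> K \<Longrightarrow> (\<lambda>e. a e + b e) \<in> K"
 using additive_subgroup.a_closed[OF ideal.axioms(1)[OF K], of a b] by simp

lemma ideal_P3_mult: "a \<in> K \<Longrightarrow> r \<in> forms CC F 0 \<Longrightarrow> lmul r a \<in> K"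
 using ideal.I_l_closed[OF K, of a r] by simp

lemma ideal_P3_zero: "(\<lambda>e. 0) \<in> K"
 using additive_subgroup.zero_closed[OF ideal.axioms(1)[OF K]] by (simp add: laurent_const_zero[of CC, simplified])

lemma ideal_P3_diff: "a \<in> K \<Longrightarrow> b \<in> K \<Longrightarrow> (\<lambda>e. a e - b e) \<in> K"
 using ideal_P3_add[of a "\<lambda>e. - b e"] ideal_P3_mult[of b "laurent_const CC (- 1)"] lmul_const[OF ideal_P3_sub, of b "- 1"]
  forms_CC_const by simp

lemma P3_coset_iff: "x \<in> K +>[P3 F] b \<longleftrightarrow> (\<lambda>e. x e - b e) \<in> K"
proof
 assume "x \<in> K +>[P3 F] b"
 then obtain h where "h \<in> K" "x = (\<lambda>e. h e + b e)" by (auto simp: a_r_coset_def')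
 thus "(\<lambda>e. x e - b e) \<in> K" by simp
next
 assume "(\<lambda>e. x e - b e) \<in> K"
 moreover have "x = (\<lambda>e. (\<lambda>e. x e - b e) e \<oplus>[CC] b e)" by simp
 ultimately show "x \<in> K +>[P3 F] b" unfolding a_r_coset_def' P3_ring_simps by blast
qed

lemma P3_coset_eqI:
 assumes "(\<lambda>e. b e - c e) \<in> K"
 shows "K +>[P3 F] b = K +>[P3 F] c"
proof (rule Set.set_eqI)
 fix x
 have "(\<lambda>e. x e - b e) \<in> K \<longleftrightarrow> (\<lambda>e. x e - c e) \<in> K"
  using ideal_P3_add[OF _ assms, of "\<lambda>e. x e - b e"] ideal_P3_diff[OF _ assms, of "\<lambda>e. x e - c e"] by auto
 thus "x \<in> K +>[P3 F] b \<longleftrightarrow> x \<in> K +>[P3 F] c" by (simp add: P3_coset_iff)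
qed

lemma P3_quot:
 assumes "a \<in> forms CC F 0" "b \<in> forms CC F 0"
 shows "(K +>[P3 F] a) \<oplus>[P3 F Quot K] (K +>[P3 F] b) = K +>[P3 F] (\<lambda>e. a e + b e)"
  and "(K +>[P3 F] a) \<otimes>[P3 F Quot K] (K +>[P3 F] b) = K +>[P3 F] (lmul a b)"
  and "K +>[P3 F] a \<in> carrier (P3 F Quot K)"
 using ring_hom_add[OF ideal.rcos_ring_hom[OF K], of a b] ring_hom_mult[OF ideal.rcos_ring_hom[OF K], of a b]
  ring_hom_closed[OF ideal.rcos_ring_hom[OF K], of a] assms by simp_all

lemma P3_quot_cases:
 assumes "x \<in> carrier (P3 F Quot K)"
 obtains b where "b \<in> forms CC F 0" "x = K +>[P3 F] b"
 using assms by (auto simp: FactRing_def A_RCOSETS_def')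

end

subsection \<open>Global sections of the normal sheaf\<close>

context
 fixes C \<phi>
 assumes C: "closed_subscheme CC C" and \<phi>: "\<phi> \<in> H0_normal C"
begin

lemma normal_facts:
 assumes F: "F \<in> charts"
 shows "a \<in> C F \<Longrightarrow> \<phi> F a \<in> carrier (P3 F Quot C F)"
  "a \<in> C F \<Longrightarrow> b \<in> C F \<Longrightarrow> \<phi> F (\<lambda>e. a e + b e) = \<phi> F a \<oplus>[P3 F Quot C F] \<phi> F b"
  "r \<in> forms CC F 0 \<Longrightarrow> a \<in> C F \<Longrightarrow> \<phi> F (lmul r a) = (C F +>[P3 F] r) \<otimes>[P3 F Quot C F] \<phi> F a"
proof -
 have *: "\<phi> F \<in> C F \<rightarrow>\<^sub>E carrier (P3 F Quot C F)"
  "\<forall>a\<in>C F. \<forall>b\<in>C F. \<phi> F (a \<oplus>[P3 F] b) = \<phi> F a \<oplus>[P3 F Quot C F] \<phi> F b"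
  "\<forall>r\<in>carrier (P3 F). \<forall>a\<in>C F. \<phi> F (r \<otimes>[P3 F] a)
   = (C F +>[P3 F] r) \<otimes>[P3 F Quot C F] \<phi> F a"
  using \<phi> F unfolding H0_normal_def H0_Hom_def by blast+
 show "a \<in> C F \<Longrightarrow> \<phi> F a \<in> carrier (P3 F Quot C F)" using *(1) by (rule PiE_mem)
 show "a \<in> C F \<Longrightarrow> b \<in> C F \<Longrightarrow> \<phi> F (\<lambda>e. a e + b e) = \<phi> F a \<oplus>[P3 F Quot C F] \<phi> F b"
  using *(2) by simp
 show "r \<in> forms CC F 0 \<Longrightarrow> a \<in> C F \<Longrightarrow> \<phi> F (lmul r a) = (C F +>[P3 F] r) \<otimes>[P3 F Quot C F] \<phi> F a"
  using *(3) by simp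
qed

lemma normal_mono: "F \<in> charts \<Longrightarrow> G \<in> charts \<Longrightarrow> F \<subseteq> G \<Longrightarrow> a \<in> C F \<Longrightarrow> \<phi> F a \<subseteq> \<phi> G a"
 using \<phi> unfolding H0_normal_def H0_Hom_def by blast

context
 fixes F assumes F: "F \<in> charts"
begin

lemmas CI = closed_subscheme_ideal[OF C F]

lemma normal_rep:
 assumes a: "a \<in> C F"
 obtains b where "b \<in> forms CC F 0" "b \<in> \<phi> F a"
proof -
 obtain b where b: "b \<in> forms CC F 0" "\<phi> F a = C F +>[P3 F] b"
  using P3_quot_cases[OF CI normal_facts(1)[OF F a]] by blast
 have "b \<in> \<phi> F a" unfolding b(2) P3_coset_iff[OF CI] using ideal_P3_zero[OF CI] by simp
 thus ?thesis using b(1) that by blast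
qed

lemma normal_coset:
 assumes a: "a \<in> C F" and b: "b \<in> \<phi> F a"
 shows "\<phi> F a = C F +>[P3 F] b" "b \<in> forms CC F 0"
proof -
 obtain c where c: "c \<in> forms CC F 0" "\<phi> F a = C F +>[P3 F] c"
  using P3_quot_cases[OF CI normal_facts(1)[OF F a]] by blast
 have d: "(\<lambda>e. b e - c e) \<in> C F" using b unfolding c(2) P3_coset_iff[OF CI] .
 thus "\<phi> F a = C F +>[P3 F] b" unfolding c(2) using P3_coset_eqI[OF CI d] by simp
 show "b \<in> forms CC F 0" using forms_CC_add[OF ideal_P3_sub[OF CI d] c(1)] by simp
qed

lemma normal_mem_iff: "a \<in> C F \<Longrightarrow> b \<in> \<phi> F a \<Longrightarrow> x \<in> \<phi> F a \<longleftrightarrow> (\<lambda>e. x e - b e) \<in> C F"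
 using P3_coset_iff[OF CI, of x b] normal_coset(1)[of a b] by simp

lemma normal_add:
 assumes "a \<in> C F" "b \<in> \<phi> F a" "c \<in> C F" "d \<in> \<phi> F c"
 shows "(\<lambda>e. b e + d e) \<in> \<phi> F (\<lambda>e. a e + c e)"
proof -
 have "\<phi> F (\<lambda>e. a e + c e) = C F +>[P3 F] (\<lambda>e. b e + d e)"
  unfolding normal_facts(2)[OF F assms(1,3)] normal_coset(1)[OF assms(1,2)] normal_coset(1)[OF assms(3,4)]
  by (rule P3_quot(1)[OF CI normal_coset(2)[OF assms(1,2)] normal_coset(2)[OF assms(3,4)]])
 thus ?thesis using ideal_P3_zero[OF CI] by (simp only: P3_coset_iff[OF CI] diff_self)
qed

lemma normal_mult:
 assumes "a \<in> C F" "b \<in> \<phi> F a" "r \<in> forms CC F 0"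
 shows "lmul r b \<in> \<phi> F (lmul r a)"
proof -
 have "\<phi> F (lmul r a) = C F +>[P3 F] (lmul r b)"
  unfolding normal_facts(3)[OF F assms(3,1)] normal_coset(1)[OF assms(1,2)]
  by (rule P3_quot(2)[OF CI assms(3) normal_coset(2)[OF assms(1,2)]])
 thus ?thesis using ideal_P3_zero[OF CI] by (simp only: P3_coset_iff[OF CI] diff_self)
qed

lemma normal_zero: "b \<in> \<phi> F (\<lambda>e. 0) \<longleftrightarrow> b \<in> C F"
proof -
 have z: "(\<lambda>e. 0) \<in> C F" by (rule ideal_P3_zero[OF CI])
 obtain c where c: "c \<in> \<phi> F (\<lambda>e. 0)" using normal_rep[OF z] by blast
 have "(\<lambda>e. 0) \<in> \<phi> F (\<lambda>e. 0)" using normal_mult[OF z c forms_CC_zero] by simp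
 from normal_mem_iff[OF z this] show ?thesis by simp
qed

end

end

subsection \<open>The deformation defined by a normal vector field\<close>

definition mk :: "complex laurent \<Rightarrow> complex laurent \<Rightarrow> complex laurent" where
 "mk a b = (\<lambda>e. enc (a e, b e))"

lemma mk_simps [simp]: "pr0 (mk a b e) = a e" "pr1 (mk a b e) = b e"
 by (simp_all add: mk_def)

lemma mk_pr: "mk (\<lambda>e. pr0 (p e)) (\<lambda>e. pr1 (p e)) = p"
 by (rule laurent_dual_eqI) simp_all

lemma mk_form: "mk a b \<in> forms dual F n \<longleftrightarrow> a \<in> forms CC F n \<and> b \<in> forms CC F n"
 by (simp add: forms_dual)

lemma mk_add: "mk a b \<oplus>[P3_ring dual F] mk c d = mk (\<lambda>e. a e + c e) (\<lambda>e. b e + d e)"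
 by (rule laurent_dual_eqI) simp_all

lemma mk_mult:
 assumes "a \<in> forms CC F n" "b \<in> forms CC F n" "c \<in> forms CC F m" "d \<in> forms CC F m"
 shows "laurent_mult dual (mk a b) (mk c d) = mk (lmul a c) (\<lambda>e. lmul a d e + lmul b c e)"
proof -
 have f: "mk a b \<in> forms dual F n" "mk c d \<in> forms dual F m" using assms by (auto simp: mk_form)
 show ?thesis
  by (rule laurent_dual_eqI; unfold dual_lmul[OF f]) simp_all
qed

text \<open>Sets of Laurent polynomials a + b eps described by a condition on the pair of complex
  parts, so that ideals over the dual numbers can be checked in the complex parts.\<close>

definition mks :: "(complex laurent \<Rightarrow> complex laurent \<Rightarrow> bool) \<Rightarrow> complex laurent set" where
 "mks K = {p. K (\<lambda>e. pr0 (p e)) (\<lambda>e. pr1 (p e))}"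

lemma mk_mks: "mk a b \<in> mks K \<longleftrightarrow> K a b"
 by (simp add: mks_def)

lemma mks_cases: "p \<in> mks K \<Longrightarrow> \<exists>a b. p = mk a b \<and> K a b"
 by (intro exI[of _ "\<lambda>e. pr0 (p e)"] exI[of _ "\<lambda>e. pr1 (p e)"]) (simp add: mks_def mk_pr)

lemma ideal_mks:
 assumes sub: "\<And>a b. K a b \<Longrightarrow> a \<in> forms CC F 0 \<and> b \<in> forms CC F 0" and z: "K (\<lambda>e. 0) (\<lambda>e. 0)"
  and add: "\<And>a b c d. K a b \<Longrightarrow> K c d \<Longrightarrow> K (\<lambda>e. a e + c e) (\<lambda>e. b e + d e)"
  and mult: "\<And>a b c d. K a b \<Longrightarrow> c \<in> forms CC F 0 \<Longrightarrow> d \<in> forms CC F 0 \<Longrightarrow> K (lmul c a) (\<lambda>e. lmul c b e + lmul d a e)"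
 shows "ideal (mks K) (P3_ring dual F)"
proof -
 interpret P: ring "P3_ring dual F" by (rule ring_P3_dual)
 have carr: "p \<in> forms dual F 0" if "p \<in> mks K" for p
  using that sub unfolding mks_def forms_dual by blast
 show ?thesis
 proof (rule idealI[OF P.ring_axioms])
  show "subgroup (mks K) (add_monoid (P3_ring dual F))"
  proof (rule P.add.subgroupI)
   show "mks K \<subseteq> carrier (P3_ring dual F)" using carr by auto
   show "mks K \<noteq> {}" using z mk_mks by blast
   fix p q assume p: "p \<in> mks K" and q: "q \<in> mks K"
   obtain a b where a: "p = mk a b" "K a b" using mks_cases[OF p] by blast
   obtain c d where c: "q = mk c d" "K c d" using mks_cases[OF q] by blast
   show "p \<oplus>[P3_ring dual F] q \<in> mks K" unfolding a(1) c(1) mk_add mk_mks by (rule add[OF a(2) c(2)])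
   have f: "a \<in> forms CC F 0" "b \<in> forms CC F 0" using sub[OF a(2)] by auto
   have n: "K (\<lambda>e. - a e) (\<lambda>e. - b e)"
    using mult[OF a(2) forms_CC_const[of "- 1" F] forms_CC_zero] f by (simp add: lmul_const)
   have "mk (\<lambda>e. - a e) (\<lambda>e. - b e) \<oplus>[P3_ring dual F] p = \<zero>[P3_ring dual F]"
    unfolding a(1) mk_add by (rule laurent_dual_eqI) (auto simp: laurent_const_def)
   hence "\<ominus>[P3_ring dual F] p = mk (\<lambda>e. - a e) (\<lambda>e. - b e)"
    using carr[OF p] carr[of "mk (\<lambda>e. - a e) (\<lambda>e. - b e)"] n by (intro P.minus_equality) (simp_all add: mk_mks)
   thus "\<ominus>[P3_ring dual F] p \<in> mks K" using n by (simp add: mk_mks)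
  qed
  fix p q assume p: "p \<in> mks K" and q: "q \<in> carrier (P3_ring dual F)"
  obtain a b where a: "p = mk a b" "K a b" using mks_cases[OF p] by blast
  define c d where "c = (\<lambda>e. pr0 (q e))" and "d = (\<lambda>e. pr1 (q e))"
  have qm: "q = mk c d" unfolding c_def d_def by (rule mk_pr[symmetric])
  have f: "a \<in> forms CC F 0" "b \<in> forms CC F 0" "c \<in> forms CC F 0" "d \<in> forms CC F 0"
   using sub[OF a(2)] q unfolding qm by (auto simp: mk_form)
  note ff = forms_CC_fin[OF f(1)] forms_CC_fin[OF f(2)] forms_CC_fin[OF f(3)] forms_CC_fin[OF f(4)]
  show "q \<otimes>[P3_ring dual F] p \<in> mks K"
   unfolding a(1) qm P3_ring_simps mk_mult[OF f(3,4,1,2)] mk_mks by (rule mult[OF a(2) f(3,4)])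
  have "mk a b \<otimes>[P3_ring dual F] q = q \<otimes>[P3_ring dual F] mk a b"
   unfolding qm P3_ring_simps mk_mult[OF f(3,4,1,2)] mk_mult[OF f]
   using lmul_comm[OF ff(1,3)] lmul_comm[OF ff(1,4)] lmul_comm[OF ff(2,3)] by (simp add: add.commute)
  thus "p \<otimes>[P3_ring dual F] q \<in> mks K" using \<open>q \<otimes>[P3_ring dual F] p \<in> mks K\<close> a(1) by simp
 qed
qed

lemma laurent_const_hom:
 fixes R (structure)
 assumes "cring R" shows "laurent_const R \<in> ring_hom R (P3_ring R F)"
proof -
 interpret base_ring R by (rule base_ring.intro[OF assms])
 show ?thesis
 proof (rule ring_hom_memI; (unfold P3_ring_simps)?)
  fix a b assume a: "a \<in> carrier R" and b: "b \<in> carrier R"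
  show "laurent_const R a \<in> forms R F 0" by (rule laurent_const_form[OF a zero_closed])
  show "laurent_const R (a \<otimes> b) = laurent_mult R (laurent_const R a) (laurent_const R b)"
   unfolding laurent_const_mult[OF a laurent_const_form[OF b zero_closed]] using a by (auto simp: laurent_const_def)
  show "laurent_const R (a \<oplus> b) = (\<lambda>e. laurent_const R a e \<oplus> laurent_const R b e)" by (auto simp: laurent_const_def)
 qed simp
qed

lemma quot_const_hom:
 assumes "cring R" "ideal I (P3_ring R F)"
 shows "(\<lambda>r. I +>[P3_ring R F] laurent_const R r) \<in> ring_hom R (P3_ring R F Quot I)"
 using ring_hom_trans[OF laurent_const_hom[OF assms(1)] ideal.rcos_ring_hom[OF assms(2)]] by (simp add: comp_def)

context
 fixes C \<phi>
 assumes C: "closed_subscheme CC C" and \<phi>: "\<phi> \<in> H0_normal C"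
begin

text \<open>The standard dictionary between normal vector fields and first order deformations: the
  ideal consists of all a + b eps with \<open>a\<close> in the ideal of \<open>C\<close> and
  \<open>b\<close> a representative of its image under \<phi>.\<close>

definition thick :: "complex subscheme" where
 "thick F = mks (\<lambda>a b. a \<in> C F \<and> b \<in> \<phi> F a)"

lemma thick_mem: "mk a b \<in> thick F \<longleftrightarrow> a \<in> C F \<and> b \<in> \<phi> F a"
 by (simp add: thick_def mk_mks)

lemma thick_ideal:
 assumes F: "F \<in> charts"
 shows "ideal (thick F) (P3_ring dual F)"
 unfolding thick_def
proof (rule ideal_mks; (elim conjE)?)
 note I = closed_subscheme_ideal[OF C F]
 note N = normal_coset[OF C \<phi> F]
 show "(\<lambda>e. 0) \<in> C F \<and> (\<lambda>e. 0) \<in> \<phi> F (\<lambda>e. 0)" using normal_zero[OF C \<phi> F] ideal_P3_zero[OF I] by blast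
 fix a b assume a: "a \<in> C F" and b: "b \<in> \<phi> F a"
 show "a \<in> forms CC F 0 \<and> b \<in> forms CC F 0" using ideal_P3_sub[OF I a] N(2)[OF a b] by simp
 fix c d
 show "(\<lambda>e. a e + c e) \<in> C F \<and> (\<lambda>e. b e + d e) \<in> \<phi> F (\<lambda>e. a e + c e)" if "c \<in> C F" "d \<in> \<phi> F c"
  using normal_add[OF C \<phi> F a b that] ideal_P3_add[OF I a that(1)] by simp
 assume c: "c \<in> forms CC F 0" and d: "d \<in> forms CC F 0"
 have ca: "lmul c a \<in> C F" by (rule ideal_P3_mult[OF I a c])
 show "lmul c a \<in> C F \<and> (\<lambda>e. lmul c b e + lmul d a e) \<in> \<phi> F (lmul c a)"
  using normal_mem_iff[OF C \<phi> F ca normal_mult[OF C \<phi> F a b c]] ca ideal_P3_mult[OF I a d] by simp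
qed

text \<open>The substantial inclusion is that the ideal on the larger index set is generated by the
  one on the smaller. It suffices to find in the generated ideal all multiples by eps of elements of
  \<open>C G\<close>, and one lift of each element of \<open>C G\<close>; any other lift differs by
  such a multiple.\<close>

lemma thick_closed: "closed_subscheme dual thick"
 unfolding closed_subscheme_def
proof (intro conjI ballI impI)
 show "F \<in> charts \<Longrightarrow> ideal (thick F) (P3_ring dual F)" for F by (rule thick_ideal)
 fix F G assume F: "F \<in> charts" and G: "G \<in> charts" and FG: "F \<subseteq> G"
 note I = closed_subscheme_ideal[OF C F] and IG = closed_subscheme_ideal[OF C G]
 interpret P: ring "P3_ring dual G" by (rule ring_P3_dual)
 interpret PC: cring "P3 G" by (rule cring_P3_CC)
 have CG: "C G = genideal (P3 G) (C F)" using C F G FG unfolding closed_subscheme_def by blast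
 have CFc: "C F \<subseteq> carrier (P3 G)" using ideal_P3_sub[OF I] forms_mono[OF FG] by auto
 have CFG: "C F \<subseteq> C G" unfolding CG by (rule PC.genideal_self[OF CFc])
 have sub: "thick F \<subseteq> thick G"
  unfolding thick_def mks_def using CFG normal_mono[OF C \<phi> F G FG] by auto
 have tc: "thick F \<subseteq> carrier (P3_ring dual G)" using sub ideal.Icarr[OF thick_ideal[OF G]] by blast
 define J where "J = genideal (P3_ring dual G) (thick F)"
 have J: "ideal J (P3_ring dual G)" unfolding J_def by (rule P.genideal_ideal[OF tc])
 have FJ: "thick F \<subseteq> J" unfolding J_def by (rule P.genideal_self[OF tc])
 have Jadd: "mk (\<lambda>e. a e + c e) (\<lambda>e. b e + d e) \<in> J" if "mk a b \<in> J" "mk c d \<in> J" for a b c d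
  using additive_subgroup.a_closed[OF ideal.axioms(1)[OF J] that] by (simp only: mk_add)
 have Jmult: "mk (lmul r a) (lmul r b) \<in> J"
  if "mk a b \<in> J" "r \<in> forms CC G 0" "a \<in> forms CC G 0" "b \<in> forms CC G 0" for a b r
  using ideal.I_l_closed[OF J that(1), of "mk r (\<lambda>e. 0)"] that mk_mult[OF that(2) forms_CC_zero that(3,4)]
  by (simp add: mk_form forms_CC_zero)
 \<comment> \<open>The elements \<open>c\<close> with c eps in \<open>J\<close> form an ideal
   containing \<open>C F\<close>, because \<phi> sends zero to zero.\<close>
 have J0: "C G \<subseteq> {c \<in> forms CC G 0. mk (\<lambda>e. 0) c \<in> J}"
  unfolding CG
 proof (rule PC.genideal_minimal[OF ideal_P3_CC_I])
  have "mk (\<lambda>e. 0) c \<in> J" if "c \<in> C F" for c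
   using that FJ thick_mem[of "\<lambda>e. 0" c F] normal_zero[OF C \<phi> F] ideal_P3_zero[OF I] by auto
  thus "C F \<subseteq> {c \<in> forms CC G 0. mk (\<lambda>e. 0) c \<in> J}" "(\<lambda>e. 0) \<in> {c \<in> forms CC G 0. mk (\<lambda>e. 0) c \<in> J}"
   using CFc ideal_P3_zero[OF I] forms_CC_zero by auto
  show "lmul r a \<in> {c \<in> forms CC G 0. mk (\<lambda>e. 0) c \<in> J}"
   if "r \<in> forms CC G 0" "a \<in> {c \<in> forms CC G 0. mk (\<lambda>e. 0) c \<in> J}" for r a
   using Jmult[of "\<lambda>e. 0" a r] that lmul_form[of r G 0 a 0] forms_CC_fin[OF that(1)] by (simp add: forms_CC_zero)
  show "(\<lambda>e. a e + b e) \<in> {c \<in> forms CC G 0. mk (\<lambda>e. 0) c \<in> J}"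
   if "a \<in> {c \<in> forms CC G 0. mk (\<lambda>e. 0) c \<in> J}" "b \<in> {c \<in> forms CC G 0. mk (\<lambda>e. 0) c \<in> J}" for a b
   using Jadd[of "\<lambda>e. 0" a "\<lambda>e. 0" b] that by (simp add: forms_CC_add)
 qed auto
 \<comment> \<open>The elements having some lift in \<open>J\<close> form an ideal containing
   \<open>C F\<close>, hence all of \<open>C G\<close>.\<close>
 have J1: "C G \<subseteq> {a \<in> C G. \<exists>b\<in>\<phi> G a. mk a b \<in> J}"
 proof -
  have "ideal {a \<in> C G. \<exists>b\<in>\<phi> G a. mk a b \<in> J} (P3 G)"
  proof (rule ideal_P3_CC_I)
   show "{a \<in> C G. \<exists>b\<in>\<phi> G a. mk a b \<in> J} \<subseteq> forms CC G 0" using ideal_P3_sub[OF IG] by auto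
   have "(\<lambda>e. 0) \<in> \<phi> G (\<lambda>e. 0)" "mk (\<lambda>e. 0) (\<lambda>e. 0) \<in> J" "(\<lambda>e. 0) \<in> C G"
    using normal_zero[OF C \<phi> G] ideal_P3_zero[OF IG] J0 by auto
   thus "(\<lambda>e. 0) \<in> {a \<in> C G. \<exists>b\<in>\<phi> G a. mk a b \<in> J}" by blast
   fix a assume "a \<in> {a \<in> C G. \<exists>b\<in>\<phi> G a. mk a b \<in> J}"
   then obtain b where a: "a \<in> C G" "b \<in> \<phi> G a" "mk a b \<in> J" by blast
   show "lmul r a \<in> {a \<in> C G. \<exists>b\<in>\<phi> G a. mk a b \<in> J}" if r: "r \<in> forms CC G 0" for r
    using normal_mult[OF C \<phi> G a(1,2) r] ideal_P3_mult[OF IG a(1) r]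
     Jmult[OF a(3) r ideal_P3_sub[OF IG a(1)] normal_coset(2)[OF C \<phi> G a(1,2)]] by blast
   fix c assume "c \<in> {a \<in> C G. \<exists>b\<in>\<phi> G a. mk a b \<in> J}"
   then obtain d where c: "c \<in> C G" "d \<in> \<phi> G c" "mk c d \<in> J" by blast
   show "(\<lambda>e. a e + c e) \<in> {a \<in> C G. \<exists>b\<in>\<phi> G a. mk a b \<in> J}"
    using normal_add[OF C \<phi> G a(1,2) c(1,2)] ideal_P3_add[OF IG a(1) c(1)] Jadd[OF a(3) c(3)] by blast
  qed
  moreover have "C F \<subseteq> {a \<in> C G. \<exists>b\<in>\<phi> G a. mk a b \<in> J}"
  proof
   fix a assume a: "a \<in> C F"
   obtain b where b: "b \<in> \<phi> F a" using normal_rep[OF C \<phi> F a] by blast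
   hence "mk a b \<in> J" using FJ a thick_mem by blast
   thus "a \<in> {a \<in> C G. \<exists>b\<in>\<phi> G a. mk a b \<in> J}" using a b CFG normal_mono[OF C \<phi> F G FG a] by blast
  qed
  ultimately have "genideal (P3 G) (C F) \<subseteq> {a \<in> C G. \<exists>b\<in>\<phi> G a. mk a b \<in> J}" by (rule PC.genideal_minimal)
  thus "C G \<subseteq> {a \<in> C G. \<exists>b\<in>\<phi> G a. mk a b \<in> J}" using CG by simp
 qed
 show "thick G = genideal (P3_ring dual G) (thick F)"
 proof
  show "genideal (P3_ring dual G) (thick F) \<subseteq> thick G" by (rule P.genideal_minimal[OF thick_ideal[OF G] sub])
  show "thick G \<subseteq> genideal (P3_ring dual G) (thick F)"
  proof
   fix p assume "p \<in> thick G"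
   then obtain a b where p: "p = mk a b" "a \<in> C G" "b \<in> \<phi> G a" unfolding thick_def using mks_cases by blast
   obtain b0 where b0: "b0 \<in> \<phi> G a" "mk a b0 \<in> J" using J1 p(2) by blast
   have "(\<lambda>e. b e - b0 e) \<in> C G" using normal_mem_iff[OF C \<phi> G p(2) b0(1)] p(3) by simp
   hence "mk (\<lambda>e. 0) (\<lambda>e. b e - b0 e) \<in> J" using J0 by blast
   from Jadd[OF b0(2) this] show "p \<in> genideal (P3_ring dual G) (thick F)" unfolding p(1) J_def[symmetric] by simp
  qed
 qed
qed

lemma thick_pr0:
 assumes F: "F \<in> charts"
 shows "(\<lambda>p e. pr0 (p e)) ` thick F = C F"
proof
 show "(\<lambda>p e. pr0 (p e)) ` thick F \<subseteq> C F" unfolding thick_def mks_def by auto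
 show "C F \<subseteq> (\<lambda>p e. pr0 (p e)) ` thick F"
 proof
  fix a assume a: "a \<in> C F"
  obtain b where b: "b \<in> \<phi> F a" using normal_rep[OF C \<phi> F a] by blast
  hence "mk a b \<in> thick F" using a thick_mem by blast
  moreover have "a = (\<lambda>e. pr0 (mk a b e))" by simp
  ultimately show "a \<in> (\<lambda>p e. pr0 (p e)) ` thick F" by blast
 qed
qed

text \<open>Multiplying a + b eps by eps gives a eps; if this is in the thickened ideal, then
  \<open>a\<close> is in the ideal of \<open>C\<close>, as \<phi> of zero is zero. Subtracting a
  lift of \<open>a\<close> leaves a multiple of eps.\<close>

lemma thick_flat:
 assumes F: "F \<in> charts"
 shows "flat_hom dual (P3_ring dual F Quot thick F) (\<lambda>r. thick F +>[P3_ring dual F] laurent_const dual r)"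
proof (rule flat_dual[OF ideal.quotient_is_ring[OF thick_ideal[OF F]] quot_const_hom[OF cring_dual thick_ideal[OF F]]])
 note I = closed_subscheme_ideal[OF C F]
 let ?P = "P3_ring dual F" and ?Q = "P3_ring dual F Quot thick F"
 interpret I: ideal "thick F" ?P by (rule thick_ideal[OF F])
 interpret Q: ring ?Q by (rule I.quotient_is_ring)
 have eps: "laurent_const dual (enc (0, 1)) = mk (\<lambda>e. 0) (laurent_const CC 1)"
  by (rule laurent_dual_eqI) (auto simp: laurent_const_def)
 have eps_form: "laurent_const dual (enc (0, 1)) \<in> carrier ?P" unfolding eps by (simp add: mk_form forms_CC_zero forms_CC_const)
 have eps_mult: "laurent_const dual (enc (0, 1)) \<otimes>[?P] mk a b = mk (\<lambda>e. 0) a" if "a \<in> forms CC F 0" "b \<in> forms CC F 0" for a b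
  unfolding eps P3_ring_simps mk_mult[OF forms_CC_zero forms_CC_const that] using that by (simp add: lmul_const)
 have zero: "\<zero>[?Q] = thick F" by (simp add: FactRing_def)
 fix q assume q: "q \<in> carrier ?Q"
  and z: "(thick F +>[?P] laurent_const dual (enc (0, 1))) \<otimes>[?Q] q = \<zero>[?Q]"
 obtain p where p: "p \<in> carrier ?P" "q = thick F +>[?P] p" using q by (auto simp: FactRing_def A_RCOSETS_def')
 define a b where "a = (\<lambda>e. pr0 (p e))" and "b = (\<lambda>e. pr1 (p e))"
 have pm: "p = mk a b" unfolding a_def b_def by (rule mk_pr[symmetric])
 have f: "a \<in> forms CC F 0" "b \<in> forms CC F 0" using p(1) by (simp_all add: pm mk_form)
 have "thick F +>[?P] mk (\<lambda>e. 0) a = thick F"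
  using z ring_hom_mult[OF I.rcos_ring_hom eps_form p(1)] eps_mult[OF f] zero unfolding p(2) pm by simp
 moreover have "mk (\<lambda>e. 0) a \<in> carrier ?P" using f by (simp add: mk_form forms_CC_zero)
 ultimately have "mk (\<lambda>e. 0) a \<in> thick F" using I.a_rcos_self by blast
 hence a: "a \<in> C F" using thick_mem normal_zero[OF C \<phi> F] by blast
 obtain b0 where b0: "b0 \<in> forms CC F 0" "b0 \<in> \<phi> F a" using normal_rep[OF C \<phi> F a] by blast
 have t: "mk a b0 \<in> thick F" using thick_mem a b0(2) by blast
 define c where "c = (\<lambda>e. b e - b0 e)"
 have "(\<lambda>e. - b0 e) \<in> forms CC F 0" using lmul_form[OF forms_CC_const[of "- 1" F] b0(1)] lmul_const[OF b0(1), of "- 1"] by simp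
 hence cf: "c \<in> forms CC F 0" using forms_CC_add[OF f(2), of "\<lambda>e. - b0 e"] by (simp add: c_def)
 have pe: "p = mk a b0 \<oplus>[?P] (laurent_const dual (enc (0, 1)) \<otimes>[?P] mk c (\<lambda>e. 0))"
  unfolding eps_mult[OF cf forms_CC_zero] mk_add pm by (simp add: c_def)
 have cp: "mk c (\<lambda>e. 0) \<in> carrier ?P" using cf by (simp add: mk_form forms_CC_zero)
 have mp: "laurent_const dual (enc (0, 1)) \<otimes>[?P] mk c (\<lambda>e. 0) \<in> carrier ?P" using eps_form cp by (rule I.m_closed)
 have "q = (thick F +>[?P] mk a b0) \<oplus>[?Q] (thick F +>[?P] (laurent_const dual (enc (0, 1)) \<otimes>[?P] mk c (\<lambda>e. 0)))"
  unfolding p(2) pe by (rule ring_hom_add[OF I.rcos_ring_hom I.Icarr[OF t] mp])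
 also have "thick F +>[?P] mk a b0 = \<zero>[?Q]"
  unfolding zero by (rule I.a_coset_join2[OF I.Icarr[OF t] I.a_subgroup t])
 also have "thick F +>[?P] (laurent_const dual (enc (0, 1)) \<otimes>[?P] mk c (\<lambda>e. 0))
   = (thick F +>[?P] laurent_const dual (enc (0, 1))) \<otimes>[?Q] (thick F +>[?P] mk c (\<lambda>e. 0))"
  by (rule ring_hom_mult[OF I.rcos_ring_hom eps_form cp])
 finally have "q = (thick F +>[?P] laurent_const dual (enc (0, 1))) \<otimes>[?Q] (thick F +>[?P] mk c (\<lambda>e. 0))"
  using ring_hom_closed[OF I.rcos_ring_hom eps_form] ring_hom_closed[OF I.rcos_ring_hom cp] by simp
 thus "\<exists>c\<in>carrier ?Q. q = (thick F +>[?P] laurent_const dual (enc (0, 1))) \<otimes>[?Q] c"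
  using ring_hom_closed[OF I.rcos_ring_hom cp] by blast
qed

end

text \<open>Over a field a nontrivial relation has an invertible coefficient and can be solved for
  one element.\<close>

lemma flat_CC:
 assumes Q: "ring (Q :: 'b ring)" and h: "h \<in> ring_hom CC Q"
 shows "flat_hom CC Q h"
 unfolding flat_hom_def
proof (intro allI impI, elim conjE)
 fix n :: nat and r m
 assume m: "m \<in> {..<n} \<rightarrow> carrier Q" and s: "(\<Oplus>\<^bsub>Q\<^esub>i\<in>{..<n}. h (r i) \<otimes>[Q] m i) = \<zero>[Q]"
 interpret Q: ring Q by (rule Q)
 interpret h: ring_hom_ring CC Q h using cring.axioms(1)[OF cring_CC] Q h by (simp add: ring_hom_ringI2)
 have mc: "m i \<in> carrier Q" if "i < n" for i using m that by auto
 show "\<exists>(k::nat) a y. (\<forall>i<n. \<forall>j<k. a i j \<in> carrier CC) \<and> y \<in> {..<k} \<rightarrow> carrier Q \<and>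
     (\<forall>i<n. m i = (\<Oplus>\<^bsub>Q\<^esub>j\<in>{..<k}. h (a i j) \<otimes>[Q] y j)) \<and>
     (\<forall>j<k. (\<Oplus>\<^bsub>CC\<^esub>i\<in>{..<n}. r i \<otimes>[CC] a i j) = \<zero>[CC])"
 proof (cases "\<forall>i<n. r i = 0")
  case True
  thus ?thesis by (intro flat_zero_relation[OF cring_CC Q h _ mc]) simp_all
 next
  case False
  then obtain i where i: "i < n" "r i \<noteq> 0" by blast
  show ?thesis
  proof (rule flat_dual_relation[OF cring_CC Q h, where \<beta> = r and w = "inverse (r i)" and e = 0 and c = "\<zero>[Q]" and ?i0.0 = i])
   show "(\<Oplus>\<^bsub>Q\<^esub>i\<in>{..<n}. h (r i) \<otimes>[Q] m i) = h 0 \<otimes>[Q] \<zero>[Q]" using s h.hom_closed[of 0] by simp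
  qed (use i mc in auto)
 qed
qed

subsection \<open>Tangent vectors of the Hilbert scheme\<close>

lemma genideal_ideal_self: "cring R \<Longrightarrow> ideal I R \<Longrightarrow> genideal R I = I"
 using ring.genideal_minimal[of R I I] ring.genideal_self[of R I] ideal.Icarr[of I R] cring.axioms(1)[of R] by blast

context
 fixes P :: "rat poly" and H :: "('p, 's) cspace" and Z :: "'p set \<Rightarrow> 's subscheme" and x :: 'p and C :: "complex subscheme"
 assumes hilb: "hilbert_scheme P H Z" and x: "closed_point H x"
  and C: "C = fibre H Z x" and CC: "closed_subscheme CC C"
begin

interpretation H: ft_scheme H
 using hilb by (simp add: hilbert_scheme_def ft_scheme_def ft_scheme_axioms_def ringed_def finite_type_scheme_def)

lemma hilb_rel: "relative_subscheme H Z"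
 using hilb by (simp add: hilbert_scheme_def hilbert_family_def)

lemma cpoint_x: "H.cpoint x"
 using x H.cpoint_iff_closed by simp

lemma x_top: "x \<in> topspace (zar H)"
 using x closedin_subset unfolding closed_point_def by fastforce

lemma hilb_C: "has_hilbert_poly C P"
 using hilb x by (simp add: C hilbert_scheme_def hilbert_family_def)

lemma fib_C: "affine_open H U \<Longrightarrow> x \<in> U \<Longrightarrow> F \<in> charts \<Longrightarrow> (\<lambda>p e. value_at H U x (p e)) ` Z U F = C F"
 using H.fibre_eq_fib[OF hilb_rel cpoint_x, of U F] by (simp add: C H.fib_def H.affine_open_iff_aff)

lemma point_hilb_family: "hilbert_family P cpt.T (cpt.fam C)"
proof (rule cpt.hilbert_family_fam[OF CC _ hilb_C])
 fix F assume "F \<in> charts"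
 hence I: "ideal (C F) (P3 F)" by (rule closed_subscheme_ideal[OF CC])
 show "flat_hom CC (P3 F Quot C F) (\<lambda>r. C F +>[P3 F] laurent_const CC r)"
  by (rule flat_CC[OF ideal.quotient_is_ring[OF I] quot_const_hom[OF cring_CC I]])
qed simp

text \<open>Uniqueness in the representability of the Hilbert functor, tested on the reduced point.
  The point \<open>y\<close> with \<open>\<rho>\<close> and the point \<open>x\<close> with
  evaluation both define morphisms that pull the universal family back to \<open>C\<close>, so they
  are equal.\<close>

lemma hilb_point_unique:
 assumes y: "y \<in> topspace (zar H)"
  and hom: "\<And>W. openin (zar H) W \<Longrightarrow> y \<in> W \<Longrightarrow> \<rho> W \<in> ring_hom (sec H W) CC"
  and scal: "\<And>W c. openin (zar H) W \<Longrightarrow> y \<in> W \<Longrightarrow> \<rho> W (scal H W c) = c"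
  and rest: "\<And>W V s. openin (zar H) W \<Longrightarrow> openin (zar H) V \<Longrightarrow> V \<subseteq> W \<Longrightarrow> y \<in> V \<Longrightarrow> s \<in> carrier (sec H W) \<Longrightarrow>
   \<rho> V (rest H W V s) = \<rho> W s"
  and loc: "\<And>W s. openin (zar H) W \<Longrightarrow> y \<in> W \<Longrightarrow> s \<in> carrier (sec H W) \<Longrightarrow> \<rho> W s \<noteq> 0 \<Longrightarrow> invertible_at H W y s"
  and gen: "\<And>U F. affine_open H U \<Longrightarrow> y \<in> U \<Longrightarrow> F \<in> charts \<Longrightarrow>
   genideal (P3 F) ((\<lambda>p e. \<rho> U (p e)) ` Z U F) = C F"
 shows "y = x" "\<And>W s. openin (zar H) W \<Longrightarrow> y \<in> W \<Longrightarrow> s \<in> carrier (sec H W) \<Longrightarrow> \<rho> W s = value_at H W x s"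
proof -
 have Zc: "Z U F \<subseteq> forms (sec H U) F 0" if "affine_open H U" "F \<in> charts" for U F
  by (rule relative_subscheme_forms[OF hilb_rel that])
 note cx = cpoint_x
 let ?f = "\<lambda>y \<rho>. (\<lambda>t\<in>{0::complex}. y, \<lambda>U\<in>{U. openin (zar H) U}. \<lambda>s\<in>carrier (sec H U). if y \<in> U then \<rho> U s else \<zero>[CC])"
 have f: "morphism cpt.T H (?f y \<rho>)" "is_pullback cpt.T H (?f y \<rho>) Z (cpt.fam C)"
  by (rule cpt.point_morphism[OF H.rc y hom scal rest loc]; assumption)
   (rule cpt.point_pullback[OF Zc gen]; assumption)
 have gx: "genideal (P3 F) ((\<lambda>p e. value_at H U x (p e)) ` Z U F) = C F"
  if "affine_open H U" "x \<in> U" "F \<in> charts" for U F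
  unfolding fib_C[OF that] by (rule genideal_ideal_self[OF cring_P3_CC closed_subscheme_ideal[OF CC that(3)]])
 have fx: "morphism cpt.T H (?f x (\<lambda>U. value_at H U x))" "is_pullback cpt.T H (?f x (\<lambda>U. value_at H U x)) Z (cpt.fam C)"
 proof (rule cpt.point_morphism[OF H.rc x_top])
  show "\<And>W. openin (zar H) W \<Longrightarrow> x \<in> W \<Longrightarrow> value_at H W x \<in> ring_hom (sec H W) CC" by (rule H.value_hom[OF cx])
  show "\<And>W c. openin (zar H) W \<Longrightarrow> x \<in> W \<Longrightarrow> value_at H W x (scal H W c) = c" by (rule H.value_scal[OF cx])
  show "value_at H V x (rest H W V s) = value_at H W x s"
   if "openin (zar H) W" "openin (zar H) V" "V \<subseteq> W" "x \<in> V" "s \<in> carrier (sec H W)" for W V s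
   by (rule H.value_rest[OF cx that(1,4,2,3,5)])
  show "invertible_at H W x s" if "openin (zar H) W" "x \<in> W" "s \<in> carrier (sec H W)" "value_at H W x s \<noteq> 0" for W s
   using H.value_zero_iff[OF cx that(1,2,3)] that(4) by simp
  show "is_pullback cpt.T H (?f x (\<lambda>U. value_at H U x)) Z (cpt.fam C)" by (rule cpt.point_pullback[OF Zc gx])
 qed
 have "\<exists>!f. morphism cpt.T H f \<and> is_pullback cpt.T H f Z (cpt.fam C)"
  using hilb cpt.finite_type_T point_hilb_family unfolding hilbert_scheme_def by blast
 hence eq: "?f y \<rho> = ?f x (\<lambda>U. value_at H U x)" using f fx by blast
 have "fst (?f y \<rho>) 0 = fst (?f x (\<lambda>U. value_at H U x)) 0" unfolding eq ..
 thus yx: "y = x" by simp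
 fix W s assume W: "openin (zar H) W" "y \<in> W" "s \<in> carrier (sec H W)"
 have "snd (?f y \<rho>) W s = snd (?f x (\<lambda>U. value_at H U x)) W s" unfolding eq ..
 thus "\<rho> W s = value_at H W x s" using W yx by simp
qed

text \<open>Existence in the representability, tested on the dual numbers: the thickening of
  \<open>C\<close> along \<phi> comes from a morphism. Modulo eps this morphism induces
  \<open>C\<close>, so its point is \<open>x\<close> and its reduction is evaluation. The eps part
  of \<eta> is the tangent vector; it takes an equation of the family to a representative of \<phi>
  of its value at \<open>x\<close>.\<close>

lemma first_order_section:
 assumes \<phi>: "\<phi> \<in> H0_normal C" and U: "affine_open H U" "x \<in> U"
 obtains \<eta> where "\<eta> \<in> ring_hom (sec H U) dual" "\<And>s. s \<in> carrier (sec H U) \<Longrightarrow> pr0 (\<eta> s) = value_at H U x s"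
  "\<And>F p. F \<in> charts \<Longrightarrow> p \<in> Z U F \<Longrightarrow> (\<lambda>e. pr1 (\<eta> (p e))) \<in> \<phi> F (\<lambda>e. value_at H U x (p e))"
proof -
 have "hilbert_family P dual.T (dual.fam (thick C \<phi>))"
  by (rule dual.hilbert_family_fam[OF thick_closed[OF CC \<phi>] thick_flat[OF CC \<phi>] hilb_C thick_pr0[OF CC \<phi>]])
 hence "\<exists>!f. morphism dual.T H f \<and> is_pullback dual.T H f Z (dual.fam (thick C \<phi>))"
  using hilb dual.finite_type_T unfolding hilbert_scheme_def by blast
 then obtain m h where f: "morphism dual.T H (m, h)" "is_pullback dual.T H (m, h) Z (dual.fam (thick C \<phi>))" by auto
 note M = morphismD[OF f(1)]
 have pre: "preim dual.T m W = {0}" if "m 0 \<in> W" for W using that by (auto simp: preim_def dual.zarT)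
 have top: "0 \<in> topspace (zar dual.T)" by (simp add: dual.zarT)
 have m0: "m 0 \<in> topspace (zar H)" using M(2) top by (auto simp: continuous_map)
 have hW: "h W \<in> ring_hom (sec H W) dual" if "openin (zar H) W" "m 0 \<in> W" for W
  using M(5)[OF that(1)] pre[OF that(2)] by simp
 have pb: "thick C \<phi> F = genideal (P3_ring dual F) ((\<lambda>p e. h W (p e)) ` Z W F)"
  if W: "affine_open H W" "m 0 \<in> W" "F \<in> charts" for W F
 proof -
  have "affine_open dual.T {0} \<and> fst (m, h) ` {0} \<subseteq> W" using W by (simp add: dual.affine_T)
  thus ?thesis using f(2) W pre[OF W(2)] unfolding is_pullback_def by fastforce
 qed
 have hZ: "(\<lambda>e. h W (p e)) \<in> thick C \<phi> F" if W: "affine_open H W" "m 0 \<in> W" "F \<in> charts" "p \<in> Z W F" for W F p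
 proof -
  have oW: "openin (zar H) W" using W(1) by (simp add: affine_open_def)
  have "(\<lambda>p e. h W (p e)) ` Z W F \<subseteq> carrier (P3_ring dual F)"
   using forms_hom[OF cring.axioms(1)[OF H.sec_cring[OF oW]] cring.axioms(1)[OF cring_dual] hW[OF oW W(2)]]
    relative_subscheme_forms[OF hilb_rel W(1,3)] by auto
  thus ?thesis unfolding pb[OF W(1-3)] using ring.genideal_self[OF ring_P3_dual] W(4) by blast
 qed
 \<comment> \<open>The reduction modulo eps of the morphism pulls the family back to
   \<open>C\<close>, which is the hypothesis for identifying its point.\<close>
 have gen: "genideal (P3 F) ((\<lambda>p e. pr0 (h W (p e))) ` Z W F) = C F"
  if W: "affine_open H W" "m 0 \<in> W" "F \<in> charts" for W F
 proof
  interpret R: cring "P3 F" by (rule cring_P3_CC)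
  interpret D: ring "P3_ring dual F" by (rule ring_P3_dual)
  note CI = closed_subscheme_ideal[OF CC W(3)]
  have sub: "(\<lambda>p e. pr0 (h W (p e))) ` Z W F \<subseteq> C F"
  proof
   fix q assume "q \<in> (\<lambda>p e. pr0 (h W (p e))) ` Z W F"
   then obtain p where p: "p \<in> Z W F" "q = (\<lambda>e. pr0 (h W (p e)))" by blast
   have "(\<lambda>e. pr0 (h W (p e))) \<in> (\<lambda>p e. pr0 (p e)) ` thick C \<phi> F" by (rule image_eqI[OF refl hZ[OF W p(1)]])
   thus "q \<in> C F" unfolding thick_pr0[OF CC \<phi> W(3)] p(2) .
  qed
  thus "genideal (P3 F) ((\<lambda>p e. pr0 (h W (p e))) ` Z W F) \<subseteq> C F" by (rule R.genideal_minimal[OF CI])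
  define J where "J = genideal (P3 F) ((\<lambda>p e. pr0 (h W (p e))) ` Z W F)"
  have car: "(\<lambda>p e. pr0 (h W (p e))) ` Z W F \<subseteq> carrier (P3 F)" using sub ideal.Icarr[OF CI] by blast
  have J: "ideal J (P3 F)" unfolding J_def by (rule R.genideal_ideal[OF car])
  have "(\<lambda>p e. pr0 (p e)) \<in> ring_hom (P3_ring dual F) (P3 F)"
   by (rule P3_ring_hom[OF cring_dual cring_CC pr0_hom])
  then interpret pr: ring_hom_ring "P3_ring dual F" "P3 F" "\<lambda>p e. pr0 (p e)"
   using D.ring_axioms R.ring_axioms by (simp add: ring_hom_ringI2)
  \<comment> \<open>Preimage of \<open>J\<close> under reduction modulo eps: an ideal that contains
    the generators of the thickening and hence all of it.\<close>
  have V: "ideal {q \<in> carrier (P3_ring dual F). (\<lambda>e. pr0 (q e)) \<in> J} (P3_ring dual F)" by (rule pr.ideal_vimage[OF J])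
  have "(\<lambda>p e. h W (p e)) ` Z W F \<subseteq> {q \<in> carrier (P3_ring dual F). (\<lambda>e. pr0 (q e)) \<in> J}"
  proof
   fix q assume "q \<in> (\<lambda>p e. h W (p e)) ` Z W F"
   then obtain p where p: "p \<in> Z W F" "q = (\<lambda>e. h W (p e))" by blast
   have "q \<in> carrier (P3_ring dual F)" unfolding p(2) by (rule ideal.Icarr[OF thick_ideal[OF CC \<phi> W(3)] hZ[OF W p(1)]])
   moreover have "(\<lambda>e. pr0 (q e)) \<in> J" unfolding J_def p(2) using R.genideal_self[OF car] p(1) by blast
   ultimately show "q \<in> {q \<in> carrier (P3_ring dual F). (\<lambda>e. pr0 (q e)) \<in> J}" by simp
  qed
  hence "thick C \<phi> F \<subseteq> {q \<in> carrier (P3_ring dual F). (\<lambda>e. pr0 (q e)) \<in> J}"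
   unfolding pb[OF W] by (rule D.genideal_minimal[OF V])
  hence "(\<lambda>p e. pr0 (p e)) ` thick C \<phi> F \<subseteq> J" by blast
  thus "C F \<subseteq> genideal (P3 F) ((\<lambda>p e. pr0 (h W (p e))) ` Z W F)"
   unfolding thick_pr0[OF CC \<phi> W(3)] J_def .
 qed
 \<comment> \<open>The conclusion must be drawn for all open sets at once, since it is not yet known
   that \<open>U\<close> contains the point \<open>m 0\<close>.\<close>
 have uniq: "m 0 = x \<and> (\<forall>W s. openin (zar H) W \<longrightarrow> m 0 \<in> W \<longrightarrow> s \<in> carrier (sec H W) \<longrightarrow> pr0 (h W s) = value_at H W x s)"
 proof -
  have hom: "(\<lambda>s. pr0 (h W s)) \<in> ring_hom (sec H W) CC" if "openin (zar H) W" "m 0 \<in> W" for W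
   using ring_hom_trans[OF hW[OF that] pr0_hom] by (simp add: comp_def)
  have scal: "pr0 (h W (scal H W c)) = c" if "openin (zar H) W" "m 0 \<in> W" for W c
   using M(6)[OF that(1), of c] pre[OF that(2)] by simp
  have rest: "pr0 (h V (rest H W V s)) = pr0 (h W s)"
   if "openin (zar H) W" "openin (zar H) V" "V \<subseteq> W" "m 0 \<in> V" "s \<in> carrier (sec H W)" for W V s
   using M(7)[OF that(1,2,3,5)] pre[OF that(4)] by simp
  have loc: "invertible_at H W (m 0) s"
   if "openin (zar H) W" "m 0 \<in> W" "s \<in> carrier (sec H W)" "pr0 (h W s) \<noteq> 0" for W s
   using M(8)[OF that(1,3), of 0] pre[OF that(2)] dual.invertible_T[of "h W s"] that(4) by simp
  have "m 0 = x" by (rule hilb_point_unique(1)[where \<rho> = "\<lambda>W s. pr0 (h W s)", OF m0 hom scal rest loc gen]; assumption)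
  moreover have "pr0 (h W s) = value_at H W x s" if "openin (zar H) W" "m 0 \<in> W" "s \<in> carrier (sec H W)" for W s
   by (rule hilb_point_unique(2)[where \<rho> = "\<lambda>W s. pr0 (h W s)", OF m0 hom scal rest loc gen that]; assumption)
  ultimately show ?thesis by blast
 qed
 have oU: "openin (zar H) U" using U(1) by (simp add: affine_open_def)
 have m0U: "m 0 \<in> U" using uniq U(2) by simp
 have pr0: "pr0 (h U s) = value_at H U x s" if "s \<in> carrier (sec H U)" for s using uniq oU m0U that by blast
 show ?thesis
 proof (rule that[of "h U"])
  show "h U \<in> ring_hom (sec H U) dual" by (rule hW[OF oU m0U])
  show "\<And>s. s \<in> carrier (sec H U) \<Longrightarrow> pr0 (h U s) = value_at H U x s" by (rule pr0)
  fix F p assume F: "F \<in> charts" and p: "p \<in> Z U F"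
  have "p e \<in> carrier (sec H U)" for e using relative_subscheme_forms[OF hilb_rel U(1) F] p formsD(1) by blast
  hence v: "(\<lambda>e. pr0 (h U (p e))) = (\<lambda>e. value_at H U x (p e))" using pr0 by blast
  have "(\<lambda>e. h U (p e)) \<in> thick C \<phi> F" by (rule hZ[OF U(1) m0U F p])
  hence "(\<lambda>e. pr1 (h U (p e))) \<in> \<phi> F (\<lambda>e. pr0 (h U (p e)))" by (simp add: thick_def[OF CC \<phi>] mks_def)
  thus "(\<lambda>e. pr1 (h U (p e))) \<in> \<phi> F (\<lambda>e. value_at H U x (p e))" unfolding v .
 qed
qed

end

subsection \<open>Lifting equations to a general point\<close>

text \<open>Division by the \<open>d\<close>-th power of the \<open>i\<close>-th variable, the shift
  of \<open>form_ideal\<close> over an arbitrary ring of coefficients.\<close>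

definition dehom :: "int \<Rightarrow> nat \<Rightarrow> 'a laurent \<Rightarrow> 'a laurent" where
 "dehom d i f = (\<lambda>e. f (e(i := e i + d)))"

lemma exponents_dehom:
 assumes i: "i < 4" and e: "e(i := e i + d) \<in> exponents {} d"
 shows "e \<in> exponents {i} 0"
proof -
 have "(\<Sum>k<4. (e(i := e i + d)) k) = (e i + d) + (\<Sum>k\<in>{..<4} - {i}. (e(i := e i + d)) k)"
  using i by (subst sum.remove[of _ i]) auto
 also have "(\<Sum>k\<in>{..<4} - {i}. (e(i := e i + d)) k) = (\<Sum>k\<in>{..<4} - {i}. e k)" by (rule sum.cong) auto
 also have "(e i + d) + \<dots> = (\<Sum>k<4. e k) + d" using i by (subst (2) sum.remove[of _ i]) auto
 finally have "(\<Sum>k<4. e k) = 0" using e by (simp add: exponents_def)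
 moreover have "e k = 0" if "k \<ge> 4" for k
 proof -
  have "(e(i := e i + d)) k = 0" using e that unfolding exponents_def by blast
  thus ?thesis using i that by simp
 qed
 moreover have "0 \<le> e k" if "k < 4" "k \<noteq> i" for k
 proof -
  have "0 \<le> (e(i := e i + d)) k" using e that unfolding exponents_def by blast
  thus ?thesis using that by simp
 qed
 ultimately show ?thesis unfolding exponents_def by blast
qed

lemma dehom_form:
 assumes f: "f \<in> forms R {} d" and i: "i < 4"
 shows "dehom d i f \<in> forms R {i} 0"
proof (rule formsI[where B = "(\<lambda>e. e(i := e i - d)) ` {e. f e \<noteq> \<zero>[R]}"])
 show "dehom d i f e \<in> carrier R" for e using formsD(1)[OF f] by (simp add: dehom_def)
 show "finite ((\<lambda>e. e(i := e i - d)) ` {e. f e \<noteq> \<zero>[R]})" using formsD(2)[OF f] by simp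
 show "dehom d i f e = \<zero>[R]" if "e \<notin> (\<lambda>e. e(i := e i - d)) ` {e. f e \<noteq> \<zero>[R]}" for e
 proof (rule ccontr)
  assume "dehom d i f e \<noteq> \<zero>[R]"
  moreover have "e = (\<lambda>e. e(i := e i - d)) (e(i := e i + d))" by simp
  ultimately show False using that unfolding dehom_def by blast
 qed
 show "dehom d i f e = \<zero>[R]" if "e \<notin> exponents {i} 0" for e
  using exponents_dehom[OF i, of e d] that formsD(3)[OF f] unfolding dehom_def by blast
qed

lemma countable_exponents: "countable (exponents F n)"
proof (rule countable_image_inj_on)
 show "countable ((\<lambda>e. (e 0, e 1, e 2, e 3)) ` exponents F n)" by simp
 show "inj_on (\<lambda>e. (e 0, e 1, e 2, e 3)) (exponents F n)"
 proof (rule inj_onI, rule ext)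
  fix e e' k assume "e \<in> exponents F n" "e' \<in> exponents F n" and eq: "(e 0, e 1, e 2, e 3) = (e' 0, e' 1, e' 2, e' 3)"
  hence z: "k \<ge> 4 \<Longrightarrow> e k = 0 \<and> e' k = 0" unfolding exponents_def by blast
  consider "k \<ge> 4" | "k = 0" | "k = 1" | "k = 2" | "k = 3" by linarith
  thus "e k = e' k" by cases (use z eq in auto)
 qed
qed

context ringed
begin

text \<open>The module in question is the sum of the four chart rings modulo the ideals of the
  family, and its submodule consists of the classes of forms of degree \<open>d\<close>. A form in
  the ideal of the fibre, with constant coefficients, has dehomogenisations in the ideal of the
  family up to coefficients in the prime of \<open>x\<close>. By \<open>very_general_pure\<close>
  the correction can be chosen to be a form with coefficients in that prime, the same for all four
  charts. Subtracting it gives an equation of the family with the prescribed value.\<close>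

lemma general_lifting:
 assumes Z: "relative_subscheme X Z" and U: "aff U" and p0: "primeideal p0 (sec X U)"
  and red: "\<And>a. a \<in> p0 \<Longrightarrow> \<exists>t\<in>Sec U - p0. t \<otimes>[sec X U] a = \<zero>[sec X U]"
 shows "\<exists>T. countable T \<and> T \<subseteq> Sec U - p0 \<and>
  (\<forall>x\<in>U. cpoint x \<and> p0 \<subseteq> ptid U x \<and> T \<inter> ptid U x = {} \<longrightarrow>
   (\<forall>G0\<in>form_ideal (fibre X Z x) d. \<exists>G\<in>forms (sec X U) {} d.
    (\<forall>i<4. dehom d i G \<in> Z U {i}) \<and> (\<lambda>e. value_at X U x (G e)) = G0))"
proof -
 define A where "A = sec X U"
 define k where "k = scal X U"
 have oU: "opn U" by (rule affD(1)[OF U])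
 have aU: "affine_open X U" using U affine_open_iff_aff by simp
 interpret A: C_algebra A k unfolding A_def k_def by (rule scal_algebra[OF oU])
 interpret B: base_ring A by (rule base_ring.intro[OF A.is_cring])
 have ch: "{i} \<in> charts" if "i < 4" for i using that by (simp add: charts_def)
 have ZI: "ideal (Z U {i}) (P3_ring A {i})" if "i < 4" for i
  unfolding A_def by (rule relative_subscheme_sub[OF Z aU ch[OF that]])
 have Zf: "p \<in> forms A {i} 0" if "i < 4" "p \<in> Z U {i}" for i p using ideal.Icarr[OF ZI[OF that(1)] that(2)] by simp
 have Zadd: "(\<lambda>e. p e \<oplus>[A] q e) \<in> Z U {i}" if "i < 4" "p \<in> Z U {i}" "q \<in> Z U {i}" for i p q
  using additive_subgroup.a_closed[OF ideal.axioms(1)[OF ZI[OF that(1)]] that(2,3)] by simp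
 have Zmult: "(\<lambda>e. a \<otimes>[A] p e) \<in> Z U {i}" if "i < 4" "p \<in> Z U {i}" "a \<in> carrier A" for i p a
  using ideal.I_l_closed[OF ZI[OF that(1)] that(2), of "laurent_const A a"] laurent_const_form[OF that(3) A.zero_closed]
   B.laurent_const_mult[OF that(3) Zf[OF that(1,2)]] by simp
 have Zzero: "(\<lambda>e. \<zero>[A]) \<in> Z U {i}" if "i < 4" for i
  using additive_subgroup.zero_closed[OF ideal.axioms(1)[OF ZI[OF that]]] by (simp add: laurent_const_zero)
 define I0 where "I0 = {4::nat} \<times> exponents {} d"
 define I where "I = I0 \<union> (\<Union>i<4. {i} \<times> exponents {i} 0)"
 have cI: "countable I" unfolding I_def I0_def using countable_exponents by (auto intro!: countable_SIGMA)
 have I0I: "I0 \<subseteq> I" by (simp add: I_def)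
 txt \<open>Index \<open>(4, e)\<close> is the coefficient of a form, \<open>(i, e)\<close> that of a correction of its dehomogenisation in chart \<open>i\<close>.\<close>
 define Rel where "Rel = {w \<in> A.fin_supp UNIV (carrier A). \<forall>i<4. (\<lambda>e. w (i, e) \<oplus>[A] w (4, e(i := e i + d))) \<in> Z U {i}}"
 have R1: "Rel \<subseteq> A.fin_supp UNIV (carrier A)" by (auto simp: Rel_def)
 have R2: "(\<lambda>j. \<zero>[A]) \<in> Rel"
 proof -
  have "(\<lambda>j. \<zero>[A]) \<in> A.fin_supp UNIV (carrier A)" by (rule A.fin_suppI[where J = "{}"]) auto
  thus ?thesis unfolding Rel_def using Zzero by simp
 qed
 have R3: "(\<lambda>j. a \<otimes>[A] c j \<oplus>[A] b \<otimes>[A] c' j) \<in> Rel"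
  if c: "c \<in> Rel" "c' \<in> Rel" "a \<in> carrier A" "b \<in> carrier A" for c c' a b
 proof -
  have cc: "c j \<in> carrier A" "c' j \<in> carrier A" for j using c(1,2) A.fin_suppD(1) unfolding Rel_def by auto
  have "(\<lambda>e. (a \<otimes>[A] c (i, e) \<oplus>[A] b \<otimes>[A] c' (i, e)) \<oplus>[A] (a \<otimes>[A] c (4, e(i := e i + d)) \<oplus>[A] b \<otimes>[A] c' (4, e(i := e i + d)))) \<in> Z U {i}"
   if i: "i < 4" for i
  proof -
   have z: "(\<lambda>e. c (i, e) \<oplus>[A] c (4, e(i := e i + d))) \<in> Z U {i}" "(\<lambda>e. c' (i, e) \<oplus>[A] c' (4, e(i := e i + d))) \<in> Z U {i}"
    using c(1,2) i unfolding Rel_def by blast+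
   have "(\<lambda>e. (a \<otimes>[A] c (i, e) \<oplus>[A] b \<otimes>[A] c' (i, e)) \<oplus>[A] (a \<otimes>[A] c (4, e(i := e i + d)) \<oplus>[A] b \<otimes>[A] c' (4, e(i := e i + d))))
    = (\<lambda>e. a \<otimes>[A] (c (i, e) \<oplus>[A] c (4, e(i := e i + d))) \<oplus>[A] b \<otimes>[A] (c' (i, e) \<oplus>[A] c' (4, e(i := e i + d))))"
    using cc c(3,4) by (simp add: A.r_distr A.a_ac)
   thus ?thesis using Zadd[OF i Zmult[OF i z(1) c(3)] Zmult[OF i z(2) c(4)]] by simp
  qed
  moreover have "(\<lambda>j. a \<otimes>[A] c j \<oplus>[A] b \<otimes>[A] c' j) \<in> A.fin_supp UNIV (carrier A)"
   using c(1,2) R1 A.fin_supp_comb[OF _ _ A.oneideal c(3,4)] by blast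
  ultimately show ?thesis unfolding Rel_def by blast
 qed
 have ex: "\<exists>T. countable T \<and> T \<subseteq> carrier A - p0 \<and>
  (\<forall>m. primeideal m A \<and> p0 \<subseteq> m \<and> T \<inter> m = {} \<longrightarrow>
   (\<forall>y\<in>A.fin_supp I0 (carrier A). \<forall>\<mu>\<in>A.fin_supp I m. (\<lambda>i. y i \<ominus>[A] \<mu> i) \<in> Rel \<longrightarrow>
    (\<exists>s\<in>carrier A - m. \<exists>v\<in>A.fin_supp I0 m. (\<lambda>i. s \<otimes>[A] y i \<ominus>[A] v i) \<in> Rel)))"
  by (rule A.very_general_pure[OF p0[folded A_def] red[folded A_def] R1 R2 R3 cI I0I])
 from ex obtain T where T: "countable T" "T \<subseteq> carrier A - p0" and
  Tm: "\<forall>m. primeideal m A \<and> p0 \<subseteq> m \<and> T \<inter> m = {} \<longrightarrow>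
   (\<forall>y\<in>A.fin_supp I0 (carrier A). \<forall>\<mu>\<in>A.fin_supp I m. (\<lambda>i. y i \<ominus>[A] \<mu> i) \<in> Rel \<longrightarrow>
    (\<exists>s\<in>carrier A - m. \<exists>v\<in>A.fin_supp I0 m. (\<lambda>i. s \<otimes>[A] y i \<ominus>[A] v i) \<in> Rel))"
  by (elim exE conjE) (rule that)
 have "\<exists>G\<in>forms A {} d. (\<forall>i<4. dehom d i G \<in> Z U {i}) \<and> (\<lambda>e. value_at X U x (G e)) = G0"
  if x: "x \<in> U" "cpoint x" "p0 \<subseteq> ptid U x" "T \<inter> ptid U x = {}" and G0: "G0 \<in> form_ideal (fibre X Z x) d" for x G0
 proof -
  define m where "m = ptid U x"
  define val where "val = value_at X U x"
  have mp: "primeideal m A" unfolding m_def A_def by (rule aff_prime[OF U x(1)])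
  have vh: "val \<in> ring_hom A CC" unfolding A_def val_def by (rule value_hom[OF x(2) oU x(1)])
  interpret v: ring_hom_ring A CC val using vh A.ring_axioms cring_CC by (simp add: ring_hom_ringI2 cring.axioms(1))
  have vminus: "val (a \<ominus>[A] b) = val a - val b" if "a \<in> carrier A" "b \<in> carrier A" for a b
   using that by (simp add: a_minus_def)
  have m_iff: "s \<in> m \<longleftrightarrow> val s = 0" if "s \<in> carrier A" for s
   using that value_zero_iff[OF x(2) oU x(1), of s] unfolding m_def A_def val_def ptid_def by blast
  have vk: "val (k c) = c" for c unfolding val_def k_def by (rule value_scal[OF x(2) oU x(1)])
  have G0f: "G0 \<in> forms CC {} d" using G0 by (simp add: form_ideal_def)
  have "\<exists>z\<in>Z U {i}. dehom d i G0 = (\<lambda>e. val (z e))" if i: "i < 4" for i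
  proof -
   have "dehom d i G0 \<in> fibre X Z x {i}" using G0 i by (simp add: form_ideal_def dehom_def)
   thus ?thesis unfolding fibre_eq_fib[OF Z x(2) U x(1) ch[OF i]] fib_def val_def by blast
  qed
  then obtain z where z: "\<And>i. i < 4 \<Longrightarrow> z i \<in> Z U {i}" "\<And>i. i < 4 \<Longrightarrow> dehom d i G0 = (\<lambda>e. val (z i e))" by metis
  note zf = Zf[OF _ z(1)]
  \<comment> \<open>\<open>G0\<close> with its coefficients read as constant sections; it has the
    right value at \<open>x\<close> but need not lie in the ideal of the family.\<close>
  define Y where "Y = (\<lambda>e. k (G0 e))"
  have Yf: "Y \<in> forms A {} d"
   unfolding Y_def using forms_hom[OF cring.axioms(1)[OF cring_CC] A.ring_axioms _ G0f, of k] scal_hom[OF oU] by (simp add: k_def A_def)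
  have Yc: "Y e \<in> carrier A" for e by (rule formsD(1)[OF Yf])
  define y where "y = (\<lambda>j :: nat \<times> (nat \<Rightarrow> int). if fst j = 4 then Y (snd j) else \<zero>[A])"
  \<comment> \<open>The chartwise errors between \<open>Y\<close> and elements \<open>z i\<close> of
    the family with the same value; they vanish at \<open>x\<close>, so their coefficients lie in
    \<open>m\<close>.\<close>
  define \<mu> where "\<mu> = (\<lambda>j. if fst j < 4 then dehom d (fst j) Y (snd j) \<ominus>[A] z (fst j) (snd j) else \<zero>[A])"
  have y: "y \<in> A.fin_supp I0 (carrier A)"
  proof (rule A.fin_suppI[where J = "{4} \<times> {e. Y e \<noteq> \<zero>[A]}"])
   show "finite ({4::nat} \<times> {e. Y e \<noteq> \<zero>[A]})" using formsD(2)[OF Yf] by blast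
   show "y j = \<zero>[A]" if "j \<notin> I0" for j using that formsD(3)[OF Yf, of "snd j"] by (cases j) (auto simp: y_def I0_def)
  qed (auto simp: y_def Yc)
  have dc: "dehom d i Y e \<in> carrier A" "z i e \<in> carrier A" if "i < 4" for i e
   using Yc formsD(1)[OF zf[OF that that]] by (simp_all add: dehom_def)
  have \<mu>: "\<mu> \<in> A.fin_supp I m"
  proof (rule A.fin_suppI[where J = "\<Union>i<4. {i} \<times> ({e. dehom d i Y e \<noteq> \<zero>[A]} \<union> {e. z i e \<noteq> \<zero>[A]})"])
   show "\<mu> j \<in> carrier A" for j using dc by (simp add: \<mu>_def)
   show "finite (\<Union>i<4. {i} \<times> ({e. dehom d i Y e \<noteq> \<zero>[A]} \<union> {e. z i e \<noteq> \<zero>[A]}))"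
    using formsD(2)[OF dehom_form[OF Yf]] formsD(2)[OF zf] by auto
   show "\<mu> j = \<zero>[A]" if "j \<notin> (\<Union>i<4. {i} \<times> ({e. dehom d i Y e \<noteq> \<zero>[A]} \<union> {e. z i e \<noteq> \<zero>[A]}))" for j
    using that by (cases j) (auto simp: \<mu>_def a_minus_def)
   show "\<mu> j = \<zero>[A]" if "j \<notin> I" for j
    using that formsD(3)[OF dehom_form[OF Yf], of "fst j" "snd j"] formsD(3)[OF zf, of "fst j" "snd j"]
    by (cases j) (auto simp: \<mu>_def I_def a_minus_def)
   show "\<mu> j \<in> m" for j
   proof (cases "fst j < 4")
    case True
    have "val (dehom d (fst j) Y (snd j)) = dehom d (fst j) G0 (snd j)" by (simp add: dehom_def Y_def vk)
    hence "val (\<mu> j) = 0" using True z(2)[OF True] vminus dc[OF True] by (simp add: \<mu>_def)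
    thus ?thesis using m_iff dc[OF True] True by (simp add: \<mu>_def)
   next
    case False
    thus ?thesis using m_iff[OF A.zero_closed] by (simp add: \<mu>_def)
   qed
  qed
  have ring1: "(\<zero>[A] \<ominus>[A] (a \<ominus>[A] b)) \<oplus>[A] (a \<ominus>[A] \<zero>[A]) = b" if "a \<in> carrier A" "b \<in> carrier A" for a b
  proof -
   have "(\<zero>[A] \<ominus>[A] (a \<ominus>[A] b)) \<oplus>[A] (a \<ominus>[A] \<zero>[A]) = (\<ominus>[A] a \<oplus>[A] b) \<oplus>[A] a"
    using that by (simp add: a_minus_def A.minus_add)
   also have "\<dots> = a \<oplus>[A] (\<ominus>[A] a \<oplus>[A] b)" using that by (intro A.a_comm) auto
   also have "\<dots> = b" using that by (rule A.r_neg2)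
   finally show ?thesis .
  qed
  \<comment> \<open>Index 4 of \<open>y\<close> contributes the dehomogenisation of \<open>Y\<close>
    and index \<open>i\<close> of \<mu> removes the error, so that \<open>z i\<close>
    remains.\<close>
  have yRel: "(\<lambda>j. y j \<ominus>[A] \<mu> j) \<in> Rel"
  proof -
   have s: "y \<in> A.fin_supp UNIV (carrier A)" "\<mu> \<in> A.fin_supp UNIV (carrier A)"
    using y \<mu> unfolding A.fin_supp_def by auto
   have "(\<lambda>j. \<one>[A] \<otimes>[A] y j \<oplus>[A] (\<ominus>[A] \<one>[A]) \<otimes>[A] \<mu> j) \<in> A.fin_supp UNIV (carrier A)"
    by (rule A.fin_supp_comb[OF s A.oneideal]) auto
   moreover have "(\<lambda>j. \<one>[A] \<otimes>[A] y j \<oplus>[A] (\<ominus>[A] \<one>[A]) \<otimes>[A] \<mu> j) = (\<lambda>j. y j \<ominus>[A] \<mu> j)"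
    using A.fin_suppD(1)[OF y] A.fin_suppD(1)[OF \<mu>] by (simp add: a_minus_def A.l_minus)
   moreover have "(\<lambda>e. (y (i, e) \<ominus>[A] \<mu> (i, e)) \<oplus>[A] (y (4, e(i := e i + d)) \<ominus>[A] \<mu> (4, e(i := e i + d)))) = z i"
    if i: "i < 4" for i
   proof
    fix e
    have "y (i, e) = \<zero>[A]" "\<mu> (i, e) = dehom d i Y e \<ominus>[A] z i e" "y (4, e(i := e i + d)) = dehom d i Y e" "\<mu> (4, e(i := e i + d)) = \<zero>[A]"
     using i by (simp_all add: y_def \<mu>_def dehom_def)
    thus "(y (i, e) \<ominus>[A] \<mu> (i, e)) \<oplus>[A] (y (4, e(i := e i + d)) \<ominus>[A] \<mu> (4, e(i := e i + d))) = z i e"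
     using ring1[OF dc[OF i]] by simp
   qed
   ultimately show ?thesis unfolding Rel_def using z(1) by simp
  qed
  obtain s v where s: "s \<in> carrier A" "s \<notin> m" and v: "v \<in> A.fin_supp I0 m" and w: "(\<lambda>j. s \<otimes>[A] y j \<ominus>[A] v j) \<in> Rel"
   using Tm[rule_format, OF conjI[OF mp conjI[OF x(3,4)[folded m_def]]] y \<mu> yRel] by blast
  have vc: "v j \<in> carrier A" for j by (rule A.fin_suppD(1)[OF v])
  \<comment> \<open>The corrected form. Its value at \<open>x\<close> is \<open>G0\<close> times the
    value of \<open>s\<close>, because the coefficients of \<open>v\<close> vanish at
    \<open>x\<close>.\<close>
  define W where "W = (\<lambda>e. s \<otimes>[A] Y e \<ominus>[A] v (4, e))"
  have Wc: "W e \<in> carrier A" for e using s Yc vc by (simp add: W_def)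
  have Wf: "W \<in> forms A {} d"
  proof (rule formsI[where B = "{e. Y e \<noteq> \<zero>[A]} \<union> snd ` {j. v j \<noteq> \<zero>[A]}"])
   show "finite ({e. Y e \<noteq> \<zero>[A]} \<union> snd ` {j. v j \<noteq> \<zero>[A]})" using formsD(2)[OF Yf] A.fin_suppD(2)[OF v] by simp
   show "W e = \<zero>[A]" if "e \<notin> {e. Y e \<noteq> \<zero>[A]} \<union> snd ` {j. v j \<noteq> \<zero>[A]}" for e
   proof -
    have "v (4, e) = \<zero>[A]" using that by force
    thus ?thesis using that s by (simp add: W_def a_minus_def)
   qed
   show "W e = \<zero>[A]" if "e \<notin> exponents {} d" for e
    using that formsD(3)[OF Yf that] A.fin_suppD(3)[OF v, of "(4, e)"] s by (simp add: W_def I0_def a_minus_def)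
  qed (rule Wc)
  have WZ: "dehom d i W \<in> Z U {i}" if i: "i < 4" for i
  proof -
   have "(\<lambda>e. (s \<otimes>[A] y (i, e) \<ominus>[A] v (i, e)) \<oplus>[A] (s \<otimes>[A] y (4, e(i := e i + d)) \<ominus>[A] v (4, e(i := e i + d)))) \<in> Z U {i}"
    using w i unfolding Rel_def by blast
   moreover have "(s \<otimes>[A] y (i, e) \<ominus>[A] v (i, e)) \<oplus>[A] (s \<otimes>[A] y (4, e') \<ominus>[A] v (4, e')) = W e'" for e e'
   proof -
    have "v (i, e) = \<zero>[A]" using A.fin_suppD(3)[OF v, of "(i, e)"] i by (simp add: I0_def)
    hence "s \<otimes>[A] y (i, e) \<ominus>[A] v (i, e) = \<zero>[A]" using i s by (simp add: y_def a_minus_def)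
    thus ?thesis using Wc[of e'] by (simp add: y_def W_def)
   qed
   ultimately show ?thesis unfolding dehom_def by simp
  qed
  \<comment> \<open>\<open>s\<close> is invertible at \<open>x\<close> but perhaps not on
    \<open>U\<close>; dividing by the constant \<open>c\<close> suffices, as only the value at
    \<open>x\<close> is prescribed.\<close>
  define c where "c = val s"
  have c: "c \<noteq> 0" using s m_iff by (simp add: c_def)
  have kc: "k (1 / c) \<in> carrier A" unfolding k_def A_def by (rule scal_closed[OF oU])
  show ?thesis
  proof (intro bexI[of _ "\<lambda>e. k (1 / c) \<otimes>[A] W e"] conjI allI impI)
   show "(\<lambda>e. k (1 / c) \<otimes>[A] W e) \<in> forms A {} d" by (rule B.forms_smult[OF Wf kc])
   show "dehom d i (\<lambda>e. k (1 / c) \<otimes>[A] W e) \<in> Z U {i}" if "i < 4" for i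
    using Zmult[OF that WZ[OF that] kc] by (simp add: dehom_def)
   have "val (k (1 / c) \<otimes>[A] W e) = G0 e" for e
   proof -
    have "val (v (4, e)) = 0" using m_iff[OF vc] A.fin_suppD(4)[OF v] by blast
    hence "val (W e) = c * G0 e" using s vc Yc vminus by (simp add: W_def Y_def vk c_def)
    thus ?thesis using kc Wc c by (simp add: vk)
   qed
   thus "(\<lambda>e. value_at X U x (k (1 / c) \<otimes>[A] W e)) = G0" by (auto simp: val_def)
  qed
 qed
 note lifted = this
 show ?thesis
  unfolding A_def[symmetric] by (intro exI[of _ T] conjI ballI impI T) (elim conjE, rule lifted, assumption+)
qed

end

subsection \<open>Deforming a surface along with the curve\<close>

definition lmono :: "nat \<Rightarrow> int \<Rightarrow> complex laurent" where
 "lmono i c = (\<lambda>e. if e = (\<lambda>k. if k = i then c else 0) then 1 else 0)"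

lemma lmono_form: "i < 4 \<Longrightarrow> i \<in> F \<Longrightarrow> lmono i c \<in> forms CC F c"
 by (rule formsI[where B = "{\<lambda>k. if k = i then c else 0}"]) (auto simp: lmono_def exponents_def split: if_splits)

lemma lmono_lmul: "lmul (lmono i c) p = (\<lambda>e. p (e - (\<lambda>k. if k = i then c else 0)))"
proof
 show "lmul (lmono i c) p e = p (e - (\<lambda>k. if k = i then c else 0))" for e
  by (subst lmul_eq[of "{\<lambda>k. if k = i then c else 0}"]) (auto simp: lmono_def)
qed

lemma dehom_lmono: "dehom d i p = lmul (lmono i (- d)) p"
proof -
 have "e - (\<lambda>k. if k = i then - d else 0) = e(i := e i + d)" for e :: "nat \<Rightarrow> int" by auto
 thus ?thesis by (simp add: dehom_def lmono_lmul)
qed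

lemma lmono_cancel: "lmul (lmono i d) (lmul (lmono i (- d)) p) = p"
proof -
 have "e - (\<lambda>k. if k = i then d else 0) - (\<lambda>k. if k = i then - d else 0) = e" for e :: "nat \<Rightarrow> int" by auto
 thus ?thesis unfolding lmono_lmul by (simp only:)
qed

text \<open>The powers of the \<open>i\<close>-th variable cancel. So a multiple \<open>G r\<close>
  on any chart inverting that variable is a multiple of the local equation of chart
  \<open>i\<close>, which lets \<phi> be evaluated on it.\<close>

lemma dehom_lmul:
 assumes i: "i < 4" "i \<in> F" and r: "r \<in> forms CC F (- d)" and G: "G \<in> forms CC {} d"
 shows "lmul (lmul (lmono i d) r) (dehom d i G) = lmul G r"
proof -
 note f = forms_CC_fin[OF lmono_form[OF i]] and fr = forms_CC_fin[OF r] and fG = forms_CC_fin[OF G]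
 have "lmul (lmul (lmono i d) r) (dehom d i G) = lmul (lmono i d) (lmul r (lmul (lmono i (- d)) G))"
  unfolding dehom_lmono by (rule lmul_assoc[OF f fr lmul_finite[OF f fG]])
 also have "lmul r (lmul (lmono i (- d)) G) = lmul (lmul (lmono i (- d)) G) r"
  by (rule lmul_comm[OF fr lmul_finite[OF f fG]])
 also have "\<dots> = lmul (lmono i (- d)) (lmul G r)" by (rule lmul_assoc[OF f fG fr])
 finally show ?thesis by (simp add: lmono_cancel)
qed

text \<open>Laurent polynomials have no zero divisors; hence the cofactor of \<open>G\<close> is
  unique and maps can be defined on multiples of \<open>G\<close>.\<close>

lemma lmul_cancel_left:
 assumes G: "G \<in> forms CC {} d" "G \<noteq> (\<lambda>e. 0)" and r: "r \<in> forms CC F n" "r' \<in> forms CC F n"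
  and eq: "lmul G r = lmul G r'"
 shows "r = r'"
proof -
 have d: "(\<lambda>e. r e - r' e) \<in> forms CC F n"
  by (rule formsI[where B = "{e. r e \<noteq> 0} \<union> {e. r' e \<noteq> 0}"])
   (use forms_CC_fin[OF r(1)] forms_CC_fin[OF r(2)] formsD(3)[OF r(1)] formsD(3)[OF r(2)] in auto)
 have "lmul G (\<lambda>e. r e - r' e) = (\<lambda>e. lmul G r e - lmul G r' e)"
  unfolding fun_eq_iff lmul_eq[OF forms_CC_fin[OF G(1)] subset_refl] by (simp add: right_diff_distrib sum_subtractf)
 hence "lmul G (\<lambda>e. r e - r' e) = (\<lambda>e. 0)" using eq by simp
 hence "(\<lambda>e. r e - r' e) = (\<lambda>e. 0)" using lmul_no_zero_divisors[OF G(1) d] G(2) by blast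
 thus ?thesis by (simp add: fun_eq_iff)
qed

text \<open>The ideal of \<open>X\<close> is free on \<open>G\<close>, so sending \<open>G r\<close>
  to the class of \<open>G1 r\<close> defines a section of the normal sheaf of \<open>X\<close>. The
  hypothesis \<open>lift\<close> says that on the standard charts \<phi> sends the local equation to
  the class of the dehomogenised \<open>G1\<close>, and this forces both images in
  \<open>Hom(I_X, O_C)\<close> to agree on all charts.\<close>

lemma first_order_embedded_lift:
 assumes C: "closed_subscheme CC C" and G: "G \<in> forms CC {} d" "G \<noteq> (\<lambda>e. 0)"
  and X: "\<And>F. F \<in> charts \<Longrightarrow> X F = lmul G ` forms CC F (- d)" and le: "\<And>F. F \<in> charts \<Longrightarrow> X F \<subseteq> C F"
  and lift: "\<And>\<phi>. \<phi> \<in> H0_normal C \<Longrightarrow> \<exists>G1\<in>forms CC {} d. \<forall>i<4. dehom d i G1 \<in> \<phi> {i} (dehom d i G)"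
 shows "first_order_embedded C X"
 unfolding first_order_embedded_def
proof
 fix \<beta> assume "\<beta> \<in> normal_beta X ` H0_normal C"
 then obtain \<phi> where \<phi>: "\<phi> \<in> H0_normal C" "\<beta> = normal_beta X \<phi>" by blast
 obtain G1 where G1: "G1 \<in> forms CC {} d" "\<And>i. i < 4 \<Longrightarrow> dehom d i G1 \<in> \<phi> {i} (dehom d i G)" using lift[OF \<phi>(1)] by blast
 note fG = forms_CC_fin[OF G(1)] and fG1 = forms_CC_fin[OF G1(1)]
 have mem: "lmul G r \<in> X F" if "F \<in> charts" "r \<in> forms CC F (- d)" for F r using X that by blast
 have cases: "\<exists>r\<in>forms CC F (- d). a = lmul G r" if "F \<in> charts" "a \<in> X F" for F a using X that by blast
 have prod: "lmul K r \<in> forms CC F 0" if "K \<in> forms CC {} d" "r \<in> forms CC F (- d)" for K F r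
  using lmul_form[of K F d r "- d"] forms_mono[of "{}" F CC d] that by auto
 have XI: "ideal (X F) (P3 F)" if F: "F \<in> charts" for F
 proof (rule ideal_P3_CC_I)
  show "X F \<subseteq> forms CC F 0" using cases[OF F] prod[OF G(1)] by blast
  show "(\<lambda>e. 0) \<in> X F" using mem[OF F forms_CC_zero] fG by simp
  fix a assume "a \<in> X F"
  then obtain r where r: "r \<in> forms CC F (- d)" "a = lmul G r" using cases[OF F] by blast
  show "lmul q a \<in> X F" if q: "q \<in> forms CC F 0" for q
  proof -
   have "lmul q a = lmul (lmul q G) r" unfolding r(2) using lmul_assoc[OF forms_CC_fin[OF q] fG forms_CC_fin[OF r(1)]] by simp
   also have "\<dots> = lmul (lmul G q) r" using lmul_comm[OF forms_CC_fin[OF q] fG] by simp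
   also have "\<dots> = lmul G (lmul q r)" by (rule lmul_assoc[OF fG forms_CC_fin[OF q] forms_CC_fin[OF r(1)]])
   finally show ?thesis using mem[OF F, of "lmul q r"] lmul_form[OF q r(1)] by simp
  qed
  fix b assume "b \<in> X F"
  then obtain r' where r': "r' \<in> forms CC F (- d)" "b = lmul G r'" using cases[OF F] by blast
  show "(\<lambda>e. a e + b e) \<in> X F"
   using mem[OF F forms_CC_add[OF r(1) r'(1)]] lmul_add_right[OF fG, of r r'] r(2) r'(2) by simp
 qed
 \<comment> \<open>The cofactor of \<open>G\<close> in \<open>a\<close>, unique by
   cancellation.\<close>
 define q where "q F a = (SOME r. r \<in> forms CC F (- d) \<and> a = lmul G r)" for F a
 have q: "q F (lmul G r) = r" if r: "r \<in> forms CC F (- d)" for F r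
  unfolding q_def by (rule some_equality) (use r lmul_cancel_left[OF G] in blast)+
 define \<psi> where "\<psi> = (\<lambda>F\<in>charts. \<lambda>a\<in>X F. X F +>[P3 F] lmul G1 (q F a))"
 have \<psi>: "\<psi> F (lmul G r) = X F +>[P3 F] lmul G1 r" if "F \<in> charts" "r \<in> forms CC F (- d)" for F r
  using that mem[OF that] q[OF that(2)] by (simp add: \<psi>_def)
 have "\<psi> \<in> H0_normal X"
  unfolding H0_normal_def H0_Hom_def
 proof (intro CollectI conjI ballI impI)
  show "\<psi> \<in> extensional charts" by (simp add: \<psi>_def)
  fix F assume F: "F \<in> charts"
  note Q = P3_quot[OF XI[OF F]]
  show "\<psi> F \<in> X F \<rightarrow>\<^sub>E carrier (P3 F Quot X F)"
  proof (rule PiE_I)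
   fix a assume "a \<in> X F"
   then obtain r where r: "r \<in> forms CC F (- d)" "a = lmul G r" using cases[OF F] by blast
   show "\<psi> F a \<in> carrier (P3 F Quot X F)"
    unfolding r(2) \<psi>[OF F r(1)] by (rule Q(3)[OF prod[OF G1(1) r(1)] prod[OF G1(1) r(1)]])
  qed (use F in \<open>simp add: \<psi>_def\<close>)
  fix a assume "a \<in> X F"
  then obtain r where r: "r \<in> forms CC F (- d)" "a = lmul G r" using cases[OF F] by blast
  show "\<psi> F (a \<oplus>[P3 F] b) = \<psi> F a \<oplus>[P3 F Quot X F] \<psi> F b" if b: "b \<in> X F" for b
  proof -
   obtain r' where r': "r' \<in> forms CC F (- d)" "b = lmul G r'" using cases[OF F b] by blast
   have "a \<oplus>[P3 F] b = lmul G (\<lambda>e. r e + r' e)" unfolding r(2) r'(2) lmul_add_right[OF fG] by simp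
   thus ?thesis
    using \<psi>[OF F forms_CC_add[OF r(1) r'(1)]] Q(1)[OF prod[OF G1(1) r(1)] prod[OF G1(1) r'(1)]] \<psi>[OF F r(1)] \<psi>[OF F r'(1)]
     lmul_add_right[OF fG1, of r r'] r(2) r'(2) by simp
  qed
  show "\<psi> F (s \<otimes>[P3 F] a) = (X F +>[P3 F] s) \<otimes>[P3 F Quot X F] \<psi> F a"
   if s: "s \<in> carrier (P3 F)" for s
  proof -
   have s': "s \<in> forms CC F 0" using s by simp
   have swap: "lmul s (lmul K r) = lmul K (lmul s r)" if "finite {e. K e \<noteq> 0}" for K
    using lmul_assoc[OF forms_CC_fin[OF s'] that forms_CC_fin[OF r(1)]] lmul_comm[OF forms_CC_fin[OF s'] that]
     lmul_assoc[OF that forms_CC_fin[OF s'] forms_CC_fin[OF r(1)]] by simp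
   have sr: "lmul s r \<in> forms CC F (- d)" using lmul_form[OF s' r(1)] by simp
   show ?thesis
    unfolding r(2) \<psi>[OF F r(1)] P3_ring_simps swap[OF fG] \<psi>[OF F sr] Q(2)[OF s' prod[OF G1(1) r(1)]] swap[OF fG1] ..
  qed
 next
  fix F K a assume F: "F \<in> charts" and K: "K \<in> charts" and FK: "F \<subseteq> K" and a: "a \<in> X F"
  obtain r where r: "r \<in> forms CC F (- d)" "a = lmul G r" using cases[OF F a] by blast
  have rK: "r \<in> forms CC K (- d)" using r(1) forms_mono[OF FK] by blast
  have "X F \<subseteq> X K" unfolding X[OF F] X[OF K] using forms_mono[OF FK] by blast
  thus "\<psi> F a \<subseteq> \<psi> K a"
   unfolding r(2) \<psi>[OF F r(1)] \<psi>[OF K rK] by (auto simp: P3_coset_iff[OF XI[OF F]] P3_coset_iff[OF XI[OF K]])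
 qed
 moreover have "\<beta> = normal_rho C X \<psi>"
  unfolding \<phi>(2) normal_beta_def normal_rho_def
 proof (intro restrict_ext)
  fix F a assume F: "F \<in> charts" and a: "a \<in> X F"
  note CI = closed_subscheme_ideal[OF C F]
  obtain r where r: "r \<in> forms CC F (- d)" "a = lmul G r" using cases[OF F a] by blast
  have "F \<noteq> {}" "F \<subseteq> {..<4}" using F by (auto simp: charts_def)
  \<comment> \<open>Chart \<open>F\<close> is an open subset of the standard chart of any of its
    indices, so what is known about \<phi> on the latter restricts to \<open>F\<close>.\<close>
  then obtain i where i: "i \<in> F" "i < 4" by auto
  have ch: "{i} \<in> charts" using i by (simp add: charts_def)
  have "dehom d i G = lmul G (lmono i (- d))"
   unfolding dehom_lmono by (rule lmul_comm[OF forms_CC_fin[OF lmono_form[OF i(2,1)]] fG])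
  hence "dehom d i G \<in> X {i}" using mem[OF ch lmono_form[OF i(2), of "{i}" "- d"]] by simp
  hence dC: "dehom d i G \<in> C {i}" using le[OF ch] by blast
  have d1: "dehom d i G1 \<in> \<phi> F (dehom d i G)" using G1(2)[OF i(2)] normal_mono[OF C \<phi>(1) ch F _ dC] i(1) by auto
  have "C {i} \<subseteq> C F"
  proof -
   have gen: "C F = genideal (P3 F) (C {i})" using C ch F i(1) unfolding closed_subscheme_def by blast
   have "C {i} \<subseteq> carrier (P3 F)" using closed_subscheme_sub[OF C ch] forms_mono[of "{i}" F CC 0] i(1) by auto
   thus ?thesis unfolding gen by (rule ring.genideal_self[OF cring.axioms(1)[OF cring_P3_CC]])
  qed
  hence dF: "dehom d i G \<in> C F" using dC by blast
  have s: "lmul (lmono i d) r \<in> forms CC F 0" using lmul_form[OF lmono_form[OF i(2,1), of d] r(1)] by simp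
  \<comment> \<open>Linearity of \<phi> with the factor \<open>lmul (lmono i d) r\<close>, which
    turns the two dehomogenised forms into \<open>G r\<close> and \<open>G1 r\<close>.\<close>
  have g: "lmul G1 r \<in> \<phi> F a"
   using normal_mult[OF C \<phi>(1) F dF d1 s] unfolding dehom_lmul[OF i(2,1) r(1) G1(1)] dehom_lmul[OF i(2,1) r(1) G(1)] r(2) .
  have aC: "a \<in> C F" using a le[OF F] by blast
  have z: "(\<lambda>e. 0) \<in> X F" by (rule ideal_P3_zero[OF XI[OF F]])
  \<comment> \<open>A coset of the ideal of \<open>X\<close> becomes the corresponding coset of the
    larger ideal of \<open>C\<close>.\<close>
  have "C F <+>\<^bsub>P3 F\<^esub> \<psi> F a = C F +>[P3 F] lmul G1 r"
  proof (intro Set.equalityI subsetI)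
   fix u assume "u \<in> C F <+>\<^bsub>P3 F\<^esub> \<psi> F a"
   then obtain c w where c: "c \<in> C F" "w \<in> \<psi> F a" "u = (\<lambda>e. c e + w e)" by (auto simp: set_add_def')
   have "(\<lambda>e. w e - lmul G1 r e) \<in> C F"
    using c(2) le[OF F] unfolding r(2) \<psi>[OF F r(1)] P3_coset_iff[OF XI[OF F]] by blast
   from ideal_P3_add[OF CI c(1) this] show "u \<in> C F +>[P3 F] lmul G1 r"
    unfolding P3_coset_iff[OF CI] c(3) by (simp add: add_diff_eq)
  next
   fix u assume "u \<in> C F +>[P3 F] lmul G1 r"
   hence u: "(\<lambda>e. u e - lmul G1 r e) \<in> C F" unfolding P3_coset_iff[OF CI] .
   have w: "lmul G1 r \<in> \<psi> F a" unfolding r(2) \<psi>[OF F r(1)] P3_coset_iff[OF XI[OF F]] using z by simp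
   have "u = (\<lambda>e. u e - lmul G1 r e) \<oplus>[P3 F] lmul G1 r" by simp
   thus "u \<in> C F <+>\<^bsub>P3 F\<^esub> \<psi> F a" unfolding set_add_def' using u w by blast
  qed
  thus "\<phi> F a = C F <+>\<^bsub>P3 F\<^esub> \<psi> F a" using normal_coset(1)[OF C \<phi>(1) F aC g] by simp
 qed
 ultimately show "\<beta> \<in> normal_rho C X ` H0_normal X" by blast
qed

section \<open>Differentiating a lifted equation along tangent vectors\<close>

theorem theorem5p5:
  fixes D :: "complex subscheme" and d :: nat
    and H :: "('p, 's) cspace" and Z :: "'p set \<Rightarrow> 's subscheme" and L :: "'p set"
  assumes "d_embeddable d D"
    and "of_nat d \<ge> curve_degree D + 4"
    and "hilbert_scheme (hilbert_poly D) H Z"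
    and "irreducible_component (zar H) L"
    and "general_point H L (\<lambda>x. curve (fibre H Z x) \<and> d_embeddable d (fibre H Z x) \<and>
           (\<exists>X. d_embedded d (fibre H Z x) X \<and> \<not> first_order_embedded (fibre H Z x) X))"
  shows "generically_nonreduced H L"
proof (rule ccontr)
 assume nr: "\<not> generically_nonreduced H L"
 note hilb = assms(3)
 have rel: "relative_subscheme H Z" using hilb by (simp add: hilbert_scheme_def hilbert_family_def)
 interpret H: ft_scheme H
  using hilb by (simp add: hilbert_scheme_def ft_scheme_def ft_scheme_axioms_def ringed_def finite_type_scheme_def)
 obtain \<B> where B: "finite \<B>" "\<forall>B\<in>\<B>. closedin (subtopology (zar H) L) B \<and> B \<noteq> L"
  and gen: "\<forall>x\<in>L - \<Union>\<B>. closed_point H x \<longrightarrow> curve (fibre H Z x) \<and> d_embeddable d (fibre H Z x) \<and>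
   (\<exists>X. d_embedded d (fibre H Z x) X \<and> \<not> first_order_embedded (fibre H Z x) X)"
  using assms(5) unfolding general_point_def by (elim exE conjE) (rule that)
 obtain U p0 where U: "H.aff U" "finite_type_algebra (sec H U) (scal H U)" and p0: "primeideal p0 (sec H U)"
  and red: "\<And>a. a \<in> p0 \<Longrightarrow> \<exists>t\<in>carrier (sec H U) - p0. t \<otimes>[sec H U] a = \<zero>[sec H U]"
  and pt: "\<And>T. countable T \<Longrightarrow> T \<subseteq> carrier (sec H U) - p0 \<Longrightarrow>
   \<exists>x\<in>U. x \<in> L - \<Union>\<B> \<and> closed_point H x \<and> p0 \<subseteq> H.ptid U x \<and> T \<inter> H.ptid U x = {}"
  by (rule H.generically_reduced_chart[OF assms(4) nr B(1)], rule bspec[OF B(2)], assumption) (rule that)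
 have "\<exists>T. countable T \<and> T \<subseteq> carrier (sec H U) - p0 \<and>
  (\<forall>x\<in>U. H.cpoint x \<and> p0 \<subseteq> H.ptid U x \<and> T \<inter> H.ptid U x = {} \<longrightarrow>
   (\<forall>G0\<in>form_ideal (fibre H Z x) (int d). \<exists>G\<in>forms (sec H U) {} (int d).
    (\<forall>i<4. dehom (int d) i G \<in> Z U {i}) \<and> (\<lambda>e. value_at H U x (G e)) = G0))" (is "\<exists>T. _ \<and> _ \<and> ?lift T")
  by (rule H.general_lifting[OF rel U(1) p0 red])
 then obtain T where T: "countable T" "T \<subseteq> carrier (sec H U) - p0" and lift: "?lift T"
  by (elim exE conjE) (rule that)
 \<comment> \<open>This one point serves two purposes: off \<B> its fibre has the property of a
   general point of \<open>L\<close>, and off \<open>T\<close> the equations of its fibre lift to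
   the chart.\<close>
 obtain x where x: "x \<in> U" "x \<in> L - \<Union>\<B>" "closed_point H x" "p0 \<subseteq> H.ptid U x" "T \<inter> H.ptid U x = {}"
  using pt[OF T] by blast
 note genx = gen[rule_format, OF x(2,3)]
 define C where "C = fibre H Z x"
 have C: "closed_subscheme CC C" using genx by (simp add: C_def curve_def)
 obtain X where X: "d_embedded d C X" and nf: "\<not> first_order_embedded C X" using genx unfolding C_def by blast
 obtain G where G: "G \<in> forms CC {} (int d)" "\<And>F. F \<in> charts \<Longrightarrow> X F = hypersurface d G F"
  and smooth: "\<And>z. (\<exists>k<4. z k \<noteq> 0) \<Longrightarrow> form_eval G z = 0 \<Longrightarrow> \<exists>k<4. form_eval (form_partial k G) z \<noteq> 0"
  using X unfolding d_embedded_def smooth_surface_def by blast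
 have XF: "X F = lmul G ` forms CC F (- int d)" if "F \<in> charts" for F using G(2)[OF that] by (simp add: hypersurface_def)
 have le: "X F \<subseteq> C F" if "F \<in> charts" for F using X that by (simp add: d_embedded_def subscheme_le_def)
 \<comment> \<open>The zero form vanishes at the vector with all entries 1 together with its partial
   derivatives, contrary to the Jacobian criterion. Nonvanishing is needed for cancelling
   \<open>G\<close>.\<close>
 have "G \<noteq> (\<lambda>e. 0)"
 proof
  assume "G = (\<lambda>e. 0)"
  moreover have "\<exists>k<4. form_eval (form_partial k G) (\<lambda>_. 1) \<noteq> 0"
  proof (rule smooth)
   show "\<exists>k::nat<4. (1::complex) \<noteq> 0" by (rule exI[of _ 0]) simp
   show "form_eval G (\<lambda>_. 1) = 0" by (simp add: form_eval_def \<open>G = (\<lambda>e. 0)\<close>)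
  qed
  ultimately show False by (simp add: form_eval_def form_partial_def)
 qed
 have GI: "G \<in> form_ideal C (int d)"
  unfolding form_ideal_def
 proof (intro CollectI conjI allI impI G(1))
  fix i :: nat assume i: "i < 4"
  have ch: "{i} \<in> charts" using i by (simp add: charts_def)
  have m: "lmono i (- int d) \<in> forms CC {i} (- int d)" by (rule lmono_form) (use i in auto)
  have "dehom (int d) i G = lmul G (lmono i (- int d))"
   unfolding dehom_lmono by (rule lmul_comm[OF forms_CC_fin[OF m] forms_CC_fin[OF G(1)]])
  hence "dehom (int d) i G \<in> C {i}" using le[OF ch] m unfolding XF[OF ch] by blast
  thus "(\<lambda>e. G (e(i := e i + int d))) \<in> C {i}" by (simp add: dehom_def)
 qed
 have aU: "affine_open H U" using U(1) H.affine_open_iff_aff by simp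
 have cx: "H.cpoint x" using x(3) H.cpoint_iff_closed by simp
 have "\<forall>G0\<in>form_ideal C (int d). \<exists>G\<in>forms (sec H U) {} (int d).
    (\<forall>i<4. dehom (int d) i G \<in> Z U {i}) \<and> (\<lambda>e. value_at H U x (G e)) = G0"
  unfolding C_def using lift[rule_format, OF x(1)] cx x(4,5) by blast
 from bspec[OF this GI] obtain E where E: "E \<in> forms (sec H U) {} (int d)" "\<And>i. i < 4 \<Longrightarrow> dehom (int d) i E \<in> Z U {i}"
  and EG: "(\<lambda>e. value_at H U x (E e)) = G"
  by blast
 have "first_order_embedded C X"
 proof (rule first_order_embedded_lift[OF C G(1) \<open>G \<noteq> (\<lambda>e. 0)\<close> XF le])
  fix \<phi> assume \<phi>: "\<phi> \<in> H0_normal C"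
  obtain \<eta> where \<eta>: "\<eta> \<in> ring_hom (sec H U) dual" "\<And>s. s \<in> carrier (sec H U) \<Longrightarrow> pr0 (\<eta> s) = value_at H U x s"
   and \<eta>Z: "\<And>F p. F \<in> charts \<Longrightarrow> p \<in> Z U F \<Longrightarrow> (\<lambda>e. pr1 (\<eta> (p e))) \<in> \<phi> F (\<lambda>e. value_at H U x (p e))"
   by (rule first_order_section[OF hilb x(3) C_def C \<phi> aU x(1)]) (rule that)
  \<comment> \<open>Applying \<eta> to the coefficients of the lifted equation gives
    \<open>G\<close> plus eps times the wanted form \<open>G1\<close>. It is a single global form
    because \<open>E\<close> is one form for all charts.\<close>
  have "(\<lambda>e. \<eta> (E e)) \<in> forms dual {} (int d)"
   by (rule forms_hom[OF cring.axioms(1)[OF H.aff_cring[OF U(1)]] cring.axioms(1)[OF cring_dual] \<eta>(1) E(1)])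
  hence "(\<lambda>e. pr1 (\<eta> (E e))) \<in> forms CC {} (int d)" by (simp add: forms_dual)
  moreover have "dehom (int d) i (\<lambda>e. pr1 (\<eta> (E e))) \<in> \<phi> {i} (dehom (int d) i G)" if i: "i < 4" for i
  proof -
   have "{i} \<in> charts" using i by (simp add: charts_def)
   from \<eta>Z[OF this E(2)[OF i]] show ?thesis using EG by (auto simp: dehom_def fun_eq_iff)
  qed
  ultimately show "\<exists>G1\<in>forms CC {} (int d). \<forall>i<4. dehom (int d) i G1 \<in> \<phi> {i} (dehom (int d) i G)" by blast
 qed
 thus False using nf by simp
qed

end
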